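(* Let $r>0$ and let $\xi\in W$ with $|\xi|\le r$. Then there exist $R=R(r,\omega)$ and $T=T(\omega,R)>0$ such that the restriction $\mathcal M_{T,R}:=\mathcal M_T|_{B_X(0,R)}$ of the solution map $\mathcal M_T$ to the (closed) ball $B_X(0,R)$ of radius $R$ centred at $0$ in $X_{\omega,T}$ maps $B_X(0,R)$ into itself, is a contraction, and possesses a unique fixed point.
   Context: Setting. $V$ is a Hilbert space, $W$ a separable Banach space; $|\cdot|$ is the norm of whichever space is relevant. $\otimes$ is a completed (projective) tensor product, so that bounded bilinear maps are identified with bounded linear maps on the tensor product. For $E\in\mathcal L(W\otimes V,W)$, $w\in W$, $K\in\mathcal L(V,W)$ write $Ew:=E(w\otimes\cdot)\in\mathcal L(V,W)$ and $EK:=E\circ(K\otimes\mathrm{Id})\in\mathcal L(V\otimes V,W)$. $A$ is a sectorial operator generating an analytic $C_0$-semigroup $(S(t))_{t\ge0}$ on $W$; $D_\gamma:=D((-A)^\gamma)$ with norm $|x|_{D_\gamma}=|(-A)^\gamma x|$. Exponents: $\frac13<\beta<\alpha\le\frac12$, $\alpha+2\beta>1$. $G:W\to\mathcal L(V,W)$ is three times continuously Fréchet differentiable with bounded derivatives, $DG(x)$ is viewed as an element of $\mathcal L(W\otimes V,W)$, and $G:W\to\mathcal L(V,D_\beta)$ is Lipschitz continuous. The equation considered is $dy_t=Ay_t\,dt+G(y_t)\,d\omega_t$, $y_0=\xi$. Increments. $\Delta_T=\{(t,s):T\ge t>s\ge0\}$; two-parameter functions vanish on the diagonal. $(\delta y)_{ts}=y_t-y_s$,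 $(\hat\delta y)_{ts}=y_t-S(t-s)y_s$, $(\hat\delta_2 z)_{t\tau s}=z_{ts}-z_{t\tau}-S(t-\tau)z_{\tau s}$. Noise. $(\omega,\omega^{(2)})$ is a fixed $\alpha$-Hölder rough path on a time interval $[0,T_0]$, $0<T\le T_0$: $\omega$ is $V$-valued $\alpha$-Hölder, $\omega^{(2)}$ is $V\otimes V$-valued with $|\omega^{(2)}_{ts}|\lesssim (t-s)^{2\alpha}$, and $\omega^{(2)}_{ts}-\omega^{(2)}_{us}-\omega^{(2)}_{tu}=(\delta\omega)_{us}\otimes(\delta\omega)_{tu}$; moreover it is the limit, in the metric $\sup\frac{|\delta\omega_{ts}-\delta\tilde\omega_{ts}|}{(t-s)^\alpha}+\sup\frac{|\omega^{(2)}_{ts}-\tilde\omega^{(2)}_{ts}|}{(t-s)^{2\alpha}}$, of $(\omega^n,\omega^{(2),n})$ with $\omega^n$ piecewise linear and $\omega^{(2),n}_{ts}=\int_s^t(\delta\omega^n)_{rs}\otimes d\omega^n_r$. (In the paper: a path of a trace-class fractional Brownian motion with Hurst index in $(1/3,1/2]$ with its Lévy area.) Supporting processes, for $K\in\mathcal L(V,W)$, $E\in\mathcal L(W\otimes V,W)$, $x\in W$: $\omega^S_{ts}(K)=S(t-s)K(\delta\omega)_{ts}-A\int_s^tS(t-r)K(\delta\omega)_{tr}dr$ (this is $\int_s^tS(t-r)K\,d\omega_r$); $a_{ts}(E,x)=\omega^S_{ts}(Ex)+\int_s^t\omega^S_{tr}(EAS(r-s)x)dr$, the integral being improper at $r=s$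 (this is $\int_s^tS(t-r)ES(r-s)x\,d\omega_r$); $c_{ts}(E,K)=S(t-s)EK\omega^{(2)}_{ts}-\int_s^tAS(t-r)EK\big[\omega^{(2)}_{tr}+(\delta\omega)_{rs}\otimes(\delta\omega)_{tr}\big]dr$, i.e. the limit of $\int_s^tS(t-r)EK(\delta\omega^n)_{rs}d\omega^n_r$; for $K\in\mathcal L(V,D_\beta)$, $b_{ts}(E,K)=\lim_{|\mathcal P|\to0}\sum_{[u,v]\in\mathcal P(s,t)}S(t-v)\big[\omega^S_{vu}(E\omega^S_{us}(K))+c_{vu}(E,K)\big]$ (this is $\int_s^tS(t-r)E\int_s^rS(r-q)K\,d\omega_q\,d\omega_r$). Sewing. For a suitable two-parameter $\Xi$, $\mathcal I\Xi$ is the path with $\mathcal I\Xi_0=0$ and $(\hat\delta\mathcal I\Xi)_{ts}=\lim_{|\mathcal P|\to0}\sum_{[u,v]\in\mathcal P(s,t)}S(t-v)\Xi_{vu}$ over partitions of $[s,t]$. Norms. $\|y\|_\infty=\sup|y_t|$, $|||y|||_{\beta,\beta}=\sup_{0<s<t\le T}s^\beta\frac{|y_t-y_s|}{(t-s)^\beta}$; $C^{\beta,\beta}([0,T],W)$ consists of the continuous $y$ with $\|y\|_{\beta,\beta}=\|y\|_\infty+|||y|||_{\beta,\beta}<\infty$. $\|z\|_\alpha=\sup_t|z_{t0}|+\sup_{0\le s<t\le T}\frac{|z_{ts}|}{(t-s)^\alpha}$, $\|z\|_{\alpha+\beta,\beta}=\sup_t|z_{t0}|+\sup_{0<s<t\le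 T}s^\beta\frac{|z_{ts}|}{(t-s)^{\alpha+\beta}}$, defining $C^\alpha(\Delta_T,\cdot)$ and $C^{\alpha+\beta,\beta}(\Delta_T,\cdot)$. Solution space. $X_{\omega,T}$ is the Banach space of pairs $(y,z)$ with $y\in C^{\beta,\beta}([0,T],W)$, $z\in C^\alpha(\Delta_T,Z)\cap C^{\alpha+\beta,\beta}(\Delta_T,Z)$, $Z=\mathcal L(\mathcal L(W\otimes V,W),W)$, and $(\hat\delta_2z)_{t\tau s}(E)=\omega^S_{t\tau}(E(\delta y)_{\tau s})$ for all $E$; norm $\|(y,z)\|_X=\|y\|_\infty+|||y|||_{\beta,\beta}+\|z\|_\alpha+\|z\|_{\alpha+\beta,\beta}$. Solution map. $\Xi^{(y)}(y,z)_{vu}=\omega^S_{vu}(G(y_u))+z_{vu}(DG(y_u))$, $\Xi^{(z)}(y,\tilde y)_{vu}(E)=b_{vu}(E,G(y_u))+a_{vu}(E,\tilde y_u)$. $\mathcal M_T(y,z)=(\tilde y,\tilde z)$ with $\tilde y_t=S(t)\xi+\mathcal I\Xi^{(y)}(y,z)_t$ and $\tilde z_{ts}(E)=(\hat\delta\mathcal I\Xi^{(z)}(y,\tilde y))_{ts}(E)-\omega^S_{ts}(E\tilde y_s)$. *)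

theory Defs
  imports "HOL-Analysis.Analysis"
begin

section \<open>The completed projective tensor product\<close>

text \<open>
  The projective norm of \<open>\<Sum> u\<^sub>i \<otimes> v\<^sub>i\<close> is the supremum of \<open>\<bar>\<Sum> B u\<^sub>i v\<^sub>i\<bar>\<close> over the bounded
  bilinear forms \<open>B\<close> of norm at most one. Hence evaluation on bilinear forms embeds the algebraic
  tensor product isometrically into the dual of the space of bounded bilinear forms, and its
  completion is the closure of the span of the elementary tensors in that dual space.
\<close>

definition elem_tensor ::
    "'a::real_normed_vector \<Rightarrow> 'b::real_normed_vector \<Rightarrow> ('a \<Rightarrow>\<^sub>L 'b \<Rightarrow>\<^sub>L real) \<Rightarrow>\<^sub>L real"
  where "elem_tensor u v = Blinfun (\<lambda>B. blinfun_apply (blinfun_apply B u) v)"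

definition ptensor_set ::
    "(('a::real_normed_vector \<Rightarrow>\<^sub>L 'b::real_normed_vector \<Rightarrow>\<^sub>L real) \<Rightarrow>\<^sub>L real) set"
  where "ptensor_set = closure (span {elem_tensor u v | u v. True})"

lemma closure_span_add:
  fixes X :: "'c::real_normed_vector set"
  assumes "x \<in> closure (span X)" "y \<in> closure (span X)"
  shows "x + y \<in> closure (span X)"
proof -
  obtain f g where "\<And>n. f n \<in> span X" "f \<longlonglongrightarrow> x" "\<And>n. g n \<in> span X" "g \<longlonglongrightarrow> y"
    using assms unfolding closure_sequential by blast
  then show ?thesis
    unfolding closure_sequential
    by (intro exI[of _ "\<lambda>n. f n + g n"]) (auto intro: span_add tendsto_add)
qed

lemma closure_span_scale:
  fixes X :: "'c::real_normed_vector set"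
  assumes "x \<in> closure (span X)"
  shows "r *\<^sub>R x \<in> closure (span X)"
proof -
  obtain f where "\<And>n. f n \<in> span X" "f \<longlonglongrightarrow> x"
    using assms unfolding closure_sequential by blast
  then show ?thesis
    unfolding closure_sequential
    by (intro exI[of _ "\<lambda>n. r *\<^sub>R f n"]) (auto intro: span_scale tendsto_scaleR)
qed

lemma ptensor_set_zero: "0 \<in> ptensor_set"
  unfolding ptensor_set_def using closure_subset span_zero by blast

typedef (overloaded) ('a, 'b) ptensor =
  "ptensor_set :: (('a::real_normed_vector \<Rightarrow>\<^sub>L 'b::real_normed_vector \<Rightarrow>\<^sub>L real) \<Rightarrow>\<^sub>L real) set"
  using ptensor_set_zero by blast

instantiation ptensor :: (real_normed_vector, real_normed_vector) real_normed_vector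
begin

definition zero_ptensor :: "('a, 'b) ptensor" where "0 = Abs_ptensor 0"
definition plus_ptensor :: "('a, 'b) ptensor \<Rightarrow> ('a, 'b) ptensor \<Rightarrow> ('a, 'b) ptensor"
  where "x + y = Abs_ptensor (Rep_ptensor x + Rep_ptensor y)"
definition scaleR_ptensor :: "real \<Rightarrow> ('a, 'b) ptensor \<Rightarrow> ('a, 'b) ptensor"
  where "r *\<^sub>R x = Abs_ptensor (r *\<^sub>R Rep_ptensor x)"
definition uminus_ptensor :: "('a, 'b) ptensor \<Rightarrow> ('a, 'b) ptensor"
  where "- x = (-1) *\<^sub>R (x :: ('a, 'b) ptensor)"
definition minus_ptensor :: "('a, 'b) ptensor \<Rightarrow> ('a, 'b) ptensor \<Rightarrow> ('a, 'b) ptensor"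
  where "x - y = x + - (y :: ('a, 'b) ptensor)"
definition norm_ptensor :: "('a, 'b) ptensor \<Rightarrow> real"
  where "norm x = norm (Rep_ptensor x)"
definition sgn_ptensor :: "('a, 'b) ptensor \<Rightarrow> ('a, 'b) ptensor"
  where "sgn x = inverse (norm x) *\<^sub>R (x :: ('a, 'b) ptensor)"
definition dist_ptensor :: "('a, 'b) ptensor \<Rightarrow> ('a, 'b) ptensor \<Rightarrow> real"
  where "dist x y = norm (x - y :: ('a, 'b) ptensor)"
definition uniformity_ptensor :: "(('a, 'b) ptensor \<times> ('a, 'b) ptensor) filter"
  where "uniformity_ptensor = (INF e\<in>{0 <..}. principal {(x, y). dist x y < e})"
definition open_ptensor :: "('a, 'b) ptensor set \<Rightarrow> bool"
  where "open_ptensor U = (\<forall>x\<in>U. \<forall>\<^sub>F (x', y) in uniformity. x' = x \<longrightarrow> y \<in> U)"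

lemma Rep_ptensor_zero: "Rep_ptensor (0 :: ('a, 'b) ptensor) = 0"
  by (simp add: zero_ptensor_def Abs_ptensor_inverse ptensor_set_zero)

lemma Rep_ptensor_add: "Rep_ptensor (x + y :: ('a, 'b) ptensor) = Rep_ptensor x + Rep_ptensor y"
  unfolding plus_ptensor_def
  by (rule Abs_ptensor_inverse, unfold ptensor_set_def, rule closure_span_add)
    (rule Rep_ptensor[unfolded ptensor_set_def])+

lemma Rep_ptensor_scale: "Rep_ptensor (r *\<^sub>R x :: ('a, 'b) ptensor) = r *\<^sub>R Rep_ptensor x"
  unfolding scaleR_ptensor_def
  by (rule Abs_ptensor_inverse, unfold ptensor_set_def, rule closure_span_scale)
    (rule Rep_ptensor[unfolded ptensor_set_def])

lemma Rep_ptensor_minus: "Rep_ptensor (x - y :: ('a, 'b) ptensor) = Rep_ptensor x - Rep_ptensor y"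
  by (simp add: minus_ptensor_def uminus_ptensor_def Rep_ptensor_add Rep_ptensor_scale)

lemmas Rep_ptensor_simps =
  Rep_ptensor_zero Rep_ptensor_add Rep_ptensor_scale Rep_ptensor_minus

instance
proof
  fix x y z :: "('a, 'b) ptensor" and r s :: real and U :: "('a, 'b) ptensor set"
  show "x + y + z = x + (y + z)" "x + y = y + x" "0 + x = x" "- x + x = 0"
    "r *\<^sub>R (x + y) = r *\<^sub>R x + r *\<^sub>R y" "(r + s) *\<^sub>R x = r *\<^sub>R x + s *\<^sub>R x"
    "r *\<^sub>R s *\<^sub>R x = (r * s) *\<^sub>R x" "1 *\<^sub>R x = x"
    by (rule Rep_ptensor_inject[THEN iffD1],
        simp add: Rep_ptensor_simps uminus_ptensor_def scaleR_add_left scaleR_add_right add_ac)+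
  show "x - y = x + - y"
    by (rule minus_ptensor_def)
  show "dist x y = norm (x - y)" by (rule dist_ptensor_def)
  show "sgn x = inverse (norm x) *\<^sub>R x" by (rule sgn_ptensor_def)
  show "uniformity = (INF e\<in>{0<..}. principal {(x :: ('a, 'b) ptensor, y). dist x y < e})"
    by (rule uniformity_ptensor_def)
  show "open U = (\<forall>x\<in>U. \<forall>\<^sub>F (x', y) in uniformity. x' = x \<longrightarrow> y \<in> U)"
    by (rule open_ptensor_def)
  show "norm x = 0 \<longleftrightarrow> x = 0"
    by (simp add: norm_ptensor_def Rep_ptensor_inject[symmetric] Rep_ptensor_zero)
  show "norm (x + y) \<le> norm x + norm y"
    by (simp add: norm_ptensor_def Rep_ptensor_add norm_triangle_ineq)
  show "norm (r *\<^sub>R x) = \<bar>r\<bar> * norm x"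
    by (simp add: norm_ptensor_def Rep_ptensor_scale)
qed

end

lemma dist_Rep_ptensor: "dist (Rep_ptensor x) (Rep_ptensor y) = dist x y"
  by (simp add: dist_norm norm_ptensor_def Rep_ptensor_simps)

instance ptensor :: (real_normed_vector, real_normed_vector) banach
proof
  fix f :: "nat \<Rightarrow> ('a, 'b) ptensor"
  assume "Cauchy f"
  then have "Cauchy (\<lambda>n. Rep_ptensor (f n))"
    by (simp add: Cauchy_def dist_Rep_ptensor)
  then obtain l where l: "(\<lambda>n. Rep_ptensor (f n)) \<longlonglongrightarrow> l"
    using Cauchy_convergent convergent_def by blast
  have "closed ptensor_set"
    by (simp add: ptensor_set_def)
  then have "l \<in> ptensor_set"
    by (rule closed_sequentially[OF _ _ l]) (rule Rep_ptensor)
  then have "Rep_ptensor (Abs_ptensor l) = l"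
    by (rule Abs_ptensor_inverse)
  then have "f \<longlonglongrightarrow> Abs_ptensor l"
    using l by (simp add: tendsto_iff dist_Rep_ptensor[symmetric])
  then show "convergent f"
    by (auto simp: convergent_def)
qed

definition tens ::
    "'a::real_normed_vector \<Rightarrow> 'b::real_normed_vector \<Rightarrow> ('a, 'b) ptensor"
  where "tens u v = Abs_ptensor (elem_tensor u v)"

text \<open>The universal property: by Hahn-Banach the lift exists, with the norm of \<open>B\<close>, and it is
  unique because the elementary tensors span a dense subspace.\<close>

definition tensor_lift ::
    "('a::real_normed_vector \<Rightarrow>\<^sub>L 'b::real_normed_vector \<Rightarrow>\<^sub>L 'c::banach) \<Rightarrow> ('a, 'b) ptensor \<Rightarrow>\<^sub>L 'c"
  where "tensor_lift B =
    (THE L. \<forall>u v. blinfun_apply L (tens u v) = blinfun_apply (blinfun_apply B u) v)"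


section \<open>Sectorial operators, semigroups, fractional powers\<close>

text \<open>
  An unbounded operator is a pair of a domain \<open>D\<close> and a function \<open>A\<close> whose values off \<open>D\<close> are
  irrelevant. \<open>W\<close> is a real space, so the resolvent set is that of the complexification:
  \<open>(x, y)\<close> stands for \<open>x + \<i> y\<close>, and \<open>cpx_shift A l\<close> is \<open>l - A\<close>. The norm of the product type
  is equivalent to every complexification norm, and sectoriality does not depend on this choice.
\<close>

definition cpx_shift ::
    "('w::real_normed_vector \<Rightarrow> 'w) \<Rightarrow> complex \<Rightarrow> 'w \<times> 'w \<Rightarrow> 'w \<times> 'w"
  where "cpx_shift A l = (\<lambda>(x, y).
    (Re l *\<^sub>R x - Im l *\<^sub>R y - A x, Im l *\<^sub>R x + Re l *\<^sub>R y - A y))"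

definition resolvent ::
    "'w::real_normed_vector set \<Rightarrow> ('w \<Rightarrow> 'w) \<Rightarrow> complex \<Rightarrow> 'w \<times> 'w \<Rightarrow> 'w \<times> 'w"
  where "resolvent D A l = inv_into (D \<times> D) (cpx_shift A l)"

definition in_resolvent_set ::
    "'w::real_normed_vector set \<Rightarrow> ('w \<Rightarrow> 'w) \<Rightarrow> complex \<Rightarrow> bool"
  where "in_resolvent_set D A l \<longleftrightarrow>
    bij_betw (cpx_shift A l) (D \<times> D) UNIV \<and> bounded_linear (resolvent D A l)"

text \<open>
  \<open>0\<close> belongs to the resolvent set, as is needed for \<open>\<bar>(-A)\<^sup>\<gamma> x\<bar>\<close> to be a norm.
  A sectorial operator in this sense generates a bounded analytic semigroup.
\<close>

definition sectorial :: "'w::real_normed_vector set \<Rightarrow> ('w \<Rightarrow> 'w) \<Rightarrow> bool"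
  where "sectorial D A \<longleftrightarrow>
    subspace D \<and> closure D = UNIV \<and>
    (\<forall>x\<in>D. \<forall>y\<in>D. A (x + y) = A x + A y) \<and> (\<forall>c. \<forall>x\<in>D. A (c *\<^sub>R x) = c *\<^sub>R A x) \<and>
    in_resolvent_set D A 0 \<and>
    (\<exists>\<theta> M. pi / 2 < \<theta> \<and> \<theta> < pi \<and>
      (\<forall>l. l \<noteq> 0 \<longrightarrow> \<bar>Arg l\<bar> < \<theta> \<longrightarrow>
        in_resolvent_set D A l \<and> onorm (resolvent D A l) \<le> M / cmod l))"

definition C0_semigroup :: "(real \<Rightarrow> 'w::real_normed_vector \<Rightarrow>\<^sub>L 'w) \<Rightarrow> bool"
  where "C0_semigroup S \<longleftrightarrow>
    S 0 = id_blinfun \<and> (\<forall>s\<ge>0. \<forall>t\<ge>0. S (s + t) = S s o\<^sub>L S t) \<and>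
    (\<forall>x. ((\<lambda>t. blinfun_apply (S t) x) \<longlongrightarrow> x) (at_right 0))"

definition generates ::
    "'w::real_normed_vector set \<Rightarrow> ('w \<Rightarrow> 'w) \<Rightarrow> (real \<Rightarrow> 'w \<Rightarrow>\<^sub>L 'w) \<Rightarrow> bool"
  where "generates D A S \<longleftrightarrow>
    D = {x. \<exists>y. ((\<lambda>h. (blinfun_apply (S h) x - x) /\<^sub>R h) \<longlongrightarrow> y) (at_right 0)} \<and>
    (\<forall>x\<in>D. ((\<lambda>h. (blinfun_apply (S h) x - x) /\<^sub>R h) \<longlongrightarrow> A x) (at_right 0))"

text \<open>
  For \<open>\<gamma> > 0\<close>, \<open>neg_frac_pow S \<gamma>\<close> is \<open>(-A)\<^sup>-\<^sup>\<gamma>\<close> for the generator \<open>A\<close> of \<open>S\<close>, written as the usual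
  Gamma integral; \<open>(-A)\<^sup>\<gamma>\<close> is its inverse, defined on its range.
\<close>

definition neg_frac_pow ::
    "(real \<Rightarrow> 'w::{banach, second_countable_topology} \<Rightarrow>\<^sub>L 'w) \<Rightarrow> real \<Rightarrow> 'w \<Rightarrow> 'w"
  where "neg_frac_pow S \<gamma> x =
    (1 / Gamma \<gamma>) *\<^sub>R (LINT t:{0<..}|lborel. t powr (\<gamma> - 1) *\<^sub>R blinfun_apply (S t) x)"

definition dom_frac_pow ::
    "(real \<Rightarrow> 'w::{banach, second_countable_topology} \<Rightarrow>\<^sub>L 'w) \<Rightarrow> real \<Rightarrow> 'w set"
  where "dom_frac_pow S \<gamma> = range (neg_frac_pow S \<gamma>)"

definition frac_pow ::
    "(real \<Rightarrow> 'w::{banach, second_countable_topology} \<Rightarrow>\<^sub>L 'w) \<Rightarrow> real \<Rightarrow> 'w \<Rightarrow> 'w"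
  where "frac_pow S \<gamma> = inv (neg_frac_pow S \<gamma>)"


section \<open>The nonlinearity\<close>

definition fderiv ::
    "('a::real_normed_vector \<Rightarrow> 'b::real_normed_vector) \<Rightarrow> 'a \<Rightarrow> 'a \<Rightarrow>\<^sub>L 'b"
  where "fderiv f x = Blinfun (frechet_derivative f (at x))"

definition C3_bounded_derivs :: "('a::real_normed_vector \<Rightarrow> 'b::real_normed_vector) \<Rightarrow> bool"
  where "C3_bounded_derivs f \<longleftrightarrow>
    (\<forall>x. f differentiable (at x)) \<and>
    (\<forall>x. fderiv f differentiable (at x)) \<and>
    (\<forall>x. fderiv (fderiv f) differentiable (at x)) \<and>
    continuous_on UNIV (fderiv (fderiv (fderiv f))) \<and>
    bounded (range (fderiv f)) \<and>
    bounded (range (fderiv (fderiv f))) \<and>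
    bounded (range (fderiv (fderiv (fderiv f))))"

text \<open>The norm of \<open>K\<close> in \<open>L(V, D\<^sub>\<gamma>)\<close> is the operator norm of \<open>(-A)\<^sup>\<gamma> K\<close>.\<close>

definition Lipschitz_into_dom ::
    "(real \<Rightarrow> 'w::{banach, second_countable_topology} \<Rightarrow>\<^sub>L 'w) \<Rightarrow> real \<Rightarrow>
     ('w \<Rightarrow> 'v::real_normed_vector \<Rightarrow>\<^sub>L 'w) \<Rightarrow> bool"
  where "Lipschitz_into_dom S \<gamma> G \<longleftrightarrow>
    (\<forall>x. range (blinfun_apply (G x)) \<subseteq> dom_frac_pow S \<gamma> \<and>
         bounded_linear (\<lambda>v. frac_pow S \<gamma> (blinfun_apply (G x) v))) \<and>
    (\<exists>L. \<forall>x x'. onorm (\<lambda>v. frac_pow S \<gamma> (blinfun_apply (G x - G x') v)) \<le> L * norm (x - x'))"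


section \<open>Increments, seminorms, rough paths\<close>

definition Delta :: "real \<Rightarrow> (real \<times> real) set"
  where "Delta T = {(t, s). 0 \<le> s \<and> s < t \<and> t \<le> T}"

definition incr :: "(real \<Rightarrow> 'a::ab_group_add) \<Rightarrow> real \<Rightarrow> real \<Rightarrow> 'a"
  where "incr y t s = y t - y s"

text \<open>Suprema are taken in \<^typ>\<open>ennreal\<close>, so that finiteness is membership in the space concerned.\<close>

definition sup_norm :: "real \<Rightarrow> (real \<Rightarrow> 'a::real_normed_vector) \<Rightarrow> ennreal"
  where "sup_norm T y = (SUP t\<in>{0..T}. ennreal (norm (y t)))"

definition holder_seminorm ::
    "real \<Rightarrow> real \<Rightarrow> (real \<Rightarrow> real \<Rightarrow> 'a::real_normed_vector) \<Rightarrow> ennreal"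
  where "holder_seminorm \<gamma> T f =
    (SUP (t, s)\<in>Delta T. ennreal (norm (f t s) / (t - s) powr \<gamma>))"

definition weighted_seminorm ::
    "real \<Rightarrow> real \<Rightarrow> real \<Rightarrow> (real \<Rightarrow> real \<Rightarrow> 'a::real_normed_vector) \<Rightarrow> ennreal"
  where "weighted_seminorm \<gamma> \<kappa> T f =
    (SUP (t, s)\<in>{(t, s). 0 < s \<and> s < t \<and> t \<le> T}.
      ennreal (s powr \<kappa> * (norm (f t s) / (t - s) powr \<gamma>)))"

definition rough_path ::
    "real \<Rightarrow> real \<Rightarrow> (real \<Rightarrow> 'v::real_normed_vector) \<Rightarrow> (real \<Rightarrow> real \<Rightarrow> ('v, 'v) ptensor) \<Rightarrow> bool"
  where "rough_path \<alpha> T \<omega> \<omega>2 \<longleftrightarrow>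
    holder_seminorm \<alpha> T (incr \<omega>) < \<infinity> \<and>
    holder_seminorm (2 * \<alpha>) T \<omega>2 < \<infinity> \<and>
    (\<forall>s u t. 0 \<le> s \<and> s \<le> u \<and> u \<le> t \<and> t \<le> T \<longrightarrow>
      \<omega>2 t s - \<omega>2 u s - \<omega>2 t u = tens (incr \<omega> u s) (incr \<omega> t u))"

definition rough_dist ::
    "real \<Rightarrow> real \<Rightarrow> (real \<Rightarrow> 'v::real_normed_vector) \<Rightarrow> (real \<Rightarrow> real \<Rightarrow> ('v, 'v) ptensor) \<Rightarrow>
     (real \<Rightarrow> 'v) \<Rightarrow> (real \<Rightarrow> real \<Rightarrow> ('v, 'v) ptensor) \<Rightarrow> ennreal"
  where "rough_dist \<alpha> T \<omega> \<omega>2 \<omega>' \<omega>2' =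
    holder_seminorm \<alpha> T (\<lambda>t s. incr \<omega> t s - incr \<omega>' t s) +
    holder_seminorm (2 * \<alpha>) T (\<lambda>t s. \<omega>2 t s - \<omega>2' t s)"

text \<open>Partitions of \<open>[s, t]\<close> are the strictly increasing lists of their points.\<close>

definition partition_of :: "real \<Rightarrow> real \<Rightarrow> real list \<Rightarrow> bool"
  where "partition_of s t ps \<longleftrightarrow>
    ps \<noteq> [] \<and> sorted_wrt (<) ps \<and> hd ps = s \<and> last ps = t"

definition piecewise_linear :: "real \<Rightarrow> (real \<Rightarrow> 'v::real_vector) \<Rightarrow> bool"
  where "piecewise_linear T f \<longleftrightarrow>
    (\<exists>ps. partition_of 0 T ps \<and>
      (\<forall>i < length ps - 1. \<exists>c d. \<forall>t\<in>{ps ! i..ps ! Suc i}. f t = c + t *\<^sub>R d))"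

text \<open>\<open>\<integral>\<^sub>s\<^sup>t (\<delta>\<omega>)\<^sub>r\<^sub>s \<otimes> d\<omega>\<^sub>r\<close> for piecewise linear \<open>\<omega>\<close>; the finitely many kinks do not matter.\<close>

definition canonical_lift ::
    "(real \<Rightarrow> 'v::real_normed_vector) \<Rightarrow> real \<Rightarrow> real \<Rightarrow> ('v, 'v) ptensor"
  where "canonical_lift \<omega> t s =
    integral {s..t} (\<lambda>r. tens (incr \<omega> r s) (vector_derivative \<omega> (at r)))"

definition limit_of_piecewise_linear ::
    "real \<Rightarrow> real \<Rightarrow> (real \<Rightarrow> 'v::real_normed_vector) \<Rightarrow> (real \<Rightarrow> real \<Rightarrow> ('v, 'v) ptensor) \<Rightarrow> bool"
  where "limit_of_piecewise_linear \<alpha> T \<omega> \<omega>2 \<longleftrightarrow>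
    (\<exists>\<omega>n. (\<forall>n. piecewise_linear T (\<omega>n n)) \<and>
      (\<lambda>n. rough_dist \<alpha> T \<omega> \<omega>2 (\<omega>n n) (canonical_lift (\<omega>n n))) \<longlonglongrightarrow> 0)"


section \<open>Limits along partitions and sewing\<close>

definition partition_limit ::
    "real \<Rightarrow> real \<Rightarrow> (real \<Rightarrow> real \<Rightarrow> 'a::real_normed_vector) \<Rightarrow> 'a \<Rightarrow> bool"
  where "partition_limit s t F l \<longleftrightarrow>
    (\<forall>\<epsilon>>0. \<exists>d>0. \<forall>ps. partition_of s t ps \<longrightarrow>
      (\<forall>i < length ps - 1. ps ! Suc i - ps ! i < d) \<longrightarrow>
      norm ((\<Sum>i < length ps - 1. F (ps ! Suc i) (ps ! i)) - l) < \<epsilon>)"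

text \<open>
  The sewing map, for a space on which the semigroup acts by \<open>act\<close>: on \<open>W\<close> itself by application,
  on the operator space \<open>Z\<close> by composition from the left. Paths on \<open>[0, T]\<close> are functions that
  vanish off \<open>[0, T]\<close>.
\<close>

definition hat_incr ::
    "(real \<Rightarrow> 'a \<Rightarrow> 'a) \<Rightarrow> (real \<Rightarrow> 'a::real_normed_vector) \<Rightarrow> real \<Rightarrow> real \<Rightarrow> 'a"
  where "hat_incr act y t s = y t - act (t - s) (y s)"

definition sew ::
    "(real \<Rightarrow> 'a \<Rightarrow> 'a) \<Rightarrow> real \<Rightarrow> (real \<Rightarrow> real \<Rightarrow> 'a::real_normed_vector) \<Rightarrow> real \<Rightarrow> 'a"
  where "sew act T \<Xi> = (THE I. I 0 = 0 \<and> (\<forall>t. t \<notin> {0..T} \<longrightarrow> I t = 0) \<and>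
    (\<forall>(t, s)\<in>Delta T. partition_limit s t (\<lambda>v u. act (t - v) (\<Xi> v u)) (hat_incr act I t s)))"


section \<open>Supporting processes\<close>

text \<open>
  \<open>L(W \<otimes> V, W)\<close> is identified with the bounded bilinear maps \<^typ>\<open>'w \<Rightarrow>\<^sub>L 'v \<Rightarrow>\<^sub>L 'w\<close>, isometrically.
  Then \<open>E w\<close> is \<open>blinfun_apply E w\<close>, and \<open>E K\<close> is \<open>tensor_lift (E o\<^sub>L K)\<close>, because
  \<open>(E K)(u \<otimes> v) = E (K u) v\<close>. All integrals are Bochner integrals.
\<close>

definition omega_S ::
    "('w \<Rightarrow> 'w) \<Rightarrow> (real \<Rightarrow> 'w::{banach, second_countable_topology} \<Rightarrow>\<^sub>L 'w) \<Rightarrow>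
     (real \<Rightarrow> 'v::real_normed_vector) \<Rightarrow> real \<Rightarrow> real \<Rightarrow> ('v \<Rightarrow>\<^sub>L 'w) \<Rightarrow> 'w"
  where "omega_S A S \<omega> t s K =
    blinfun_apply (S (t - s)) (blinfun_apply K (incr \<omega> t s))
    - A (LINT r:{s..t}|lborel. blinfun_apply (S (t - r)) (blinfun_apply K (incr \<omega> t r)))"

definition proc_a ::
    "('w \<Rightarrow> 'w) \<Rightarrow> (real \<Rightarrow> 'w::{banach, second_countable_topology} \<Rightarrow>\<^sub>L 'w) \<Rightarrow>
     (real \<Rightarrow> 'v::real_normed_vector) \<Rightarrow> real \<Rightarrow> real \<Rightarrow> ('w \<Rightarrow>\<^sub>L 'v \<Rightarrow>\<^sub>L 'w) \<Rightarrow> 'w \<Rightarrow> 'w"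
  where "proc_a A S \<omega> t s E x =
    omega_S A S \<omega> t s (blinfun_apply E x)
    + Lim (at_right 0) (\<lambda>\<epsilon>. LINT r:{s + \<epsilon>..t}|lborel.
        omega_S A S \<omega> t r (blinfun_apply E (A (blinfun_apply (S (r - s)) x))))"

definition proc_c ::
    "('w \<Rightarrow> 'w) \<Rightarrow> (real \<Rightarrow> 'w::{banach, second_countable_topology} \<Rightarrow>\<^sub>L 'w) \<Rightarrow>
     (real \<Rightarrow> 'v::real_normed_vector) \<Rightarrow> (real \<Rightarrow> real \<Rightarrow> ('v, 'v) ptensor) \<Rightarrow>
     real \<Rightarrow> real \<Rightarrow> ('w \<Rightarrow>\<^sub>L 'v \<Rightarrow>\<^sub>L 'w) \<Rightarrow> ('v \<Rightarrow>\<^sub>L 'w) \<Rightarrow> 'w"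
  where "proc_c A S \<omega> \<omega>2 t s E K =
    blinfun_apply (S (t - s)) (blinfun_apply (tensor_lift (E o\<^sub>L K)) (\<omega>2 t s))
    - (LINT r:{s..t}|lborel. A (blinfun_apply (S (t - r))
        (blinfun_apply (tensor_lift (E o\<^sub>L K)) (\<omega>2 t r + tens (incr \<omega> r s) (incr \<omega> t r)))))"

definition proc_b ::
    "('w \<Rightarrow> 'w) \<Rightarrow> (real \<Rightarrow> 'w::{banach, second_countable_topology} \<Rightarrow>\<^sub>L 'w) \<Rightarrow>
     (real \<Rightarrow> 'v::real_normed_vector) \<Rightarrow> (real \<Rightarrow> real \<Rightarrow> ('v, 'v) ptensor) \<Rightarrow>
     real \<Rightarrow> real \<Rightarrow> ('w \<Rightarrow>\<^sub>L 'v \<Rightarrow>\<^sub>L 'w) \<Rightarrow> ('v \<Rightarrow>\<^sub>L 'w) \<Rightarrow> 'w"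
  where "proc_b A S \<omega> \<omega>2 t s E K =
    (THE l. partition_limit s t (\<lambda>v u. blinfun_apply (S (t - v))
      (omega_S A S \<omega> v u (blinfun_apply E (omega_S A S \<omega> u s K)) + proc_c A S \<omega> \<omega>2 v u E K)) l)"


section \<open>Solution space and solution map\<close>

type_synonym ('v, 'w) Z = "('w \<Rightarrow>\<^sub>L 'v \<Rightarrow>\<^sub>L 'w) \<Rightarrow>\<^sub>L 'w"

type_synonym ('v, 'w) pair = "(real \<Rightarrow> 'w) \<times> (real \<Rightarrow> real \<Rightarrow> ('v, 'w) Z)"

definition y_norm :: "real \<Rightarrow> real \<Rightarrow> (real \<Rightarrow> 'w::real_normed_vector) \<Rightarrow> ennreal"
  where "y_norm \<beta> T y = sup_norm T y + weighted_seminorm \<beta> \<beta> T (incr y)"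

definition z_norm ::
    "real \<Rightarrow> real \<Rightarrow> (real \<Rightarrow> real \<Rightarrow> 'z::real_normed_vector) \<Rightarrow> ennreal"
  where "z_norm \<alpha> T z = sup_norm T (\<lambda>t. z t 0) + holder_seminorm \<alpha> T z"

definition z_weighted_norm ::
    "real \<Rightarrow> real \<Rightarrow> real \<Rightarrow> (real \<Rightarrow> real \<Rightarrow> 'z::real_normed_vector) \<Rightarrow> ennreal"
  where "z_weighted_norm \<gamma> \<kappa> T z = sup_norm T (\<lambda>t. z t 0) + weighted_seminorm \<gamma> \<kappa> T z"

definition X_norm ::
    "real \<Rightarrow> real \<Rightarrow> real \<Rightarrow> ('v::real_normed_vector, 'w::real_normed_vector) pair \<Rightarrow> ennreal"
  where "X_norm \<alpha> \<beta> T = (\<lambda>(y, z).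
    y_norm \<beta> T y + z_norm \<alpha> T z + z_weighted_norm (\<alpha> + \<beta>) \<beta> T z)"

text \<open>
  Paths vanish off \<open>[0, T]\<close> and two-parameter functions off \<open>\<Delta>\<^sub>T\<close> (in particular on the diagonal),
  so that equality of elements of the solution space is equality of functions.
\<close>

definition X_space ::
    "('w \<Rightarrow> 'w) \<Rightarrow> (real \<Rightarrow> 'w \<Rightarrow>\<^sub>L 'w) \<Rightarrow> real \<Rightarrow> real \<Rightarrow> (real \<Rightarrow> 'v) \<Rightarrow> real \<Rightarrow>
     ('v::real_normed_vector, 'w::{banach, second_countable_topology}) pair set"
  where "X_space A S \<alpha> \<beta> \<omega> T = {(y, z).
    (\<forall>t. t \<notin> {0..T} \<longrightarrow> y t = 0) \<and> continuous_on {0..T} y \<and> y_norm \<beta> T y < \<infinity> \<and>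
    (\<forall>t s. (t, s) \<notin> Delta T \<longrightarrow> z t s = 0) \<and>
    z_norm \<alpha> T z < \<infinity> \<and> z_weighted_norm (\<alpha> + \<beta>) \<beta> T z < \<infinity> \<and>
    (\<forall>s \<tau> t E. 0 \<le> s \<and> s \<le> \<tau> \<and> \<tau> \<le> t \<and> t \<le> T \<longrightarrow>
      blinfun_apply (z t s) E - blinfun_apply (z t \<tau>) E
        - blinfun_apply (S (t - \<tau>)) (blinfun_apply (z \<tau> s) E)
      = omega_S A S \<omega> t \<tau> (blinfun_apply E (incr y \<tau> s)))}"

definition X_ball ::
    "('w \<Rightarrow> 'w) \<Rightarrow> (real \<Rightarrow> 'w \<Rightarrow>\<^sub>L 'w) \<Rightarrow> real \<Rightarrow> real \<Rightarrow> (real \<Rightarrow> 'v) \<Rightarrow> real \<Rightarrow> real \<Rightarrow>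
     ('v::real_normed_vector, 'w::{banach, second_countable_topology}) pair set"
  where "X_ball A S \<alpha> \<beta> \<omega> T R = {p \<in> X_space A S \<alpha> \<beta> \<omega> T. X_norm \<alpha> \<beta> T p \<le> ennreal R}"

definition Xi_y ::
    "('w \<Rightarrow> 'w) \<Rightarrow> (real \<Rightarrow> 'w \<Rightarrow>\<^sub>L 'w) \<Rightarrow> (real \<Rightarrow> 'v) \<Rightarrow> ('w \<Rightarrow> 'v \<Rightarrow>\<^sub>L 'w) \<Rightarrow>
     ('v::real_normed_vector, 'w::{banach, second_countable_topology}) pair \<Rightarrow> real \<Rightarrow> real \<Rightarrow> 'w"
  where "Xi_y A S \<omega> G = (\<lambda>(y, z) v u.
    omega_S A S \<omega> v u (G (y u)) + blinfun_apply (z v u) (fderiv G (y u)))"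

definition Xi_z ::
    "('w \<Rightarrow> 'w) \<Rightarrow> (real \<Rightarrow> 'w \<Rightarrow>\<^sub>L 'w) \<Rightarrow> (real \<Rightarrow> 'v) \<Rightarrow> (real \<Rightarrow> real \<Rightarrow> ('v, 'v) ptensor) \<Rightarrow>
     ('w \<Rightarrow> 'v \<Rightarrow>\<^sub>L 'w) \<Rightarrow> (real \<Rightarrow> 'w) \<Rightarrow> (real \<Rightarrow> 'w) \<Rightarrow> real \<Rightarrow> real \<Rightarrow>
     ('v::real_normed_vector, 'w::{banach, second_countable_topology}) Z"
  where "Xi_z A S \<omega> \<omega>2 G y y' v u =
    Blinfun (\<lambda>E. proc_b A S \<omega> \<omega>2 v u E (G (y u)) + proc_a A S \<omega> v u E (y' u))"

definition solution_map ::
    "('w \<Rightarrow> 'w) \<Rightarrow> (real \<Rightarrow> 'w \<Rightarrow>\<^sub>L 'w) \<Rightarrow> (real \<Rightarrow> 'v) \<Rightarrow> (real \<Rightarrow> real \<Rightarrow> ('v, 'v) ptensor) \<Rightarrow>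
     ('w \<Rightarrow> 'v \<Rightarrow>\<^sub>L 'w) \<Rightarrow> 'w \<Rightarrow> real \<Rightarrow>
     ('v::real_normed_vector, 'w::{banach, second_countable_topology}) pair \<Rightarrow> ('v, 'w) pair"
  where "solution_map A S \<omega> \<omega>2 G \<xi> T p =
    (let
      y = fst p;
      y' = (\<lambda>t. if t \<in> {0..T}
        then blinfun_apply (S t) \<xi> + sew (\<lambda>t. blinfun_apply (S t)) T (Xi_y A S \<omega> G p) t else 0);
      act = (\<lambda>t \<zeta>. S t o\<^sub>L \<zeta>);
      I = sew act T (Xi_z A S \<omega> \<omega>2 G y y');
      z' = (\<lambda>t s. if (t, s) \<in> Delta T
        then Blinfun (\<lambda>E. blinfun_apply (hat_incr act I t s) E - omega_S A S \<omega> t s (blinfun_apply E (y' s)))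
        else 0)
    in (y', z'))"

end

theory Submission
  imports Defs "HOL-Probability.Sinc_Integral"
begin

text \<open>
 The resolvent bounds on the half plane \<open>Re l \<ge> 0\<close> control the Laplace transforms of \<open>t\<^sup>k S t x\<close> along
 vertical lines. Inverting these transforms after applying functionals gives exponential decay of
 \<open>S\<close> and \<open>\<bar>A (S t x)\<bar> \<le> M \<bar>x\<bar> / t\<close>. Of the space \<open>D\<^sub>\<beta>\<close> only the bound \<open>\<bar>A (S u x)\<bar> \<le> N u powr (\<beta> - 1)\<close> is used.

 Partition sums converge because removing the subinterval around the midpoint halves the interval at
 the cost of one defect \<open>\<delta>\<^sub>2 \<Xi>\<close>. A weight \<open>u powr - \<theta>\<close> in the bound of the defect can be moved to the right
 endpoint \<open>v\<close>, where it is dominated by an increment of the control \<open>v powr (1 - \<theta>)\<close>.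

 The processes \<open>b\<close> and \<open>c\<close> differ by a term of order \<open>2 \<alpha> + \<beta>\<close>. So \<open>b (E, K\<^sub>u - K\<^sub>m)\<close> costs the \<open>W\<close>-norm of
 \<open>K\<^sub>u - K\<^sub>m\<close> at the rate \<open>2 \<alpha>\<close>, and its \<open>D\<^sub>\<beta>\<close>-norm only at the rate \<open>2 \<alpha> + \<beta>\<close>, where no decay of this norm
 is needed; hence Lipschitz continuity of \<open>G\<close> into \<open>D\<^sub>\<beta>\<close> suffices.

 On the ball of radius \<open>R\<close> the solution map is Lipschitz with constant \<open>\<kappa> R * T powr \<alpha>\<close>, and the image of
 \<open>0\<close> is bounded in terms of \<open>r\<close> alone. Taking \<open>R\<close> large for the latter and then \<open>T\<close> small, the ball is
 invariant and Picard iteration converges.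
\<close>

text \<open>The limits behind \<open>proc_b\<close> and \<open>sew\<close> and the operators wrapped
  in \<open>Blinfun\<close> are descriptions, so existence, uniqueness and linearity come before any
  estimate of the solution map. For the solution map this is done once, for differences: two pairs
  are compared directly, the zero pair has additive germs and hence explicit paths, and a single
  pair is treated through its difference from zero. One estimate thus yields well-definedness,
  invariance and contraction. The obstacle is the initial value, which lies in the base space only.
  Increments are \<beta>-Hoelder only with the weight \<open>s powr - \<beta>\<close>, and products
  of two of them carry \<open>s powr - (2 * \<beta>)\<close>, integrable because
  \<open>2 * \<beta> < 1\<close>. Each germ therefore has two bounds, an unweighted one with an
  exponent of at most 1 and a weighted one with an exponent above 1; sewing needs both. The margins
  are \<open>\<alpha> + 2 * \<beta> - 1\<close> for \<open>y\<close> and for \<open>b\<close>, and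
  \<open>2 * \<alpha> + \<beta> - 1\<close> for \<open>z\<close>. Times are kept at most 1, so that
  higher powers of an interval length are dominated by lower ones.\<close>

lemma convergent_of_tail_bound:
 fixes X :: "nat => 'a::banach"
 assumes "\<And>n m. norm (X (n + m) - X n) <= c n" "c \<longlonglongrightarrow> 0"
 shows "convergent X"
proof -
 have "Cauchy X"
 proof (rule metric_CauchyI)
  fix e :: real assume "0 < e"
  then obtain N where N: "norm (c N) < e / 2" using LIMSEQ_D[OF assms(2), of "e / 2"] by auto
  have "dist (X n) (X N) < e / 2" if "N <= n" for n using assms(1)[of N "n - N"] N that by (simp add: dist_norm)
  then show "\<exists>N. \<forall>m\<ge>N. \<forall>n\<ge>N. dist (X m) (X n) < e" using dist_triangle_half_r by (metis dist_commute)
 qed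
 then show ?thesis by (rule Cauchy_convergent)
qed

section \<open>Functionals that attain the norm\<close>

definition sublinear_below_norm :: "('a::real_normed_vector => real) => bool"
 where "sublinear_below_norm q \<longleftrightarrow>
  (\<forall>x y. q (x + y) <= q x + q y) \<and> (\<forall>c x. 0 <= c --> q (c *\<^sub>R x) = c * q x) \<and> (\<forall>x. q x <= norm x)"

lemma sublinear_below_norm_lower:
 assumes "sublinear_below_norm q"
 shows "- q (- x) <= q x" "- norm x <= q x"
proof -
 have "q (x + - x) <= q x + q (- x)" using assms unfolding sublinear_below_norm_def by blast
 moreover have "q 0 = 0" using assms unfolding sublinear_below_norm_def
  by (metis mult_zero_left order_refl scaleR_zero_left)
 ultimately show 1: "- q (- x) <= q x" by simp
 have "q (- x) <= norm (- x)" using assms unfolding sublinear_below_norm_def by blast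
 then show "- norm x <= q x" using 1 by simp
qed

text \<open>Subadditivity bounds the values along the ray below by \<open>- q (- x)\<close>, so the
  infimum exists, and adding two ray parameters gives subadditivity of \<open>qy\<close>. The last
  claim is the parameter 1: where tilting changes nothing, it reads
  \<open>q x + q y \<le> q (x + y)\<close>, which is what makes a minimal functional
  additive.\<close>

lemma sublinear_below_norm_tilt:
 fixes q :: "'a::real_normed_vector => real" and y :: 'a
 assumes q: "sublinear_below_norm q"
 defines "qy \<equiv> \<lambda>x. INF t\<in>{0..}. q (x + t *\<^sub>R y) - t * q y"
 shows "sublinear_below_norm qy" "qy x <= q x" "qy x <= q (x + y) - q y"
proof -
 have sub: "q (a + b) <= q a + q b" for a b using q unfolding sublinear_below_norm_def by blast
 have hom: "0 <= c ==> q (c *\<^sub>R a) = c * q a" for c a using q unfolding sublinear_below_norm_def by blast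
 have bd: "- q (- x) <= q (x + t *\<^sub>R y) - t * q y" if "t \<ge> 0" for x and t :: real
 proof -
  have "t * q y <= q (x + t *\<^sub>R y) + q (- x)" using sub[of "x + t *\<^sub>R y" "- x"] hom[OF that, of y] by simp
  then show ?thesis by simp
 qed
 have bdd: "bdd_below ((\<lambda>t. q (x + t *\<^sub>R y) - t * q y) ` {0..})" for x
  by (rule bdd_belowI[of _ "- q (- x)"]) (use bd in auto)
 have le: "qy x <= q (x + t *\<^sub>R y) - t * q y" if "t \<ge> 0" for x t
  unfolding qy_def by (rule cINF_lower[OF bdd]) (use that in auto)
 have ge: "z <= qy x" if "\<And>t. t \<ge> 0 ==> z <= q (x + t *\<^sub>R y) - t * q y" for x z
  unfolding qy_def by (rule cINF_greatest) (use that in auto)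
 show leq: "qy x <= q x" for x using le[of 0 x] by simp
 show "qy x <= q (x + y) - q y" using le[of 1 x] by simp
 show "sublinear_below_norm qy" unfolding sublinear_below_norm_def
 proof (intro conjI allI impI)
  fix a b
  show "qy (a + b) <= qy a + qy b"
  proof -
   have "qy (a + b) - (q (b + t *\<^sub>R y) - t * q y) <= qy a" if t: "t \<ge> 0" for t
   proof (rule ge)
    fix s :: real assume s: "s \<ge> 0"
    have "q (a + b + (s + t) *\<^sub>R y) <= q (a + s *\<^sub>R y) + q (b + t *\<^sub>R y)"
     using sub[of "a + s *\<^sub>R y" "b + t *\<^sub>R y"] by (simp add: algebra_simps)
    then show "qy (a + b) - (q (b + t *\<^sub>R y) - t * q y) <= q (a + s *\<^sub>R y) - s * q y"
     using le[of "s + t" "a + b"] s t by (simp add: algebra_simps)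
   qed
   then have "qy (a + b) - qy a <= q (b + t *\<^sub>R y) - t * q y" if "t \<ge> 0" for t
    using that by (simp add: algebra_simps)
   then have "qy (a + b) - qy a <= qy b" by (rule ge)
   then show ?thesis by simp
  qed
 next
  fix c :: real and x assume c: "0 <= c"
  show "qy (c *\<^sub>R x) = c * qy x"
  proof (cases "c = 0")
   case True
   have "- q (- 0) <= qy 0" by (rule ge) (use bd[of _ 0] in auto)
   moreover have "q 0 = 0" using hom[of 0 0] by simp
   ultimately show ?thesis using leq[of 0] True by simp
  next
   case False
   then have c0: "c > 0" using c by simp
   have *: "qy (c *\<^sub>R x) <= c * qy x" if c: "c > 0" for c x
   proof -
    have "qy (c *\<^sub>R x) / c <= q (x + t *\<^sub>R y) - t * q y" if "t \<ge> 0" for t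
    proof -
     have "qy (c *\<^sub>R x) <= q (c *\<^sub>R (x + t *\<^sub>R y)) - c * t * q y"
      using le[of "c * t" "c *\<^sub>R x"] c that by (simp add: algebra_simps)
     then have "qy (c *\<^sub>R x) <= c * (q (x + t *\<^sub>R y) - t * q y)"
      using hom[of c "x + t *\<^sub>R y"] c by (simp add: algebra_simps)
     then show ?thesis using c by (simp add: field_simps)
    qed
    then have "qy (c *\<^sub>R x) / c <= qy x" by (rule ge)
    then show ?thesis using c by (simp add: field_simps)
   qed
   have "qy x <= qy (c *\<^sub>R x) / c" using *[of "1 / c" "c *\<^sub>R x"] c0 by simp
   then show ?thesis using *[OF c0, of x] c0 by (simp add: field_simps)
  qed
 next
  fix x show "qy x <= norm x" using leq[of x] q unfolding sublinear_below_norm_def by (meson order_trans)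
 qed
qed

text \<open>A minimal sublinear functional is linear, because tilting it along any direction cannot make
 it smaller.\<close>

theorem norming_functional:
 fixes c :: "'a::real_normed_vector"
 obtains \<phi> :: "'a \<Rightarrow>\<^sub>L real" where "norm \<phi> <= 1" "blinfun_apply \<phi> c = norm c"
proof -
 have nrm: "sublinear_below_norm (norm :: 'a => real)"
  unfolding sublinear_below_norm_def by (auto simp: norm_triangle_ineq)
 \<comment> \<open>Tilting the norm along \<open>c\<close> pushes the value at \<open>- c\<close>
   down to \<open>- norm c\<close>; a linear functional below \<open>p\<close> then has the value
   \<open>norm c\<close> at \<open>c\<close>.\<close>
 define p where "p = (\<lambda>x::'a. INF t\<in>{0..}. norm (x + t *\<^sub>R c) - t * norm c)"
 have p: "sublinear_below_norm p" "p (- c) <= - norm c" using sublinear_below_norm_tilt(1)[OF nrm, of c]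
   sublinear_below_norm_tilt(3)[OF nrm, where x = "- c" and y = c] unfolding p_def by simp_all
 define Q where "Q = {q :: 'a => real. sublinear_below_norm q \<and> q <= p}"
 have "\<exists>m\<in>Q. \<forall>q\<in>Q. q <= m --> q = m"
 proof (rule predicate_Zorn[of Q "(\<ge>)"])
  show "partial_order_on Q (relation_of (\<ge>) Q)" by (rule partial_order_on_relation_ofI) auto
 next
  fix C assume "C \<in> Chains (relation_of (\<ge>) Q)"
  then have C: "C \<subseteq> Q" and tot: "\<And>f g. f \<in> C ==> g \<in> C ==> f <= g \<or> g <= f" unfolding Chains_def relation_of_def by auto
  show "\<exists>u\<in>Q. \<forall>a\<in>C. u <= a"
  proof (cases "C = {}")
   case True
   then show ?thesis using p by (auto simp: Q_def)
  next
   case False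
   \<comment> \<open>A pointwise infimum of sublinear functionals is subadditive along a chain,
     where one member lies below any two.\<close>
   define u where "u = (\<lambda>x. INF q\<in>C. q x)"
   have sl: "sublinear_below_norm q" "q <= p" if "q \<in> C" for q using C that by (auto simp: Q_def)
   have bdd: "bdd_below ((\<lambda>q. q x) ` C)" for x
    by (rule bdd_belowI[of _ "- norm x"]) (use sl sublinear_below_norm_lower in blast)
   have le: "u x <= q x" if "q \<in> C" for q x unfolding u_def by (rule cINF_lower[OF bdd that])
   have ge: "y <= u x" if "\<And>q. q \<in> C ==> y <= q x" for x y unfolding u_def by (rule cINF_greatest[OF False that])
   obtain q0 where q0: "q0 \<in> C" using False by auto
   have "sublinear_below_norm u" unfolding sublinear_below_norm_def
   proof (intro conjI allI impI)
    fix x y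
    have "u (x + y) <= f x + g y" if fg: "f \<in> C" "g \<in> C" for f g
    proof -
     obtain h where h: "h \<in> C" "h <= f" "h <= g" using tot[OF fg] fg by auto
     have "u (x + y) <= h x + h y"
      using le[OF h(1)] sl[OF h(1)] unfolding sublinear_below_norm_def by (meson order_trans)
     then show ?thesis using h(2,3) by (meson add_mono le_funD order_trans)
    qed
    then have "u (x + y) - f x <= u y" if "f \<in> C" for f using that by (intro ge) (metis add.commute diff_le_eq)
    then have "u (x + y) - u y <= u x" by (intro ge) (metis add.commute diff_le_eq)
    then show "u (x + y) <= u x + u y" by simp
   next
    fix a :: real and x assume a: "0 <= a"
    have eq: "q (a *\<^sub>R x) = a * q x" if "q \<in> C" for q
     using sl[OF that] a unfolding sublinear_below_norm_def by blast
    show "u (a *\<^sub>R x) = a * u x"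
    proof (cases "a = 0")
     case True
     then have "q 0 = 0" if "q \<in> C" for q using eq[OF that] by simp
     then have "u 0 = 0" using le[OF q0, of 0] ge[of 0 0] q0 by (metis order_antisym order_refl)
     then show ?thesis using True by simp
    next
     case False
     then have a: "a > 0" using a by simp
     have "u (a *\<^sub>R x) / a <= u x" by (rule ge) (metis a eq le mult.commute pos_divide_le_eq)
     moreover have "a * u x <= u (a *\<^sub>R x)" by (rule ge) (simp add: eq le a less_imp_le)
     ultimately show ?thesis using a by (simp add: field_simps)
    qed
   next
    fix x show "u x <= norm x"
     using le[OF q0, of x] sl(1)[OF q0] unfolding sublinear_below_norm_def by (meson order_trans)
   qed
   moreover have "u <= p" using le[OF q0] sl(2)[OF q0] by (meson le_funD le_funI order_trans)
   ultimately show ?thesis using le by (auto simp: Q_def le_fun_def)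
  qed
 qed
 then obtain m where m: "m \<in> Q" and min: "\<And>q. q \<in> Q ==> q <= m ==> q = m" by blast
 then have slm: "sublinear_below_norm m" and mp: "m <= p" by (auto simp: Q_def)
 have hom: "0 <= a ==> m (a *\<^sub>R x) = a * m x" for a x using slm unfolding sublinear_below_norm_def by blast
 have add: "m (x + y) = m x + m y" for x y
 proof -
  let ?q = "\<lambda>x. INF t\<in>{0..}. m (x + t *\<^sub>R y) - t * m y"
  have "?q <= m" using sublinear_below_norm_tilt(2)[OF slm] by (simp add: le_fun_def)
  then have qm: "?q = m" using sublinear_below_norm_tilt(1)[OF slm, of y] mp by (intro min) (auto simp: Q_def)
  then have "m x <= m (x + y) - m y"
   using sublinear_below_norm_tilt(3)[OF slm, where x = x and y = y] fun_cong[OF qm, of x] by simp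
  then show ?thesis using slm unfolding sublinear_below_norm_def by (smt (verit))
 qed
 have m0: "m 0 = 0" using hom[of 0 0] by simp
 have minus: "m (- x) = - m x" for x using add[of x "- x"] m0 by simp
 have bl: "bounded_linear m"
 proof (rule bounded_linear_intro[where K = 1])
  show "m (a *\<^sub>R x) = a *\<^sub>R m x" for a x
  proof (cases "0 <= a")
   case True then show ?thesis using hom by simp
  next
   case False
   then have "m ((- a) *\<^sub>R x) = (- a) * m x" by (intro hom) simp
   then show ?thesis using minus[of "a *\<^sub>R x"] by simp
  qed
  show "norm (m x) <= norm x * 1" for x
   using sublinear_below_norm_lower(2)[OF slm, of x] slm unfolding sublinear_below_norm_def by (auto simp: abs_le_iff)
 qed (rule add)
 have nle: "norm (Blinfun m) <= 1"
 proof (rule norm_blinfun_bound)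
  show "norm (blinfun_apply (Blinfun m) x) <= 1 * norm x" for x
   using sublinear_below_norm_lower(2)[OF slm, of x] slm bl
   unfolding sublinear_below_norm_def by (auto simp: bounded_linear_Blinfun_apply abs_le_iff)
 qed simp
 have "norm c <= m c" using mp p(2) minus[of c] by (smt (verit) le_funD)
 then have "m c = norm c" using slm unfolding sublinear_below_norm_def by (smt (verit))
 then show ?thesis using that[of "Blinfun m"] nle bl by (simp add: bounded_linear_Blinfun_apply)
qed

lemma eq_by_functionals:
 fixes x y :: "'a::real_normed_vector"
 assumes "\<And>\<phi> :: 'a \<Rightarrow>\<^sub>L real. blinfun_apply \<phi> x = blinfun_apply \<phi> y"
 shows "x = y"
proof -
 obtain \<phi> :: "'a \<Rightarrow>\<^sub>L real" where "blinfun_apply \<phi> (x - y) = norm (x - y)" by (rule norming_functional)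
 then show ?thesis using assms[of \<phi>] by (simp add: blinfun.diff_right)
qed

lemma norm_le_by_functionals:
 fixes x :: "'a::real_normed_vector"
 assumes "\<And>\<phi> :: 'a \<Rightarrow>\<^sub>L real. norm \<phi> <= 1 ==> blinfun_apply \<phi> x <= b"
 shows "norm x <= b" by (metis assms norming_functional)

section \<open>Bounded bilinear maps as linear maps on the tensor product\<close>

lemma elem_tensor_apply: "blinfun_apply (elem_tensor u v) B = B u v"
proof -
 have "bounded_linear (\<lambda>B :: 'a \<Rightarrow>\<^sub>L 'b \<Rightarrow>\<^sub>L real. B u v)"
  by (intro bounded_linear_compose[OF blinfun.bounded_linear_left blinfun.bounded_linear_left])
 then show ?thesis by (simp add: elem_tensor_def bounded_linear_Blinfun_apply)
qed

lemma Rep_tens: "Rep_ptensor (tens u v) = elem_tensor u v" unfolding tens_def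
 by (rule Abs_ptensor_inverse) (auto simp: ptensor_set_def intro!: subsetD[OF closure_subset] span_base)

lemma norm_tens_le: "norm (tens u v) <= norm u * norm v" unfolding norm_ptensor_def Rep_tens
proof (rule norm_blinfun_bound)
 fix B :: "'a \<Rightarrow>\<^sub>L 'b \<Rightarrow>\<^sub>L real"
 have "norm (B u v) <= norm (B u) * norm v" by (rule norm_blinfun)
 also have "\<dots> <= norm B * norm u * norm v" by (intro mult_right_mono norm_blinfun) simp
 finally show "norm (blinfun_apply (elem_tensor u v) B) <= norm u * norm v * norm B"
  by (simp add: elem_tensor_apply mult_ac)
qed simp

lemma tens_zero_right [simp]: "tens u 0 = 0" and tens_zero_left [simp]: "tens 0 v = 0"
 using norm_tens_le[of u "0"] norm_tens_le[of "0" v] by simp_all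

lemma bounded_linear_Rep_ptensor: "bounded_linear Rep_ptensor"
 by (rule bounded_linear_intro[where K = 1]) (simp_all add: Rep_ptensor_simps norm_ptensor_def)

text \<open>Density of the span of the elementary tensors, as an induction rule: the first four
  premises reach the span, closedness reaches its limits.\<close>

lemma ptensor_induct:
 fixes P :: "('a::real_normed_vector, 'b::real_normed_vector) ptensor => bool"
 assumes "\<And>u v. P (tens u v)" "P 0" "\<And>x y. P x ==> P y ==> P (x + y)"
  "\<And>c x. P x ==> P (c *\<^sub>R x)" "closed {x. P x}"
 shows "P x"
proof -
 have span: "\<exists>g. P g \<and> Rep_ptensor g = f"
  if "f \<in> span {elem_tensor u v | u v. True}" for f :: "('a \<Rightarrow>\<^sub>L 'b \<Rightarrow>\<^sub>L real) \<Rightarrow>\<^sub>L real" using that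
 proof (induction f rule: span_induct_alt)
  case base
  then show ?case using assms(2) Rep_ptensor_zero by blast
 next
  case (step c x y)
  then obtain u v g where "x = elem_tensor u v" "P g" "Rep_ptensor g = y" by auto
  then show ?case
   using assms(1,3,4) by (intro exI[of _ "c *\<^sub>R tens u v + g"]) (simp add: Rep_ptensor_simps Rep_tens)
 qed
 have "Rep_ptensor x \<in> closure (span {elem_tensor u v | u v. True})"
  using Rep_ptensor[of x] by (simp add: ptensor_set_def)
 then obtain f where f: "\<And>n. f n \<in> span {elem_tensor u v | u v. True}" "f \<longlonglongrightarrow> Rep_ptensor x"
  unfolding closure_sequential by blast
 from span[OF f(1)] obtain g where g: "\<And>n. P (g n)" "\<And>n. Rep_ptensor (g n) = f n" by metis
 have "g \<longlonglongrightarrow> x" using f(2) unfolding tendsto_iff by (simp add: g(2)[symmetric] dist_Rep_ptensor)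
 then have "x \<in> {x. P x}" by (rule closed_sequentially[OF assms(5), rotated]) (simp add: g(1))
 then show ?thesis by simp
qed

lemma tensor_lift_unique:
 fixes L L' :: "('a::real_normed_vector, 'b::real_normed_vector) ptensor \<Rightarrow>\<^sub>L 'c::real_normed_vector"
 assumes "\<And>u v. L (tens u v) = L' (tens u v)"
 shows "L = L'"
proof (rule blinfun_eqI)
 fix x show "L x = L' x"
 proof (induction x rule: ptensor_induct)
  case 5
  show ?case by (intro closed_Collect_eq continuous_intros)
 qed (simp_all add: assms blinfun.bilinear_simps)
qed

text \<open>The relation \<open>R x c\<close> prescribes the value \<open>c\<close> at
  \<open>x\<close> through functionals only: \<open>Rep_ptensor x\<close> is evaluated at the scalar
  forms \<open>comp \<phi>\<close>. Functionals separate points, so \<open>R\<close> is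
  single-valued; \<open>R_norm\<close> makes its domain closed, since the target is complete;
  elementary tensors belong to it. By density it is everything, and norming functionals give the
  norm bound.\<close>

lemma tensor_lift_exists:
 fixes B :: "'a::real_normed_vector \<Rightarrow>\<^sub>L 'b::real_normed_vector \<Rightarrow>\<^sub>L 'c::banach"
 shows "\<exists>L :: ('a, 'b) ptensor \<Rightarrow>\<^sub>L 'c. (\<forall>u v. blinfun_apply L (tens u v) = blinfun_apply (blinfun_apply B u) v) \<and> norm L <= norm B"
proof -
 define comp :: "('c \<Rightarrow>\<^sub>L real) => 'a \<Rightarrow>\<^sub>L 'b \<Rightarrow>\<^sub>L real"
  where "comp \<phi> = Blinfun (\<lambda>f. \<phi> o\<^sub>L f) o\<^sub>L B" for \<phi>
 have comp: "comp \<phi> u v = \<phi> (B u v)" for \<phi> u v unfolding comp_def by (simp add: bounded_linear_Blinfun_apply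
    bounded_bilinear.bounded_linear_right[OF bounded_bilinear_blinfun_compose])
 have norm_comp: "norm (comp \<phi>) <= norm B" if "norm \<phi> <= 1" for \<phi>
 proof (rule norm_blinfun_bound, simp, rule norm_blinfun_bound)
  fix u v
  have "norm (\<phi> (B u v)) <= norm \<phi> * (norm (B u v))" by (rule norm_blinfun)
  also have "\<dots> <= 1 * norm (B u v)" by (intro mult_right_mono that) simp
  also have "\<dots> <= norm (B u) * norm v" by (simp add: norm_blinfun)
  also have "\<dots> <= norm B * norm u * norm v" by (intro mult_right_mono norm_blinfun) simp
  finally show "norm (comp \<phi> u v) <= norm B * norm u * norm v" by (simp add: comp)
 qed simp
 define R where "R x c \<longleftrightarrow> (\<forall>\<phi>. blinfun_apply \<phi> c = blinfun_apply (Rep_ptensor x) (comp \<phi>))" for x and c :: 'c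
 have R_norm: "norm c <= norm B * norm x" if "R x c" for x c
 proof (rule norm_le_by_functionals)
  fix \<phi> :: "'c \<Rightarrow>\<^sub>L real" assume *: "norm \<phi> <= 1"
  have "\<phi> c <= norm (Rep_ptensor x (comp \<phi>))" using that by (simp add: R_def)
  also have "\<dots> <= norm (Rep_ptensor x) * norm (comp \<phi>)" by (rule norm_blinfun)
  also have "\<dots> <= norm x * norm B" using norm_comp[OF *] by (simp add: norm_ptensor_def mult_left_mono)
  finally show "\<phi> c <= norm B * norm x" by (simp add: mult.commute)
 qed
 have R_add: "R (x + y) (c + d)" if "R x c" "R y d" for x y c d
  using that by (simp add: R_def Rep_ptensor_simps blinfun.bilinear_simps)
 have R_scale: "R (r *\<^sub>R x) (r *\<^sub>R c)" if "R x c" for x c and r :: real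
  using that by (simp add: R_def Rep_ptensor_simps blinfun.bilinear_simps)
 have R_uniq: "c = d" if "R x c" "R x d" for x c d by (rule eq_by_functionals) (metis R_def that)
 have ex: "\<exists>c. R x c" for x
 proof (induction x rule: ptensor_induct)
  case (1 u v)
  show ?case by (rule exI[of _ "B u v"]) (simp add: R_def Rep_tens elem_tensor_apply comp)
 next
  case 2
  show ?case by (rule exI[of _ 0]) (simp add: R_def Rep_ptensor_simps)
 next
  case (3 x y) then show ?case using R_add by blast
 next
  case (4 c x) then show ?case using R_scale by blast
 next
  case 5
  show ?case unfolding closed_sequential_limits
  proof safe
   fix x l assume "\<forall>n. x n \<in> {x. \<exists>c. R x c}" and xl: "x \<longlonglongrightarrow> l"
   then obtain c where c: "\<And>n. R (x n) (c n)" by (auto, metis)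
   have "norm (c m - c n) <= norm B * norm (x m - x n)" for m n
   proof (rule R_norm)
    have "R (x m + (-1) *\<^sub>R x n) (c m + (-1) *\<^sub>R c n)" by (intro R_add R_scale c)
    then show "R (x m - x n) (c m - c n)" by simp
   qed
   then have *: "dist (c m) (c n) <= norm B * dist (x m) (x n)" for m n by (simp add: dist_norm)
   have "Cauchy c"
   proof (rule metric_CauchyI)
    fix e :: real assume e: "e > 0"
    have "Cauchy x" using xl by (rule LIMSEQ_imp_Cauchy)
    then obtain M where M: "\<And>m n. m \<ge> M ==> n \<ge> M ==> dist (x m) (x n) < e / (norm B + 1)"
     using e by (metis Cauchy_def add_nonneg_pos divide_pos_pos norm_ge_zero zero_less_one)
    have "dist (c m) (c n) < e" if "m \<ge> M" "n \<ge> M" for m n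
    proof -
     have "dist (c m) (c n) <= (norm B + 1) * dist (x m) (x n)"
      using *[of m n] by (simp add: distrib_right) (smt (verit) zero_le_dist)
     also have "\<dots> < (norm B + 1) * (e / (norm B + 1))"
      using M[OF that] by (intro mult_strict_left_mono) (auto simp: add_nonneg_pos)
     also have "\<dots> = e" by (simp add: add_nonneg_eq_0_iff)
     finally show ?thesis .
    qed
    then show "\<exists>M. \<forall>m\<ge>M. \<forall>n\<ge>M. dist (c m) (c n) < e" by blast
   qed
   then obtain d where d: "c \<longlonglongrightarrow> d" by (auto simp: Cauchy_convergent_iff convergent_def)
   have "R l d" unfolding R_def
   proof
    fix \<phi> :: "'c \<Rightarrow>\<^sub>L real"
    have "(\<lambda>n. \<phi> (c n)) \<longlonglongrightarrow> \<phi> d" by (intro tendsto_intros d)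
    moreover have "(\<lambda>n. Rep_ptensor (x n) (comp \<phi>)) \<longlonglongrightarrow> Rep_ptensor l (comp \<phi>)"
     by (intro tendsto_intros bounded_linear.tendsto[OF bounded_linear_Rep_ptensor] xl)
    ultimately show "\<phi> d = Rep_ptensor l (comp \<phi>)"
     using c unfolding R_def by (intro LIMSEQ_unique[of "\<lambda>n. \<phi> (c n)"]) auto
   qed
   then show "\<exists>c. R l c" by blast
  qed
 qed
 then obtain L where L: "\<And>x. R x (L x)" by metis
 have bl: "bounded_linear L"
 proof (rule bounded_linear_intro[where K = "norm B"])
  show "L (x + y) = L x + L y" for x y by (rule R_uniq[OF L]) (intro R_add L)
  show "L (r *\<^sub>R x) = r *\<^sub>R L x" for r x by (rule R_uniq[OF L]) (intro R_scale L)
  show "norm (L x) <= norm x * norm B" for x using R_norm[OF L] by (simp add: mult.commute)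
 qed
 have "L (tens u v) = B u v" for u v by (rule R_uniq[OF L]) (simp add: R_def Rep_tens elem_tensor_apply comp)
 moreover have "norm (Blinfun L) <= norm B"
  by (rule norm_blinfun_bound) (simp_all add: bounded_linear_Blinfun_apply[OF bl] R_norm[OF L])
 ultimately show ?thesis by (intro exI[of _ "Blinfun L"]) (simp add: bounded_linear_Blinfun_apply[OF bl])
qed

lemma tensor_lift:
 fixes B :: "'a::real_normed_vector \<Rightarrow>\<^sub>L 'b::real_normed_vector \<Rightarrow>\<^sub>L 'c::banach"
 shows tensor_lift_tens: "tensor_lift B (tens u v) = B u v"
  and norm_tensor_lift: "norm (tensor_lift B) <= norm B"
proof -
 obtain L :: "('a, 'b) ptensor \<Rightarrow>\<^sub>L 'c" where L: "\<forall>u v. blinfun_apply L (tens u v) = blinfun_apply (blinfun_apply B u) v" "norm L <= norm B"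
  using tensor_lift_exists by blast
 have "tensor_lift B = L" unfolding tensor_lift_def
 proof (rule the_equality)
  fix L' :: "('a, 'b) ptensor \<Rightarrow>\<^sub>L 'c"
  assume "\<forall>u v. blinfun_apply L' (tens u v) = blinfun_apply (blinfun_apply B u) v"
  then show "L' = L" using L(1) by (metis tensor_lift_unique)
 qed (rule L(1))
 then show "tensor_lift B (tens u v) = B u v" "norm (tensor_lift B) <= norm B" using L by auto
qed

lemma tensor_lift_add: "tensor_lift (B + C) = tensor_lift B + tensor_lift C"
 by (rule tensor_lift_unique) (simp add: tensor_lift_tens blinfun.bilinear_simps)

lemma tensor_lift_diff: "tensor_lift (B - C) = tensor_lift B - tensor_lift C"
 by (rule tensor_lift_unique) (simp add: tensor_lift_tens blinfun.bilinear_simps)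

lemma tensor_lift_scaleR: "tensor_lift (r *\<^sub>R B) = r *\<^sub>R tensor_lift B"
 by (rule tensor_lift_unique) (simp add: tensor_lift_tens blinfun.bilinear_simps)

section \<open>Partitions\<close>

definition psum :: "(real => real => 'a::comm_monoid_add) => real list => 'a"
 where "psum F ps = (\<Sum>i < length ps - 1. F (ps ! Suc i) (ps ! i))"

definition mesh_less :: "real => real list => bool"
 where "mesh_less d ps \<longleftrightarrow> (\<forall>i < length ps - 1. ps ! Suc i - ps ! i < d)"

lemma psum_single [simp]: "psum F [a] = 0" by (simp add: psum_def)

lemma psum_Cons [simp]: "psum F (a # b # ps) = F b a + psum F (b # ps)"
 by (simp add: psum_def sum.lessThan_Suc_shift del: sum.lessThan_Suc)

lemma psum_append: "psum F (xs @ a # ys) = psum F (xs @ [a]) + psum F (a # ys)"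
proof (induction xs)
 case (Cons x xs)
 then show ?case by (cases xs) (simp_all add: add.assoc)
qed simp

lemma mesh_less_single [simp]: "mesh_less d [a]" by (simp add: mesh_less_def)

lemma mesh_less_Cons [simp]: "mesh_less d (a # b # ps) \<longleftrightarrow> b - a < d \<and> mesh_less d (b # ps)"
 by (simp add: mesh_less_def All_less_Suc2)

lemma mesh_less_append: "mesh_less d (xs @ a # ys) \<longleftrightarrow> mesh_less d (xs @ [a]) \<and> mesh_less d (a # ys)"
proof (induction xs)
 case (Cons x xs)
 then show ?case by (cases xs) simp_all
qed simp

lemma partition_of_single [simp]: "partition_of s t [a] \<longleftrightarrow> a = s \<and> a = t" by (auto simp: partition_of_def)

lemma partition_of_Cons [simp]:
 "partition_of s t (a # b # ps) \<longleftrightarrow> a = s \<and> a < b \<and> partition_of b t (b # ps)" by (auto simp: partition_of_def)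

lemma partition_of_append:
 "partition_of s t (xs @ a # ys) \<longleftrightarrow> partition_of s a (xs @ [a]) \<and> partition_of a t (a # ys)"
proof (induction xs arbitrary: s)
 case Nil
 show ?case by (auto simp: partition_of_def)
next
 case (Cons x xs)
 show ?case
 proof (cases xs)
  case Nil
  show ?thesis unfolding Nil by (auto simp: partition_of_def)
 next
  case (Cons y zs)
  show ?thesis using Cons.IH[of y] unfolding Cons by simp
 qed
qed

lemma partition_of_subset: "partition_of s t ps ==> s <= t \<and> set ps \<subseteq> {s..t}"
proof (induction ps arbitrary: s)
 case (Cons a ps)
 show ?case
 proof (cases ps)
  case (Cons b qs)
  then have "a = s" "a < b" "partition_of b t (b # qs)" using Cons.prems by auto
  with Cons.IH[of b] Cons show ?thesis by auto
 qed (use Cons.prems in auto)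
qed (simp add: partition_of_def)

lemma partition_of_trivial: "partition_of s s ps ==> ps = [s]"
proof (cases ps rule: remdups_adj.cases)
 case (3 a b qs)
 assume "partition_of s s ps"
 then show ?thesis using 3 partition_of_subset[of b s "b # qs"] by auto
qed (auto simp: partition_of_def)

lemma partition_split_at:
 assumes "partition_of s t ps" "s <= c" "c < t"
 obtains xs a b ys where "ps = xs @ a # b # ys" "a <= c" "c < b"
proof -
 have "\<exists>xs a b ys. ps = xs @ a # b # ys \<and> a <= c \<and> c < b" using assms(1,2)
 proof (induction ps arbitrary: s)
  case (Cons a ps)
  show ?case
  proof (cases ps)
   case Nil
   then show ?thesis using Cons.prems assms(3) by auto
  next
   case (Cons b qs)
   then have *: "a = s" "a < b" "partition_of b t (b # qs)" using Cons.prems by auto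
   show ?thesis
   proof (cases "c < b")
    case True
    then show ?thesis using Cons * Cons.prems by (intro exI[of _ "[]"]) auto
   next
    case False
    then obtain xs a' b' ys where "ps = xs @ a' # b' # ys" "a' <= c" "c < b'" using Cons.IH[of b] * Cons by auto
    then show ?thesis by (intro exI[of _ "a # xs"]) auto
   qed
  qed
 qed (simp add: partition_of_def)
 then show ?thesis using that by blast
qed

lemma psum_cong:
 assumes "partition_of s t ps" "\<And>u v. s <= u ==> u < v ==> v <= t ==> F v u = F' v u"
 shows "psum F ps = psum F' ps" using assms
proof (induction ps arbitrary: s)
 case (Cons a ps)
 show ?case
 proof (cases ps)
  case (Cons b qs)
  then have *: "a = s" "a < b" "partition_of b t (b # qs)" using Cons.prems by auto
  then have "psum F ps = psum F' ps" using Cons by (intro Cons.IH) (auto intro!: Cons.prems)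
  moreover have "F b a = F' b a" using * partition_of_subset[OF *(3)] by (intro Cons.prems) auto
  ultimately show ?thesis using Cons by simp
 qed simp
qed (simp add: partition_of_def)

lemma psum_linear:
 assumes "bounded_linear h"
 shows "h (psum F ps) = psum (\<lambda>v u. h (F v u)) ps"
proof -
 interpret bounded_linear h by fact
 show ?thesis by (simp add: psum_def sum)
qed

lemma psum_add: "psum (\<lambda>v u. F v u + G v u) ps = psum F ps + psum G ps" by (simp add: psum_def sum.distrib)

definition uniform_partition :: "real => real => nat => real list"
 where "uniform_partition s t n = map (\<lambda>i. s + (t - s) * (real i / real (Suc n))) [0..<Suc (Suc n)]"

lemma uniform_partition:
 assumes "s < t"
 shows "partition_of s t (uniform_partition s t n)"
  and "(t - s) / real (Suc n) < d ==> mesh_less d (uniform_partition s t n)"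
proof -
 have nth: "uniform_partition s t n ! i = s + (t - s) * (real i / real (Suc n))" if "i < Suc (Suc n)" for i
  using that unfolding uniform_partition_def by (subst nth_map) (auto simp del: upt_Suc)
 have len: "length (uniform_partition s t n) = Suc (Suc n)" by (simp add: uniform_partition_def del: upt_Suc)
 have ne: "uniform_partition s t n \<noteq> []" using len by auto
 have "uniform_partition s t n ! i < uniform_partition s t n ! j" if "i < j" "j < Suc (Suc n)" for i j
 proof -
  have "(t - s) * (real i / real (Suc n)) < (t - s) * (real j / real (Suc n))"
   using that assms by (intro mult_strict_left_mono divide_strict_right_mono) auto
  then show ?thesis using that by (simp add: nth)
 qed
 then show "partition_of s t (uniform_partition s t n)" unfolding partition_of_def using ne
  by (auto simp: sorted_wrt_iff_nth_less len hd_conv_nth last_conv_nth nth simp del: of_nat_Suc)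
 have "uniform_partition s t n ! Suc i - uniform_partition s t n ! i = (t - s) / real (Suc n)"
  if "i < Suc n" for i using that by (simp add: nth field_simps del: of_nat_Suc) (simp add: field_simps)
 then show "(t - s) / real (Suc n) < d ==> mesh_less d (uniform_partition s t n)" by (simp add: mesh_less_def len)
qed

lemma fine_partition_exists:
 assumes "s <= t" "0 < d"
 obtains ps where "partition_of s t ps" "mesh_less d ps"
proof (cases "s = t")
 case True
 then show ?thesis using that[of "[s]"] by simp
next
 case False
 obtain n where "(t - s) / d < real (Suc n)" using reals_Archimedean2 by (metis less_trans lessI of_nat_less_iff)
 then have "(t - s) / real (Suc n) < d" using assms by (simp add: field_simps)
 then show ?thesis using that uniform_partition[of s t] False assms by force
qed

lemma common_refinement:
 assumes "partition_of s t ps" "partition_of s t qs"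
 obtains rs where "partition_of s t rs" "set ps \<subseteq> set rs" "set qs \<subseteq> set rs"
proof
 let ?X = "set ps \<union> set qs"
 let ?rs = "sorted_list_of_set ?X"
 have X: "?X \<subseteq> {s..t}" "s \<in> ?X" "t \<in> ?X"
  using partition_of_subset[OF assms(1)] partition_of_subset[OF assms(2)] assms by (auto simp: partition_of_def)
 have ne: "?rs \<noteq> []" using X(2) by (metis List.finite_set empty_iff finite_UnI list.set(1) set_sorted_list_of_set)
 have srt: "sorted_wrt (<) ?rs" by (rule strict_sorted_list_of_set)
 have set: "set ?rs = ?X" by simp
 have "hd ?rs = s"
 proof -
  obtain a as where as: "?rs = a # as" using ne by (cases ?rs) auto
  then have "a <= s" using srt X(2) set by (metis less_imp_le order_refl set_ConsD sorted_wrt.simps(2))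
  moreover have "s <= a" using as set X(1) by (metis atLeastAtMost_iff in_mono list.set_intros(1))
  ultimately show ?thesis using as by simp
 qed
 moreover have "last ?rs = t"
 proof -
  obtain a as where as: "?rs = as @ [a]" using ne by (metis rev_exhaust)
  then have "t = a \<or> t \<in> set as" using X(3) set by auto
  then have "t <= a" using srt by (auto simp: sorted_wrt_append as less_imp_le)
  moreover have "a <= t" using as set X(1) by (metis atLeastAtMost_iff in_mono in_set_conv_decomp)
  ultimately show ?thesis using as by simp
 qed
 ultimately show "partition_of s t ?rs" unfolding partition_of_def using ne srt by blast
qed auto

section \<open>Limits along partitions\<close>

lemma partition_limit_psum:
 "partition_limit s t F l \<longleftrightarrow>
  (\<forall>\<epsilon>>0. \<exists>d>0. \<forall>ps. partition_of s t ps --> mesh_less d ps --> norm (psum F ps - l) < \<epsilon>)"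
 by (simp add: partition_limit_def psum_def mesh_less_def)

lemma mesh_less_mono: "mesh_less d ps ==> d <= d' ==> mesh_less d' ps" by (force simp: mesh_less_def)

lemma partition_limitD:
 assumes "partition_limit s t F l" "0 < e"
 obtains d where "d > 0" "\<And>ps. partition_of s t ps ==> mesh_less d ps ==> norm (psum F ps - l) < e"
 using assms unfolding partition_limit_psum by metis

lemma partition_limit_refl: "partition_limit s s F 0"
 unfolding partition_limit_psum by (auto intro!: exI[of _ 1] dest: partition_of_trivial)

lemma partition_limit_unique:
 assumes "partition_limit s t F l" "partition_limit s t F l'" "s <= t"
 shows "l = l'"
proof (rule ccontr)
 assume "l \<noteq> l'"
 then have e: "norm (l - l') / 2 > 0" by simp
 obtain d where d: "d > 0" "\<And>ps. partition_of s t ps ==> mesh_less d ps ==> norm (psum F ps - l) < norm (l - l') / 2"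
  using partition_limitD[OF assms(1) e] by blast
 obtain d' where d': "d' > 0" "\<And>ps. partition_of s t ps ==> mesh_less d' ps ==> norm (psum F ps - l') < norm (l - l') / 2"
  using partition_limitD[OF assms(2) e] by blast
 obtain ps where ps: "partition_of s t ps" "mesh_less (min d d') ps"
  using fine_partition_exists[OF assms(3), of "min d d'"] d(1) d'(1) by auto
 have "norm (psum F ps - l) < norm (l - l') / 2" "norm (psum F ps - l') < norm (l - l') / 2"
  using d(2) d'(2) ps mesh_less_mono[OF ps(2)] by auto
 then show False using norm_triangle_ineq4[of "psum F ps - l" "psum F ps - l'"] by (simp add: norm_minus_commute)
qed

lemma partition_limit_cong:
 assumes "partition_limit s t F l" "\<And>u v. s <= u ==> u < v ==> v <= t ==> F v u = F' v u"
 shows "partition_limit s t F' l"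
proof -
 have "psum F ps = psum F' ps" if "partition_of s t ps" for ps by (rule psum_cong[OF that assms(2)])
 with assms(1) show ?thesis unfolding partition_limit_psum by metis
qed

lemma partition_limit_linear:
 assumes "partition_limit s t F l" "bounded_linear h"
 shows "partition_limit s t (\<lambda>v u. h (F v u)) (h l)" unfolding partition_limit_psum
proof (intro allI impI)
 fix e :: real assume e: "e > 0"
 interpret h: bounded_linear h by fact
 obtain K where K: "K > 0" "\<And>x. norm (h x) <= norm x * K" using h.pos_bounded by blast
 obtain d where d: "d > 0" "\<And>ps. partition_of s t ps ==> mesh_less d ps ==> norm (psum F ps - l) < e / K"
  using partition_limitD[OF assms(1), of "e / K"] e K(1) by auto
 show "\<exists>d>0. \<forall>ps. partition_of s t ps --> mesh_less d ps --> norm (psum (\<lambda>v u. h (F v u)) ps - h l) < e"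
 proof (intro exI[of _ d] conjI d(1) allI impI)
  fix ps assume "partition_of s t ps" "mesh_less d ps"
  then have "norm (psum F ps - l) < e / K" by (rule d(2))
  then have "norm (h (psum F ps - l)) < e" using K(1) K(2)[of "psum F ps - l"] by (simp add: field_simps)
  then show "norm (psum (\<lambda>v u. h (F v u)) ps - h l) < e" by (simp add: psum_linear[OF assms(2)] h.diff)
 qed
qed

lemma partition_limit_add:
 assumes "partition_limit s t F l" "partition_limit s t G m"
 shows "partition_limit s t (\<lambda>v u. F v u + G v u) (l + m)" unfolding partition_limit_psum
proof (intro allI impI)
 fix e :: real assume e: "e > 0"
 obtain d where d: "d > 0" "\<And>ps. partition_of s t ps ==> mesh_less d ps ==> norm (psum F ps - l) < e / 2"
  using partition_limitD[OF assms(1), of "e / 2"] e by auto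
 obtain d' where d': "d' > 0" "\<And>ps. partition_of s t ps ==> mesh_less d' ps ==> norm (psum G ps - m) < e / 2"
  using partition_limitD[OF assms(2), of "e / 2"] e by auto
 show "\<exists>d>0. \<forall>ps. partition_of s t ps --> mesh_less d ps --> norm (psum (\<lambda>v u. F v u + G v u) ps - (l + m)) < e"
 proof (intro exI[of _ "min d d'"] conjI allI impI)
  fix ps assume ps: "partition_of s t ps" "mesh_less (min d d') ps"
  have "norm (psum F ps - l) < e / 2" "norm (psum G ps - m) < e / 2"
   using d(2) d'(2) ps mesh_less_mono[OF ps(2)] by auto
  then have "norm ((psum F ps - l) + (psum G ps - m)) < e / 2 + e / 2" by (rule norm_add_less)
  then show "norm (psum (\<lambda>v u. F v u + G v u) ps - (l + m)) < e" by (simp add: psum_add algebra_simps)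
 qed (use d(1) d'(1) in auto)
qed

lemma partition_limit_diff:
 assumes "partition_limit s t F l" "partition_limit s t G m"
 shows "partition_limit s t (\<lambda>v u. F v u - G v u) (l - m)"
 using partition_limit_add[OF assms(1) partition_limit_linear[OF assms(2) bounded_linear_minus[OF bounded_linear_ident]]]
 by simp

text \<open>Concatenation reaches only partitions through \<open>\<tau>\<close>, so the limit over
  \<open>[s, t]\<close> has to be given; it is then identified along these partitions.\<close>

lemma partition_limit_concat:
 assumes l1: "partition_limit s \<tau> F l1" and l2: "partition_limit \<tau> t F l2" and l: "partition_limit s t F l"
  and "s <= \<tau>" "\<tau> <= t"
 shows "l = l1 + l2"
proof (rule ccontr)
 assume "l \<noteq> l1 + l2"
 then have e: "norm (l - (l1 + l2)) / 3 > 0" (is "?e > 0") by simp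
 obtain d1 where d1: "d1 > 0" "\<And>ps. partition_of s \<tau> ps ==> mesh_less d1 ps ==> norm (psum F ps - l1) < ?e"
  using partition_limitD[OF l1 e] by blast
 obtain d2 where d2: "d2 > 0" "\<And>ps. partition_of \<tau> t ps ==> mesh_less d2 ps ==> norm (psum F ps - l2) < ?e"
  using partition_limitD[OF l2 e] by blast
 obtain d3 where d3: "d3 > 0" "\<And>ps. partition_of s t ps ==> mesh_less d3 ps ==> norm (psum F ps - l) < ?e"
  using partition_limitD[OF l e] by blast
 define d where "d = min d1 (min d2 d3)"
 have d: "d > 0" "d <= d1" "d <= d2" "d <= d3" using d1(1) d2(1) d3(1) by (auto simp: d_def)
 obtain ps where ps: "partition_of s \<tau> ps" "mesh_less d ps" using fine_partition_exists[OF assms(4) d(1)] .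
 obtain qs where qs: "partition_of \<tau> t qs" "mesh_less d qs" using fine_partition_exists[OF assms(5) d(1)] .
 obtain xs where xs: "ps = xs @ [\<tau>]" using ps(1) unfolding partition_of_def by (metis append_butlast_last_id)
 obtain ys where ys: "qs = \<tau> # ys" using qs(1) unfolding partition_of_def by (metis list.collapse)
 have "norm (psum F ps - l1) < ?e" "norm (psum F qs - l2) < ?e" using d1(2) d2(2) ps qs mesh_less_mono d by blast+
 then have "norm ((psum F ps - l1) + (psum F qs - l2)) < ?e + ?e" by (rule norm_add_less)
 moreover have "partition_of s t (xs @ \<tau> # ys)" using partition_of_append[of s t xs \<tau> ys] ps(1) qs(1) xs ys by simp
 moreover have "mesh_less d3 (xs @ \<tau> # ys)"
  using mesh_less_append[of d3 xs \<tau> ys] ps(2) qs(2) mesh_less_mono[OF _ d(4)] xs ys by metis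
 ultimately have "norm ((psum F ps - l1) + (psum F qs - l2) - (psum F (xs @ \<tau> # ys) - l)) < (?e + ?e) + ?e"
  by (smt (verit) d3(2) norm_triangle_ineq4)
 moreover have "psum F (xs @ \<tau> # ys) = psum F ps + psum F qs" using psum_append[of F xs \<tau> ys] xs ys by simp
 ultimately have "norm (l - (l1 + l2)) < ?e + ?e + ?e" by (simp add: algebra_simps)
 then show False by simp
qed

section \<open>The sewing lemma\<close>

lemma powr_small:
 fixes B \<epsilon> e :: real
 assumes "0 <= B" "0 < \<epsilon>" "0 < e"
 obtains d where "0 < d" "B * d powr \<epsilon> < e"
proof (rule that)
 let ?d = "(e / (B + 1)) powr (1 / \<epsilon>)"
 have "0 < e / (B + 1)" using assms by simp
 then show "0 < ?d" using assms by auto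
 have d: "?d powr \<epsilon> = e / (B + 1)" using assms by (simp add: powr_powr)
 show "B * ?d powr \<epsilon> < e" unfolding d using assms by (simp add: field_simps)
qed

text \<open>Sewing takes place twice, for paths in the base space and for paths of operators on
  which the semigroup acts by composition from the left. The bound \<open>M\<close> is uniform in
  time.\<close>

locale semigroup_action =
 fixes act :: "real => 'a::banach => 'a" and M :: real
 assumes act_bounded_linear: "t \<ge> 0 ==> bounded_linear (act t)"
  and act_0: "act 0 x = x"
  and act_add: "s \<ge> 0 ==> t \<ge> 0 ==> act (s + t) x = act s (act t x)"
  and norm_act: "t \<ge> 0 ==> norm (act t x) <= M * norm x"
begin

definition delta2 :: "(real => real => 'a) => real => real => real => 'a"
 where "delta2 \<Xi> v m u = \<Xi> v u - \<Xi> v m - act (v - m) (\<Xi> m u)"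

abbreviation shifted :: "(real => real => 'a) => real => real => real => 'a"
 where "shifted \<Xi> t \<equiv> \<lambda>v u. act (t - v) (\<Xi> v u)"

lemma act_simps:
 assumes "t \<ge> 0"
 shows "act t (x + y) = act t x + act t y" "act t (x - y) = act t x - act t y" "act t 0 = 0"
  "act t (- x) = - act t x" by (rule linear_simps[OF act_bounded_linear[OF assms]])+

lemma psum_shifted:
 assumes "partition_of s a ps" "a <= t"
 shows "psum (shifted \<Xi> t) ps = act (t - a) (psum (shifted \<Xi> a) ps)"
proof -
 have "psum (shifted \<Xi> t) ps = psum (\<lambda>v u. act (t - a) (shifted \<Xi> a v u)) ps"
 proof (rule psum_cong[OF assms(1)])
  fix u v assume "v <= a"
  then show "shifted \<Xi> t v u = act (t - a) (shifted \<Xi> a v u)"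
   using assms(2) act_add[of "t - a" "a - v" "\<Xi> v u"] by simp
 qed
 then show ?thesis using psum_linear[OF act_bounded_linear] assms(2) by simp
qed

text \<open>The defect is bounded behind every \<open>act r\<close>. In the recursion, defects are
  carried to the right endpoint; estimating the action there anew at each level would multiply
  powers of \<open>M\<close>. The control \<open>F\<close> measures intervals additively and may
  replace their length where a weight is singular.\<close>

context
 fixes \<Xi> :: "real => real => 'a" and F :: "real => real" and \<epsilon> N s0 t0 K :: real
 assumes eps: "0 < \<epsilon>" and N: "0 <= N"
  and F: "\<And>u v. s0 <= u ==> u <= v ==> v <= t0 ==> F u <= F v"
  and diag: "\<And>u. s0 <= u ==> u <= t0 ==> \<Xi> u u = 0"
  and bound: "\<And>r u m v. 0 <= r ==> s0 <= u ==> u <= m ==> m <= v ==> v <= t0 ==>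
   norm (act r (delta2 \<Xi> v m u)) <= N * (v - u) powr \<epsilon> * (F v - F u)"
  and K: "K = 2 * N / (1 - 2 powr - \<epsilon>)"
begin

text \<open>\<open>K\<close> is the fixed point of the recursion: a constant passes to its product
  with \<open>2 powr - \<epsilon>\<close>, and two defects are added.\<close>

lemma K_eq: "K * 2 powr - \<epsilon> + 2 * N = K" and K_nonneg: "0 <= K"
proof -
 have "2 powr - \<epsilon> < (1::real)" using eps powr_less_mono[of "-\<epsilon>" 0 2] by simp
 then have "K * (1 - 2 powr - \<epsilon>) = 2 * N" "0 <= K" using N eps by (simp_all add: K)
 then show "K * 2 powr - \<epsilon> + 2 * N = K" "0 <= K" by (simp_all add: right_diff_distrib)
qed

text \<open>Removing the subinterval that contains the midpoint leaves two intervals of at most half the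
 length; the factor \<open>2\<^sup>-\<^sup>\<epsilon>\<close> gained there pays for the two defects.\<close>

lemma partition_sum_bound:
 assumes "partition_of s t ps" "s0 <= s" "t <= t0" "0 <= r"
 shows "norm (act r (psum (shifted \<Xi> t) ps - \<Xi> t s)) <= K * (t - s) powr \<epsilon> * (F t - F s)" using assms
proof (induction "length ps" arbitrary: ps s t r rule: less_induct)
 case less
 have st: "s <= t" using partition_of_subset[OF less.prems(1)] by simp
 show ?case
 proof (cases "s = t")
  case True
  then have "ps = [s]" using less.prems(1) partition_of_trivial by blast
  then show ?thesis using True diag[of s] less.prems act_simps(3) by simp
 next
  case False
  then have lt: "s < t" using st by simp
  have mid: "s <= (s + t) / 2" "(s + t) / 2 < t" using lt by auto
  obtain xs a b ys where ps: "ps = xs @ a # b # ys" and ab: "a <= (s + t) / 2" "(s + t) / 2 < b"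
   by (rule partition_split_at[OF less.prems(1) mid])
  have P1: "partition_of s a (xs @ [a])" and "partition_of a t (a # b # ys)"
   using less.prems(1) partition_of_append[of s t xs a "b # ys"] unfolding ps by auto
  then have P2: "partition_of b t (b # ys)" and "a < b" by auto
  have le: "s <= a" "b <= t" using partition_of_subset[OF P1] partition_of_subset[OF P2] by auto
  define L where "L = (t - s) powr \<epsilon>"
  have L0: "L \<ge> 0" by (simp add: L_def)
  define e1 where "e1 = psum (shifted \<Xi> a) (xs @ [a]) - \<Xi> a s"
  define e2 where "e2 = psum (shifted \<Xi> t) (b # ys) - \<Xi> t b"
  have "psum (shifted \<Xi> t) ps
    = act (t - a) (psum (shifted \<Xi> a) (xs @ [a])) + (act (t - b) (\<Xi> b a) + psum (shifted \<Xi> t) (b # ys))"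
   unfolding ps using psum_append[of "shifted \<Xi> t" xs a "b # ys"] psum_shifted[OF P1, of t \<Xi>] le \<open>a < b\<close> by simp
  moreover have "act (t - b) (act (b - a) (\<Xi> a s)) = act (t - a) (\<Xi> a s)"
   using act_add[of "t - b" "b - a" "\<Xi> a s"] le \<open>a < b\<close> by simp
  \<comment> \<open>\<open>[s, t]\<close> is cut at \<open>b\<close> and \<open>[s, b]\<close> at
    \<open>a\<close>, with one defect for each cut; the term \<open>\<Xi> b a\<close> is absorbed by
    the second.\<close>
  ultimately have eq: "psum (shifted \<Xi> t) ps - \<Xi> t s
    = act (t - a) e1 + e2 - delta2 \<Xi> t b s - act (t - b) (delta2 \<Xi> b a s)"
   using le \<open>a < b\<close> by (simp add: e1_def e2_def delta2_def act_simps)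
  have r: "0 <= r" by (rule less.prems)
  have "act r (psum (shifted \<Xi> t) ps - \<Xi> t s)
    = act (r + (t - a)) e1 + act r e2 - act r (delta2 \<Xi> t b s) - act (r + (t - b)) (delta2 \<Xi> b a s)"
   unfolding eq using r le \<open>a < b\<close> by (simp add: act_simps act_add)
  moreover have "norm (act (r + (t - a)) e1) <= K * (a - s) powr \<epsilon> * (F a - F s)"
   unfolding e1_def using less.prems le \<open>a < b\<close> ps by (intro less.hyps P1) auto
  moreover have "norm (act r e2) <= K * (t - b) powr \<epsilon> * (F t - F b)" unfolding e2_def using less.prems le \<open>a < b\<close> ps
   by (intro less.hyps P2) auto
  moreover have "norm (act r (delta2 \<Xi> t b s)) <= N * L * (F t - F s)"
   unfolding L_def using less.prems le \<open>a < b\<close> by (intro bound) auto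
  moreover have "norm (act (r + (t - b)) (delta2 \<Xi> b a s)) <= N * (b - s) powr \<epsilon> * (F b - F s)"
   using less.prems le \<open>a < b\<close> by (intro bound) auto
  moreover have Fs: "F s <= F a" "F a <= F b" "F b <= F t" using less.prems le \<open>a < b\<close> by (auto intro!: F)
  have half: "x powr \<epsilon> <= L * 2 powr - \<epsilon>" if "0 <= x" "x <= (t - s) / 2" for x
  proof -
   have "x powr \<epsilon> <= ((t - s) / 2) powr \<epsilon>" using that eps by (intro powr_mono2) auto
   also have "\<dots> = L * 2 powr - \<epsilon>" by (simp add: L_def powr_divide powr_minus_divide)
   finally show ?thesis .
  qed
  \<comment> \<open>Both lengths are at most \<open>(t - s) / 2\<close>, and the increments of
    \<open>F\<close> over \<open>[s, a]\<close> and over \<open>[b, t]\<close>, enlarged to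
    \<open>[a, t]\<close>, add up to that over \<open>[s, t]\<close>, so that \<open>K\<close> is
    reproduced only once.\<close>
  have "K * (a - s) powr \<epsilon> * (F a - F s) <= K * (L * 2 powr - \<epsilon>) * (F a - F s)"
   using le ab Fs K_nonneg by (intro mult_right_mono mult_left_mono half) (auto simp: field_simps)
  moreover have "K * (t - b) powr \<epsilon> * (F t - F b) <= K * (L * 2 powr - \<epsilon>) * (F t - F a)"
   using le ab Fs K_nonneg L0 by (intro mult_mono mult_left_mono half) (auto simp: field_simps)
  moreover have "N * (b - s) powr \<epsilon> * (F b - F s) <= N * L * (F t - F s)" unfolding L_def using le \<open>a < b\<close> Fs N eps
   by (intro mult_mono mult_left_mono powr_mono2) auto
  ultimately have "norm (act r (psum (shifted \<Xi> t) ps - \<Xi> t s))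
    <= K * (L * 2 powr - \<epsilon>) * (F a - F s) + K * (L * 2 powr - \<epsilon>) * (F t - F a)
     + N * L * (F t - F s) + N * L * (F t - F s)" by (smt (verit) norm_triangle_ineq norm_triangle_ineq4)
  also have "\<dots> = (K * 2 powr - \<epsilon> + 2 * N) * L * (F t - F s)" by (simp add: algebra_simps)
  also have "\<dots> = K * L * (F t - F s)" by (simp only: K_eq)
  finally show ?thesis by (simp add: L_def)
 qed
qed

text \<open>Inside each subinterval of \<open>ps\<close> the finer sum is compared with a single
  term by \<open>partition_sum_bound\<close>. The mesh contributes \<open>d powr \<epsilon>\<close>,
  and the increments of \<open>F\<close> telescope.\<close>

lemma refinement_bound:
 assumes "partition_of s t ps" "partition_of s t qs" "set ps \<subseteq> set qs" "mesh_less d ps"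
  and "s0 <= s" "t <= t0"
 shows "norm (psum (shifted \<Xi> t) qs - psum (shifted \<Xi> t) ps) <= K * d powr \<epsilon> * (F t - F s)" using assms
proof (induction ps arbitrary: s qs)
 case Nil
 then show ?case by (simp add: partition_of_def)
next
 case (Cons x ps)
 show ?case
 proof (cases ps)
  case Nil
  then have "s = t" using Cons.prems by simp
  then have "qs = [s]" using Cons.prems partition_of_trivial by blast
  then show ?thesis using Nil \<open>s = t\<close> by simp
 next
  case (Cons b rest)
  have x: "x = s" "s < b" and Pb: "partition_of b t (b # rest)" using Cons.prems(1) Cons by auto
  have "b \<in> set qs" using Cons.prems(3) Cons by auto
  then obtain as bs where qs: "qs = as @ b # bs" by (meson split_list)
  have Q1: "partition_of s b (as @ [b])" and Q2: "partition_of b t (b # bs)"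
   using Cons.prems(2) partition_of_append[of s t as b bs] unfolding qs by auto
  have bt: "b <= t" using partition_of_subset[OF Pb] by simp
  have "set (b # rest) \<subseteq> set (b # bs)"
  proof
   fix y assume y: "y \<in> set (b # rest)"
   then have "b <= y" using partition_of_subset[OF Pb] by auto
   moreover have "y \<in> set qs" using y Cons.prems(3) Cons by auto
   moreover have "y <= b" if "y \<in> set as" using partition_of_subset[OF Q1] that by auto
   ultimately show "y \<in> set (b # bs)" using qs by (auto intro: antisym)
  qed
  then have IH: "norm (psum (shifted \<Xi> t) (b # bs) - psum (shifted \<Xi> t) (b # rest))
    <= K * d powr \<epsilon> * (F t - F b)" using Cons.IH[of b "b # bs"] Cons Pb Q2 Cons.prems x by auto
  have eq: "psum (shifted \<Xi> t) qs - psum (shifted \<Xi> t) (x # ps)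
    = act (t - b) (psum (shifted \<Xi> b) (as @ [b]) - \<Xi> b s)
     + (psum (shifted \<Xi> t) (b # bs) - psum (shifted \<Xi> t) (b # rest))"
   unfolding qs Cons using psum_append[of "shifted \<Xi> t" as b bs] psum_shifted[OF Q1 bt, of \<Xi>] bt x
   by (simp add: act_simps)
  have "norm (act (t - b) (psum (shifted \<Xi> b) (as @ [b]) - \<Xi> b s)) <= K * (b - s) powr \<epsilon> * (F b - F s)"
   using Cons.prems bt x by (intro partition_sum_bound[OF Q1]) auto
  moreover have "K * (b - s) powr \<epsilon> * (F b - F s) <= K * d powr \<epsilon> * (F b - F s)"
   using Cons.prems bt x K_nonneg eps F[of s b] Cons by (intro mult_right_mono mult_left_mono powr_mono2) auto
  ultimately have "norm (psum (shifted \<Xi> t) qs - psum (shifted \<Xi> t) (x # ps))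
    <= K * d powr \<epsilon> * (F b - F s) + K * d powr \<epsilon> * (F t - F b)"
   using IH norm_triangle_ineq[of "act (t - b) (psum (shifted \<Xi> b) (as @ [b]) - \<Xi> b s)"
     "psum (shifted \<Xi> t) (b # bs) - psum (shifted \<Xi> t) (b # rest)"] unfolding eq by linarith
  then show ?thesis by (simp add: algebra_simps)
 qed
qed

text \<open>Two partitions of mesh below \<open>d\<close> are compared through a common refinement,
  at distance \<open>2 * B * d powr \<epsilon>\<close>; hence the sums along a sequence of
  partitions with vanishing mesh are Cauchy, and their limit attracts all fine partitions.\<close>

lemma partition_limit_exists:
 assumes "s0 <= s" "s <= t" "t <= t0"
 obtains l where "partition_limit s t (shifted \<Xi> t) l"
  and "\<And>r. 0 <= r ==> norm (act r (l - \<Xi> t s)) <= K * (t - s) powr \<epsilon> * (F t - F s)"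
proof (cases "s = t")
 case True
 then show ?thesis using assms diag[of s] act_simps(3) by (intro that[of 0]) (auto simp: partition_limit_refl)
next
 case False
 then have st: "s < t" using assms by simp
 define B where "B = K * (F t - F s)"
 have B: "B \<ge> 0" using K_nonneg F[of s t] assms by (simp add: B_def)
 have cmp: "norm (psum (shifted \<Xi> t) ps - psum (shifted \<Xi> t) qs) <= 2 * B * d powr \<epsilon>"
  if ps: "partition_of s t ps" "mesh_less d ps" and qs: "partition_of s t qs" "mesh_less d qs" for ps qs d
 proof -
  obtain rs where rs: "partition_of s t rs" "set ps \<subseteq> set rs" "set qs \<subseteq> set rs"
   using common_refinement[OF ps(1) qs(1)] .
  have "norm (psum (shifted \<Xi> t) rs - psum (shifted \<Xi> t) ps) <= B * d powr \<epsilon>"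
   using refinement_bound[OF ps(1) rs(1,2) ps(2)] assms by (simp add: B_def mult_ac)
  moreover have "norm (psum (shifted \<Xi> t) rs - psum (shifted \<Xi> t) qs) <= B * d powr \<epsilon>"
   using refinement_bound[OF qs(1) rs(1,3) qs(2)] assms by (simp add: B_def mult_ac)
  ultimately show ?thesis using norm_triangle_ineq4[of "psum (shifted \<Xi> t) rs - psum (shifted \<Xi> t) qs"
     "psum (shifted \<Xi> t) rs - psum (shifted \<Xi> t) ps"] by simp
 qed
 have "\<exists>ps. partition_of s t ps \<and> mesh_less (1 / real (Suc n)) ps" for n
  using fine_partition_exists[OF assms(2), of "1 / real (Suc n)"] by auto
 then obtain P where P: "\<And>n. partition_of s t (P n)" "\<And>n. mesh_less (1 / real (Suc n)) (P n)" by metis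
 have mesh: "mesh_less (1 / real (Suc n)) (P m)" if "n <= m" for n m
  using that by (intro mesh_less_mono[OF P(2)[of m]] divide_left_mono) auto
 define S where "S n = psum (shifted \<Xi> t) (P n)" for n
 define e where "e n = 2 * B * (1 / real (Suc n)) powr \<epsilon>" for n
 have "e \<longlonglongrightarrow> 2 * B * 0 powr \<epsilon>"
  unfolding e_def using eps LIMSEQ_Suc[OF lim_1_over_n[where 'a = real]] by (intro tendsto_intros tendsto_powr') auto
 moreover have "norm (S (n + m) - S n) <= e n" for n m unfolding S_def e_def by (intro cmp P(1) mesh) auto
 ultimately have "convergent S" using convergent_of_tail_bound[of S e] eps by simp
 then obtain l where l: "S \<longlonglongrightarrow> l" by (auto simp: convergent_def)
 show ?thesis
 proof (rule that[of l])
  show "partition_limit s t (shifted \<Xi> t) l" unfolding partition_limit_psum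
  proof (intro allI impI)
   fix e :: real assume "e > 0"
   then obtain d where d: "d > 0" "2 * B * d powr \<epsilon> < e" using powr_small[of "2 * B" \<epsilon> e] B eps by auto
   obtain n0 where "1 / real (Suc n0) < d" using d(1) by (rule nat_approx_posE)
   then have n0: "mesh_less d (P n)" if "n0 <= n" for n using mesh_less_mono[OF mesh[OF that]] by simp
   have "norm (psum (shifted \<Xi> t) ps - l) < e" if ps: "partition_of s t ps" "mesh_less d ps" for ps
   proof -
    have "(\<lambda>n. norm (psum (shifted \<Xi> t) ps - S n)) \<longlonglongrightarrow> norm (psum (shifted \<Xi> t) ps - l)" by (intro tendsto_intros l)
    moreover have "\<forall>n\<ge>n0. norm (psum (shifted \<Xi> t) ps - S n) <= 2 * B * d powr \<epsilon>"
     unfolding S_def using cmp[OF ps P(1) n0] by blast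
    ultimately have "norm (psum (shifted \<Xi> t) ps - l) <= 2 * B * d powr \<epsilon>" by (meson LIMSEQ_le_const2)
    then show ?thesis using d(2) by simp
   qed
   then show "\<exists>d>0. \<forall>ps. partition_of s t ps --> mesh_less d ps --> norm (psum (shifted \<Xi> t) ps - l) < e"
    using d(1) by blast
  qed
  fix r :: real assume r: "0 <= r"
  have "(\<lambda>n. norm (act r (S n - \<Xi> t s))) \<longlonglongrightarrow> norm (act r (l - \<Xi> t s))"
   by (intro tendsto_norm bounded_linear.tendsto[OF act_bounded_linear[OF r]] tendsto_intros l)
  moreover have "norm (act r (S n - \<Xi> t s)) <= K * (t - s) powr \<epsilon> * (F t - F s)" for n
   unfolding S_def using assms r by (intro partition_sum_bound[OF P(1)])
  ultimately show "norm (act r (l - \<Xi> t s)) <= K * (t - s) powr \<epsilon> * (F t - F s)" by (meson LIMSEQ_le_const2)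
 qed
qed

end

lemma partition_limit_shift:
 assumes "partition_limit s a (shifted \<Xi> a) l" "a <= t"
 shows "partition_limit s a (shifted \<Xi> t) (act (t - a) l)"
proof -
 have "partition_limit s a (\<lambda>v u. act (t - a) (shifted \<Xi> a v u)) (act (t - a) l)"
  using assms(2) by (intro partition_limit_linear[OF assms(1) act_bounded_linear]) simp
 then show ?thesis
 proof (rule partition_limit_cong)
  fix u v assume "v <= a"
  then show "act (t - a) (shifted \<Xi> a v u) = shifted \<Xi> t v u"
   using assms(2) act_add[of "t - a" "a - v" "\<Xi> v u"] by simp
 qed
qed

lemma partition_limit_additive:
 assumes "partition_limit s \<tau> (shifted \<Xi> \<tau>) l1" "partition_limit \<tau> t (shifted \<Xi> t) l2"
  "partition_limit s t (shifted \<Xi> t) l" "s <= \<tau>" "\<tau> <= t"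
 shows "l = act (t - \<tau>) l1 + l2"
 using partition_limit_concat[OF partition_limit_shift[OF assms(1,5)] assms(2,3,4,5)] .

text \<open>Identifies a partition limit when an additive candidate \<open>J\<close> is known in
  advance: its sums telescope to \<open>J t s\<close>, and a germ close to \<open>J\<close> beyond
  first order has the same limit.\<close>

lemma partition_limit_of_additive:
 fixes J \<Xi> :: "real => real => 'a"
 assumes J: "\<And>u m v. s <= u ==> u <= m ==> m <= v ==> v <= t ==> delta2 J v m u = 0"
  and "0 < \<epsilon>" "0 <= N" "s <= t"
  and F: "\<And>u v. s <= u ==> u <= v ==> v <= t ==> F u <= F v"
  and near: "\<And>u v. s <= u ==> u <= v ==> v <= t ==>
   norm (J v u - \<Xi> v u) <= N * (v - u) powr \<epsilon> * (F v - F u)"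
 shows "partition_limit s t (shifted \<Xi> t) (J t s)"
proof -
 have diag: "J u u = 0" if "s <= u" "u <= t" for u using J[of u u u] that by (simp add: delta2_def act_0)
 \<comment> \<open>An additive germ has defect 0, so \<open>partition_sum_bound\<close> with
   \<open>N = 0\<close> is an equality.\<close>
 have tele: "psum (shifted J t) ps = J t s" if "partition_of s t ps" for ps
  using partition_sum_bound[of 1 0 s t "\<lambda>x. x" J 0, OF _ _ _ diag _ _ that, of 0] J act_simps(3) by (simp add: act_0)
 have M: "0 <= \<bar>M\<bar> * N" using assms by simp
 have err: "norm (psum (shifted \<Xi> t) ps - psum (shifted J t) ps) <= \<bar>M\<bar> * N * d powr \<epsilon> * (F t - F s)"
  if "partition_of s t ps" "mesh_less d ps" for ps d using that near F
 proof (induction ps arbitrary: s)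
  case (Cons a ps)
  show ?case
  proof (cases ps)
   case Nil
   then have "s = t" using Cons.prems by simp
   then show ?thesis using Nil by simp
  next
   case (Cons b qs)
   then have *: "a = s" "a < b" "partition_of b t (b # qs)" "b - a < d" using Cons.prems by auto
   then have bt: "b <= t" using partition_of_subset by blast
   have IH: "norm (psum (shifted \<Xi> t) ps - psum (shifted J t) ps) <= \<bar>M\<bar> * N * d powr \<epsilon> * (F t - F b)"
    using Cons * Cons.prems(2) by (intro Cons.IH) (auto intro!: Cons.prems)
   have "norm (act (t - b) (\<Xi> b a - J b a)) <= M * norm (\<Xi> b a - J b a)" using bt by (intro norm_act) simp
   also have "\<dots> <= \<bar>M\<bar> * norm (J b a - \<Xi> b a)" by (simp add: norm_minus_commute mult_right_mono)
   also have "\<dots> <= \<bar>M\<bar> * (N * (b - a) powr \<epsilon> * (F b - F s))"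
    using * bt by (intro mult_left_mono) (auto intro!: Cons.prems)
   also have "\<dots> <= \<bar>M\<bar> * (N * d powr \<epsilon> * (F b - F s))" using * bt assms(2,3) Cons.prems(4)[of s b]
    by (intro mult_left_mono mult_right_mono powr_mono2) auto
   finally have 1: "norm (act (t - b) (\<Xi> b a - J b a)) <= \<bar>M\<bar> * N * d powr \<epsilon> * (F b - F s)" by (simp add: mult_ac)
   have eq: "psum (shifted \<Xi> t) (a # ps) - psum (shifted J t) (a # ps)
    = act (t - b) (\<Xi> b a - J b a) + (psum (shifted \<Xi> t) ps - psum (shifted J t) ps)"
    using Cons bt by (simp add: act_simps)
   have "norm (psum (shifted \<Xi> t) (a # ps) - psum (shifted J t) (a # ps))
    <= \<bar>M\<bar> * N * d powr \<epsilon> * (F b - F s) + \<bar>M\<bar> * N * d powr \<epsilon> * (F t - F b)"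
    unfolding eq by (intro norm_triangle_mono 1 IH)
   then show ?thesis by (simp add: algebra_simps)
  qed
 qed (simp add: partition_of_def)
 show ?thesis unfolding partition_limit_psum
 proof (intro allI impI)
  fix e :: real assume e: "e > 0"
  define B where "B = \<bar>M\<bar> * N * (F t - F s)"
  have B: "B \<ge> 0" using M F[of s t] \<open>s <= t\<close> by (simp add: B_def)
  obtain d where d: "0 < d" "B * d powr \<epsilon> < e" using powr_small[OF B assms(2) e] .
  then have "\<forall>ps. partition_of s t ps --> mesh_less d ps --> norm (psum (shifted \<Xi> t) ps - J t s) < e"
   using err[of _ d] tele by (fastforce simp: B_def mult_ac)
  then show "\<exists>d>0. \<forall>ps. partition_of s t ps --> mesh_less d ps --> norm (psum (shifted \<Xi> t) ps - J t s) < e"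
   using d(1) by blast
 qed
qed

text \<open>The predicate under the description in \<open>sew\<close>. Statements are proved for
  \<open>sewn\<close>; its uniqueness transfers them to \<open>sew\<close>.\<close>

definition sewn :: "real => (real => real => 'a) => (real => 'a) => bool"
 where "sewn T \<Xi> I \<longleftrightarrow> I 0 = 0 \<and> (\<forall>t. t \<notin> {0..T} --> I t = 0) \<and>
  (\<forall>(t, s)\<in>Delta T. partition_limit s t (shifted \<Xi> t) (hat_incr act I t s))"

lemma sewn_unique:
 assumes "sewn T \<Xi> I" "sewn T \<Xi> I'"
 shows "I = I'"
proof
 fix t
 show "I t = I' t"
 proof (cases "0 < t \<and> t <= T")
  case True
  then have "(t, 0) \<in> Delta T" by (simp add: Delta_def)
  then have "partition_limit 0 t (shifted \<Xi> t) (hat_incr act I t 0)"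
   "partition_limit 0 t (shifted \<Xi> t) (hat_incr act I' t 0)" using assms unfolding sewn_def by blast+
  then have "hat_incr act I t 0 = hat_incr act I' t 0" using True by (intro partition_limit_unique) auto
  then show ?thesis using assms True by (simp add: hat_incr_def sewn_def act_simps)
 next
  case False
  then show ?thesis using assms by (cases "t = 0") (auto simp: sewn_def)
 qed
qed

lemma sew_eqI: "sewn T \<Xi> I ==> sew act T \<Xi> = I"
 unfolding sew_def sewn_def[symmetric] by (rule the_equality) (auto intro: sewn_unique)

lemma hat_incr_diff:
 "s <= t ==> hat_incr act (\<lambda>t. I t - I' t) t s = hat_incr act I t s - hat_incr act I' t s"
 by (simp add: hat_incr_def act_simps)

lemma sewn_diff:
 assumes "sewn T \<Xi> I" "sewn T \<Xi>' I'"
 shows "sewn T (\<lambda>v u. \<Xi> v u - \<Xi>' v u) (\<lambda>t. I t - I' t)" unfolding sewn_def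
proof safe
 fix t s assume ts: "(t, s) \<in> Delta T"
 then have st: "s <= t" by (simp add: Delta_def)
 have "partition_limit s t (shifted \<Xi> t) (hat_incr act I t s)"
  "partition_limit s t (shifted \<Xi>' t) (hat_incr act I' t s)" using assms ts unfolding sewn_def by auto
 then have "partition_limit s t (\<lambda>v u. shifted \<Xi> t v u - shifted \<Xi>' t v u)
  (hat_incr act I t s - hat_incr act I' t s)" by (rule partition_limit_diff)
 then show "partition_limit s t (\<lambda>v u. act (t - v) (\<Xi> v u - \<Xi>' v u)) (hat_incr act (\<lambda>t. I t - I' t) t s)"
  unfolding hat_incr_diff[OF st] by (rule partition_limit_cong) (simp add: act_simps)
qed (use assms in \<open>auto simp: sewn_def\<close>)

text \<open>An additive germ is the increment of its own path \<open>J t 0\<close>. This supplies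
  the paths of the zero pair.\<close>

lemma sewn_additive:
 assumes J: "\<And>u m v. 0 <= u ==> u <= m ==> m <= v ==> v <= T ==> delta2 J v m u = 0"
  and "0 < T"
 defines "I \<equiv> \<lambda>t. if t \<in> {0..T} then J t 0 else 0"
 shows "sewn T J I"
  and "0 <= s ==> s <= t ==> t <= T ==> hat_incr act I t s = J t s"
proof -
 let ?I = I
 have hi: "hat_incr act ?I t s = J t s" if "0 <= s" "s <= t" "t <= T" for s t
  using J[of 0 s t] that by (simp add: I_def hat_incr_def delta2_def algebra_simps)
 then show "0 <= s ==> s <= t ==> t <= T ==> hat_incr act ?I t s = J t s" by blast
 have "J 0 0 = 0" using J[of 0 0 0] assms by (simp add: delta2_def act_0)
 then show "sewn T J ?I" unfolding sewn_def
 proof (intro conjI allI impI ballI)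
  fix p assume "p \<in> Delta T"
  then obtain t s where p: "p = (t, s)" and ts: "0 <= s" "s < t" "t <= T" by (auto simp: Delta_def)
  have "partition_limit s t (shifted J t) (J t s)"
   by (rule partition_limit_of_additive[where N = 0 and F = "\<lambda>x. x" and \<epsilon> = 1])
    (use ts in \<open>auto intro!: J\<close>)
  then show "case p of (t, s) => partition_limit s t (shifted J t) (hat_incr act I t s)"
   using hi[of s t] ts p by simp
 qed (auto simp: I_def)
qed

text \<open>The limits over all subintervals are additive under concatenation, hence by
  \<open>sewn_additive\<close> they are the increments of one path.\<close>

lemma sewing_control:
 assumes eps: "0 < \<epsilon>" and N: "0 <= N" and T: "0 < T"
  and F: "\<And>u v. 0 <= u ==> u <= v ==> v <= T ==> F u <= F v"
  and diag: "\<And>u. 0 <= u ==> u <= T ==> \<Xi> u u = 0"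
  and bound: "\<And>r u m v. 0 <= r ==> 0 <= u ==> u <= m ==> m <= v ==> v <= T ==>
   norm (act r (delta2 \<Xi> v m u)) <= N * (v - u) powr \<epsilon> * (F v - F u)"
 obtains I where "sewn T \<Xi> I"
  and "\<And>s t. 0 <= s ==> s <= t ==> t <= T ==>
   norm (hat_incr act I t s - \<Xi> t s) <= 2 * N / (1 - 2 powr - \<epsilon>) * (t - s) powr \<epsilon> * (F t - F s)"
proof -
 define K where "K = 2 * N / (1 - 2 powr - \<epsilon>)"
 define J where "J t s = (SOME l. partition_limit s t (shifted \<Xi> t) l \<and>
   (\<forall>r\<ge>0. norm (act r (l - \<Xi> t s)) <= K * (t - s) powr \<epsilon> * (F t - F s)))" for t s
 have "\<exists>l. partition_limit s t (shifted \<Xi> t) l \<and>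
   (\<forall>r\<ge>0. norm (act r (l - \<Xi> t s)) <= K * (t - s) powr \<epsilon> * (F t - F s))"
  if "0 <= s" "s <= t" "t <= T" for s t by (rule partition_limit_exists[OF eps N F diag bound K_def that]) blast+
 from someI_ex[OF this]
 have J: "partition_limit s t (shifted \<Xi> t) (J t s)"
  and Jb: "0 <= r ==> norm (act r (J t s - \<Xi> t s)) <= K * (t - s) powr \<epsilon> * (F t - F s)"
  if "0 <= s" "s <= t" "t <= T" for s t r using that unfolding J_def by blast+
 have add: "delta2 J v m u = 0" if "0 <= u" "u <= m" "m <= v" "v <= T" for u m v
  using partition_limit_additive[OF J[of u m] J[of m v] J[of u v]] that by (simp add: delta2_def)
 let ?I = "\<lambda>t. if t \<in> {0..T} then J t 0 else 0"
 have JI: "hat_incr act ?I t s = J t s" if "0 <= s" "s <= t" "t <= T" for s t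
  by (rule sewn_additive(2)[OF _ T that]) (rule add)
 have "?I 0 = 0" using partition_limit_unique[OF J partition_limit_refl, of 0] T by simp
 show ?thesis
 proof (rule that[of ?I])
  show "sewn T \<Xi> ?I" using JI J \<open>?I 0 = 0\<close> unfolding sewn_def by (auto simp: Delta_def)
  show "norm (hat_incr act ?I t s - \<Xi> t s) <= 2 * N / (1 - 2 powr - \<epsilon>) * (t - s) powr \<epsilon> * (F t - F s)"
   if "0 <= s" "s <= t" "t <= T" for s t using JI[OF that] Jb[OF that, of 0] by (simp add: act_0 K_def)
 qed
qed

end

text \<open>If \<open>v \<le> 2 * u\<close>, the weights at \<open>u\<close> and \<open>v\<close>
  differ by a factor of at most 2. Otherwise \<open>v - u\<close> exceeds \<open>v / 2\<close>, and
  the unweighted bound suffices, since \<open>(v - u) powr - \<theta>\<close> is at most twice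
  \<open>v powr - \<theta>\<close>. The second case also covers \<open>u = 0\<close>.\<close>

lemma powr_left_to_right_weight:
 fixes u v :: real
 assumes uv: "0 <= u" "u < v" and \<theta>: "0 <= \<theta>" "\<theta> <= 1" and N: "0 <= N"
  and X: "X <= N * (v - u) powr a" "0 < u ==> X <= N * u powr - \<theta> * (v - u) powr (a + \<theta>)"
 shows "X <= 2 * N * v powr - \<theta> * (v - u) powr (a + \<theta>)"
proof -
 have half: "(v / 2) powr - \<theta> <= 2 * v powr - \<theta>"
 proof -
  have "(v / 2) powr - \<theta> = 2 powr \<theta> * v powr - \<theta>" by (simp add: powr_divide powr_minus field_simps)
  also have "\<dots> <= 2 powr 1 * v powr - \<theta>" using \<theta> by (intro mult_right_mono powr_mono) auto
  finally show ?thesis by simp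
 qed
 show ?thesis
 proof (cases "v <= 2 * u")
  case True
  then have u: "0 < u" using uv by simp
  have "u powr - \<theta> <= (v / 2) powr - \<theta>" using True uv \<theta> by (intro powr_mono2') auto
  then have "N * u powr - \<theta> * (v - u) powr (a + \<theta>) <= N * (2 * v powr - \<theta>) * (v - u) powr (a + \<theta>)"
   using half N by (intro mult_right_mono mult_left_mono) auto
  then show ?thesis using X(2)[OF u] by (simp add: mult_ac)
 next
  case False
  have "(v - u) powr - \<theta> <= (v / 2) powr - \<theta>" using False uv \<theta> by (intro powr_mono2') auto
  then have "(v - u) powr - \<theta> * (v - u) powr (a + \<theta>) <= 2 * v powr - \<theta> * (v - u) powr (a + \<theta>)"
   using half by (intro mult_right_mono) auto
  moreover have "(v - u) powr - \<theta> * (v - u) powr (a + \<theta>) = (v - u) powr a" by (simp add: powr_add[symmetric])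
  ultimately have "N * (v - u) powr a <= N * (2 * v powr - \<theta> * (v - u) powr (a + \<theta>))"
   using N by (intro mult_left_mono) auto
  then show ?thesis using X(1) by (simp add: mult_ac)
 qed
qed

text \<open>Concavity of \<open>x powr (1 - \<theta>)\<close>: its least slope on
  \<open>[u, v]\<close> is the one at \<open>v\<close>, in the form of Young's inequality. The upper
  bound only compares \<open>u powr - \<theta>\<close> with
  \<open>v powr - \<theta>\<close>.\<close>

lemma powr_increment_bounds:
 fixes u v :: real
 assumes "0 <= u" "u <= v" "0 < v" "0 <= \<theta>" "\<theta> < 1"
 shows "(1 - \<theta>) * v powr - \<theta> * (v - u) <= v powr (1 - \<theta>) - u powr (1 - \<theta>)"
  and "v powr (1 - \<theta>) - u powr (1 - \<theta>) <= v powr - \<theta> * (v - u)"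
proof -
 have vv: "v powr (1 - \<theta>) = v * v powr - \<theta>" using assms by (simp add: powr_mult_base)
 show "(1 - \<theta>) * v powr - \<theta> * (v - u) <= v powr (1 - \<theta>) - u powr (1 - \<theta>)"
 proof (cases "u = 0")
  case True
  then show ?thesis using assms vv by (simp add: mult_right_mono)
 next
  case False
  then have "u powr (1 - \<theta>) * v powr \<theta> <= (1 - \<theta>) * u + \<theta> * v" using assms by (intro Youngs_inequality_0) auto
  then have "u powr (1 - \<theta>) * v powr \<theta> * v powr - \<theta> <= ((1 - \<theta>) * u + \<theta> * v) * v powr - \<theta>"
   by (intro mult_right_mono) auto
  moreover have "u powr (1 - \<theta>) * v powr \<theta> * v powr - \<theta> = u powr (1 - \<theta>)"
   using assms False by (simp add: mult.assoc powr_add[symmetric])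
  ultimately have "u powr (1 - \<theta>) <= ((1 - \<theta>) * u + \<theta> * v) * v powr - \<theta>" by simp
  then show ?thesis unfolding vv by (simp add: algebra_simps)
 qed
 show "v powr (1 - \<theta>) - u powr (1 - \<theta>) <= v powr - \<theta> * (v - u)"
 proof (cases "u = 0")
  case False
  then have "u * v powr - \<theta> <= u * u powr - \<theta>" using assms by (intro mult_left_mono powr_mono2') auto
  then show ?thesis using assms vv by (simp add: powr_mult_base algebra_simps)
 qed (simp add: vv)
qed

context semigroup_action
begin

text \<open>The factor 4 collects 2 from \<open>powr_left_to_right_weight\<close> and 2 from
  \<open>sewing_control\<close>; \<open>\<bar>M\<bar>\<close> pays for the action in front of the
  defect, \<open>1 - \<theta>\<close> for the comparison of weight and control.\<close>

definition sewing_const :: "real => real => real"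
 where "sewing_const \<theta> \<epsilon> = 4 * \<bar>M\<bar> / ((1 - 2 powr - \<epsilon>) * (1 - \<theta>))"

text \<open>The unweighted exponent \<open>1 + \<epsilon> - \<theta>\<close> may be below 1; that
  bound serves to cross the neighbourhood of 0. The increment of the control in the result is
  finally turned back into a weight, now at the right endpoint \<open>t\<close>, so that the
  estimate extends to \<open>s = 0\<close>.\<close>

theorem sewing_weighted:
 assumes eps: "0 < \<epsilon>" and \<theta>: "0 <= \<theta>" "\<theta> < 1" and N: "0 <= N" and T: "0 < T"
  and diag: "\<And>u. 0 <= u ==> u <= T ==> \<Xi> u u = 0"
  and bound0: "\<And>u m v. 0 <= u ==> u <= m ==> m <= v ==> v <= T ==>
   norm (delta2 \<Xi> v m u) <= N * (v - u) powr (1 + \<epsilon> - \<theta>)"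
  and bound: "\<And>u m v. 0 < u ==> u <= m ==> m <= v ==> v <= T ==>
   norm (delta2 \<Xi> v m u) <= N * u powr - \<theta> * (v - u) powr (1 + \<epsilon>)"
 obtains I where "sewn T \<Xi> I"
  and "\<And>s t. 0 <= s ==> s <= t ==> t <= T ==>
   norm (hat_incr act I t s - \<Xi> t s) <= sewing_const \<theta> \<epsilon> * N * t powr - \<theta> * (t - s) powr (1 + \<epsilon>)"
proof -
 let ?F = "\<lambda>t::real. t powr (1 - \<theta>)"
 let ?N = "2 * \<bar>M\<bar> * N / (1 - \<theta>)"
 have *: "norm (act r (delta2 \<Xi> v m u)) <= ?N * (v - u) powr \<epsilon> * (?F v - ?F u)"
  if r: "0 <= r" and u: "0 <= u" "u <= m" "m <= v" "v <= T" for r u m v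
 proof (cases "u = v")
  case True
  then have "norm (delta2 \<Xi> v m u) <= 0" using bound0[OF u] by simp
  then have "delta2 \<Xi> v m u = 0" by simp
  then show ?thesis using True act_simps(3)[OF r] by simp
 next
  case False
  then have uv: "u < v" using u by simp
  have "norm (delta2 \<Xi> v m u) <= 2 * N * v powr - \<theta> * (v - u) powr (1 + \<epsilon> - \<theta> + \<theta>)"
   using u \<theta> N uv bound0[of u m v] bound[of u m v] by (intro powr_left_to_right_weight) auto
  also have "\<dots> = 2 * N * ((v - u) powr \<epsilon> * (v powr - \<theta> * (v - u)))"
   using uv by (simp add: powr_mult_base[symmetric])
  also have "\<dots> <= 2 * N * ((v - u) powr \<epsilon> * ((?F v - ?F u) / (1 - \<theta>)))"
   using powr_increment_bounds(1)[of u v \<theta>] u uv \<theta> N by (intro mult_left_mono) (auto simp: field_simps)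
  finally have "\<bar>M\<bar> * norm (delta2 \<Xi> v m u)
    <= \<bar>M\<bar> * (2 * N * ((v - u) powr \<epsilon> * ((?F v - ?F u) / (1 - \<theta>))))" by (rule mult_left_mono) simp
  also have "\<dots> = ?N * (v - u) powr \<epsilon> * (?F v - ?F u)" by simp
  finally have "\<bar>M\<bar> * norm (delta2 \<Xi> v m u) <= ?N * (v - u) powr \<epsilon> * (?F v - ?F u)" .
  moreover have "norm (act r (delta2 \<Xi> v m u)) <= M * norm (delta2 \<Xi> v m u)" by (rule norm_act[OF r])
  moreover have "M * norm (delta2 \<Xi> v m u) <= \<bar>M\<bar> * norm (delta2 \<Xi> v m u)" by (intro mult_right_mono) auto
  ultimately show ?thesis by linarith
 qed
 have mono: "?F u <= ?F v" if "0 <= u" "u <= v" for u v using that \<theta> by (intro powr_mono2) auto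
 have N': "0 <= ?N" using N \<theta> by simp
 obtain I where I: "sewn T \<Xi> I"
  and b: "\<And>s t. 0 <= s ==> s <= t ==> t <= T ==>
   norm (hat_incr act I t s - \<Xi> t s) <= 2 * ?N / (1 - 2 powr - \<epsilon>) * (t - s) powr \<epsilon> * (?F t - ?F s)"
  using sewing_control[OF eps N' T mono diag *] by blast
 show ?thesis
 proof (rule that[OF I])
  fix s t assume st: "0 <= s" "s <= t" "t <= T"
  show "norm (hat_incr act I t s - \<Xi> t s) <= sewing_const \<theta> \<epsilon> * N * t powr - \<theta> * (t - s) powr (1 + \<epsilon>)"
  proof (cases "t = 0")
   case True
   then show ?thesis using b[OF st] st by simp
  next
   case False
   have q: "2 powr - \<epsilon> < (1::real)" using eps powr_less_mono[of "-\<epsilon>" 0 2] by simp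
   have "norm (hat_incr act I t s - \<Xi> t s)
     <= 2 * ?N / (1 - 2 powr - \<epsilon>) * (t - s) powr \<epsilon> * (?F t - ?F s)" by (rule b[OF st])
   also have "\<dots> <= 2 * ?N / (1 - 2 powr - \<epsilon>) * (t - s) powr \<epsilon> * (t powr - \<theta> * (t - s))"
   proof (rule mult_left_mono)
    show "0 <= 2 * ?N / (1 - 2 powr - \<epsilon>) * (t - s) powr \<epsilon>"
     using N q \<theta> by (intro mult_nonneg_nonneg divide_nonneg_nonneg) auto
   qed (use powr_increment_bounds(2)[of s t \<theta>] st False \<theta> in auto)
   also have "\<dots> = sewing_const \<theta> \<epsilon> * N * t powr - \<theta> * ((t - s) * (t - s) powr \<epsilon>)"
    by (simp add: sewing_const_def mult_ac)
   also have "\<dots> = sewing_const \<theta> \<epsilon> * N * t powr - \<theta> * (t - s) powr (1 + \<epsilon>)" using st by (simp add: powr_mult_base)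
   finally show ?thesis .
  qed
 qed
qed

end

section \<open>Vector-valued integrals on the line\<close>

lemma set_integral_bounded_linear:
 fixes f :: "'b => 'a::{banach, second_countable_topology}"
  and h :: "'a => 'c::{banach, second_countable_topology}"
 assumes "bounded_linear h" "set_integrable M A f"
 shows "set_integrable M A (\<lambda>x. h (f x))"
  and "(LINT x:A|M. h (f x)) = h (LINT x:A|M. f x)"
proof -
 interpret bounded_linear h by fact
 have "h (indicator A x *\<^sub>R f x) = indicator A x *\<^sub>R h (f x)" for x by (rule scaleR)
 then show "set_integrable M A (\<lambda>x. h (f x))"
  "(LINT x:A|M. h (f x)) = h (LINT x:A|M. f x)"
  using integral_bounded_linear[OF assms(1), of M "\<lambda>x. indicator A x *\<^sub>R f x"]
   integrable_bounded_linear[OF assms(1), of M "\<lambda>x. indicator A x *\<^sub>R f x"] assms(2)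
  by (simp_all add: set_integrable_def set_lebesgue_integral_def)
qed

text \<open>Functionals commute with the Bochner integral and reduce the claim to real
  integrands.\<close>

lemma set_integral_FTC:
 fixes F f :: "real => 'a::{banach, second_countable_topology}"
 assumes "a <= b"
  and F: "\<And>x. a <= x ==> x <= b ==> (F has_vector_derivative f x) (at x within {a..b})"
  and f: "continuous_on {a..b} f"
 shows "(LINT x:{a..b}|lborel. f x) = F b - F a"
proof (rule eq_by_functionals)
 fix \<phi> :: "'a \<Rightarrow>\<^sub>L real"
 have "\<phi> (LINT x:{a..b}|lborel. f x) = (LINT x:{a..b}|lborel. \<phi> (f x))"
  by (rule set_integral_bounded_linear(2)[symmetric, OF blinfun.bounded_linear_right
    borel_integrable_atLeastAtMost'[OF f]])
 also have "\<dots> = \<phi> (F b) - \<phi> (F a)" unfolding set_lebesgue_integral_def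
  by (intro integral_FTC_atLeastAtMost[OF assms(1)] continuous_intros f
    bounded_linear.has_vector_derivative[OF blinfun.bounded_linear_right] F)
 finally show "\<phi> (LINT x:{a..b}|lborel. f x) = \<phi> (F b - F a)" by (simp add: blinfun.diff_right)
qed

lemma set_integral_FTC_half_line:
 fixes F f :: "real => 'a::{banach, second_countable_topology}"
 assumes F: "\<And>x. 0 <= x ==> (F has_vector_derivative f x) (at x within {0..})"
  and f: "continuous_on {0..} f" "set_integrable lborel {0..} f"
  and lim: "(F \<longlongrightarrow> 0) at_top"
 shows "(LINT x:{0..}|lborel. f x) = - F 0"
proof -
 have eq: "(LINT x:{0..b}|lborel. f x) = F b - F 0" if "b \<ge> 0" for b using that
  by (intro set_integral_FTC continuous_on_subset[OF f(1)] has_vector_derivative_within_subset[OF F]) auto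
 have "((\<lambda>b. LINT x:{0..b}|lborel. f x) \<longlongrightarrow> (LINT x:{0..}|lborel. f x)) at_top"
  by (rule tendsto_set_lebesgue_integral_at_top) (use f in auto)
 moreover have "((\<lambda>b. LINT x:{0..b}|lborel. f x) \<longlongrightarrow> 0 - F 0) at_top"
  by (rule Lim_transform_eventually[of "\<lambda>b. F b - F 0"])
   (use tendsto_diff[OF lim tendsto_const] eq in
    \<open>auto intro!: eventually_mono[OF eventually_ge_at_top[of 0]]\<close>)
 ultimately show ?thesis using tendsto_unique trivial_limit_at_top_linorder by fastforce
qed

lemma set_integrable_dominated:
 fixes f :: "real => 'a::{banach, second_countable_topology}" and g :: "real => real"
 assumes "A \<in> sets borel" "continuous_on A f" "set_integrable lborel A g"
  "\<And>x. x \<in> A ==> norm (f x) <= g x"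
 shows "set_integrable lborel A f" "norm (LINT x:A|lborel. f x) <= (LINT x:A|lborel. g x)"
proof -
 have "norm (f x) <= norm (g x)" if "x \<in> A" for x using assms(4)[OF that] by auto
 then show i: "set_integrable lborel A f" using assms(1,2) by (intro set_integrable_bound[OF assms(3)])
   (auto simp: set_borel_measurable_def intro!: borel_measurable_continuous_on_indicator)
 have "norm (LINT x:A|lborel. f x) <= (LINT x:A|lborel. norm (f x))" by (rule set_integral_norm_bound[OF i])
 also have "\<dots> <= (LINT x:A|lborel. g x)" by (rule set_integral_mono[OF set_integrable_norm[OF i] assms(3,4)])
 finally show "norm (LINT x:A|lborel. f x) <= (LINT x:A|lborel. g x)" .
qed

lemma exp_minus_integrable: "0 < a ==> set_integrable lborel {0..} (\<lambda>x. exp (- (a * x)) :: real)"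
proof -
 assume a: "0 < a"
 have "set_integrable lborel ({0..0} \<union> {0<..}) (\<lambda>x. exp (- (a * x)))" using integrable_I0i_exp_mscale[OF a]
  by (intro set_integrable_Un borel_integrable_atLeastAtMost' continuous_intros) (auto simp: mult.commute)
 moreover have "{0..0} \<union> {0<..} = {0::real..}" by auto
 ultimately show ?thesis by simp
qed

text \<open>Half of the exponential absorbs the power: \<open>?b * s \<le> exp (?b * s)\<close> is
  raised to the \<open>k\<close>-th power. Dividing by \<open>k + 1\<close> instead of
  \<open>k\<close> covers \<open>k = 0\<close>.\<close>

lemma power_exp_minus_bound:
 fixes a :: real assumes "0 < a" "0 <= s"
 shows "s ^ k * exp (- (a * s)) <= (2 * (real k + 1) / a) ^ k * exp (- (a / 2 * s))"
proof -
 let ?b = "a / (2 * (real k + 1))"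
 have b: "?b > 0" using assms by simp
 have "?b * s <= exp (?b * s)" using exp_ge_add_one_self[of "?b * s"] by linarith
 then have "(?b * s) ^ k <= exp (?b * s) ^ k" using b assms by (intro power_mono) auto
 also have "\<dots> = exp (real k * (?b * s))" by (simp only: exp_of_nat_mult)
 also have "\<dots> <= exp (a / 2 * s)"
 proof -
  have "real k * (?b * s) = (real k / (real k + 1)) * (a / 2 * s)" by simp
  also have "\<dots> <= 1 * (a / 2 * s)" using assms by (intro mult_right_mono) auto
  finally show ?thesis by simp
 qed
 finally have "?b ^ k * s ^ k <= exp (a / 2 * s)" by (simp only: power_mult_distrib)
 then have "s ^ k <= exp (a / 2 * s) / ?b ^ k" using b by (simp add: field_simps)
 then have "s ^ k * exp (- (a * s)) <= exp (a / 2 * s) / ?b ^ k * exp (- (a * s))" by (intro mult_right_mono) auto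
 also have "\<dots> = (1 / ?b) ^ k * (exp (a / 2 * s) * exp (- (a * s)))" by (simp add: power_divide)
 also have "exp (a / 2 * s) * exp (- (a * s)) = exp (- (a / 2 * s))" by (simp add: exp_add[symmetric])
 finally show ?thesis by simp
qed

section \<open>Recovering a bound on a function from its cosine and sine transforms\<close>

lemma exp_minus_tendsto_0: "0 < a ==> ((\<lambda>x. exp (- (a * x)) :: real) \<longlongrightarrow> 0) at_top"
 by (auto intro!: exp_at_bot[THEN filterlim_compose] filterlim_tendsto_pos_mult_at_top filterlim_ident
   simp: filterlim_uminus_at_bot)

lemma cosine_laplace:
 fixes e a :: real
 assumes e: "0 < e"
 shows "(LINT x:{0..}|lborel. exp (- (e * x)) * cos (a * x)) = e / (e\<^sup>2 + a\<^sup>2)"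
proof -
 \<comment> \<open>The real part of
   \<open>exp ((- e + \<i> * a) * x) / (- e + \<i> * a)\<close>.\<close>
 let ?F = "\<lambda>x. exp (- (e * x)) * ((a * sin (a * x) - e * cos (a * x)) / (e\<^sup>2 + a\<^sup>2))"
 have pos: "e\<^sup>2 + a\<^sup>2 > 0" using e by (simp add: add_pos_nonneg)
 have "(LINT x:{0..}|lborel. exp (- (e * x)) * cos (a * x)) = - ?F 0"
 proof (rule set_integral_FTC_half_line)
  fix x :: real
  have "a * a * cos (a * x) + e * a * sin (a * x) - e * (a * sin (a * x) - e * cos (a * x))
    = cos (a * x) * (e\<^sup>2 + a\<^sup>2)" by (simp add: algebra_simps power2_eq_square)
  then have quot: "(a * a * cos (a * x) + e * a * sin (a * x)) / (e\<^sup>2 + a\<^sup>2)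
    - e * ((a * sin (a * x) - e * cos (a * x)) / (e\<^sup>2 + a\<^sup>2)) = cos (a * x)"
   using pos e by (simp add: diff_divide_distrib[symmetric])
  have alg: "X * - e * r + p * X = X * (p - e * r)" for X p r :: real by (simp add: algebra_simps)
  have eq: "exp (- (e * x)) * - e * ((a * sin (a * x) - e * cos (a * x)) / (e\<^sup>2 + a\<^sup>2))
    + (a * a * cos (a * x) + e * a * sin (a * x)) / (e\<^sup>2 + a\<^sup>2) * exp (- (e * x))
    = exp (- (e * x)) * cos (a * x)" by (simp only: alg quot)
  have "((\<lambda>x. exp (- (e * x))) has_real_derivative exp (- (e * x)) * - e) (at x within {0..})"
   by (auto intro!: derivative_eq_intros)
  moreover have "((\<lambda>x. a * sin (a * x) - e * cos (a * x)) has_real_derivative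
    a * a * cos (a * x) + e * a * sin (a * x)) (at x within {0..})" by (auto intro!: derivative_eq_intros)
  ultimately have "(?F has_real_derivative exp (- (e * x)) * cos (a * x)) (at x within {0..})"
   unfolding eq[symmetric] by (intro DERIV_mult DERIV_cdivide)
  then show "(?F has_vector_derivative exp (- (e * x)) * cos (a * x)) (at x within {0..})"
   by (simp add: has_real_derivative_iff_has_vector_derivative)
 next
  show "set_integrable lborel {0..} (\<lambda>x. exp (- (e * x)) * cos (a * x))"
   by (rule set_integrable_dominated(1)[OF _ _ exp_minus_integrable[OF e]])
    (auto intro!: continuous_intros simp: abs_mult mult_left_le)
  show "(?F \<longlongrightarrow> 0) at_top"
  proof (rule Lim_null_comparison)
   show "\<forall>\<^sub>F x in at_top. norm (?F x) <= exp (- (e * x)) * ((\<bar>a\<bar> + e) / (e\<^sup>2 + a\<^sup>2))"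
   proof (intro always_eventually allI)
    fix x
    have "\<bar>a * sin (a * x) - e * cos (a * x)\<bar> <= \<bar>a * sin (a * x)\<bar> + \<bar>e * cos (a * x)\<bar>"
     by (rule abs_triangle_ineq4)
    also have "\<dots> <= \<bar>a\<bar> + e" using e by (intro add_mono) (simp_all add: abs_mult mult_left_le)
    finally show "norm (?F x) <= exp (- (e * x)) * ((\<bar>a\<bar> + e) / (e\<^sup>2 + a\<^sup>2))"
     using pos by (simp add: abs_mult divide_right_mono)
   qed
   show "((\<lambda>x. exp (- (e * x)) * ((\<bar>a\<bar> + e) / (e\<^sup>2 + a\<^sup>2))) \<longlongrightarrow> 0) at_top"
    by (rule tendsto_mult_left_zero[OF exp_minus_tendsto_0[OF e]])
  qed
 qed (auto intro!: continuous_intros)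
 then show ?thesis by simp
qed

lemma integrable_cauchy_kernel: "integrable lborel (\<lambda>x::real. 1 / (1 + x\<^sup>2))"
 and integral_cauchy_kernel: "(\<integral>x. 1 / (1 + x\<^sup>2) \<partial>lborel) = pi"
 using integrable_inverse_1_plus_square LBINT_inverse_1_plus_square
 by (simp_all add: einterval_eq interval_lebesgue_integral_def set_integrable_def
   set_lebesgue_integral_def inverse_eq_divide)

lemma cauchy_kernel_half_line:
 fixes c :: real assumes c: "0 < c"
 shows "set_integrable lborel {0..} (\<lambda>x. 1 / (c\<^sup>2 + x\<^sup>2))"
  and "(LINT x:{0..}|lborel. 1 / (c\<^sup>2 + x\<^sup>2)) = pi / (2 * c)"
proof -
 have pos: "c\<^sup>2 + x\<^sup>2 > 0" "1 + x\<^sup>2 > 0" for x :: real using c by (simp_all add: add_pos_nonneg)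
 have dom: "1 / (c\<^sup>2 + x\<^sup>2) <= (1 + 1 / c\<^sup>2) * (1 / (1 + x\<^sup>2))" for x
 proof -
  have "1 + x\<^sup>2 <= (1 + 1 / c\<^sup>2) * (c\<^sup>2 + x\<^sup>2)" using c by (simp add: field_simps)
  then show ?thesis using pos[of x] by (simp add: field_simps)
 qed
 have "set_integrable lborel {0..} (\<lambda>x::real. (1 + 1 / c\<^sup>2) * (1 / (1 + x\<^sup>2)))" unfolding set_integrable_def
  by (intro integrable_mult_indicator integrable_mult_right integrable_cauchy_kernel) auto
 then show i: "set_integrable lborel {0..} (\<lambda>x. 1 / (c\<^sup>2 + x\<^sup>2))" by (rule set_integrable_dominated(1)[rotated 2])
   (use dom pos in \<open>auto intro!: continuous_intros simp: less_imp_le order_less_imp_not_eq2\<close>)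
 \<comment> \<open>The primitive is normalised by \<open>- pi / 2\<close> to vanish at
   infinity.\<close>
 have "(LINT x:{0..}|lborel. 1 / (c\<^sup>2 + x\<^sup>2)) = - ((arctan (0 / c) - pi / 2) / c)"
 proof (rule set_integral_FTC_half_line[OF _ _ i])
  fix x :: real
  have "c\<^sup>2 * (1 + (x / c)\<^sup>2) = c\<^sup>2 + x\<^sup>2" using c by (simp add: field_simps power2_eq_square)
  moreover have "inverse (1 + (x / c)\<^sup>2) * (1 / c) / c = 1 / (c\<^sup>2 * (1 + (x / c)\<^sup>2))"
   by (simp add: inverse_eq_divide power2_eq_square)
  ultimately have "inverse (1 + (x / c)\<^sup>2) * (1 / c) / c = 1 / (c\<^sup>2 + x\<^sup>2)" by simp
  moreover have "((\<lambda>x. (arctan (x / c) - pi / 2) / c) has_real_derivative inverse (1 + (x / c)\<^sup>2) * (1 / c) / c) (at x within {0..})"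
   using c by (auto intro!: derivative_eq_intros)
  ultimately show "((\<lambda>x. (arctan (x / c) - pi / 2) / c) has_vector_derivative 1 / (c\<^sup>2 + x\<^sup>2)) (at x within {0..})"
   by (simp add: has_real_derivative_iff_has_vector_derivative)
  have "filterlim (\<lambda>x. 1 / c * x) at_top at_top"
   by (rule filterlim_tendsto_pos_mult_at_top[OF tendsto_const _ filterlim_ident]) (use c in simp)
  then have "filterlim (\<lambda>x. x / c) at_top at_top" by simp
  then have "((\<lambda>x. arctan (x / c)) \<longlongrightarrow> pi / 2) at_top" by (rule filterlim_compose[OF tendsto_arctan_at_top])
  then have "((\<lambda>x. (arctan (x / c) - pi / 2) / c) \<longlongrightarrow> (pi / 2 - pi / 2) / c) at_top"
   using c by (intro tendsto_intros) auto
  then show "((\<lambda>x. (arctan (x / c) - pi / 2) / c) \<longlongrightarrow> 0) at_top" by simp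
 qed (use pos in \<open>auto intro!: continuous_intros simp: order_less_imp_not_eq2\<close>)
 then show "(LINT x:{0..}|lborel. 1 / (c\<^sup>2 + x\<^sup>2)) = pi / (2 * c)" by (simp add: field_simps)
qed

text \<open>Abel summation of the inversion formula: the transforms are integrated against
 \<open>e\<^bsup>-\<epsilon>\<tau>\<^esup>\<close>, which turns the inner integral into the Poisson kernel.\<close>

theorem bound_by_transforms:
 fixes g :: "real => real"
 assumes g: "integrable lborel g" and G: "\<And>s. \<bar>g s\<bar> <= G" and cont: "isCont g t"
  and c: "0 < c" and b: "0 <= b"
  and C: "\<And>\<tau>. 0 <= \<tau> ==> \<bar>\<integral>s. g s * cos (\<tau> * s) \<partial>lborel\<bar> <= b / (c\<^sup>2 + \<tau>\<^sup>2)"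
  and S: "\<And>\<tau>. 0 <= \<tau> ==> \<bar>\<integral>s. g s * sin (\<tau> * s) \<partial>lborel\<bar> <= b / (c\<^sup>2 + \<tau>\<^sup>2)"
 shows "\<bar>g t\<bar> <= b / c"
proof -
 have [measurable]: "g \<in> borel_measurable borel" using g by auto
 have gi: "integrable lborel (\<lambda>s. g s * w s)" if "w \<in> borel_measurable borel" "\<And>s. \<bar>w s\<bar> <= 1" for w :: "real => real"
  using that by (intro Bochner_Integration.integrable_bound[OF g]) (auto simp: abs_mult mult_left_le)
 have eps: "\<bar>\<integral>r. g (t + e * r) * (1 / (1 + r\<^sup>2)) \<partial>lborel\<bar> <= pi * b / c" if e: "0 < e" for e
 proof -
  \<comment> \<open>Integrated over \<open>\<tau>\<close> first, \<open>f\<close> gives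
    \<open>g\<close> against the Poisson kernel; integrated over \<open>s\<close> first, it gives
    the two transforms, by the addition theorem for the cosine.\<close>
  define f where "f s \<tau> = g s * (indicator {0..} \<tau> * exp (- (e * \<tau>)) * cos ((t - s) * \<tau>))" for s \<tau>
  have hi: "integrable lborel (\<lambda>\<tau>. indicator {0..} \<tau> * exp (- (e * \<tau>)) :: real)"
   using exp_minus_integrable[OF e] by (simp add: set_integrable_def)
  have "integrable (lborel \<Otimes>\<^sub>M lborel) (\<lambda>(s, \<tau>). g s * (indicator {0..} \<tau> * exp (- (e * \<tau>)) :: real))"
  proof (rule lborel_pair.Fubini_integrable)
   show "integrable lborel (\<lambda>x. \<integral>y. norm (case (x, y) of (s, \<tau>) => g s * (indicator {0..} \<tau> * exp (- (e * \<tau>)))) \<partial>lborel)"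
    using integrable_norm[OF g] integrable_norm[OF hi] by (auto simp: abs_mult)
  qed (auto intro!: AE_I2 integrable_mult_right hi)
  then have fi: "integrable (lborel \<Otimes>\<^sub>M lborel) (case_prod f)"
  proof (rule Bochner_Integration.integrable_bound)
   show "case_prod f \<in> borel_measurable (lborel \<Otimes>\<^sub>M lborel)" unfolding f_def by measurable
   show "AE x in lborel \<Otimes>\<^sub>M lborel. norm (case_prod f x)
     <= norm (case x of (s, \<tau>) => g s * (indicator {0..} \<tau> * exp (- (e * \<tau>))))"
    by (intro AE_I2) (auto simp: f_def abs_mult mult_left_le intro!: mult_left_mono)
  qed
  have inn: "(\<integral>s. f s \<tau> \<partial>lborel) = indicator {0..} \<tau> * exp (- (e * \<tau>)) *
    (cos (t * \<tau>) * (\<integral>s. g s * cos (\<tau> * s) \<partial>lborel) + sin (t * \<tau>) * (\<integral>s. g s * sin (\<tau> * s) \<partial>lborel))" for \<tau>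
  proof -
   have "f s \<tau> = indicator {0..} \<tau> * exp (- (e * \<tau>)) *
     (cos (t * \<tau>) * (g s * cos (\<tau> * s)) + sin (t * \<tau>) * (g s * sin (\<tau> * s)))" for s
    by (simp add: f_def left_diff_distrib cos_diff algebra_simps)
   then show ?thesis using gi[of "\<lambda>s. cos (\<tau> * s)"] gi[of "\<lambda>s. sin (\<tau> * s)"] by simp
  qed
  have inner: "\<bar>\<integral>s. f s \<tau> \<partial>lborel\<bar> <= 2 * b * (indicator {0..} \<tau> * (1 / (c\<^sup>2 + \<tau>\<^sup>2)))" for \<tau>
  proof (cases "0 <= \<tau>")
   case True
   let ?C = "\<integral>s. g s * cos (\<tau> * s) \<partial>lborel" and ?S = "\<integral>s. g s * sin (\<tau> * s) \<partial>lborel"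
   have "\<bar>cos (t * \<tau>) * ?C + sin (t * \<tau>) * ?S\<bar> <= \<bar>cos (t * \<tau>)\<bar> * \<bar>?C\<bar> + \<bar>sin (t * \<tau>)\<bar> * \<bar>?S\<bar>"
    using abs_triangle_ineq[of "cos (t * \<tau>) * ?C" "sin (t * \<tau>) * ?S"] by (simp only: abs_mult)
   also have "\<dots> <= 1 * (b / (c\<^sup>2 + \<tau>\<^sup>2)) + 1 * (b / (c\<^sup>2 + \<tau>\<^sup>2))" by (intro add_mono mult_mono C S True) auto
   finally have *: "\<bar>cos (t * \<tau>) * ?C + sin (t * \<tau>) * ?S\<bar> <= 2 * b * (1 / (c\<^sup>2 + \<tau>\<^sup>2))" by simp
   have "\<bar>\<integral>s. f s \<tau> \<partial>lborel\<bar> = exp (- (e * \<tau>)) * \<bar>cos (t * \<tau>) * ?C + sin (t * \<tau>) * ?S\<bar>"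
    unfolding inn using True by (simp add: abs_mult)
   also have "\<dots> <= 1 * (2 * b * (1 / (c\<^sup>2 + \<tau>\<^sup>2)))" using True e by (intro mult_mono *) auto
   finally show ?thesis using True by simp
  qed (simp add: inn)
  have Ki: "integrable lborel (\<lambda>\<tau>. 2 * b * (indicator {0..} \<tau> * (1 / (c\<^sup>2 + \<tau>\<^sup>2))))"
   using cauchy_kernel_half_line(1)[OF c] unfolding set_integrable_def real_scaleR_def
   by (intro integrable_mult_right)
  have K: "(\<integral>\<tau>. indicator {0..} \<tau> * (1 / (c\<^sup>2 + \<tau>\<^sup>2)) \<partial>lborel) = pi / (2 * c)"
   using cauchy_kernel_half_line(2)[OF c] unfolding set_lebesgue_integral_def real_scaleR_def .
  have "\<bar>\<integral>\<tau>. (\<integral>s. f s \<tau> \<partial>lborel) \<partial>lborel\<bar> <= (\<integral>\<tau>. 2 * b * (indicator {0..} \<tau> * (1 / (c\<^sup>2 + \<tau>\<^sup>2))) \<partial>lborel)"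
   using Bochner_Integration.integral_norm_bound_integral[OF lborel_pair.integrable_snd[OF fi] Ki] inner by simp
  also have "\<dots> = 2 * b * (pi / (2 * c))" by (simp only: integral_mult_right_zero K)
  finally have "\<bar>\<integral>s. (\<integral>\<tau>. f s \<tau> \<partial>lborel) \<partial>lborel\<bar> <= pi * b / c"
   using lborel_pair.Fubini_integral[OF fi] by (simp add: mult.commute)
  moreover have "(\<integral>\<tau>. f s \<tau> \<partial>lborel) = g s * (e / (e\<^sup>2 + (t - s)\<^sup>2))" for s
   using cosine_laplace[OF e, of "t - s"] by (simp add: f_def set_lebesgue_integral_def mult.assoc)
  moreover have "(\<integral>s. g s * (e / (e\<^sup>2 + (t - s)\<^sup>2)) \<partial>lborel) = (\<integral>r. g (t + e * r) * (1 / (1 + r\<^sup>2)) \<partial>lborel)"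
  proof -
   have "(\<integral>s. g s * (e / (e\<^sup>2 + (t - s)\<^sup>2)) \<partial>lborel)
    = e * (\<integral>r. g (t + e * r) * (e / (e\<^sup>2 + (t - (t + e * r))\<^sup>2)) \<partial>lborel)"
    using e by (subst lborel_integral_real_affine[of e _ t]) auto
   also have "\<dots> = (\<integral>r. e * (g (t + e * r) * (e / (e\<^sup>2 + (t - (t + e * r))\<^sup>2))) \<partial>lborel)"
    by (rule integral_mult_right_zero[symmetric])
   also have "\<dots> = (\<integral>r. g (t + e * r) * (1 / (1 + r\<^sup>2)) \<partial>lborel)"
   proof (rule Bochner_Integration.integral_cong[OF refl])
    fix r :: real
    have "e * (e / (e\<^sup>2 + (t - (t + e * r))\<^sup>2)) = e\<^sup>2 / (e\<^sup>2 * (1 + r\<^sup>2))"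
     by (simp add: power2_eq_square algebra_simps)
    also have "\<dots> = 1 / (1 + r\<^sup>2)" using e by simp
    finally show "e * (g (t + e * r) * (e / (e\<^sup>2 + (t - (t + e * r))\<^sup>2))) = g (t + e * r) * (1 / (1 + r\<^sup>2))"
     by (metis mult.left_commute)
   qed
   finally show ?thesis .
  qed
  ultimately show ?thesis by simp
 qed
 \<comment> \<open>The substitution \<open>s = t + e * r\<close> has made the kernel independent of
   \<open>e\<close>, so continuity of \<open>g\<close> at \<open>t\<close> gives the limit; the
   kernel has total mass \<open>pi\<close>, which cancels the \<open>pi\<close> in the
   bound.\<close>
 have "(\<lambda>n. \<integral>r. g (t + (1 / real (Suc n)) * r) * (1 / (1 + r\<^sup>2)) \<partial>lborel)
   \<longlonglongrightarrow> (\<integral>r. g t * (1 / (1 + r\<^sup>2)) \<partial>lborel)"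
 proof (rule integral_dominated_convergence[where w = "\<lambda>r. G * (1 / (1 + r\<^sup>2))"])
  show "AE r in lborel. (\<lambda>n. g (t + (1 / real (Suc n)) * r) * (1 / (1 + r\<^sup>2))) \<longlonglongrightarrow> g t * (1 / (1 + r\<^sup>2))"
  proof (intro AE_I2 tendsto_intros)
   fix r :: real
   have "(\<lambda>n. t + (1 / real (Suc n)) * r) \<longlonglongrightarrow> t + 0 * r" by (intro tendsto_intros lim_1_over_n[THEN LIMSEQ_Suc])
   then show "(\<lambda>n. g (t + (1 / real (Suc n)) * r)) \<longlonglongrightarrow> g t" by (intro isCont_tendsto_compose[OF cont]) simp
  qed
  show "AE r in lborel. norm (g (t + (1 / real (Suc n)) * r) * (1 / (1 + r\<^sup>2))) <= G * (1 / (1 + r\<^sup>2))" for n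
   by (intro AE_I2) (simp add: abs_mult G divide_right_mono)
  show "integrable lborel (\<lambda>r. G * (1 / (1 + r\<^sup>2)))" by (intro integrable_mult_right integrable_cauchy_kernel)
 qed auto
 then have "(\<lambda>n. \<bar>\<integral>r. g (t + (1 / real (Suc n)) * r) * (1 / (1 + r\<^sup>2)) \<partial>lborel\<bar>) \<longlonglongrightarrow> \<bar>g t * pi\<bar>"
  unfolding integral_mult_right_zero integral_cauchy_kernel by (rule tendsto_rabs)
 then have "\<bar>g t * pi\<bar> <= pi * b / c" by (rule LIMSEQ_le_const2) (intro exI[of _ 0] allI impI eps, simp)
 then have "pi * \<bar>g t\<bar> <= pi * (b / c)" by (simp add: abs_mult mult.commute)
 then show ?thesis by (simp only: mult_le_cancel_left_pos[OF pi_gt_zero])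
qed

section \<open>Uniform boundedness\<close>

text \<open>The closed sets \<open>C k\<close> cover the space, so by Baire one of them contains a
  ball; differences of two points of that ball bound all operators at once.\<close>

theorem uniform_boundedness:
 fixes T :: "'i => 'a::banach \<Rightarrow>\<^sub>L 'b::real_normed_vector"
 assumes pw: "\<And>x. \<exists>B. \<forall>n. norm (T n x) <= B"
 shows "\<exists>B. \<forall>n. norm (T n) <= B"
proof -
 define C where "C k = {x. \<forall>n. norm (T n x) <= real k}" for k
 have closed: "closed (C k)" for k
  unfolding C_def by (intro closed_Collect_all closed_Collect_le continuous_intros)
 have "\<exists>k. interior (C k) \<noteq> {}"
 proof (rule ccontr)
  assume "\<not> ?thesis"
  then have "interior (\<Union>k. C k) = {}"
   using Baire_category_alt[of "euclidean :: 'a topology" "range C"] closed completely_metrizable_space_euclidean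
   by (auto simp: interior_of_def interior_def)
  moreover have "x \<in> (\<Union>k. C k)" for x
  proof -
   obtain B where "\<And>n. norm (T n x) <= B" using pw by blast
   moreover obtain k where "B <= real k" using real_arch_simple by blast
   ultimately have "x \<in> C k" unfolding C_def using order_trans by blast
   then show ?thesis by blast
  qed
  ultimately show False by (metis UNIV_I UNIV_eq_I interior_UNIV empty_iff)
 qed
 then obtain k z where "z \<in> interior (C k)" by blast
 then obtain e where e: "0 < e" "cball z e \<subseteq> C k" by (auto simp: mem_interior_cball)
 have "norm (T n x) <= 2 * real k / e * norm x" for n x
 proof (cases "x = 0")
  case False
  define y where "y = (e / norm x) *\<^sub>R x"
  have "norm (T n (z + y)) <= real k" "norm (T n z) <= real k" using e False by (auto simp: C_def y_def subset_iff dist_norm)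
  then have "norm (T n y) <= 2 * real k" using norm_triangle_ineq4[of "T n (z + y)" "T n z"] by (simp add: blinfun.add_right)
  then show ?thesis using e(1) False by (simp add: y_def blinfun.scaleR_right field_simps)
 qed (simp add: blinfun.zero_right)
 then show ?thesis using e(1) by (intro exI[of _ "2 * real k / e"] allI norm_blinfun_bound) auto
qed

section \<open>Strongly continuous semigroups\<close>

locale c0_semigroup =
 fixes S :: "real => 'w::banach \<Rightarrow>\<^sub>L 'w"
 assumes C0: "C0_semigroup S"
begin

lemma S_0: "S 0 x = x" using C0 by (simp add: C0_semigroup_def)

lemma S_add: "0 <= s ==> 0 <= t ==> S (s + t) x = S s (S t x)" using C0 by (simp add: C0_semigroup_def)

lemma S_at_0: "((\<lambda>t. S t x) \<longlongrightarrow> x) (at_right 0)" using C0 by (simp add: C0_semigroup_def)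

lemma S_near_0:
 assumes "0 < e"
 obtains d where "0 < d" "\<And>h. 0 <= h ==> h < d ==> norm (S h x - x) < e"
proof -
 obtain d where d: "d > 0" "\<And>h. 0 < h ==> h < d ==> dist (S h x) x < e"
  using tendstoD[OF S_at_0 assms, of x] by (auto simp: eventually_at_right_field)
 have "norm (S h x - x) < e" if "0 <= h" "h < d" for h
  using d(2)[of h] that assms by (cases "h = 0") (auto simp: dist_norm S_0)
 then show ?thesis using that d(1) by blast
qed

text \<open>Strong continuity bounds orbits, not operators. Unbounded norms along times tending to 0
  would contradict uniform boundedness on the convergent orbits.\<close>

lemma S_bounded_near_0: "\<exists>d>0. \<exists>B\<ge>1. \<forall>h. 0 <= h --> h <= d --> norm (S h) <= B"
proof (rule ccontr)
 assume "\<not> ?thesis"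
 then have neg: "\<exists>h. 0 <= h \<and> h <= d \<and> B < norm (S h)" if "d > 0" "B \<ge> 1" for d B using that by (meson not_le)
 have "\<exists>h. 0 <= h \<and> h <= 1 / real (Suc n) \<and> real (Suc n) < norm (S h)" for n by (rule neg) auto
 then obtain h where h: "\<And>n. 0 <= h n" "\<And>n. h n <= 1 / real (Suc n)" "\<And>n. real (Suc n) < norm (S (h n))" by metis
 have lim: "h \<longlonglongrightarrow> 0" by (rule tendsto_sandwich[OF _ _ tendsto_const lim_1_over_n[THEN LIMSEQ_Suc]]) (use h in auto)
 have "\<exists>B. \<forall>n. norm (S (h n) x) <= B" for x
 proof -
  have "(\<lambda>n. S (h n) x) \<longlonglongrightarrow> x"
  proof (rule metric_LIMSEQ_I)
   fix e :: real assume "e > 0"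
   then obtain d where d: "d > 0" "\<And>h. 0 <= h ==> h < d ==> norm (S h x - x) < e" using S_near_0 by blast
   obtain N where "\<And>n. n \<ge> N ==> h n < d"
    using order_tendstoD(2)[OF lim d(1)] by (auto simp: eventually_sequentially)
   then show "\<exists>N. \<forall>n\<ge>N. dist (S (h n) x) x < e" using d(2) h(1) by (auto simp: dist_norm)
  qed
  then have "Bseq (\<lambda>n. S (h n) x)" by (intro convergent_imp_Bseq) (auto simp: convergent_def)
  then show ?thesis by (auto simp: Bseq_def)
 qed
 then obtain B where B: "\<And>n. norm (S (h n)) <= B" using uniform_boundedness[of "\<lambda>n. S (h n)"] by blast
 obtain n where "B < real n" using reals_Archimedean2 by blast
 then show False using B[of n] h(3)[of n] by simp
qed

definition growth :: "real => bool"
 where "growth w \<longleftrightarrow> (\<exists>M\<ge>1. \<forall>t\<ge>0. norm (S t) <= M * exp (w * t))"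

lemma norm_S_add: "0 <= s ==> 0 <= t ==> norm (S (s + t)) <= norm (S s) * norm (S t)"
proof -
 assume "0 <= s" "0 <= t"
 then have "S (s + t) = S s o\<^sub>L S t" using C0 by (simp add: C0_semigroup_def)
 then show ?thesis by (simp add: norm_blinfun_compose)
qed

text \<open>The operator norm at the single time \<open>d\<close> fixes the growth exponent. Later
  an estimate at one well chosen time lowers the exponent in this way.\<close>

lemma growth_from_step:
 assumes d: "0 < d" and q: "0 < q" "norm (S d) <= q" and B: "1 <= B" "\<And>r. 0 <= r ==> r <= d ==> norm (S r) <= B"
 shows "growth (ln q / d)"
proof -
 have pow: "norm (S (real n * d + r)) <= q ^ n * B" if r: "0 <= r" "r <= d" for n r
 proof (induction n)
  case 0
  then show ?case using B r by simp
 next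
  case (Suc n)
  have "norm (S (real (Suc n) * d + r)) = norm (S (d + (real n * d + r)))" by (simp add: algebra_simps)
  also have "\<dots> <= norm (S d) * norm (S (real n * d + r))" using d r by (intro norm_S_add) auto
  also have "\<dots> <= q * (q ^ n * B)" using q Suc by (intro mult_mono) auto
  finally show ?case by simp
 qed
 have "norm (S t) <= B * exp \<bar>ln q\<bar> * exp (ln q / d * t)" if t: "0 <= t" for t
 proof -
  define n where "n = nat \<lfloor>t / d\<rfloor>"
  define r where "r = t - real n * d"
  have n: "real n <= t / d" "t / d < real n + 1" using t d by (auto simp: n_def)
  then have r: "0 <= r" "r <= d" using d by (auto simp: r_def field_simps)
  have "norm (S t) <= q ^ n * B" using pow[OF r, of n] by (simp add: r_def)
  also have "q ^ n = exp (real n * ln q)" using q by (simp add: exp_of_nat_mult)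
  also have "real n * ln q = ln q / d * t + (- (r / d)) * ln q" using d by (simp add: r_def field_simps)
  \<comment> \<open>\<open>q\<close> may lie on either side of 1, hence the absolute value.\<close>
  also have "(- (r / d)) * ln q <= \<bar>(- (r / d)) * ln q\<bar>" by (rule abs_ge_self)
  also have "\<bar>(- (r / d)) * ln q\<bar> <= 1 * \<bar>ln q\<bar>" unfolding abs_mult using r d by (intro mult_right_mono) auto
  finally show ?thesis using B by (simp add: exp_add mult_ac)
 qed
 then show ?thesis unfolding growth_def using B
  by (intro exI[of _ "B * exp \<bar>ln q\<bar>"]) (auto intro: order_trans[of 1 "B * 1"] mult_left_mono)
qed

lemma growth_exists: "\<exists>w\<ge>0. growth w"
proof -
 obtain d B where dB: "d > 0" "B \<ge> 1" "\<And>h. 0 <= h ==> h <= d ==> norm (S h) <= B" using S_bounded_near_0 by blast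
 have "growth (ln B / d)" using dB by (intro growth_from_step[of d B B]) auto
 then show ?thesis using dB by (intro exI[of _ "ln B / d"]) auto
qed

lemma S_locally_bounded: "\<exists>B\<ge>1. \<forall>t. 0 <= t --> t <= a --> norm (S t) <= B"
proof -
 obtain w M where w: "w \<ge> 0" and M: "M \<ge> 1" "\<And>t. t \<ge> 0 ==> norm (S t) <= M * exp (w * t)"
  using growth_exists unfolding growth_def by blast
 have "norm (S t) <= M * exp (w * \<bar>a\<bar>)" if "0 <= t" "t <= a" for t
 proof -
  have "M * exp (w * t) <= M * exp (w * \<bar>a\<bar>)" using w M that by (auto intro!: mult_left_mono)
  then show ?thesis using M(2)[OF that(1)] by linarith
 qed
 moreover have "1 <= M * exp (w * \<bar>a\<bar>)" using mult_mono[of 1 M 1 "exp (w * \<bar>a\<bar>)"] w M by simp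
 ultimately show ?thesis by blast
qed

lemma norm_S_diff:
 assumes "0 <= s" "0 <= t"
 shows "norm (S s x - S t x) <= norm (S (min s t)) * norm (S \<bar>s - t\<bar> x - x)"
proof -
 have *: "norm (S (a + h) x - S a x) <= norm (S a) * norm (S h x - x)" if "0 <= a" "0 <= h" for a h
  using norm_blinfun[of "S a" "S h x - x"] S_add[OF that] by (simp add: blinfun.diff_right)
 show ?thesis
 proof (cases "s <= t")
  case True
  then show ?thesis using *[of s "t - s"] assms by (simp add: norm_minus_commute)
 next
  case False
  then show ?thesis using *[of t "s - t"] assms by simp
 qed
qed

lemma continuous_S: "continuous_on {0..} (\<lambda>t. S t x)" unfolding continuous_on_iff
proof (intro ballI allI impI)
 fix t e :: real assume t: "t \<in> {0..}" and e: "0 < e"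
 obtain B where B: "B \<ge> 1" "\<And>s. 0 <= s ==> s <= t ==> norm (S s) <= B" using S_locally_bounded[of t] by auto
 obtain d where d: "d > 0" "\<And>h. 0 <= h ==> h < d ==> norm (S h x - x) < e / B" using S_near_0[of "e / B" x] e B by auto
 have "dist (S s x) (S t x) < e" if s: "s \<in> {0..}" "dist s t < d" for s
 proof -
  have "norm (S s x - S t x) <= norm (S (min s t)) * norm (S \<bar>s - t\<bar> x - x)" using s t by (intro norm_S_diff) auto
  also have "\<dots> <= B * norm (S \<bar>s - t\<bar> x - x)" using B(2)[of "min s t"] s t by (intro mult_right_mono) auto
  also have "\<dots> < B * (e / B)" using d(2)[of "\<bar>s - t\<bar>"] s B by (intro mult_strict_left_mono) (auto simp: dist_real_def)
  finally show ?thesis using B by (simp add: dist_norm)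
 qed
 then show "\<exists>d>0. \<forall>s\<in>{0..}. dist s t < d --> dist (S s x) (S t x) < e" using d(1) by blast
qed

text \<open>Joint continuity: the variation of \<open>f\<close> is absorbed by the local bound on
  \<open>norm (S s)\<close>, that of \<open>r\<close> by strong continuity at the fixed vector
  \<open>f a\<close>.\<close>

lemma continuous_S_compose:
 fixes f :: "real => 'w" and r :: "real => real"
 assumes r: "continuous_on X r" "\<And>x. x \<in> X ==> 0 <= r x" and f: "continuous_on X f"
 shows "continuous_on X (\<lambda>x. S (r x) (f x))" unfolding continuous_on_def
proof
 fix a assume a: "a \<in> X"
 obtain B where B: "B \<ge> 1" "\<And>s. 0 <= s ==> s <= r a + 1 ==> norm (S s) <= B" using S_locally_bounded[of "r a + 1"] by auto
 have "continuous_on X (\<lambda>x. S (r x) (f a))" using r(2) by (intro continuous_on_compose2[OF continuous_S r(1)]) auto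
 then have 1: "((\<lambda>x. S (r x) (f a)) \<longlongrightarrow> S (r a) (f a)) (at a within X)" using a by (auto simp: continuous_on_def)
 have ra: "(r \<longlongrightarrow> r a) (at a within X)" and fa: "(f \<longlongrightarrow> f a) (at a within X)"
  using r f a by (auto simp: continuous_on_def)
 have "((\<lambda>x. S (r x) (f x - f a)) \<longlongrightarrow> 0) (at a within X)"
 proof (rule Lim_null_comparison)
  have "\<forall>\<^sub>F x in at a within X. r x < r a + 1" using order_tendstoD(2)[OF ra] by simp
  moreover have "\<forall>\<^sub>F x in at a within X. x \<in> X" by (simp add: eventually_at_filter)
  ultimately show "\<forall>\<^sub>F x in at a within X. norm (S (r x) (f x - f a)) <= B * norm (f x - f a)"
  proof eventually_elim
   case (elim x)
   then have "norm (S (r x)) <= B" using B(2)[of "r x"] r(2)[of x] by simp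
   then show ?case using norm_blinfun[of "S (r x)" "f x - f a"] by (meson mult_right_mono norm_ge_zero order_trans)
  qed
  have "((\<lambda>x. B * norm (f x - f a)) \<longlongrightarrow> B * norm (f a - f a)) (at a within X)" by (intro tendsto_intros fa)
  then show "((\<lambda>x. B * norm (f x - f a)) \<longlongrightarrow> 0) (at a within X)" by simp
 qed
 from tendsto_add[OF this 1] show "((\<lambda>x. S (r x) (f x)) \<longlongrightarrow> S (r a) (f a)) (at a within X)"
  by (simp add: blinfun.diff_right)
qed

end

section \<open>Generators of analytic semigroups\<close>

locale sectorial_generator = c0_semigroup S for S :: "real => 'w::{banach, second_countable_topology} \<Rightarrow>\<^sub>L 'w" +
 fixes D :: "'w set" and A :: "'w => 'w"
 assumes sectorial: "sectorial D A" and generates: "generates D A S"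
begin

lemma generator_limit: "x \<in> D ==> ((\<lambda>h. (S h x - x) /\<^sub>R h) \<longlongrightarrow> A x) (at_right 0)"
 using generates by (simp add: generates_def)

lemma generatorI:
 assumes "((\<lambda>h. (S h x - x) /\<^sub>R h) \<longlongrightarrow> y) (at_right 0)"
 shows "x \<in> D" "A x = y"
proof -
 show "x \<in> D" using generates assms unfolding generates_def by blast
 from tendsto_unique[OF _ generator_limit[OF this] assms] show "A x = y" by simp
qed

lemma D_subspace: "subspace D" and D_dense: "closure D = UNIV" using sectorial by (auto simp: sectorial_def)

lemma A_add: "x \<in> D ==> y \<in> D ==> A (x + y) = A x + A y"
 and A_scale: "x \<in> D ==> A (c *\<^sub>R x) = c *\<^sub>R A x" using sectorial by (auto simp: sectorial_def)

lemma A_0: "A 0 = 0" using A_scale[of 0 0] subspace_0[OF D_subspace] by simp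

lemma A_minus: "x \<in> D ==> A (- x) = - A x" using A_scale[of x "-1"] by simp

lemma S_invariant:
 assumes "x \<in> D" "0 <= t"
 shows "S t x \<in> D" "A (S t x) = S t (A x)"
proof -
 have "((\<lambda>h. S t ((S h x - x) /\<^sub>R h)) \<longlongrightarrow> S t (A x)) (at_right 0)" by (intro tendsto_intros generator_limit assms)
 moreover have "\<forall>\<^sub>F h in at_right 0. S t ((S h x - x) /\<^sub>R h) = (S h (S t x) - S t x) /\<^sub>R h"
  using eventually_at_right_less[of 0]
 proof eventually_elim
  case (elim h)
  then have "S t (S h x) = S h (S t x)" using S_add[of t h x] S_add[of h t x] assms by (simp add: add.commute)
  then show ?case by (simp add: blinfun.bilinear_simps)
 qed
 ultimately have "((\<lambda>h. (S h (S t x) - S t x) /\<^sub>R h) \<longlongrightarrow> S t (A x)) (at_right 0)" by (rule Lim_transform_eventually)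
 from generatorI[OF this] show "S t x \<in> D" "A (S t x) = S t (A x)" by auto
qed

text \<open>Both one-sided quotients are based at the smaller time \<open>m\<close>: there the
  quotient is \<open>S m\<close> applied to the one at 0, and strong continuity replaces
  \<open>S m (A x)\<close> by \<open>S t (A x)\<close>. The case \<open>s < t\<close> only reverses
  the sign.\<close>

lemma S_derivative_D:
 assumes x: "x \<in> D" and t: "0 <= t"
 shows "((\<lambda>t. S t x) has_vector_derivative S t (A x)) (at t within {0..})"
 unfolding has_vector_derivative_def has_derivative_within_alt
proof (intro conjI allI impI)
 show "bounded_linear (\<lambda>h. h *\<^sub>R S t (A x))" by (rule bounded_linear_scaleR_left)
 fix e :: real assume e: "e > 0"
 obtain B where B: "B \<ge> 1" "\<And>s. 0 <= s ==> s <= t ==> norm (S s) <= B" using S_locally_bounded[of t] by auto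
 have "e / (2 * B) > 0" using e B by simp
 from tendstoD[OF generator_limit[OF x] this]
 obtain d where d: "d > 0" "\<And>h. 0 < h ==> h < d ==> norm ((S h x - x) /\<^sub>R h - A x) < e / (2 * B)"
  by (auto simp: eventually_at_right_field dist_norm)
 obtain d' where d': "d' > 0" "\<And>s. 0 <= s ==> \<bar>s - t\<bar> < d' ==> norm (S s (A x) - S t (A x)) < e / 2"
  using continuous_S[of "A x", unfolded continuous_on_iff, rule_format, of t "e / 2"] t e by (auto simp: dist_norm)
 have "norm (S s x - S t x - (s - t) *\<^sub>R S t (A x)) <= e * norm (s - t)"
  if s: "0 <= s" "norm (s - t) < min d d'" for s
 proof (cases "s = t")
  case False
  define h where "h = \<bar>s - t\<bar>"
  define m where "m = min s t"
  have h: "0 < h" "h < d" using False s by (auto simp: h_def)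
  have "\<bar>s - t\<bar> < d'" using s(2) by simp
  then have m: "0 <= m" "m <= t" "\<bar>m - t\<bar> < d'" using s(1) t d'(1) by (auto simp: m_def min_def)
  have mh: "S (m + h) x = S m (S h x)" using m h by (intro S_add) auto
  define v where "v = S m ((S h x - x) /\<^sub>R h - A x) + (S m (A x) - S t (A x))"
  have "norm v <= norm (S m ((S h x - x) /\<^sub>R h - A x)) + norm (S m (A x) - S t (A x))"
   unfolding v_def by (rule norm_triangle_ineq)
  also have "norm (S m ((S h x - x) /\<^sub>R h - A x)) <= B * norm ((S h x - x) /\<^sub>R h - A x)"
   using norm_blinfun[of "S m"] B(2)[OF m(1,2)] by (meson mult_right_mono norm_ge_zero order_trans)
  also have "\<dots> <= B * (e / (2 * B))" using d(2)[OF h] B by (intro mult_left_mono) auto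
  also have "norm (S m (A x) - S t (A x)) <= e / 2" using d'(2)[OF m(1,3)] by simp
  finally have v: "norm v <= e" using B by simp
  have hv: "S (m + h) x - S m x - h *\<^sub>R S t (A x) = h *\<^sub>R v"
   using h unfolding mh v_def by (simp add: blinfun.bilinear_simps scaleR_diff_right scaleR_add_right)
  have "S s x - S t x - (s - t) *\<^sub>R S t (A x) = h *\<^sub>R v \<or> S s x - S t x - (s - t) *\<^sub>R S t (A x) = - (h *\<^sub>R v)"
  proof (cases "s < t")
   case True
   then have eq: "m + h = t" "s - t = - h" "m = s" by (auto simp: m_def h_def)
   have "S s x - S t x - (s - t) *\<^sub>R S t (A x) = - (h *\<^sub>R v)"
    unfolding eq(2) hv[symmetric] eq(1) unfolding eq(3) by simp
   then show ?thesis ..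
  next
   case False
   then have eq: "m + h = s" "s - t = h" "m = t" by (auto simp: m_def h_def)
   have "S s x - S t x - (s - t) *\<^sub>R S t (A x) = h *\<^sub>R v"
    unfolding eq(2) hv[symmetric] eq(1) unfolding eq(3) by simp
   then show ?thesis ..
  qed
  then have "norm (S s x - S t x - (s - t) *\<^sub>R S t (A x)) = h * norm v"
   using h by (metis abs_of_pos norm_minus_cancel norm_scaleR)
  also have "\<dots> <= h * e" using v h by (intro mult_left_mono) auto
  finally show ?thesis by (simp add: h_def mult.commute)
 qed simp
 then show "\<exists>d>0. \<forall>y\<in>{0..}. norm (y - t) < d -->
   norm (S y x - S t x - (y - t) *\<^sub>R S t (A x)) <= e * norm (y - t)"
  using d(1) d'(1) by (intro exI[of _ "min d d'"]) auto
qed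

text \<open>The inverse of \<open>A\<close>, cut out of the resolvent of the complexification at 0;
  that resolvent inverts \<open>- A\<close>, hence the sign.\<close>

definition Ainv :: "'w => 'w"
 where "Ainv x = - fst (resolvent D A 0 (x, 0))"

lemma bounded_linear_Ainv: "bounded_linear Ainv"
proof -
 have "bounded_linear (resolvent D A 0)" using sectorial by (auto simp: sectorial_def in_resolvent_set_def)
 then have "bounded_linear (\<lambda>x. fst (resolvent D A 0 (x, 0)))"
  by (rule bounded_linear_compose[OF bounded_linear_fst bounded_linear_compose[OF _
    bounded_linear_Pair[OF bounded_linear_ident bounded_linear_zero]]])
 then show ?thesis unfolding Ainv_def by (rule bounded_linear_minus)
qed

lemma cpx_shift_0_bij: "bij_betw (cpx_shift A 0) (D \<times> D) UNIV"
 using sectorial by (auto simp: sectorial_def in_resolvent_set_def)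

lemma Ainv_in_D: "Ainv x \<in> D" and A_Ainv: "A (Ainv x) = x"
proof -
 let ?u = "resolvent D A 0 (x, 0)"
 have u: "?u \<in> D \<times> D" "cpx_shift A 0 ?u = (x, 0)"
  using bij_betw_inv_into_right[OF cpx_shift_0_bij] bij_betw_apply[OF bij_betw_inv_into[OF cpx_shift_0_bij]]
  unfolding resolvent_def by auto
 then have f: "fst ?u \<in> D" "- A (fst ?u) = x" by (auto simp: cpx_shift_def split: prod.splits)
 show "Ainv x \<in> D" unfolding Ainv_def by (rule subspace_neg[OF D_subspace f(1)])
 show "A (Ainv x) = x" unfolding Ainv_def A_minus[OF f(1)] by (rule f(2))
qed

lemma Ainv_A: "x \<in> D ==> Ainv (A x) = x"
proof -
 assume x: "x \<in> D"
 have "cpx_shift A 0 (Ainv (A x), 0) = cpx_shift A 0 (x, 0)" by (simp add: cpx_shift_def A_Ainv)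
 then show ?thesis
  using inj_onD[OF bij_betw_imp_inj_on[OF cpx_shift_0_bij]] x Ainv_in_D subspace_0[OF D_subspace] by auto
qed

text \<open>Closedness of \<open>A\<close> comes from continuity of \<open>Ainv\<close>.\<close>

lemma closed_generator:
 assumes "\<And>n. x n \<in> D" "x \<longlonglongrightarrow> a" "(\<lambda>n. A (x n)) \<longlonglongrightarrow> b"
 shows "a \<in> D" "A a = b"
proof -
 have "(\<lambda>n. Ainv (A (x n))) \<longlonglongrightarrow> Ainv b" by (intro bounded_linear.tendsto[OF bounded_linear_Ainv] assms)
 then have "x \<longlonglongrightarrow> Ainv b" using assms(1) by (simp add: Ainv_A)
 then have "a = Ainv b" using assms(2) LIMSEQ_unique by blast
 then show "a \<in> D" "A a = b" by (simp_all add: Ainv_in_D A_Ainv)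
qed

lemma resolvent_estimate:
 assumes "in_resolvent_set D A l" "u \<in> D \<times> D"
 shows "norm u <= onorm (resolvent D A l) * norm (cpx_shift A l u)"
proof -
 have bij: "bij_betw (cpx_shift A l) (D \<times> D) UNIV" and bl: "bounded_linear (resolvent D A l)"
  using assms(1) by (auto simp: in_resolvent_set_def)
 have "resolvent D A l (cpx_shift A l u) = u"
  unfolding resolvent_def by (rule bij_betw_inv_into_left[OF bij assms(2)])
 then show ?thesis using onorm[OF bl, of "cpx_shift A l u"] by simp
qed

lemma norm_cpx_scale:
 fixes x y :: 'w
 shows "norm (Re l *\<^sub>R x - Im l *\<^sub>R y, Im l *\<^sub>R x + Re l *\<^sub>R y) <= 4 * cmod l * norm (x, y)"
proof -
 have x: "norm x <= norm (x, y)" and y: "norm y <= norm (x, y)" using norm_fst_le[of x y] norm_snd_le[of y x] by auto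
 have sc: "norm (a *\<^sub>R z) <= cmod l * norm (x, y)" if "\<bar>a\<bar> <= cmod l" "norm z <= norm (x, y)" for a and z :: 'w
  unfolding norm_scaleR using that by (intro mult_mono) auto
 have "norm (Re l *\<^sub>R x - Im l *\<^sub>R y) <= cmod l * norm (x, y) + cmod l * norm (x, y)"
  by (rule order_trans[OF norm_triangle_ineq4])
   (intro add_mono sc x y abs_Re_le_cmod abs_Im_le_cmod)
 moreover have "norm (Im l *\<^sub>R x + Re l *\<^sub>R y) <= cmod l * norm (x, y) + cmod l * norm (x, y)"
  by (rule order_trans[OF norm_triangle_ineq])
   (intro add_mono sc x y abs_Re_le_cmod abs_Im_le_cmod)
 ultimately show ?thesis using norm_Pair_le[of "Re l *\<^sub>R x - Im l *\<^sub>R y" "Im l *\<^sub>R x + Re l *\<^sub>R y"] by linarith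
qed

text \<open>The sectorial bound degenerates at 0, but 0 is a resolvent point. For
  \<open>cmod l \<le> 1 / (8 * N)\<close> the term \<open>l\<close> perturbs \<open>- A\<close> by
  at most half of what the resolvent at 0 controls. For larger \<open>l\<close> one has
  \<open>1 < 8 * N * cmod l\<close>, and the sectorial bound applies because the closed half plane
  without 0 lies in the sector, \<open>\<theta>\<close> exceeding \<open>pi / 2\<close>. The
  \<open>9\<close> is \<open>8 + 1\<close>, from
  \<open>1 + cmod l \<le> 9 * N * cmod l\<close>.\<close>

lemma half_plane_estimate:
 "\<exists>c>0. \<forall>l u. 0 <= Re l --> u \<in> D \<times> D --> c * (1 + cmod l) * norm u <= norm (cpx_shift A l u)"
proof -
 obtain \<theta> M where \<theta>: "pi / 2 < \<theta>" and M: "\<And>l. l \<noteq> 0 ==> \<bar>Arg l\<bar> < \<theta> ==>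
   in_resolvent_set D A l \<and> onorm (resolvent D A l) <= M / cmod l" using sectorial unfolding sectorial_def by blast
 have res0: "in_resolvent_set D A 0" using sectorial by (simp add: sectorial_def)
 define N where "N = max 1 (max M (onorm (resolvent D A 0)))"
 have N: "N \<ge> 1" "N \<ge> M" "N \<ge> onorm (resolvent D A 0)" by (auto simp: N_def)
 have "1 / (9 * N\<^sup>2) * (1 + cmod l) * norm u <= norm (cpx_shift A l u)"
  if l: "0 <= Re l" and u: "u \<in> D \<times> D" for l u
 proof (cases "cmod l <= 1 / (8 * N)")
  case True
  obtain x y where xy: "u = (x, y)" by (cases u)
  have "norm u <= onorm (resolvent D A 0) * norm (cpx_shift A 0 u)" by (rule resolvent_estimate[OF res0 u])
  also have "\<dots> <= N * norm (cpx_shift A 0 u)" using N by (intro mult_right_mono) auto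
  finally have a: "norm u <= N * norm (cpx_shift A 0 u)" .
  have "cpx_shift A l u = cpx_shift A 0 u + (Re l *\<^sub>R x - Im l *\<^sub>R y, Im l *\<^sub>R x + Re l *\<^sub>R y)"
   by (simp add: cpx_shift_def xy)
  then have "norm (cpx_shift A 0 u) <= norm (cpx_shift A l u)
    + norm (Re l *\<^sub>R x - Im l *\<^sub>R y, Im l *\<^sub>R x + Re l *\<^sub>R y)"
   by (metis add_diff_cancel_right' norm_triangle_ineq4)
  also have "\<dots> <= norm (cpx_shift A l u) + 4 * cmod l * norm u" using norm_cpx_scale[of l x y] by (simp add: xy)
  also have "4 * cmod l * norm u <= 4 * (1 / (8 * N)) * norm u" using True by (intro mult_right_mono) auto
  finally have "N * norm (cpx_shift A 0 u) <= N * (norm (cpx_shift A l u) + 4 * (1 / (8 * N)) * norm u)"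
   using N by (intro mult_left_mono) auto
  also have "\<dots> = N * norm (cpx_shift A l u) + norm u / 2" using N by (simp add: field_simps)
  finally have b: "norm u <= 2 * N * norm (cpx_shift A l u)" using a by linarith
  have "1 / (8 * N) <= 1" using N by simp
  then have "1 + cmod l <= 2" using True by linarith
  then have "1 / (9 * N\<^sup>2) * (1 + cmod l) * norm u <= 1 / (9 * N\<^sup>2) * 2 * norm u"
   by (intro mult_right_mono mult_left_mono) auto
  also have "\<dots> <= 1 / (9 * N\<^sup>2) * 2 * (2 * N * norm (cpx_shift A l u))" using b by (intro mult_left_mono) auto
  also have "\<dots> = (4 / (9 * N)) * norm (cpx_shift A l u)" using N by (simp add: power2_eq_square)
  also have "\<dots> <= 1 * norm (cpx_shift A l u)" using N by (intro mult_right_mono) auto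
  finally show ?thesis by simp
 next
  case False
  then have cl: "1 < 8 * N * cmod l" using N by (simp add: field_simps)
  then have l0: "l \<noteq> 0" by auto
  have Arg: "\<bar>Arg l\<bar> < \<theta>" using Arg_Re_nonneg[of l] l \<theta> by linarith
  have "norm u <= onorm (resolvent D A l) * norm (cpx_shift A l u)"
   using M[OF l0 Arg] by (intro resolvent_estimate u) auto
  also have "\<dots> <= N / cmod l * norm (cpx_shift A l u)"
  proof (rule mult_right_mono)
   have "M / cmod l <= N / cmod l" using N by (intro divide_right_mono) auto
   then show "onorm (resolvent D A l) <= N / cmod l" using M[OF l0 Arg] by linarith
  qed simp
  finally have a: "cmod l * norm u <= N * norm (cpx_shift A l u)" using l0 by (simp add: field_simps)
  have "cmod l <= N * cmod l" using N by (simp add: mult_le_cancel_right1)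
  then have "1 + cmod l <= 8 * N * cmod l + cmod l" using cl by simp
  also have "8 * N * cmod l + cmod l <= 8 * N * cmod l + N * cmod l" using \<open>cmod l <= N * cmod l\<close> by simp
  finally have "1 + cmod l <= 9 * N * cmod l" by simp
  then have "(1 + cmod l) * norm u <= 9 * N * cmod l * norm u" by (intro mult_right_mono) auto
  also have "\<dots> <= 9 * N * (N * norm (cpx_shift A l u))" using a N by simp
  finally have "1 / (9 * N\<^sup>2) * ((1 + cmod l) * norm u) <= 1 / (9 * N\<^sup>2) * (9 * N * (N * norm (cpx_shift A l u)))"
   by (intro mult_left_mono) auto
  then show ?thesis using N by (simp add: power2_eq_square)
 qed
 then show ?thesis using N by (intro exI[of _ "1 / (9 * N\<^sup>2)"]) auto
qed

section \<open>Laplace transforms of weighted orbits\<close>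

definition laplace :: "(real => real) => 'w => 'w"
 where "laplace p y = (LINT s:{0..}|lborel. p s *\<^sub>R S s y)"

context
 fixes w \<sigma> M :: real
 assumes growth: "1 <= M" "\<And>t. 0 <= t ==> norm (S t) <= M * exp (w * t)" and w: "w < \<sigma>" and \<sigma>: "0 < \<sigma>"
begin

text \<open>The rate lies halfway between \<open>\<sigma>\<close> and \<open>w\<close>: a power
  times \<open>exp (- (\<sigma> * s))\<close> still has it, and the rate
  \<open>(\<sigma> - w) / 2\<close> remains against the growth of \<open>S\<close>.\<close>

definition decays :: "(real => real) => bool"
 where "decays p \<longleftrightarrow> continuous_on {0..} p \<and> (\<exists>K\<ge>0. \<forall>s\<ge>0. \<bar>p s\<bar> <= K * exp (- ((\<sigma> + w) / 2 * s)))"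

lemma decays_continuous: "decays p ==> continuous_on {0..} p" by (simp add: decays_def)

lemma decays_bound:
 assumes "decays p"
 obtains K where "0 <= K" "\<And>s y. 0 <= s ==> norm (p s *\<^sub>R S s y) <= K * norm y * exp (- ((\<sigma> - w) / 2 * s))"
proof -
 obtain K where K: "K \<ge> 0" "\<And>s. s \<ge> 0 ==> \<bar>p s\<bar> <= K * exp (- ((\<sigma> + w) / 2 * s))"
  using assms unfolding decays_def by blast
 show ?thesis
 proof (rule that[of "K * M"])
  show "0 <= K * M" using K growth by simp
  fix s :: real and y assume s: "0 <= s"
  have "norm (S s y) <= norm (S s) * norm y" by (rule norm_blinfun)
  also have "\<dots> <= M * exp (w * s) * norm y" using growth(2)[OF s] by (intro mult_right_mono) auto
  finally have "\<bar>p s\<bar> * norm (S s y) <= (K * exp (- ((\<sigma> + w) / 2 * s))) * (M * exp (w * s) * norm y)"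
   using K growth s by (intro mult_mono) auto
  also have "\<dots> = K * M * norm y * (exp (- ((\<sigma> + w) / 2 * s)) * exp (w * s))" by simp
  also have "exp (- ((\<sigma> + w) / 2 * s)) * exp (w * s) = exp (- ((\<sigma> - w) / 2 * s))"
   by (simp add: exp_add[symmetric] field_simps)
  finally show "norm (p s *\<^sub>R S s y) <= K * M * norm y * exp (- ((\<sigma> - w) / 2 * s))" by simp
 qed
qed

lemma laplace_integrable:
 assumes "decays p"
 shows "set_integrable lborel {0..} (\<lambda>s. p s *\<^sub>R S s y)"
proof -
 obtain K where K: "0 <= K" "\<And>s y. 0 <= s ==> norm (p s *\<^sub>R S s y) <= K * norm y * exp (- ((\<sigma> - w) / 2 * s))"
  using decays_bound[OF assms] by blast
 have "set_integrable lborel {0..} (\<lambda>s. K * norm y * exp (- ((\<sigma> - w) / 2 * s)))"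
  using exp_minus_integrable[of "(\<sigma> - w) / 2"] w by (intro set_integrable_mult_right) simp
 then show ?thesis by (rule set_integrable_dominated(1)[rotated 2])
   (use K(2) in \<open>auto intro!: continuous_intros decays_continuous[OF assms] continuous_S\<close>)
qed

lemma decays_add: "decays p ==> decays q ==> decays (\<lambda>s. p s + q s)"
proof -
 assume "decays p" "decays q"
 then obtain K L where "continuous_on {0..} p" "continuous_on {0..} q"
  and K: "K \<ge> 0" "\<And>s. s \<ge> 0 ==> \<bar>p s\<bar> <= K * exp (- ((\<sigma> + w) / 2 * s))"
  and L: "L \<ge> 0" "\<And>s. s \<ge> 0 ==> \<bar>q s\<bar> <= L * exp (- ((\<sigma> + w) / 2 * s))" unfolding decays_def by blast
 moreover have "\<bar>p s + q s\<bar> <= (K + L) * exp (- ((\<sigma> + w) / 2 * s))" if "s \<ge> 0" for s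
  using K(2)[OF that] L(2)[OF that] by (simp add: distrib_right)
 ultimately show ?thesis unfolding decays_def by (intro conjI continuous_intros exI[of _ "K + L"]) auto
qed

lemma decays_scale: "decays p ==> decays (\<lambda>s. c * p s)"
proof -
 assume "decays p"
 then obtain K where "continuous_on {0..} p"
  and K: "K \<ge> 0" "\<And>s. s \<ge> 0 ==> \<bar>p s\<bar> <= K * exp (- ((\<sigma> + w) / 2 * s))" unfolding decays_def by blast
 moreover have "\<bar>c * p s\<bar> <= (\<bar>c\<bar> * K) * exp (- ((\<sigma> + w) / 2 * s))" if "s \<ge> 0" for s
  using mult_left_mono[OF K(2)[OF that], of "\<bar>c\<bar>"] by (simp add: abs_mult mult.assoc)
 ultimately show ?thesis unfolding decays_def by (intro conjI continuous_intros exI[of _ "\<bar>c\<bar> * K"]) auto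
qed

lemma laplace_add: "decays p ==> decays q ==> laplace (\<lambda>s. p s + q s) y = laplace p y + laplace q y"
 unfolding laplace_def scaleR_add_left by (intro set_integral_add laplace_integrable)

lemma laplace_scale: "laplace (\<lambda>s. c * p s) y = c *\<^sub>R laplace p y"
 unfolding laplace_def scaleR_scaleR[symmetric] by (rule set_integral_scaleR_right)

text \<open>\<open>A\<close> passes through the integral because its bounded inverse does,
  \<open>S s x\<close> being \<open>Ainv (S s (A x))\<close>. The last claim is integration by
  parts.\<close>

lemma laplace_generator:
 assumes p: "decays p" and p': "decays p'" and x: "x \<in> D"
  and deriv: "\<And>s. 0 <= s ==> (p has_real_derivative p' s) (at s within {0..})"
 shows "laplace p x \<in> D" "A (laplace p x) = laplace p (A x)"
  "laplace p (A x) = - (p 0 *\<^sub>R x) - laplace p' x"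
proof -
 have "laplace p x = (LINT s:{0..}|lborel. Ainv (p s *\<^sub>R S s (A x)))" unfolding laplace_def
 proof (rule set_lebesgue_integral_cong)
  show "\<forall>s. s \<in> {0..} --> p s *\<^sub>R S s x = Ainv (p s *\<^sub>R S s (A x))"
   using S_invariant[OF x] by (auto simp: linear_simps(5)[OF bounded_linear_Ainv] Ainv_A simp flip: S_invariant(2)[OF x])
 qed simp
 also have "\<dots> = Ainv (laplace p (A x))" unfolding laplace_def
  by (rule set_integral_bounded_linear(2)[OF bounded_linear_Ainv laplace_integrable[OF p]])
 finally have "laplace p x = Ainv (laplace p (A x))" .
 then show "laplace p x \<in> D" "A (laplace p x) = laplace p (A x)" by (simp_all add: Ainv_in_D A_Ainv)
 have "(LINT s:{0..}|lborel. p s *\<^sub>R S s (A x) + p' s *\<^sub>R S s x) = - (p 0 *\<^sub>R S 0 x)"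
 proof (rule set_integral_FTC_half_line)
  show "((\<lambda>s. p s *\<^sub>R S s x) has_vector_derivative p s *\<^sub>R S s (A x) + p' s *\<^sub>R S s x) (at s within {0..})"
   if "0 <= s" for s by (intro has_vector_derivative_scaleR deriv that S_derivative_D x)
  show "continuous_on {0..} (\<lambda>s. p s *\<^sub>R S s (A x) + p' s *\<^sub>R S s x)"
   by (intro continuous_intros decays_continuous p p' continuous_S)
  show "set_integrable lborel {0..} (\<lambda>s. p s *\<^sub>R S s (A x) + p' s *\<^sub>R S s x)"
   by (intro set_integral_add laplace_integrable p p')
  obtain K where K: "0 <= K" "\<And>s y. 0 <= s ==> norm (p s *\<^sub>R S s y) <= K * norm y * exp (- ((\<sigma> - w) / 2 * s))"
   using decays_bound[OF p] by blast
  show "((\<lambda>s. p s *\<^sub>R S s x) \<longlongrightarrow> 0) at_top"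
  proof (rule Lim_null_comparison)
   show "\<forall>\<^sub>F s in at_top. norm (p s *\<^sub>R S s x) <= K * norm x * exp (- ((\<sigma> - w) / 2 * s))"
    using eventually_ge_at_top[of 0] by eventually_elim (rule K(2))
   show "((\<lambda>s. K * norm x * exp (- ((\<sigma> - w) / 2 * s))) \<longlongrightarrow> 0) at_top"
    using w by (intro tendsto_mult_right_zero exp_minus_tendsto_0) simp
  qed
 qed
 then show "laplace p (A x) = - (p 0 *\<^sub>R x) - laplace p' x"
  using set_integral_add(2)[OF laplace_integrable[OF p, of "A x"] laplace_integrable[OF p', of x]]
  by (simp add: laplace_def S_0 algebra_simps)
qed

text \<open>\<open>cos_weight\<close> and \<open>- sin_weight\<close> are the real and imaginary
  parts of \<open>s ^ k * exp (- l * s)\<close> for \<open>l = Complex \<sigma> \<tau>\<close>. The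
  complexified transform is therefore the pair written \<open>(C k, - E k)\<close> below.\<close>

definition cos_weight :: "nat => real => real => real"
 where "cos_weight k \<tau> s = s ^ k * exp (- (\<sigma> * s)) * cos (\<tau> * s)"

definition sin_weight :: "nat => real => real => real"
 where "sin_weight k \<tau> s = s ^ k * exp (- (\<sigma> * s)) * sin (\<tau> * s)"

lemma weight_decays: "decays (cos_weight k \<tau>)" "decays (sin_weight k \<tau>)"
proof -
 let ?C = "(2 * (real k + 1) / (\<sigma> - w)) ^ k"
 have b: "s ^ k * exp (- (\<sigma> * s)) <= ?C * exp (- ((\<sigma> + w) / 2 * s))" if s: "0 <= s" for s
 proof -
  have "s ^ k * exp (- ((\<sigma> - w) * s)) <= ?C * exp (- ((\<sigma> - w) / 2 * s))"
   using w s by (intro power_exp_minus_bound) auto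
  then have "s ^ k * exp (- ((\<sigma> - w) * s)) * exp (- (w * s)) <= ?C * exp (- ((\<sigma> - w) / 2 * s)) * exp (- (w * s))"
   by (intro mult_right_mono) auto
  then show ?thesis by (simp add: mult.assoc exp_add[symmetric]) (simp add: algebra_simps diff_divide_distrib add_divide_distrib)
 qed
 have b': "\<bar>s ^ k * exp (- (\<sigma> * s)) * z\<bar> <= ?C * exp (- ((\<sigma> + w) / 2 * s))" if "0 <= s" "\<bar>z\<bar> <= 1" for s z
 proof -
  have "\<bar>s ^ k * exp (- (\<sigma> * s)) * z\<bar> <= s ^ k * exp (- (\<sigma> * s)) * 1"
   unfolding abs_mult using that by (intro mult_mono) auto
  then show ?thesis using b[OF that(1)] by simp
 qed
 have "0 <= ?C" using w by simp
 with b' show "decays (cos_weight k \<tau>)" "decays (sin_weight k \<tau>)" unfolding decays_def cos_weight_def sin_weight_def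
  by (auto intro!: continuous_intros exI[of _ ?C])
qed

lemma weight_derivative:
 "(cos_weight k \<tau> has_real_derivative
  real k * cos_weight (k - 1) \<tau> s + (- \<sigma> * cos_weight k \<tau> s + - \<tau> * sin_weight k \<tau> s)) (at s within X)"
 "(sin_weight k \<tau> has_real_derivative
  real k * sin_weight (k - 1) \<tau> s + (- \<sigma> * sin_weight k \<tau> s + \<tau> * cos_weight k \<tau> s)) (at s within X)"
 unfolding cos_weight_def sin_weight_def by (auto intro!: derivative_eq_intros simp: algebra_simps)

text \<open>Integration by parts. The boundary term at 0 survives for \<open>k = 0\<close> only, and
  there the truncated \<open>k - 1\<close> stands behind the factor 0.\<close>

lemma laplace_weight_generator:
 fixes k \<tau>
 assumes x: "x \<in> D"
 defines "C \<equiv> \<lambda>k. laplace (cos_weight k \<tau>) x" and "E \<equiv> \<lambda>k. laplace (sin_weight k \<tau>) x"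
 shows "C k \<in> D" "E k \<in> D"
  "laplace (cos_weight k \<tau>) (A x) = A (C k)" "laplace (sin_weight k \<tau>) (A x) = A (E k)"
  "A (C k) = - ((if k = 0 then 1 else 0) *\<^sub>R x) - real k *\<^sub>R C (k - 1) + \<sigma> *\<^sub>R C k + \<tau> *\<^sub>R E k"
  "A (E k) = - (real k *\<^sub>R E (k - 1)) + \<sigma> *\<^sub>R E k - \<tau> *\<^sub>R C k"
proof -
 note d = weight_decays decays_add decays_scale
 have c: "decays (\<lambda>s. real k * cos_weight (k - 1) \<tau> s + (- \<sigma> * cos_weight k \<tau> s + - \<tau> * sin_weight k \<tau> s))"
  and s: "decays (\<lambda>s. real k * sin_weight (k - 1) \<tau> s + (- \<sigma> * sin_weight k \<tau> s + \<tau> * cos_weight k \<tau> s))"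
  by (intro d)+
 note C = laplace_generator[OF weight_decays(1) c x weight_derivative(1)]
 note E = laplace_generator[OF weight_decays(2) s x weight_derivative(2)]
 show "C k \<in> D" "E k \<in> D"
  "laplace (cos_weight k \<tau>) (A x) = A (C k)" "laplace (sin_weight k \<tau>) (A x) = A (E k)"
  using C E by (simp_all add: C_def E_def)
 have "laplace (\<lambda>s. real k * cos_weight (k - 1) \<tau> s + (- \<sigma> * cos_weight k \<tau> s + - \<tau> * sin_weight k \<tau> s)) x
   = real k *\<^sub>R C (k - 1) + (- \<sigma> *\<^sub>R C k + - \<tau> *\<^sub>R E k)" by (simp only: laplace_add laplace_scale d C_def E_def)
 moreover have "laplace (\<lambda>s. real k * sin_weight (k - 1) \<tau> s + (- \<sigma> * sin_weight k \<tau> s + \<tau> * cos_weight k \<tau> s)) x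
   = real k *\<^sub>R E (k - 1) + (- \<sigma> *\<^sub>R E k + \<tau> *\<^sub>R C k)" by (simp only: laplace_add laplace_scale d C_def E_def)
 moreover have "cos_weight k \<tau> 0 = (if k = 0 then 1 else 0)" "sin_weight k \<tau> 0 = 0"
  by (auto simp: cos_weight_def sin_weight_def)
 ultimately show "A (C k) = - ((if k = 0 then 1 else 0) *\<^sub>R x) - real k *\<^sub>R C (k - 1) + \<sigma> *\<^sub>R C k + \<tau> *\<^sub>R E k"
  "A (E k) = - (real k *\<^sub>R E (k - 1)) + \<sigma> *\<^sub>R E k - \<tau> *\<^sub>R C k" using C E by (simp_all add: C_def E_def)
qed

text \<open>By \<open>shift\<close>, \<open>l - A\<close> maps the pair of index \<open>k\<close> to
  \<open>k\<close> times the previous one, and the pair of index 0 to \<open>(x, 0)\<close>: the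
  pairs are factorials times powers of the resolvent. Each use of the half plane estimate divides by
  \<open>c * m\<close>.\<close>

lemma laplace_weight_bounds:
 fixes \<tau> c
 assumes x: "x \<in> D" and c: "0 < c"
  and est: "\<And>l u. 0 <= Re l ==> u \<in> D \<times> D ==> c * (1 + cmod l) * norm u <= norm (cpx_shift A l u)"
 defines "C \<equiv> \<lambda>k. laplace (cos_weight k \<tau>) x" and "E \<equiv> \<lambda>k. laplace (sin_weight k \<tau>) x"
  and "m \<equiv> 1 + cmod (Complex \<sigma> \<tau>)"
 shows "norm (C 1, - E 1) <= norm x / (c * m)\<^sup>2" "norm (C 2, - E 2) <= 2 * norm x / (c * m) ^ 3"
proof -
 note gen = laplace_weight_generator[OF x, of _ \<tau>]
 have cm: "c * m > 0" using c by (simp add: m_def add_pos_nonneg)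
 have shift: "cpx_shift A (Complex \<sigma> \<tau>) (C k, - E k)
   = (if k = 0 then (x, 0) else real k *\<^sub>R (C (k - 1), - E (k - 1)))" for k
  unfolding cpx_shift_def using gen(5,6)[of k] A_minus[OF gen(2)[of k]] by (auto simp: algebra_simps C_def E_def)
 have "c * m * norm (C k, - E k) <= norm (cpx_shift A (Complex \<sigma> \<tau>) (C k, - E k))" for k
  unfolding m_def using \<sigma> gen(1,2) subspace_neg[OF D_subspace] by (intro est) (auto simp: C_def E_def)
 then have "c * m * norm (C k, - E k) <= norm (if k = 0 then (x, 0) else real k *\<^sub>R (C (k - 1), - E (k - 1)))" for k
  unfolding shift .
 from this[of 0] this[of 1] this[of 2]
 have 0: "c * m * norm (C 0, - E 0) <= norm x" and 1: "c * m * norm (C 1, - E 1) <= norm (C 0, - E 0)"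
  and 2: "c * m * norm (C 2, - E 2) <= 2 * norm (C 1, - E 1)"
  unfolding norm_scaleR if_distrib[of norm] by (simp_all add: norm_Pair[of x 0])
 have "(c * m)\<^sup>2 * norm (C 1, - E 1) <= c * m * norm (C 0, - E 0)"
  using mult_left_mono[OF 1, of "c * m"] cm by (simp add: power2_eq_square mult.assoc)
 then have 3: "(c * m)\<^sup>2 * norm (C 1, - E 1) <= norm x" using 0 by linarith
 then have "norm (C 1, - E 1) * (c * m)\<^sup>2 <= norm x" by (simp only: mult.commute)
 then show "norm (C 1, - E 1) <= norm x / (c * m)\<^sup>2" by (rule mult_imp_le_div_pos[OF zero_less_power[OF cm]])
 have "(c * m) ^ 3 * norm (C 2, - E 2) = (c * m)\<^sup>2 * (c * m * norm (C 2, - E 2))"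
  by (simp only: power3_eq_cube power2_eq_square mult.assoc)
 also have "\<dots> <= (c * m)\<^sup>2 * (2 * norm (C 1, - E 1))" by (rule mult_left_mono[OF 2]) simp
 finally have "(c * m) ^ 3 * norm (C 2, - E 2) <= (c * m)\<^sup>2 * (2 * norm (C 1, - E 1))" .
 then have "norm (C 2, - E 2) * (c * m) ^ 3 <= 2 * norm x" using 3 by (simp only: mult.commute)
 then show "norm (C 2, - E 2) <= 2 * norm x / (c * m) ^ 3" by (rule mult_imp_le_div_pos[OF zero_less_power[OF cm]])
qed

text \<open>\<^term>\<open>bound_by_transforms\<close> for the path \<open>s \<mapsto> s\<^sup>k e\<^bsup>-\<sigma>s\<^esup> S s y\<close>.\<close>

lemma weighted_orbit_bound:
 assumes t: "0 < t" and c: "0 < c" and b: "0 <= b"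
  and C: "\<And>\<tau>. 0 <= \<tau> ==> norm (laplace (cos_weight k \<tau>) y) <= b / (c\<^sup>2 + \<tau>\<^sup>2)"
  and E: "\<And>\<tau>. 0 <= \<tau> ==> norm (laplace (sin_weight k \<tau>) y) <= b / (c\<^sup>2 + \<tau>\<^sup>2)"
 shows "t ^ k * exp (- (\<sigma> * t)) * norm (S t y) <= b / c"
proof -
 let ?p = "\<lambda>s. s ^ k * exp (- (\<sigma> * s))"
 have p: "decays ?p" using weight_decays(1)[of k 0] by (simp add: cos_weight_def[abs_def])
 have "norm (?p t *\<^sub>R S t y) <= b / c"
 proof (rule norm_le_by_functionals)
  fix \<phi> :: "'w \<Rightarrow>\<^sub>L real" assume \<phi>: "norm \<phi> <= 1"
  \<comment> \<open>Extended by 0 to the negative axis, \<open>g\<close> has the Laplace integrals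
    as its transforms over the line; continuity is asked for at \<open>t > 0\<close> only.\<close>
  define g where "g s = indicator {0..} s * blinfun_apply \<phi> (?p s *\<^sub>R S s y)" for s
  have \<phi>le: "\<bar>blinfun_apply \<phi> z\<bar> <= norm z" for z
   using norm_blinfun[of \<phi> z] mult_right_mono[OF \<phi>, of "norm z"] by simp
  have tr: "(\<integral>s. g s * q s \<partial>lborel) = blinfun_apply \<phi> (laplace (\<lambda>s. ?p s * q s) y)"
   if "decays (\<lambda>s. ?p s * q s)" for q
  proof -
   have "(\<integral>s. g s * q s \<partial>lborel) = (LINT s:{0..}|lborel. blinfun_apply \<phi> ((?p s * q s) *\<^sub>R S s y))"
    unfolding set_lebesgue_integral_def
    by (intro Bochner_Integration.integral_cong) (auto simp: g_def blinfun.scaleR_right)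
   then show ?thesis
    using set_integral_bounded_linear(2)[OF blinfun.bounded_linear_right laplace_integrable[OF that, of y], of \<phi>]
    by (simp add: laplace_def)
  qed
  obtain K where K: "0 <= K" "\<And>s y. 0 <= s ==> norm (?p s *\<^sub>R S s y) <= K * norm y * exp (- ((\<sigma> - w) / 2 * s))"
   using decays_bound[OF p] by blast
  have "\<bar>g t\<bar> <= b / c"
  proof (rule bound_by_transforms[where g = g and G = "K * norm y", OF _ _ _ c b])
   show "integrable lborel g"
    using set_integral_bounded_linear(1)[OF blinfun.bounded_linear_right laplace_integrable[OF p, of y], of \<phi>]
    by (simp add: set_integrable_def g_def[abs_def])
   show "\<bar>g s\<bar> <= K * norm y" for s
   proof (cases "0 <= s")
    case True
    have "exp (- ((\<sigma> - w) / 2 * s)) <= 1" using True w by simp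
    then have "K * norm y * exp (- ((\<sigma> - w) / 2 * s)) <= K * norm y * 1" using K(1) by (intro mult_left_mono) auto
    then show ?thesis using K(2)[OF True, of y] \<phi>le[of "?p s *\<^sub>R S s y"] True by (simp add: g_def)
   qed (simp add: g_def K)
   have "isCont (\<lambda>s. blinfun_apply \<phi> (?p s *\<^sub>R S s y)) t"
   proof (rule continuous_on_interior[of "{0..}"])
    show "continuous_on {0..} (\<lambda>s. blinfun_apply \<phi> (?p s *\<^sub>R S s y))" by (intro continuous_intros continuous_S)
    show "t \<in> interior {0..}" using t by simp
   qed
   moreover have ev: "\<forall>\<^sub>F s in nhds t. g s = blinfun_apply \<phi> (?p s *\<^sub>R S s y)"
    using eventually_nhds_in_open[of "{0<..}" t] t by (auto simp: g_def elim: eventually_mono)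
   ultimately show "isCont g t" by (simp only: isCont_cong[OF ev])
   fix \<tau> :: real assume \<tau>: "0 <= \<tau>"
   have "(\<integral>s. g s * cos (\<tau> * s) \<partial>lborel) = blinfun_apply \<phi> (laplace (cos_weight k \<tau>) y)"
    using tr[of "\<lambda>s. cos (\<tau> * s)"] weight_decays(1)[of k \<tau>] by (simp add: cos_weight_def[abs_def])
   then show "\<bar>\<integral>s. g s * cos (\<tau> * s) \<partial>lborel\<bar> <= b / (c\<^sup>2 + \<tau>\<^sup>2)" using \<phi>le C[OF \<tau>] by (metis order_trans)
   have "(\<integral>s. g s * sin (\<tau> * s) \<partial>lborel) = blinfun_apply \<phi> (laplace (sin_weight k \<tau>) y)"
    using tr[of "\<lambda>s. sin (\<tau> * s)"] weight_decays(2)[of k \<tau>] by (simp add: sin_weight_def[abs_def])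
   then show "\<bar>\<integral>s. g s * sin (\<tau> * s) \<partial>lborel\<bar> <= b / (c\<^sup>2 + \<tau>\<^sup>2)" using \<phi>le E[OF \<tau>] by (metis order_trans)
  qed
  then show "blinfun_apply \<phi> (?p t *\<^sub>R S t y) <= b / c" using t by (simp add: g_def)
 qed
 then show ?thesis using t by (simp add: abs_mult)
qed

end

end

context sectorial_generator
begin

section \<open>Exponential decay and the analyticity bound\<close>

lemma all_from_D:
 assumes "\<And>x. x \<in> D ==> norm (S t x) <= K * norm x"
 shows "norm (S t x) <= K * norm x"
proof -
 have "closed {x. norm (S t x) <= K * norm x}" by (intro closed_Collect_le continuous_intros)
 then have "closure D \<subseteq> {x. norm (S t x) <= K * norm x}" using assms by (intro closure_minimal) auto
 then show ?thesis using D_dense by auto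
qed

text \<open>Inversion of the transforms bounds \<open>t \<bar>S t\<bar>\<close> by a multiple of \<open>exp (w * t)\<close>; the step \<open>\<eta>\<close> depends
 on the resolvent bound only, so finitely many decrements make the growth exponent negative.\<close>

lemma growth_decrement: "\<exists>\<eta>>0. \<forall>w\<ge>0. growth w --> growth (w - \<eta>)"
proof -
 obtain c where c: "c > 0"
  and est: "\<And>l u. 0 <= Re l ==> u \<in> D \<times> D ==> c * (1 + cmod l) * norm u <= norm (cpx_shift A l u)"
  using half_plane_estimate by blast
 \<comment> \<open>Inversion with \<open>k = 1\<close> and \<open>\<sigma> = w + 1 / t0\<close> will
   bound \<open>norm (S t0)\<close> by \<open>exp (w * t0) * exp 1 / (t0 * c\<^sup>2)\<close>. This
   \<open>t0\<close> makes it \<open>exp (w * t0) / 2\<close>, so \<open>growth_from_step\<close>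
   lowers the exponent by \<open>ln 2 / t0\<close>, which depends on \<open>c\<close> alone.\<close>
 define t0 where "t0 = 2 * exp 1 / c\<^sup>2"
 have t0: "t0 > 0" using c by (simp add: t0_def)
 have "growth (w - ln 2 / t0)" if w: "w \<ge> 0" "growth w" for w
 proof -
  obtain M where M: "1 <= M" "\<And>t. 0 <= t ==> norm (S t) <= M * exp (w * t)" using w(2) unfolding growth_def by blast
  define \<sigma> where "\<sigma> = w + 1 / t0"
  have \<sigma>: "w < \<sigma>" "0 < \<sigma>" using t0 w by (auto simp: \<sigma>_def add_nonneg_pos)
  have "t0 * exp (- (\<sigma> * t0)) * norm (S t0 x) <= norm x / c\<^sup>2" if x: "x \<in> D" for x
  proof -
   have "t0 ^ 1 * exp (- (\<sigma> * t0)) * norm (S t0 x) <= (norm x / c\<^sup>2) / 1"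
   proof (rule weighted_orbit_bound[OF M \<sigma> t0])
    fix \<tau> :: real
    let ?m = "1 + cmod (Complex \<sigma> \<tau>)"
    have m: "1\<^sup>2 + \<tau>\<^sup>2 <= ?m\<^sup>2"
    proof -
     have "\<tau>\<^sup>2 <= (cmod (Complex \<sigma> \<tau>))\<^sup>2" by (simp add: cmod_power2)
     then show ?thesis using norm_ge_zero[of "Complex \<sigma> \<tau>"] unfolding power2_sum one_power2 by linarith
    qed
    have pos: "0 < 1\<^sup>2 + \<tau>\<^sup>2" by (simp add: add_pos_nonneg)
    have "norm x / (c * ?m)\<^sup>2 = norm x / c\<^sup>2 / ?m\<^sup>2" by (simp add: power_mult_distrib)
    also have "\<dots> <= norm x / c\<^sup>2 / (1\<^sup>2 + \<tau>\<^sup>2)"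
     by (intro divide_left_mono mult_pos_pos m pos less_le_trans[OF pos m]) auto
    finally have *: "norm x / (c * ?m)\<^sup>2 <= norm x / c\<^sup>2 / (1\<^sup>2 + \<tau>\<^sup>2)" .
    have b: "norm (laplace (cos_weight \<sigma> 1 \<tau>) x, - laplace (sin_weight \<sigma> 1 \<tau>) x) <= norm x / (c * ?m)\<^sup>2"
     by (rule laplace_weight_bounds(1)[OF M \<sigma> x c est])
    show "norm (laplace (cos_weight \<sigma> 1 \<tau>) x) <= norm x / c\<^sup>2 / (1\<^sup>2 + \<tau>\<^sup>2)"
     using b * norm_fst_le[of "laplace (cos_weight \<sigma> 1 \<tau>) x" "- laplace (sin_weight \<sigma> 1 \<tau>) x"] by linarith
    show "norm (laplace (sin_weight \<sigma> 1 \<tau>) x) <= norm x / c\<^sup>2 / (1\<^sup>2 + \<tau>\<^sup>2)"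
     using b * norm_snd_le[of "- laplace (sin_weight \<sigma> 1 \<tau>) x" "laplace (cos_weight \<sigma> 1 \<tau>) x"] by simp
   qed auto
   then show ?thesis by simp
  qed
  then have "norm (S t0 x) <= exp (\<sigma> * t0) / (t0 * c\<^sup>2) * norm x" if "x \<in> D" for x
   using that t0 c by (fastforce simp: field_simps exp_minus)
  then have "norm (S t0 x) <= exp (\<sigma> * t0) / (t0 * c\<^sup>2) * norm x" for x by (rule all_from_D)
  then have "norm (S t0) <= exp (\<sigma> * t0) / (t0 * c\<^sup>2)" using t0 c by (intro norm_blinfun_bound) auto
  also have "\<dots> = exp (w * t0) / 2" using t0 c by (simp add: \<sigma>_def distrib_right exp_add) (simp add: t0_def)
  finally have q: "norm (S t0) <= exp (w * t0) / 2" .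
  obtain B where B: "B \<ge> 1" "\<And>r. 0 <= r ==> r <= t0 ==> norm (S r) <= B" using S_locally_bounded by blast
  have "growth (ln (exp (w * t0) / 2) / t0)" using q t0 B by (intro growth_from_step) auto
  then show ?thesis using t0 by (simp add: ln_div diff_divide_distrib)
 qed
 then show ?thesis using t0 by (intro exI[of _ "ln 2 / t0"]) auto
qed

lemma exponential_decay: "\<exists>\<delta>>0. growth (- \<delta>)"
proof -
 obtain \<eta> where \<eta>: "\<eta> > 0" "\<And>w. w \<ge> 0 ==> growth w ==> growth (w - \<eta>)" using growth_decrement by blast
 have "growth w ==> w < real n * \<eta> ==> \<exists>w<0. growth w" for w n
 proof (induction n arbitrary: w)
  case (Suc n)
  show ?case
  proof (cases "w < 0")
   case True
   then show ?thesis using Suc.prems by blast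
  next
   case False
   then have "growth (w - \<eta>)" using Suc.prems by (intro \<eta>(2)) auto
   then show ?thesis using Suc.prems by (intro Suc.IH[of "w - \<eta>"]) (auto simp: algebra_simps)
  qed
 qed auto
 moreover obtain w where w: "growth w" using growth_exists by blast
 moreover obtain n where "w / \<eta> < real n" using reals_Archimedean2 by blast
 ultimately obtain w' where "w' < 0" "growth w'" using \<eta>(1) by (metis pos_divide_less_eq)
 then show ?thesis by (intro exI[of _ "- w'"]) auto
qed

text \<open>Inversion with \<open>k = 2\<close> for the orbit of \<open>A x\<close>. By the
  generator identities its transforms are combinations of the pairs of index 1 and, with a factor of
  at most \<open>cmod l\<close>, of index 2; all are of order \<open>1 / (cmod l)\<^sup>2\<close>,
  as inversion requires. Elements of \<open>D\<close> come first, because there \<open>A\<close>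
  commutes with \<open>S t\<close>.\<close>

lemma analytic_bound_D: "\<exists>K\<ge>0. \<forall>x\<in>D. \<forall>t>0. norm (A (S t x)) <= K / t * norm x"
proof -
 obtain c where c: "c > 0"
  and est: "\<And>l u. 0 <= Re l ==> u \<in> D \<times> D ==> c * (1 + cmod l) * norm u <= norm (cpx_shift A l u)"
  using half_plane_estimate by blast
 obtain \<delta> M where \<delta>: "\<delta> > 0" and M: "1 <= M" "\<And>t. 0 <= t ==> norm (S t) <= M * exp (- \<delta> * t)"
  using exponential_decay unfolding growth_def by auto
 define b where "b = 2 / c\<^sup>2 + 4 / c ^ 3"
 have "norm (A (S t x)) <= exp 1 * b / t * norm x" if x: "x \<in> D" and t: "t > 0" for x t
 proof -
  \<comment> \<open>Exponential decay admits every positive \<open>\<sigma>\<close>, and this one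
    turns the inversion bound \<open>b * norm x / \<sigma>\<close> for the orbit weighted by
    \<open>t\<^sup>2\<close> into a bound of order \<open>1 / t\<close>.\<close>
  define \<sigma> where "\<sigma> = 1 / t"
  have \<sigma>: "- \<delta> < \<sigma>" "0 < \<sigma>" using t \<delta> by (auto simp: \<sigma>_def) (smt (verit) divide_pos_pos)
  have b0: "0 <= b" using c by (simp add: b_def)
  have "t ^ 2 * exp (- (\<sigma> * t)) * norm (S t (A x)) <= (b * norm x) / \<sigma>"
  proof (rule weighted_orbit_bound[OF M \<sigma> t])
   fix \<tau> :: real
   let ?l = "cmod (Complex \<sigma> \<tau>)"
   let ?C = "\<lambda>k. laplace (cos_weight \<sigma> k \<tau>) x" and ?E = "\<lambda>k. laplace (sin_weight \<sigma> k \<tau>) x"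
   have l2: "?l\<^sup>2 = \<sigma>\<^sup>2 + \<tau>\<^sup>2" by (simp add: cmod_power2)
   have l0: "?l > 0" using \<sigma> by (simp add: complex_eq_iff)
   have l\<sigma>: "\<bar>\<sigma>\<bar> <= ?l" "\<bar>\<tau>\<bar> <= ?l" using abs_Re_le_cmod[of "Complex \<sigma> \<tau>"] abs_Im_le_cmod[of "Complex \<sigma> \<tau>"] by auto
   have p1: "0 < c * (1 + ?l)" "0 < c * ?l" by (intro mult_pos_pos c l0 add_pos_pos zero_less_one)+
   have bd: "norm (?C 1, - ?E 1) <= norm x / (c * (1 + ?l))\<^sup>2"
    "norm (?C 2, - ?E 2) <= 2 * norm x / (c * (1 + ?l)) ^ 3"
    by (rule laplace_weight_bounds[OF M \<sigma> x c est]; assumption)+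
   note gen = laplace_weight_generator[OF M \<sigma> x, of 2 \<tau>]
   have B1: "norm (?C 1, - ?E 1) <= norm x / (c\<^sup>2 * ?l\<^sup>2)"
   proof -
    have "(c * ?l)\<^sup>2 <= (c * (1 + ?l))\<^sup>2" using c by (intro power_mono mult_left_mono) auto
    then have "norm x / (c * (1 + ?l))\<^sup>2 <= norm x / (c * ?l)\<^sup>2"
     by (intro divide_left_mono mult_pos_pos zero_less_power p1) auto
    then have "norm (?C 1, - ?E 1) <= norm x / (c * ?l)\<^sup>2" using bd(1) by linarith
    then show ?thesis by (simp only: power_mult_distrib)
   qed
   have B2: "?l * norm (?C 2, - ?E 2) <= 2 * norm x / (c ^ 3 * ?l\<^sup>2)"
   proof -
    have "(c * ?l) ^ 3 <= (c * (1 + ?l)) ^ 3" using c by (intro power_mono mult_left_mono) auto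
    then have "2 * norm x / (c * (1 + ?l)) ^ 3 <= 2 * norm x / (c * ?l) ^ 3"
     by (intro divide_left_mono mult_pos_pos zero_less_power p1) auto
    then have "norm (?C 2, - ?E 2) <= 2 * norm x / (c * ?l) ^ 3" using bd(2) by linarith
    then have "?l * norm (?C 2, - ?E 2) <= ?l * (2 * norm x / (c * ?l) ^ 3)" by (intro mult_left_mono) auto
    also have "\<dots> = 2 * norm x / (c ^ 3 * ?l\<^sup>2)"
     using l0 by (simp add: power_mult_distrib power3_eq_cube power2_eq_square)
    finally show ?thesis .
   qed
   have comp: "norm (?C k) <= norm (?C k, - ?E k)" "norm (?E k) <= norm (?C k, - ?E k)" for k
    using norm_fst_le[of "?C k" "- ?E k"] norm_snd_le[of "- ?E k" "?C k"] by auto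
   have sc: "norm (a *\<^sub>R z) <= 2 * norm x / (c ^ 3 * ?l\<^sup>2)"
    if "\<bar>a\<bar> <= ?l" "norm z <= norm (?C 2, - ?E 2)" for a and z :: 'w
   proof -
    have "norm (a *\<^sub>R z) <= ?l * norm (?C 2, - ?E 2)" unfolding norm_scaleR using that by (intro mult_mono) auto
    then show ?thesis using B2 by linarith
   qed
   have fin: "norm (- (2 *\<^sub>R z1) + a *\<^sub>R z2 + a' *\<^sub>R z3) <= b * norm x / (\<sigma>\<^sup>2 + \<tau>\<^sup>2)"
    if "norm z1 <= norm (?C 1, - ?E 1)" "\<bar>a\<bar> <= ?l" "norm z2 <= norm (?C 2, - ?E 2)"
     "\<bar>a'\<bar> <= ?l" "norm z3 <= norm (?C 2, - ?E 2)" for a a' and z1 z2 z3 :: 'w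
   proof -
    have "norm (- (2 *\<^sub>R z1)) <= 2 * (norm x / (c\<^sup>2 * ?l\<^sup>2))" using that(1) B1 by simp
    then have "norm (- (2 *\<^sub>R z1) + a *\<^sub>R z2 + a' *\<^sub>R z3)
      <= 2 * (norm x / (c\<^sup>2 * ?l\<^sup>2)) + 2 * norm x / (c ^ 3 * ?l\<^sup>2) + 2 * norm x / (c ^ 3 * ?l\<^sup>2)"
     by (intro norm_triangle_mono sc that)
    also have "\<dots> = b * norm x / ?l\<^sup>2" using l0 c by (simp add: b_def add_divide_distrib distrib_right)
    finally show ?thesis by (simp only: l2)
   qed
   have "laplace (cos_weight \<sigma> 2 \<tau>) (A x) = - (2 *\<^sub>R ?C 1) + \<sigma> *\<^sub>R ?C 2 + \<tau> *\<^sub>R ?E 2" using gen by simp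
   then show "norm (laplace (cos_weight \<sigma> 2 \<tau>) (A x)) <= b * norm x / (\<sigma>\<^sup>2 + \<tau>\<^sup>2)"
    using fin[OF comp(1) l\<sigma>(1) comp(1) l\<sigma>(2) comp(2)] by simp
   have "laplace (sin_weight \<sigma> 2 \<tau>) (A x) = - (2 *\<^sub>R ?E 1) + \<sigma> *\<^sub>R ?E 2 + (- \<tau>) *\<^sub>R ?C 2" using gen by simp
   moreover have "\<bar>- \<tau>\<bar> <= ?l" using l\<sigma>(2) by simp
   ultimately show "norm (laplace (sin_weight \<sigma> 2 \<tau>) (A x)) <= b * norm x / (\<sigma>\<^sup>2 + \<tau>\<^sup>2)"
    using fin[OF comp(2) l\<sigma>(1) comp(2) _ comp(1), of "- \<tau>"] by simp
  qed (use b0 \<sigma> in auto)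
  then have "t\<^sup>2 * exp (- 1) * norm (S t (A x)) <= b * norm x * t" using t by (simp add: \<sigma>_def)
  then have "norm (S t (A x)) <= exp 1 * b / t * norm x"
   using t by (simp add: exp_minus field_simps power2_eq_square)
  then show ?thesis using S_invariant(2)[OF x] t by simp
 qed
 moreover have "0 <= exp 1 * b" using c by (simp add: b_def)
 ultimately show ?thesis by (intro exI[of _ "exp 1 * b"]) auto
qed

text \<open>The bound on \<open>D\<close> makes \<open>A (S t (f n))\<close> Cauchy along
  approximations of \<open>x\<close>; closedness of \<open>A\<close> yields the limit.\<close>

lemma S_in_D:
 assumes K: "\<forall>x\<in>D. \<forall>t>0. norm (A (S t x)) <= K / t * norm x" and t: "0 < t"
 shows "S t x \<in> D" "norm (A (S t x)) <= K / t * norm x"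
proof -
 have "x \<in> closure D" using D_dense by simp
 then obtain f where f: "\<And>n. f n \<in> D" "f \<longlonglongrightarrow> x" unfolding closure_sequential by blast
 have d: "A (S t (f m)) - A (S t (f n)) = A (S t (f m - f n))" "f m - f n \<in> D" for m n
 proof -
  show "f m - f n \<in> D" by (intro subspace_diff D_subspace f)
  have "A (S t (f m - f n)) = A (S t (f m) + (- 1) *\<^sub>R S t (f n))" by (simp add: blinfun.diff_right)
  also have "\<dots> = A (S t (f m)) + (- 1) *\<^sub>R A (S t (f n))"
   using S_invariant(1)[OF f(1)] t by (subst A_add) (auto simp: A_scale A_minus intro: subspace_neg[OF D_subspace])
  finally show "A (S t (f m)) - A (S t (f n)) = A (S t (f m - f n))" by simp
 qed
 have "Cauchy (\<lambda>n. A (S t (f n)))"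
 proof (rule metric_CauchyI)
  fix e :: real assume e: "e > 0"
  define k where "k = \<bar>K / t\<bar> + 1"
  have k: "k > 0" "K / t <= k" unfolding k_def by linarith+
  have "Cauchy f" using f(2) by (rule LIMSEQ_imp_Cauchy)
  then obtain N where N: "\<And>m n. m \<ge> N ==> n \<ge> N ==> dist (f m) (f n) < e / k"
   using e k(1) unfolding Cauchy_def by (meson divide_pos_pos)
  have "dist (A (S t (f m))) (A (S t (f n))) < e" if "m \<ge> N" "n \<ge> N" for m n
  proof -
   have "dist (A (S t (f m))) (A (S t (f n))) <= K / t * norm (f m - f n)"
    unfolding dist_norm d(1) using K d(2) t by blast
   also have "\<dots> <= k * norm (f m - f n)" using k by (intro mult_right_mono) auto
   also have "\<dots> < k * (e / k)" using N[OF that] k by (intro mult_strict_left_mono) (auto simp: dist_norm)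
   finally show ?thesis using k by simp
  qed
  then show "\<exists>N. \<forall>m\<ge>N. \<forall>n\<ge>N. dist (A (S t (f m))) (A (S t (f n))) < e" by blast
 qed
 then obtain y where y: "(\<lambda>n. A (S t (f n))) \<longlonglongrightarrow> y" by (auto simp: Cauchy_convergent_iff convergent_def)
 have lim: "(\<lambda>n. S t (f n)) \<longlonglongrightarrow> S t x" by (intro tendsto_intros f)
 have SD: "\<And>n. S t (f n) \<in> D" using S_invariant(1)[OF f(1)] t by simp
 note cl = closed_generator[OF SD lim y]
 show "S t x \<in> D" by (rule cl)
 have "(\<lambda>n. norm (A (S t (f n)))) \<longlonglongrightarrow> norm y" by (intro tendsto_intros y)
 moreover have "(\<lambda>n. K / t * norm (f n)) \<longlonglongrightarrow> K / t * norm x" by (intro tendsto_intros f)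
 moreover have "norm (A (S t (f n))) <= K / t * norm (f n)" for n using K f(1) t by blast
 ultimately show "norm (A (S t x)) <= K / t * norm x" unfolding cl(2) by (intro LIMSEQ_le) auto
qed

end

text \<open>What the later sections use of sectoriality. The values of \<open>A\<close> that matter
  are those behind \<open>S t\<close> with \<open>t > 0\<close>, at 0, and on the range of
  \<open>Ainv\<close>.\<close>

locale analytic_semigroup = c0_semigroup S for S :: "real => 'w::{banach, second_countable_topology} \<Rightarrow>\<^sub>L 'w" +
 fixes A Ainv :: "'w => 'w" and M \<delta> :: real
 assumes M_ge_1: "1 <= M" and \<delta>_pos: "0 < \<delta>"
  and norm_S_decay: "0 <= t ==> norm (S t) <= M * exp (- (\<delta> * t))"
  and bounded_linear_AS: "0 < t ==> bounded_linear (\<lambda>x. A (S t x))"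
  and norm_AS: "0 < t ==> norm (A (S t x)) <= M / t * norm x"
  and S_derivative: "0 < t ==> ((\<lambda>t. S t x) has_vector_derivative A (S t x)) (at t)"
  and AS_add: "0 <= s ==> 0 < t ==> A (S (s + t) x) = S s (A (S t x))"
  and Ainv: "bounded_linear Ainv" "A (Ainv x) = x" "0 < t ==> Ainv (A (S t x)) = S t x"

lemma (in sectorial_generator) analytic_semigroup: "\<exists>M \<delta>. analytic_semigroup S A Ainv M \<delta>"
proof -
 obtain K where "K \<ge> 0" and K: "\<forall>x\<in>D. \<forall>t>0. norm (A (S t x)) <= K / t * norm x" using analytic_bound_D by blast
 obtain \<delta> M where \<delta>: "\<delta> > 0" and M: "1 <= M" "\<And>t. 0 <= t ==> norm (S t) <= M * exp (- \<delta> * t)"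
  using exponential_decay unfolding growth_def by auto
 note SD = S_in_D[OF K]
 have "analytic_semigroup S A Ainv (max M K) \<delta>"
 proof (intro analytic_semigroup.intro analytic_semigroup_axioms.intro)
  show "c0_semigroup S" by (rule c0_semigroup_axioms)
  show "1 <= max M K" "0 < \<delta>" using M \<delta> by auto
  show "norm (S t) <= max M K * exp (- (\<delta> * t))" if "0 <= t" for t
  proof -
   have "M * exp (- \<delta> * t) <= max M K * exp (- \<delta> * t)" by (intro mult_right_mono) auto
   then have "norm (S t) <= max M K * exp (- \<delta> * t)" using M(2)[OF that] by (rule order_trans[rotated])
   then show ?thesis by simp
  qed
  show AS: "norm (A (S t x)) <= max M K / t * norm x" if "0 < t" for t x
   using SD(2)[OF that, of x] that mult_right_mono[of "K / t" "max M K / t" "norm x"]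
   by (simp add: divide_right_mono)
  show "bounded_linear (\<lambda>x. A (S t x))" if t: "0 < t" for t by (rule bounded_linear_intro[where K = "max M K / t"])
    (use AS[OF t] SD(1)[OF t] in \<open>auto simp: blinfun.bilinear_simps A_add A_scale mult.commute\<close>)
  show add: "A (S (s + t) x) = S s (A (S t x))" if "0 <= s" "0 < t" for s t x
   using S_add[of s t x] S_invariant(2)[OF SD(1)[OF that(2)] that(1), of x] that by simp
  show "bounded_linear Ainv" by (rule bounded_linear_Ainv)
  show "A (Ainv x) = x" for x by (rule A_Ainv)
  show "Ainv (A (S t x)) = S t x" if "0 < t" for t x by (rule Ainv_A[OF SD(1)[OF that]])
  show "((\<lambda>t. S t x) has_vector_derivative A (S t x)) (at t)" if t: "0 < t" for t x
  proof -
   \<comment> \<open>The orbit is restarted at time \<open>t / 2\<close>, where it has entered the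
     domain.\<close>
   let ?y = "S (t / 2) x"
   have y: "?y \<in> D" using SD(1) t by simp
   have "{0<..} \<subseteq> {0::real..}" by auto
   then have "((\<lambda>s. S s ?y) has_vector_derivative S (t / 2) (A ?y)) (at (t / 2))"
    using has_vector_derivative_within_subset[OF S_derivative_D[OF y], of "t / 2" "{0<..}"] t
    by (simp add: at_within_open[of _ "{0<..}"])
   moreover have "((\<lambda>s. s - t / 2) has_vector_derivative 1) (at t)"
    by (auto intro!: derivative_eq_intros simp: has_real_derivative_iff_has_vector_derivative[symmetric])
   ultimately have "((\<lambda>s. S s ?y) \<circ> (\<lambda>s. s - t / 2) has_vector_derivative 1 *\<^sub>R S (t / 2) (A ?y)) (at t)"
    by (intro vector_diff_chain_at) simp_all
   then have "((\<lambda>s. S (s - t / 2) ?y) has_vector_derivative A (S t x)) (at t)"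
    using add[of "t / 2" "t / 2" x] t by (simp add: o_def)
   then show ?thesis
   proof (rule has_vector_derivative_transform_within_open[of _ _ _ "{t/2<..}"])
    fix s assume "s \<in> {t/2<..}"
    then show "S (s - t / 2) ?y = S s x" using S_add[of "s - t / 2" "t / 2" x] t by simp
   qed (use t in auto)
  qed
 qed
 then show ?thesis by blast
qed

section \<open>Power weights\<close>

text \<open>Nonnegativity turns a gauge integral into a Lebesgue integral, which gives access to the
  integrals of powers and of the Beta kernel.\<close>

lemma set_integral_of_has_integral:
 fixes f :: "real => real"
 assumes "(f has_integral I) X" "X \<in> sets borel" "continuous_on X f" "\<And>x. x \<in> X ==> 0 <= f x"
 shows "set_integrable lborel X f" "(LINT x:X|lborel. f x) = I"
proof -
 have I: "0 <= I" using has_integral_nonneg[OF assms(1,4)] .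
 have m: "(\<lambda>x. indicator X x *\<^sub>R f x) \<in> borel_measurable lborel"
  using borel_measurable_continuous_on_indicator[OF assms(2,3)] by simp
 have eq: "ennreal (indicator X x *\<^sub>R f x) = indicator X x * f x" for x by (simp add: indicator_def)
 have "(\<integral>\<^sup>+x. ennreal (indicator X x *\<^sub>R f x) \<partial>lborel) = ennreal I"
  unfolding eq by (rule nn_integral_has_integral_lebesgue[OF assms(4,1)])
 then have "has_bochner_integral lborel (\<lambda>x. indicator X x *\<^sub>R f x) I"
  using assms(4) by (intro has_bochner_integral_nn_integral[OF m] I) (auto simp: indicator_def)
 then show "set_integrable lborel X f" "(LINT x:X|lborel. f x) = I"
  by (auto simp: has_bochner_integral_iff set_integrable_def set_lebesgue_integral_def)
qed

lemma powr_integral: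
 fixes a h :: real
 assumes "0 < a" "0 <= h"
 shows "set_integrable lborel {0<..h} (\<lambda>x. x powr (a - 1))"
  "(LINT x:{0<..h}|lborel. x powr (a - 1)) = h powr a / a"
proof -
 have "((\<lambda>x. x powr (a - 1)) has_integral (h powr (a - 1 + 1) / (a - 1 + 1))) {0..h}"
  using assms by (intro has_integral_powr_from_0) auto
 moreover have n: "negligible {x \<in> {0..h} - {0<..h}. x powr (a - 1) \<noteq> 0}"
  "negligible {x \<in> {0<..h} - {0..h}. x powr (a - 1) \<noteq> 0}" by (auto intro: negligible_subset[of "{0}"])
 ultimately have hi: "((\<lambda>x. x powr (a - 1)) has_integral (h powr a / a)) {0<..h}"
  unfolding has_integral_spike_set_eq[OF n] by simp
 have cont: "continuous_on {0<..h} (\<lambda>x. x powr (a - 1))" by (intro continuous_intros) auto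
 show "set_integrable lborel {0<..h} (\<lambda>x. x powr (a - 1))"
  "(LINT x:{0<..h}|lborel. x powr (a - 1)) = h powr a / a" using set_integral_of_has_integral[OF hi _ cont] by auto
qed

lemma powr_tail_integral:
 fixes b u :: real
 assumes "b < 1" "0 < u"
 shows "set_integrable lborel {u..} (\<lambda>x. x powr (b - 2))"
  "(LINT x:{u..}|lborel. x powr (b - 2)) = u powr (b - 1) / (1 - b)"
proof -
 have "((\<lambda>x. x powr (b - 2)) has_integral - (u powr (b - 2 + 1)) / (b - 2 + 1)) {u..}"
  using assms by (intro has_integral_powr_to_inf) auto
 moreover have "- (u powr (b - 2 + 1)) / (b - 2 + 1) = u powr (b - 1) / (1 - b)"
  using assms by (simp add: field_simps)
 ultimately have hi: "((\<lambda>x. x powr (b - 2)) has_integral u powr (b - 1) / (1 - b)) {u..}" by simp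
 have cont: "continuous_on {u..} (\<lambda>x. x powr (b - 2))" using assms by (intro continuous_intros) auto
 show "set_integrable lborel {u..} (\<lambda>x. x powr (b - 2))"
  "(LINT x:{u..}|lborel. x powr (b - 2)) = u powr (b - 1) / (1 - b)"
  using set_integral_of_has_integral[OF hi _ cont] by auto
qed

text \<open>The exponents \<open>- b\<close> and \<open>b - 1\<close> add up to \<open>-1\<close>,
  so scaling to \<open>r = 1\<close> leaves the value independent of \<open>r\<close>.\<close>

lemma beta_integral:
 fixes b r :: real
 assumes b: "0 < b" "b < 1" and r: "0 < r"
 shows "integrable lborel (\<lambda>t. indicator {0<..<r} t * (t powr - b * (r - t) powr (b - 1)))"
  "(\<integral>t. indicator {0<..<r} t * (t powr - b * (r - t) powr (b - 1)) \<partial>lborel) = Beta (1 - b) b"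
proof -
 let ?f = "\<lambda>t. indicator {0<..<1} t * (t powr - b * (1 - t) powr (b - 1)) :: real"
 let ?g = "\<lambda>t. indicator {0<..<r} t * (t powr - b * (r - t) powr (b - 1))"
 have "((\<lambda>t. t powr (1 - b - 1) * (1 - t) powr (b - 1)) has_integral Beta (1 - b) b) {0..1}"
  using b by (intro has_integral_Beta_real) auto
 then have hi: "((\<lambda>t. t powr - b * (1 - t) powr (b - 1)) has_integral Beta (1 - b) b) {0<..<1}"
  by (simp add: has_integral_Icc_iff_Ioo)
 have cont: "continuous_on {0<..<1} (\<lambda>t. t powr - b * (1 - t) powr (b - 1))" by (intro continuous_intros) auto
 have "set_integrable lborel {0<..<1} (\<lambda>t. t powr - b * (1 - t) powr (b - 1))"
  "(LINT t:{0<..<1}|lborel. t powr - b * (1 - t) powr (b - 1)) = Beta (1 - b) b"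
  using set_integral_of_has_integral[OF hi _ cont] by auto
 then have f: "integrable lborel ?f" "(\<integral>t. ?f t \<partial>lborel) = Beta (1 - b) b"
  unfolding set_integrable_def set_lebesgue_integral_def real_scaleR_def by auto
 have eq: "?g (0 + r * s) = (1 / r) * ?f s" for s
 proof (cases "0 < s \<and> s < 1")
  case True
  have f1: "(r - r * s) powr (b - 1) = r powr (b - 1) * (1 - s) powr (b - 1)"
   by (metis mult.right_neutral powr_mult right_diff_distrib')
  have f2: "r powr - b * r powr (b - 1) = 1 / r"
  proof -
   have "r powr - b * r powr (b - 1) = r powr (- b + (b - 1))" by (rule powr_add[symmetric])
   then show ?thesis using r by (simp add: powr_minus_divide)
  qed
  have "(r powr - b * s powr - b) * (r powr (b - 1) * (1 - s) powr (b - 1))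
    = (r powr - b * r powr (b - 1)) * (s powr - b * (1 - s) powr (b - 1))" by (simp only: mult_ac)
  then have "(r * s) powr - b * (r - r * s) powr (b - 1) = 1 / r * (s powr - b * (1 - s) powr (b - 1))"
   by (simp only: f1 f2 powr_mult)
  then show ?thesis using True r by (simp add: zero_less_mult_iff)
 next
  case False
  then show ?thesis using r by (auto simp: indicator_def zero_less_mult_iff)
 qed
 have "integrable lborel (\<lambda>s. ?g (0 + r * s))" unfolding eq by (intro integrable_mult_right f)
 then show "integrable lborel ?g" using r by (subst (asm) lborel_integrable_real_affine_iff) auto
 have "(\<integral>t. ?g t \<partial>lborel) = \<bar>r\<bar> *\<^sub>R (\<integral>s. ?g (0 + r * s) \<partial>lborel)" using r by (intro lborel_integral_real_affine) auto
 also have "\<dots> = \<bar>r\<bar> *\<^sub>R (1 / r * Beta (1 - b) b)" unfolding eq integral_mult_right_zero f(2) ..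
 finally show "(\<integral>t. ?g t \<partial>lborel) = Beta (1 - b) b" using r by simp
qed

context analytic_semigroup
begin

lemma norm_S: "0 <= t ==> norm (S t x) <= M * norm x"
proof -
 assume t: "0 <= t"
 have "exp (- (\<delta> * t)) <= 1" using t \<delta>_pos by simp
 then have "M * exp (- (\<delta> * t)) <= M * 1" using M_ge_1 by (intro mult_left_mono) auto
 then have "norm (S t) <= M" using norm_S_decay[OF t] by simp
 then show ?thesis using norm_blinfun[of "S t" x] by (meson mult_right_mono norm_ge_zero order_trans)
qed

lemma norm_S_exp: "0 <= t ==> norm (S t x) <= M * norm x * exp (- (\<delta> * t))"
 using norm_blinfun[of "S t" x] mult_right_mono[OF norm_S_decay[of t], of "norm x"] by (simp add: mult_ac)

lemma continuous_AS: "continuous_on {0<..} (\<lambda>t. A (S t x))"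
proof (rule continuous_at_imp_continuous_on, rule ballI)
 fix t :: real assume "t \<in> {0<..}"
 then have t: "0 < t" by simp
 have "continuous_on {t/2<..} (\<lambda>s. S (s - t / 2) (A (S (t / 2) x)))"
  by (intro continuous_S_compose continuous_intros) auto
 moreover have "S (s - t / 2) (A (S (t / 2) x)) = A (S s x)" if "s \<in> {t/2<..}" for s
  using AS_add[of "s - t / 2" "t / 2" x] t that by simp
 ultimately have "continuous_on {t/2<..} (\<lambda>s. A (S s x))" by (rule continuous_on_eq)
 then show "isCont (\<lambda>t. A (S t x)) t" using t by (simp add: continuous_on_eq_continuous_at)
qed

text \<open>\<^term>\<open>N\<close> bounds \<open>x\<close> in the real interpolation space of order \<open>\<theta>\<close> between the base space and the domain.
 This is all that is used of the domains of fractional powers.\<close>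

definition smooth :: "real => real => 'w => bool"
 where "smooth \<theta> N x \<longleftrightarrow> (\<forall>u>0. norm (A (S u x)) <= N * u powr (\<theta> - 1))"

context
 fixes \<beta> :: real
 assumes \<beta>: "0 < \<beta>" "\<beta> < 1"
begin

section \<open>Negative fractional powers: smoothing and injectivity\<close>

lemma frac_pow_integrable: "set_integrable lborel {0<..} (\<lambda>t. t powr (\<beta> - 1) *\<^sub>R S t x)"
proof -
 have "set_integrable lborel {0<..1} (\<lambda>t. M * norm x * t powr (\<beta> - 1))"
  using powr_integral(1)[of \<beta> 1] \<beta> by (intro set_integrable_mult_right) simp
 then have 1: "set_integrable lborel {0<..1} (\<lambda>t. t powr (\<beta> - 1) *\<^sub>R S t x)"
 proof (rule set_integrable_dominated(1)[rotated 2])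
  show "continuous_on {0<..1} (\<lambda>t. t powr (\<beta> - 1) *\<^sub>R S t x)"
   by (intro continuous_intros continuous_on_subset[OF continuous_S]) auto
  show "norm (t powr (\<beta> - 1) *\<^sub>R S t x) <= M * norm x * t powr (\<beta> - 1)" if "t \<in> {0<..1}" for t
   using that mult_right_mono[OF norm_S[of t x], of "t powr (\<beta> - 1)"] by (simp add: mult.commute)
 qed simp
 have "set_integrable lborel {1..} (\<lambda>t. M * norm x * exp (- (\<delta> * t)))"
  using set_integrable_subset[OF exp_minus_integrable[OF \<delta>_pos], of "{1..}"]
  by (intro set_integrable_mult_right) auto
 then have 2: "set_integrable lborel {1..} (\<lambda>t. t powr (\<beta> - 1) *\<^sub>R S t x)"
 proof (rule set_integrable_dominated(1)[rotated 2])
  show "continuous_on {1..} (\<lambda>t. t powr (\<beta> - 1) *\<^sub>R S t x)"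
   by (intro continuous_intros continuous_on_subset[OF continuous_S]) auto
  show "norm (t powr (\<beta> - 1) *\<^sub>R S t x) <= M * norm x * exp (- (\<delta> * t))" if t: "t \<in> {1..}" for t
  proof -
   have "t powr (\<beta> - 1) <= 1" using t \<beta> powr_mono[of "\<beta> - 1" 0 t] by simp
   then have "t powr (\<beta> - 1) * norm (S t x) <= 1 * (M * norm x * exp (- (\<delta> * t)))"
    using t norm_S_exp[of t x] by (intro mult_mono) auto
   then show ?thesis by simp
  qed
 qed simp
 have "{0<..1} \<union> {1..} = {0::real<..}" by auto
 then show ?thesis using set_integrable_Un[OF 1 2] by simp
qed

lemma neg_frac_pow_linear:
 "neg_frac_pow S \<beta> (x + y) = neg_frac_pow S \<beta> x + neg_frac_pow S \<beta> y"
 "neg_frac_pow S \<beta> (x - y) = neg_frac_pow S \<beta> x - neg_frac_pow S \<beta> y"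
 using set_integral_add(2)[OF frac_pow_integrable[of x] frac_pow_integrable[of y]]
  set_integral_diff(2)[OF frac_pow_integrable[of x] frac_pow_integrable[of y]]
 by (simp_all add: neg_frac_pow_def blinfun.bilinear_simps scaleR_add_right scaleR_diff_right)

text \<open>\<open>A (S u)\<close> goes under the Gamma integral, where
  \<open>A (S (u + t) x)\<close> is at most \<open>M / (u + t) * norm x\<close>. Here
  \<open>u + t\<close> is replaced by \<open>u\<close> for \<open>t \<le> u\<close> and by
  \<open>t\<close> for \<open>t \<ge> u\<close>; the two power integrals give
  \<open>1 / \<beta>\<close> and \<open>1 / (1 - \<beta>)\<close>.\<close>

lemma smooth_neg_frac_pow:
 "smooth \<beta> (1 / Gamma \<beta> * M * (1 / \<beta> + 1 / (1 - \<beta>)) * norm x) (neg_frac_pow S \<beta> x)" unfolding smooth_def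
proof (intro allI impI)
 fix u :: real assume u: "0 < u"
 interpret AS: bounded_linear "\<lambda>x. A (S u x)" by (rule bounded_linear_AS[OF u])
 let ?f = "\<lambda>t. A (S u (t powr (\<beta> - 1) *\<^sub>R S t x))"
 have G: "0 < Gamma \<beta>" using \<beta> by (intro Gamma_real_pos)
 note int = set_integral_bounded_linear[OF bounded_linear_AS[OF u] frac_pow_integrable[of x]]
 have "A (S u (neg_frac_pow S \<beta> x)) = (1 / Gamma \<beta>) *\<^sub>R (LINT t:{0<..}|lborel. ?f t)"
  by (simp only: neg_frac_pow_def[of S \<beta> x] AS.scaleR[of "1 / Gamma \<beta>"] int(2))
 also have "(LINT t:{0<..}|lborel. ?f t)
   = (LINT t:{0<..u} \<union> {u..}|lborel. ?f t)" using u by (intro arg_cong[where f = "\<lambda>X. LINT t:X|lborel. ?f t"]) auto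
 also have "\<dots> = (LINT t:{0<..u}|lborel. ?f t)
   + (LINT t:{u..}|lborel. ?f t)"
 proof (rule set_integral_Un_AE)
  show "AE t in lborel. \<not> (t \<in> {0<..u} \<and> t \<in> {u..})" using AE_lborel_singleton[of u] by eventually_elim auto
  show "set_integrable lborel {0<..u} ?f"
   "set_integrable lborel {u..} ?f" using u by (auto intro!: set_integrable_subset[OF int(1)])
 qed auto
 finally have eq: "A (S u (neg_frac_pow S \<beta> x)) = (1 / Gamma \<beta>) *\<^sub>R
   ((LINT t:{0<..u}|lborel. ?f t)
   + (LINT t:{u..}|lborel. ?f t))" .
 have b: "norm (A (S u (t powr (\<beta> - 1) *\<^sub>R S t x))) <= t powr (\<beta> - 1) * (M / v * norm x)"
  if "0 < t" "0 < v" "v <= u + t" for t v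
 proof -
  have "norm (A (S (u + t) x)) <= M / (u + t) * norm x" using u that by (intro norm_AS) auto
  also have "\<dots> <= M / v * norm x" using that M_ge_1 u by (intro mult_right_mono divide_left_mono) auto
  finally have fin: "norm (A (S (u + t) x)) <= M / v * norm x" .
  have eq: "norm (A (S u (t powr (\<beta> - 1) *\<^sub>R S t x))) = t powr (\<beta> - 1) * norm (A (S (u + t) x))"
   using S_add[of u t x] u that by (simp add: AS.scaleR)
  show ?thesis unfolding eq by (rule mult_left_mono[OF fin]) simp
 qed
 have cont: "continuous_on {0<..} ?f"
  by (intro AS.continuous_on continuous_intros continuous_on_subset[OF continuous_S]) auto
 have "norm (LINT t:{0<..u}|lborel. ?f t)
   <= (LINT t:{0<..u}|lborel. (M / u * norm x) * t powr (\<beta> - 1))"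
 proof (rule set_integrable_dominated(2))
  show "set_integrable lborel {0<..u} (\<lambda>t. (M / u * norm x) * t powr (\<beta> - 1))"
   using powr_integral(1)[of \<beta> u] \<beta> u by (intro set_integrable_mult_right) simp
  show "norm (A (S u (t powr (\<beta> - 1) *\<^sub>R S t x))) <= (M / u * norm x) * t powr (\<beta> - 1)"
   if "t \<in> {0<..u}" for t using b[of t u] that u by (simp add: mult.commute)
 qed (auto intro: continuous_on_subset[OF cont])
 also have "\<dots> = M * norm x * (u powr (\<beta> - 1) * (1 / \<beta>))"
  unfolding set_integral_mult_right powr_integral(2)[OF \<beta>(1) less_imp_le[OF u]] using u by (simp add: powr_diff)
 finally have 1: "norm (LINT t:{0<..u}|lborel. ?f t)
   <= M * norm x * (u powr (\<beta> - 1) * (1 / \<beta>))" .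
 have "norm (LINT t:{u..}|lborel. ?f t)
   <= (LINT t:{u..}|lborel. (M * norm x) * t powr (\<beta> - 2))"
 proof (rule set_integrable_dominated(2))
  show "set_integrable lborel {u..} (\<lambda>t. (M * norm x) * t powr (\<beta> - 2))"
   using powr_tail_integral(1)[of \<beta> u] \<beta> u by (intro set_integrable_mult_right) simp
  show "norm (A (S u (t powr (\<beta> - 1) *\<^sub>R S t x))) <= (M * norm x) * t powr (\<beta> - 2)"
   if "t \<in> {u..}" for t
  proof -
   have t: "0 < t" using that u by auto
   have "t powr (\<beta> - 2) = t powr (\<beta> - 1 - 1)" by simp
   also have "\<dots> = t powr (\<beta> - 1) / t" using t by (subst powr_diff) auto
   finally have "t powr (\<beta> - 1) * (M / t * norm x) = (M * norm x) * t powr (\<beta> - 2)" by simp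
   then show ?thesis using b[OF t t] u by simp
  qed
 qed (use u in \<open>auto intro: continuous_on_subset[OF cont]\<close>)
 also have "\<dots> = M * norm x * (u powr (\<beta> - 1) * (1 / (1 - \<beta>)))"
  unfolding set_integral_mult_right powr_tail_integral(2)[OF \<beta>(2) u] by simp
 finally have 2: "norm (LINT t:{u..}|lborel. ?f t)
   <= M * norm x * (u powr (\<beta> - 1) * (1 / (1 - \<beta>)))" .
 have "norm (A (S u (neg_frac_pow S \<beta> x))) <= 1 / Gamma \<beta> *
   (M * norm x * (u powr (\<beta> - 1) * (1 / \<beta>)) + M * norm x * (u powr (\<beta> - 1) * (1 / (1 - \<beta>))))"
  unfolding eq norm_scaleR using G by (intro mult_mono norm_triangle_mono 1 2) auto
 then show "norm (A (S u (neg_frac_pow S \<beta> x)))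
   <= 1 / Gamma \<beta> * M * (1 / \<beta> + 1 / (1 - \<beta>)) * norm x * u powr (\<beta> - 1)" by (simp add: algebra_simps)
qed

text \<open>Integrating \<open>S \<tau>\<close> applied to the vanishing Gamma integral against \<open>\<tau> powr - \<beta>\<close> leaves, by the Beta
 integral, a multiple of \<open>\<integral>\<^sub>\<rho>\<^sup>\<infinity> S r x dr\<close>.\<close>

lemma neg_frac_pow_injective:
 assumes x: "neg_frac_pow S \<beta> x = 0"
 shows "x = 0"
proof -
 have G: "0 < Gamma \<beta>" using \<beta> by (intro Gamma_real_pos)
 have I0: "(LINT t:{0<..}|lborel. t powr (\<beta> - 1) *\<^sub>R S t x) = 0" using x G by (simp add: neg_frac_pow_def)
 \<comment> \<open>The shift by \<open>\<rho>\<close> keeps \<open>A (S (r + \<rho>) x)\<close>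
   bounded down to \<open>r = 0\<close>; it is removed at the end by strong continuity.\<close>
 have S0: "S \<rho> x = 0" if \<rho>: "0 < \<rho>" for \<rho>
 proof -
  define f where "f r = indicator {0<..} r *\<^sub>R S (r + \<rho>) x" for r :: real
  define k where "k r \<tau> = (indicator {0<..<r} \<tau> * (\<tau> powr - \<beta> * (r - \<tau>) powr (\<beta> - 1))) *\<^sub>R f r" for r \<tau> :: real
  have f_m[measurable]: "f \<in> borel_measurable borel" unfolding f_def
   by (intro borel_measurable_continuous_on_indicator continuous_S_compose continuous_intros)
    (use \<rho> in auto)
  have nf: "norm (f r) <= (M * norm x) * (indicator {0..} r * exp (- (\<delta> * r)))" for r
  proof (cases "0 < r")
   case True
   have "norm (S (r + \<rho>) x) <= M * norm x * exp (- (\<delta> * (r + \<rho>)))" using True \<rho> by (intro norm_S_exp) auto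
   also have "\<dots> <= M * norm x * exp (- (\<delta> * r))" using M_ge_1 \<rho> \<delta>_pos by (intro mult_left_mono) auto
   finally show ?thesis using True by (simp add: f_def)
  qed (use M_ge_1 in \<open>auto simp: f_def\<close>)
  have fi: "integrable lborel f"
  proof (rule Bochner_Integration.integrable_bound)
   show "integrable lborel (\<lambda>r. (M * norm x) * (indicator {0..} r * exp (- (\<delta> * r))))"
    using exp_minus_integrable[OF \<delta>_pos] unfolding set_integrable_def real_scaleR_def
    by (intro integrable_mult_right)
   show "AE r in lborel. norm (f r) <= norm ((M * norm x) * (indicator {0..} r * exp (- (\<delta> * r))))"
    unfolding real_norm_def by (intro AE_I2 order_trans[OF nf abs_ge_self])
  qed simp
  let ?B = "Beta (1 - \<beta>) \<beta>"
  have ki: "integrable lborel (\<lambda>\<tau>. k r \<tau>)" "(\<integral>\<tau>. k r \<tau> \<partial>lborel) = ?B *\<^sub>R f r"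
   "(\<integral>\<tau>. norm (k r \<tau>) \<partial>lborel) = ?B * norm (f r)" for r
  proof -
   have "integrable lborel (\<lambda>\<tau>. k r \<tau>) \<and> (\<integral>\<tau>. k r \<tau> \<partial>lborel) = ?B *\<^sub>R f r \<and>
    (\<integral>\<tau>. norm (k r \<tau>) \<partial>lborel) = ?B * norm (f r)"
   proof (cases "0 < r")
    case True
    note b = beta_integral[OF \<beta> True]
    have "(\<lambda>\<tau>. norm (k r \<tau>)) = (\<lambda>\<tau>. (indicator {0<..<r} \<tau> * (\<tau> powr - \<beta> * (r - \<tau>) powr (\<beta> - 1))) * norm (f r))"
     by (auto simp: k_def abs_mult)
    then show ?thesis using b by (simp add: k_def[abs_def])
   next
    case False
    then show ?thesis by (simp add: k_def[abs_def] f_def)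
   qed
   then show "integrable lborel (\<lambda>\<tau>. k r \<tau>)" "(\<integral>\<tau>. k r \<tau> \<partial>lborel) = ?B *\<^sub>R f r"
    "(\<integral>\<tau>. norm (k r \<tau>) \<partial>lborel) = ?B * norm (f r)" by auto
  qed
  have "integrable (lborel \<Otimes>\<^sub>M lborel) (case_prod k)"
  proof (rule lborel_pair.Fubini_integrable)
   have eq: "case_prod k = (\<lambda>p. ((if 0 < snd p \<and> snd p < fst p then 1 else 0) *
     (snd p powr - \<beta> * (fst p - snd p) powr (\<beta> - 1))) *\<^sub>R f (fst p))"
    by (auto simp: k_def fun_eq_iff indicator_def)
   show "case_prod k \<in> borel_measurable (lborel \<Otimes>\<^sub>M lborel)" unfolding eq by measurable
   show "integrable lborel (\<lambda>r. \<integral>\<tau>. norm (case (r, \<tau>) of (r, \<tau>) => k r \<tau>) \<partial>lborel)"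
    using integrable_norm[OF fi] by (simp add: ki(3))
  qed (use ki(1) in auto)
  then have "(\<integral>\<tau>. (\<integral>r. k r \<tau> \<partial>lborel) \<partial>lborel) = (\<integral>r. (\<integral>\<tau>. k r \<tau> \<partial>lborel) \<partial>lborel)"
   by (rule lborel_pair.Fubini_integral)
  \<comment> \<open>With \<open>r = \<tau> + t\<close> the inner integral becomes a multiple of
    \<open>S (\<tau> + \<rho>)\<close> applied to the vanishing Gamma integral
    \<open>I0\<close>.\<close>
  moreover have "(\<integral>r. k r \<tau> \<partial>lborel) = 0" for \<tau>
  proof (cases "0 < \<tau>")
   case True
   have "(\<integral>r. k r \<tau> \<partial>lborel) = (\<integral>t. k (\<tau> + 1 * t) \<tau> \<partial>lborel)" by (subst lborel_integral_real_affine[of 1 _ \<tau>]) auto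
   also have "\<dots> = (\<integral>t. \<tau> powr - \<beta> *\<^sub>R S (\<tau> + \<rho>) (indicator {0<..} t *\<^sub>R (t powr (\<beta> - 1) *\<^sub>R S t x)) \<partial>lborel)"
   proof (rule Bochner_Integration.integral_cong[OF refl])
    fix t :: real
    show "k (\<tau> + 1 * t) \<tau> = \<tau> powr - \<beta> *\<^sub>R S (\<tau> + \<rho>) (indicator {0<..} t *\<^sub>R (t powr (\<beta> - 1) *\<^sub>R S t x))"
    proof (cases "0 < t")
     case t: True
     have "S (\<tau> + t + \<rho>) x = S (\<tau> + \<rho>) (S t x)" using S_add[of "\<tau> + \<rho>" t x] t True \<rho> by (simp add: algebra_simps)
     then show ?thesis using t True by (simp add: k_def f_def blinfun.scaleR_right)
    qed (auto simp: k_def blinfun.zero_right)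
   qed
   also have "\<dots> = \<tau> powr - \<beta> *\<^sub>R S (\<tau> + \<rho>) (LINT t:{0<..}|lborel. t powr (\<beta> - 1) *\<^sub>R S t x)"
    using integral_bounded_linear[OF blinfun.bounded_linear_right frac_pow_integrable[of x, unfolded set_integrable_def], of "S (\<tau> + \<rho>)"]
    by (simp add: set_lebesgue_integral_def)
   finally show ?thesis by (simp add: I0 blinfun.zero_right)
  qed (auto simp: k_def)
  ultimately have "?B *\<^sub>R (\<integral>r. f r \<partial>lborel) = 0" by (simp add: ki(2))
  moreover have "?B > 0" using \<beta> by (simp add: Beta_def Gamma_real_pos)
  ultimately have f0: "(LINT r:{0<..}|lborel. S (r + \<rho>) x) = 0" by (simp add: set_lebesgue_integral_def f_def)
  have "set_integrable lborel {0..} (\<lambda>r. M * (M / \<rho> * norm x) * exp (- (\<delta> * r)))"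
   by (intro set_integrable_mult_right exp_minus_integrable \<delta>_pos)
  then have ASi: "set_integrable lborel {0..} (\<lambda>r. A (S (r + \<rho>) x))"
  proof (rule set_integrable_dominated(1)[rotated 2])
   show "continuous_on {0..} (\<lambda>r. A (S (r + \<rho>) x))"
    using \<rho> by (intro continuous_on_compose2[OF continuous_AS] continuous_intros) auto
   show "norm (A (S (r + \<rho>) x)) <= M * (M / \<rho> * norm x) * exp (- (\<delta> * r))" if "r \<in> {0..}" for r
   proof -
    have "norm (S r (A (S \<rho> x))) <= M * norm (A (S \<rho> x)) * exp (- (\<delta> * r))" using that by (intro norm_S_exp) auto
    also have "\<dots> <= M * (M / \<rho> * norm x) * exp (- (\<delta> * r))"
     using M_ge_1 by (intro mult_right_mono mult_left_mono norm_AS \<rho>) auto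
    finally show ?thesis using AS_add[of r \<rho> x] that \<rho> by simp
   qed
  qed simp
  have "(LINT r:{0..}|lborel. A (S (r + \<rho>) x)) = - S (0 + \<rho>) x"
  proof (rule set_integral_FTC_half_line[OF _ _ ASi])
   show "((\<lambda>r. S (r + \<rho>) x) has_vector_derivative A (S (r + \<rho>) x)) (at r within {0..})" if "0 <= r" for r
   proof -
    have "((\<lambda>r. r + \<rho>) has_vector_derivative 1) (at r)"
     by (auto intro!: derivative_eq_intros simp: has_real_derivative_iff_has_vector_derivative[symmetric])
    from vector_diff_chain_at[OF this S_derivative[of "r + \<rho>" x]] that \<rho>
    show ?thesis by (auto simp: o_def intro: has_vector_derivative_at_within)
   qed
   show "continuous_on {0..} (\<lambda>r. A (S (r + \<rho>) x))"
    using \<rho> by (intro continuous_on_compose2[OF continuous_AS] continuous_intros) auto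
   show "((\<lambda>r. S (r + \<rho>) x) \<longlongrightarrow> 0) at_top"
   proof (rule Lim_null_comparison)
    show "\<forall>\<^sub>F r in at_top. norm (S (r + \<rho>) x) <= M * norm x * exp (- (\<delta> * r))" using eventually_gt_at_top[of 0]
    proof eventually_elim
     case (elim r)
     then show ?case using nf[of r] by (simp add: f_def)
    qed
    show "((\<lambda>r. M * norm x * exp (- (\<delta> * r))) \<longlongrightarrow> 0) at_top"
     by (intro tendsto_mult_right_zero exp_minus_tendsto_0 \<delta>_pos)
   qed
  qed
  \<comment> \<open>The integral of \<open>A (S (r + \<rho>) x)\<close> is
    \<open>- S \<rho> x\<close>, and \<open>Ainv\<close> turns it into the integral in
    \<open>f0\<close>, which is 0.\<close>
  then have "Ainv (- S \<rho> x) = (LINT r:{0..}|lborel. Ainv (A (S (r + \<rho>) x)))"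
   using set_integral_bounded_linear(2)[OF Ainv(1) ASi] by simp
  also have "\<dots> = (LINT r:{0..}|lborel. S (r + \<rho>) x)" by (rule set_lebesgue_integral_cong) (use Ainv(3) \<rho> in auto)
  also have "\<dots> = (LINT r:{0<..}|lborel. S (r + \<rho>) x)"
  proof -
   have "AE r in lborel. indicator {0..} r *\<^sub>R S (r + \<rho>) x = indicator {0<..} r *\<^sub>R S (r + \<rho>) x"
    using AE_lborel_singleton[of 0] by eventually_elim (auto simp: indicator_def)
   moreover have "(\<lambda>r. indicator {0..} r *\<^sub>R S (r + \<rho>) x) \<in> borel_measurable borel"
    by (intro borel_measurable_continuous_on_indicator continuous_S_compose continuous_intros) (use \<rho> in auto)
   moreover have "(\<lambda>r. indicator {0<..} r *\<^sub>R S (r + \<rho>) x) \<in> borel_measurable borel"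
    using f_m by (simp add: f_def[abs_def])
   ultimately show ?thesis unfolding set_lebesgue_integral_def by (intro integral_cong_AE) auto
  qed
  finally have "Ainv (- S \<rho> x) = 0" using f0 by simp
  moreover have "Ainv 0 = 0" using Ainv(1) by (simp add: linear_simps)
  ultimately have "A (Ainv (- S \<rho> x)) = A (Ainv 0)" by simp
  then show ?thesis by (simp add: Ainv(2))
 qed
 have "((\<lambda>t. S t x) \<longlongrightarrow> 0) (at_right 0)" by (rule Lim_transform_eventually[OF tendsto_const])
   (use eventually_at_right_less[of 0] S0 in \<open>auto elim: eventually_mono\<close>)
 then show ?thesis using S_at_0[of x] tendsto_unique trivial_limit_at_right_real by blast
qed

end

end

section \<open>Weakly singular integrals\<close>

text \<open>At an endpoint the integrands below may involve \<open>A (S 0 x)\<close>, a value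
  without meaning for general \<open>x\<close>; the endpoints are a null set.\<close>

lemma set_integral_Icc_Ioo:
 fixes f :: "real => 'a::{banach, second_countable_topology}"
 assumes "set_integrable lborel {s<..<t} f"
 shows "set_integrable lborel {s..t} f" "(LINT r:{s..t}|lborel. f r) = (LINT r:{s<..<t}|lborel. f r)"
proof -
 have 1: "set_integrable lborel ({s<..<t} \<union> ({s..s} \<union> {t..t})) f"
  by (intro set_integrable_Un assms borel_integrable_atLeastAtMost') auto
 show i: "set_integrable lborel {s..t} f" by (rule set_integrable_subset[OF 1]) auto
 show "(LINT r:{s..t}|lborel. f r) = (LINT r:{s<..<t}|lborel. f r)" unfolding set_lebesgue_integral_def
 proof (rule integral_cong_AE)
  show "(\<lambda>x. indicator {s..t} x *\<^sub>R f x) \<in> borel_measurable lborel"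
   "(\<lambda>x. indicator {s<..<t} x *\<^sub>R f x) \<in> borel_measurable lborel"
   using i assms by (auto simp: set_integrable_def intro: borel_measurable_integrable)
  show "AE x in lborel. indicator {s..t} x *\<^sub>R f x = indicator {s<..<t} x *\<^sub>R f x"
   using AE_lborel_singleton[of s] AE_lborel_singleton[of t] by eventually_elim (auto simp: indicator_def)
 qed
qed

lemma set_integral_dominated_Icc:
 fixes f :: "real => 'a::{banach, second_countable_topology}" and g :: "real => real"
 assumes g: "(g has_integral I) {s..t}" "continuous_on {s<..<t} g"
  and f: "continuous_on {s<..<t} f" "\<And>r. s < r ==> r < t ==> norm (f r) <= g r"
 shows "set_integrable lborel {s..t} f" "norm (LINT r:{s..t}|lborel. f r) <= I"
proof -
 have "(g has_integral I) {s<..<t}" using g(1) by (simp add: has_integral_Icc_iff_Ioo)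
 moreover have "0 <= g r" if "r \<in> {s<..<t}" for r using order_trans[OF norm_ge_zero f(2)[of r]] that by simp
 ultimately have gi: "set_integrable lborel {s<..<t} g" "(LINT r:{s<..<t}|lborel. g r) = I"
  using set_integral_of_has_integral[OF _ _ g(2)] by auto
 have fi: "set_integrable lborel {s<..<t} f" "norm (LINT r:{s<..<t}|lborel. f r) <= I"
  using set_integrable_dominated[OF _ f(1) gi(1)] f(2) gi(2) by auto
 then show "set_integrable lborel {s..t} f" "norm (LINT r:{s..t}|lborel. f r) <= I"
  using set_integral_Icc_Ioo[OF fi(1)] by auto
qed

lemma has_integral_powr_right:
 fixes s t a :: real
 assumes "s <= t" "0 < a"
 shows "((\<lambda>r. K * (t - r) powr (a - 1)) has_integral K * (t - s) powr a / a) {s..t}"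
proof -
 have "((\<lambda>r. (t - r) powr (a - 1)) has_integral (- ((t - t) powr a) / a - - ((t - s) powr a) / a)) {s..t}"
 proof (rule fundamental_theorem_of_calculus_interior[OF assms(1)])
  show "continuous_on {s..t} (\<lambda>r. - ((t - r) powr a) / a)"
   using assms by (intro continuous_intros continuous_on_powr') auto
  show "((\<lambda>r. - ((t - r) powr a) / a) has_vector_derivative (t - r) powr (a - 1)) (at r)"
   if "r \<in> {s<..<t}" for r unfolding has_real_derivative_iff_has_vector_derivative[symmetric]
   using assms that by (auto intro!: derivative_eq_intros simp: powr_diff)
 qed
 from has_integral_mult_right[OF this, of K] show ?thesis by simp
qed

lemma has_integral_powr_left:
 fixes s t a :: real
 assumes "s <= t" "0 < a"
 shows "((\<lambda>r. K * (r - s) powr (a - 1)) has_integral K * (t - s) powr a / a) {s..t}"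
proof -
 have "((\<lambda>r. (r - s) powr (a - 1)) has_integral ((t - s) powr a / a - (s - s) powr a / a)) {s..t}"
 proof (rule fundamental_theorem_of_calculus_interior[OF assms(1)])
  show "continuous_on {s..t} (\<lambda>r. (r - s) powr a / a)"
   using assms by (intro continuous_intros continuous_on_powr') auto
  show "((\<lambda>r. (r - s) powr a / a) has_vector_derivative (r - s) powr (a - 1)) (at r)"
   if "r \<in> {s<..<t}" for r unfolding has_real_derivative_iff_has_vector_derivative[symmetric]
   using assms that by (auto intro!: derivative_eq_intros simp: powr_diff)
 qed
 from has_integral_mult_right[OF this, of K] show ?thesis by simp
qed

lemma set_integral_powr_right:
 fixes f :: "real => 'a::{banach, second_countable_topology}"
 assumes "s <= t" "0 < a" "continuous_on {s<..<t} f"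
  "\<And>r. s < r ==> r < t ==> norm (f r) <= K * (t - r) powr (a - 1)"
 shows "set_integrable lborel {s..t} f" "norm (LINT r:{s..t}|lborel. f r) <= K * (t - s) powr a / a"
proof -
 have "continuous_on {s<..<t} (\<lambda>r. K * (t - r) powr (a - 1))" by (intro continuous_intros) auto
 from set_integral_dominated_Icc[OF has_integral_powr_right[OF assms(1,2)] this assms(3,4)]
 show "set_integrable lborel {s..t} f" "norm (LINT r:{s..t}|lborel. f r) <= K * (t - s) powr a / a" by auto
qed

lemma set_integral_powr_left:
 fixes f :: "real => 'a::{banach, second_countable_topology}"
 assumes "s <= t" "0 < a" "continuous_on {s<..<t} f"
  "\<And>r. s < r ==> r < t ==> norm (f r) <= K * (r - s) powr (a - 1)"
 shows "set_integrable lborel {s..t} f" "norm (LINT r:{s..t}|lborel. f r) <= K * (t - s) powr a / a"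
proof -
 have "continuous_on {s<..<t} (\<lambda>r. K * (r - s) powr (a - 1))" by (intro continuous_intros) auto
 from set_integral_dominated_Icc[OF has_integral_powr_left[OF assms(1,2)] this assms(3,4)]
 show "set_integrable lborel {s..t} f" "norm (LINT r:{s..t}|lborel. f r) <= K * (t - s) powr a / a" by auto
qed

lemma set_integral_split:
 fixes f :: "real => 'a::{banach, second_countable_topology}"
 assumes "set_integrable lborel {s..t} f" "s <= m" "m <= t"
 shows "(LINT r:{s..t}|lborel. f r) = (LINT r:{s..m}|lborel. f r) + (LINT r:{m..t}|lborel. f r)"
proof -
 have "{s..t} = {s..m} \<union> {m..t}" using assms by auto
 moreover have "(LINT r:{s..m} \<union> {m..t}|lborel. f r) = (LINT r:{s..m}|lborel. f r) + (LINT r:{m..t}|lborel. f r)"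
 proof (rule set_integral_Un_AE)
  show "AE x in lborel. \<not> (x \<in> {s..m} \<and> x \<in> {m..t})" using AE_lborel_singleton[of m] by eventually_elim auto
  show "set_integrable lborel {s..m} f" "set_integrable lborel {m..t} f"
   using assms by (auto intro!: set_integrable_subset[OF assms(1)])
 qed auto
 ultimately show ?thesis by simp
qed

lemma set_integral_singleton:
 fixes f :: "real => 'a::{banach, second_countable_topology}"
 shows "(LINT r:{t..t}|lborel. f r) = 0"
proof -
 have "(LINT r:{t..t}|lborel. f r) = (LINT r:{t<..<t}|lborel. f r)"
  by (rule set_integral_Icc_Ioo(2)) (simp add: set_integrable_def)
 then show ?thesis by (simp add: set_lebesgue_integral_def)
qed

lemma set_integral_cong_Ioo:
 fixes f g :: "real => 'a::{banach, second_countable_topology}"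
 assumes "set_integrable lborel {s..t} f" "set_integrable lborel {s..t} g"
  "\<And>r. s < r ==> r < t ==> f r = g r"
 shows "(LINT r:{s..t}|lborel. f r) = (LINT r:{s..t}|lborel. g r)"
proof -
 have "set_integrable lborel {s<..<t} f" "set_integrable lborel {s<..<t} g"
  using assms by (auto intro!: set_integrable_subset[of lborel "{s..t}"])
 moreover have "(LINT r:{s<..<t}|lborel. f r) = (LINT r:{s<..<t}|lborel. g r)"
  using assms(3) by (intro set_lebesgue_integral_cong) auto
 ultimately show ?thesis by (simp add: set_integral_Icc_Ioo(2))
qed

section \<open>Convolution of an analytic semigroup with a path\<close>

context analytic_semigroup
begin

lemma A_0: "A 0 = 0"
proof -
 have "Ainv 0 = 0" using Ainv(1) by (simp add: linear_simps)
 then show ?thesis using Ainv(2)[of 0] by simp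
qed

lemma AS_simps:
 assumes "0 < t"
 shows "A (S t (x + y)) = A (S t x) + A (S t y)" "A (S t (x - y)) = A (S t x) - A (S t y)"
  "A (S t (c *\<^sub>R x)) = c *\<^sub>R A (S t x)" "A (S t 0) = 0" by (rule linear_simps[OF bounded_linear_AS[OF assms]])+

lemma AS_zero: "A (S t 0) = 0" by (simp add: A_0 blinfun.zero_right)

lemma AS_swap: "0 < s ==> 0 <= t ==> A (S s (S t x)) = A (S (s + t) x)" using S_add[of s t x] by simp

text \<open>Locally \<open>A (S (r x))\<close> is \<open>S (r x - h)\<close> after the bounded
  operator \<open>A (S h)\<close>, with \<open>h\<close> half of \<open>r a\<close>, so joint
  continuity of \<open>S\<close> applies.\<close>

lemma continuous_AS_compose:
 fixes f :: "real => 'w" and r :: "real => real"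
 assumes r: "continuous_on X r" "\<And>x. x \<in> X ==> 0 < r x" and f: "continuous_on X f"
 shows "continuous_on X (\<lambda>x. A (S (r x) (f x)))" unfolding continuous_on_def
proof
 fix a assume a: "a \<in> X"
 define h where "h = r a / 2"
 have h: "0 < h" "h < r a" using r(2)[OF a] by (auto simp: h_def)
 define Y where "Y = {x \<in> X. h < r x}"
 have "continuous_on Y (\<lambda>x. S (r x - h) (A (S h (f x))))"
  using continuous_on_subset[OF r(1)] continuous_on_subset[OF f]
  by (intro continuous_S_compose continuous_intros bounded_linear.continuous_on[OF bounded_linear_AS[OF h(1)]])
   (auto simp: Y_def)
 moreover have "S (r x - h) (A (S h (f x))) = A (S (r x) (f x))" if "x \<in> Y" for x
  using AS_add[of "r x - h" h "f x"] that h by (simp add: Y_def)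
 ultimately have "continuous_on Y (\<lambda>x. A (S (r x) (f x)))" by (rule continuous_on_eq)
 moreover have "a \<in> Y" using a h by (simp add: Y_def)
 ultimately have lim: "((\<lambda>x. A (S (r x) (f x))) \<longlongrightarrow> A (S (r a) (f a))) (at a within Y)"
  by (auto simp: continuous_on_def)
 have "(r \<longlongrightarrow> r a) (at a within X)" using r(1) a by (auto simp: continuous_on_def)
 then have "\<forall>\<^sub>F x in at a within X. h < r x" using h(2) by (rule order_tendstoD(1))
 then have "at a within X = at a within Y" unfolding filter_eq_iff eventually_at_filter Y_def
  by (auto elim: eventually_elim2)
 then show "((\<lambda>x. A (S (r x) (f x))) \<longlongrightarrow> A (S (r a) (f a))) (at a within X)" using lim by simp
qed

lemma smooth_norm_le: "smooth \<theta> N x ==> N <= N' ==> smooth \<theta> N' x"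
 unfolding smooth_def by (meson mult_right_mono order_trans powr_ge_zero)

lemma smooth_add: "smooth \<theta> N x ==> smooth \<theta> N' y ==> smooth \<theta> (N + N') (x + y)"
 unfolding smooth_def by (auto simp: AS_simps distrib_right intro: norm_triangle_mono)

text \<open>Interpolation between the two times: \<open>1 / (u + \<tau>)\<close> is at most
  \<open>u powr (\<theta> - 1) * \<tau> powr - \<theta>\<close>.\<close>

lemma smooth_orbit:
 assumes "0 < \<tau>" "0 <= \<theta>" "\<theta> <= 1"
 shows "smooth \<theta> (M * norm x * \<tau> powr - \<theta>) (S \<tau> x)" unfolding smooth_def
proof (intro allI impI)
 fix u :: real assume u: "0 < u"
 have "norm (A (S u (S \<tau> x))) <= M / (u + \<tau>) * norm x" using norm_AS[of "u + \<tau>" x] AS_swap[of u \<tau> x] u assms by simp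
 also have "1 / (u + \<tau>) <= u powr (\<theta> - 1) * \<tau> powr - \<theta>"
 proof -
  have "1 / (u + \<tau>) = (u + \<tau>) powr (\<theta> - 1) * (u + \<tau>) powr - \<theta>"
   unfolding powr_add[symmetric] using u assms by (simp add: powr_minus_divide)
  also have "\<dots> <= u powr (\<theta> - 1) * \<tau> powr - \<theta>" using u assms by (intro mult_mono powr_mono2') auto
  finally show ?thesis .
 qed
 then have "M / (u + \<tau>) * norm x <= M * (u powr (\<theta> - 1) * \<tau> powr - \<theta>) * norm x"
  using M_ge_1 mult_left_mono[of "1 / (u + \<tau>)" "u powr (\<theta> - 1) * \<tau> powr - \<theta>" M] by (intro mult_right_mono) auto
 finally show "norm (A (S u (S \<tau> x))) <= M * norm x * \<tau> powr - \<theta> * u powr (\<theta> - 1)" by (simp add: mult_ac)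
qed

text \<open>\<open>A (S t x)\<close> is integrated over \<open>[0, h]\<close>; the bound
  \<open>t powr (\<theta> - 1)\<close> is integrable because \<open>\<theta> > 0\<close>.\<close>

lemma smooth_S_diff:
 assumes x: "smooth \<theta> N x" and h: "0 <= h" and \<theta>: "0 < \<theta>"
 shows "norm (S h x - x) <= N / \<theta> * h powr \<theta>"
proof (cases "h = 0")
 case True
 then show ?thesis by (simp add: S_0)
next
 case False
 then have h: "0 < h" using h by simp
 have "norm (S h x - S 0 x) <= N / \<theta> * h powr \<theta> - N / \<theta> * 0 powr \<theta>"
 proof (rule differentiable_bound_general[OF h])
  show "continuous_on {0..h} (\<lambda>t. S t x)" by (rule continuous_on_subset[OF continuous_S]) auto
  show "continuous_on {0..h} (\<lambda>t. N / \<theta> * t powr \<theta>)" using \<theta> by (intro continuous_intros continuous_on_powr') auto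
  fix t assume t: "0 < t" "t < h"
  show "((\<lambda>t. S t x) has_vector_derivative A (S t x)) (at t)" by (rule S_derivative[OF t(1)])
  show "((\<lambda>t. N / \<theta> * t powr \<theta>) has_vector_derivative N * t powr (\<theta> - 1)) (at t)"
   unfolding has_real_derivative_iff_has_vector_derivative[symmetric]
   using t \<theta> by (auto intro!: derivative_eq_intros simp: powr_diff)
  show "norm (A (S t x)) <= N * t powr (\<theta> - 1)" using x t by (simp add: smooth_def)
 qed
 then show ?thesis by (simp add: S_0)
qed

lemma AS_orbit_integral:
 assumes "s <= m" "m < t"
 shows "(LINT r:{s..m}|lborel. A (S (t - r) x)) = S (t - s) x - S (t - m) x"
proof -
 have "(LINT r:{s..m}|lborel. A (S (t - r) x)) = - S (t - m) x - - S (t - s) x"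
 proof (rule set_integral_FTC[OF assms(1)])
  show "((\<lambda>r. - S (t - r) x) has_vector_derivative A (S (t - r) x)) (at r within {s..m})"
   if "s <= r" "r <= m" for r
  proof -
   have "((\<lambda>r. t - r) has_vector_derivative - 1) (at r)"
    by (auto intro!: derivative_eq_intros simp: has_real_derivative_iff_has_vector_derivative[symmetric])
   from vector_diff_chain_at[OF this S_derivative[of "t - r" x]] that assms
   have "((\<lambda>r. S (t - r) x) has_vector_derivative - A (S (t - r) x)) (at r)" by (simp add: o_def)
   from has_vector_derivative_minus[OF this] show ?thesis by (auto intro: has_vector_derivative_at_within)
  qed
  show "continuous_on {s..m} (\<lambda>r. A (S (t - r) x))"
   using assms by (intro continuous_AS_compose continuous_intros) auto
 qed
 then show ?thesis by simp
qed

text \<open>For smooth \<open>p\<close> this is \<open>\<integral>\<^sub>s\<^sup>t S (t - r) dp\<^sub>r\<close>, integrated by parts.\<close>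

definition convolution :: "real => real => (real => 'w) => 'w"
 where "convolution t s p = S (t - s) (p t - p s) - (LINT r:{s..t}|lborel. A (S (t - r) (p t - p r)))"

lemma convolution_refl [simp]: "convolution t t p = 0"
 unfolding convolution_def set_integral_singleton by (simp add: blinfun.zero_right)

lemma convolution_integrand:
 assumes "s <= t" "0 < a" and p: "continuous_on {s..t} p"
  and H: "\<And>r. s < r ==> r < t ==> norm (p t - p r) <= H * (t - r) powr a"
 shows "set_integrable lborel {s..t} (\<lambda>r. A (S (t - r) (p t - p r)))"
  "norm (LINT r:{s..t}|lborel. A (S (t - r) (p t - p r))) <= M * H * (t - s) powr a / a"
proof -
 have c: "continuous_on {s<..<t} (\<lambda>r. A (S (t - r) (p t - p r)))"
  by (intro continuous_AS_compose continuous_intros continuous_on_subset[OF p]) auto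
 have b: "norm (A (S (t - r) (p t - p r))) <= M * H * (t - r) powr (a - 1)" if r: "s < r" "r < t" for r
 proof -
  have "norm (A (S (t - r) (p t - p r))) <= M / (t - r) * norm (p t - p r)" using r by (intro norm_AS) auto
  also have "\<dots> <= M / (t - r) * (H * (t - r) powr a)" using r M_ge_1 by (intro mult_left_mono H) auto
  also have "\<dots> = M * H * (t - r) powr (a - 1)" using r by (simp add: powr_diff)
  finally show ?thesis .
 qed
 show "set_integrable lborel {s..t} (\<lambda>r. A (S (t - r) (p t - p r)))"
  "norm (LINT r:{s..t}|lborel. A (S (t - r) (p t - p r))) <= M * H * (t - s) powr a / a"
  using set_integral_powr_right[OF assms(1,2) c b] by auto
qed

lemma norm_convolution:
 assumes "s <= t" "0 < a" and p: "continuous_on {s..t} p"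
  and H: "\<And>r. s <= r ==> r <= t ==> norm (p t - p r) <= H * (t - r) powr a"
 shows "norm (convolution t s p) <= M * (1 + 1 / a) * H * (t - s) powr a"
proof -
 have "norm (S (t - s) (p t - p s)) <= M * (H * (t - s) powr a)"
  using norm_S[of "t - s" "p t - p s"] H[of s] assms(1) M_ge_1
  by (meson diff_ge_0_iff_ge mult_left_mono order_refl order_trans zero_le_one)
 moreover have "norm (LINT r:{s..t}|lborel. A (S (t - r) (p t - p r))) <= M * H * (t - s) powr a / a"
  by (rule convolution_integrand[OF assms(1,2) p]) (simp add: H)
 ultimately have "norm (convolution t s p) <= M * (H * (t - s) powr a) + M * H * (t - s) powr a / a"
  unfolding convolution_def by (meson add_mono norm_triangle_ineq4 order_trans)
 then show ?thesis by (simp add: algebra_simps)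
qed

lemma convolution_cong:
 assumes "\<And>r. s <= r ==> r <= t ==> p t - p r = q t - q r" "s <= t"
 shows "convolution t s p = convolution t s q"
proof -
 have "(LINT r:{s..t}|lborel. A (S (t - r) (p t - p r))) = (LINT r:{s..t}|lborel. A (S (t - r) (q t - q r)))"
  by (intro set_lebesgue_integral_cong) (auto simp: assms(1))
 then show ?thesis by (simp add: convolution_def assms(1)[OF order_refl assms(2)])
qed

text \<open>Over \<open>[s, m]\<close> the increment \<open>p t - p r\<close> is split at
  \<open>p m\<close>. The constant part integrates in closed form, and its boundary terms repair the
  failure of \<open>S (t - s) (p t - p s)\<close> to be additive.\<close>

lemma convolution_additive:
 assumes st: "s <= m" "m <= t" and a: "0 < a" and p: "continuous_on {s..t} p"
  and H: "\<And>r r'. s <= r ==> r <= r' ==> r' <= t ==> norm (p r' - p r) <= H * (r' - r) powr a"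
 shows "convolution t s p = convolution t m p + S (t - m) (convolution m s p)"
proof (cases "m = t")
 case True
 then show ?thesis by (simp add: S_0)
next
 case False
 then have mt: "m < t" using st by simp
 have i1: "set_integrable lborel {s..t} (\<lambda>r. A (S (t - r) (p t - p r)))"
  by (rule convolution_integrand[OF _ a p, of H]) (use st in \<open>auto intro!: H\<close>)
 have i2: "set_integrable lborel {s..m} (\<lambda>r. A (S (m - r) (p m - p r)))"
  by (rule convolution_integrand[OF _ a continuous_on_subset[OF p], of _ _ H]) (use st in \<open>auto intro!: H\<close>)
 have i3: "set_integrable lborel {s..m} (\<lambda>r. A (S (t - r) (p t - p m)))"
  using mt by (intro borel_integrable_atLeastAtMost' continuous_AS_compose continuous_intros) auto
 note i4 = set_integral_bounded_linear[OF blinfun.bounded_linear_right i2, of "S (t - m)"]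
 have i5: "set_integrable lborel {s..m} (\<lambda>r. A (S (t - r) (p t - p r)))"
  using st by (intro set_integrable_subset[OF i1]) auto
 have "(LINT r:{s..m}|lborel. A (S (t - r) (p t - p r)))
   = (LINT r:{s..m}|lborel. A (S (t - r) (p t - p m)) + S (t - m) (A (S (m - r) (p m - p r))))"
 proof (rule set_integral_cong_Ioo[OF i5 set_integral_add(1)[OF i3 i4(1)]])
  fix r assume r: "s < r" "r < m"
  have "A (S (t - r) (p t - p r)) = A (S (t - r) (p t - p m)) + A (S (t - r) (p m - p r))"
   using AS_simps(1)[of "t - r" "p t - p m" "p m - p r"] r mt by simp
  then show "A (S (t - r) (p t - p r)) = A (S (t - r) (p t - p m)) + S (t - m) (A (S (m - r) (p m - p r)))"
   using AS_add[of "t - m" "m - r" "p m - p r"] r mt by simp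
 qed
 also have "\<dots> = (S (t - s) (p t - p m) - S (t - m) (p t - p m))
   + S (t - m) (LINT r:{s..m}|lborel. A (S (m - r) (p m - p r)))"
  unfolding set_integral_add(2)[OF i3 i4(1)] AS_orbit_integral[OF st(1) mt] i4(2) ..
 finally have eq: "(LINT r:{s..m}|lborel. A (S (t - r) (p t - p r))) = (S (t - s) (p t - p m) - S (t - m) (p t - p m))
   + S (t - m) (LINT r:{s..m}|lborel. A (S (m - r) (p m - p r)))" .
 have "S (t - s) (p m - p s) = S (t - m) (S (m - s) (p m - p s))"
  using S_add[of "t - m" "m - s" "p m - p s"] st by simp
 then show ?thesis unfolding convolution_def set_integral_split[OF i1 st] eq
  by (simp add: blinfun.bilinear_simps algebra_simps)
qed

lemma convolution_add:
 assumes "s <= t" "0 < a" "continuous_on {s..t} p" "continuous_on {s..t} q"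
  and "\<And>r. s <= r ==> r <= t ==> norm (p t - p r) <= H * (t - r) powr a"
  and "\<And>r. s <= r ==> r <= t ==> norm (q t - q r) <= H' * (t - r) powr a"
 shows "convolution t s (\<lambda>r. p r + q r) = convolution t s p + convolution t s q"
proof -
 have i: "set_integrable lborel {s..t} (\<lambda>r. A (S (t - r) (p t - p r)))"
  "set_integrable lborel {s..t} (\<lambda>r. A (S (t - r) (q t - q r)))"
  by (rule convolution_integrand(1)[OF assms(1,2,3), of H], simp add: assms(5))
   (rule convolution_integrand(1)[OF assms(1,2,4), of H'], simp add: assms(6))
 have "A (S (t - r) (p t + q t - (p r + q r))) = A (S (t - r) (p t - p r)) + A (S (t - r) (q t - q r))"
  if "s <= r" "r <= t" for r
 proof (cases "r = t")
  case False
  then show ?thesis using AS_simps(1)[of "t - r" "p t - p r" "q t - q r"] that by (simp add: algebra_simps)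
 qed (simp add: AS_zero A_0)
 then have "(LINT r:{s..t}|lborel. A (S (t - r) (p t + q t - (p r + q r))))
   = (LINT r:{s..t}|lborel. A (S (t - r) (p t - p r)) + A (S (t - r) (q t - q r)))"
  by (intro set_lebesgue_integral_cong) auto
 also have "\<dots> = (LINT r:{s..t}|lborel. A (S (t - r) (p t - p r))) + (LINT r:{s..t}|lborel. A (S (t - r) (q t - q r)))"
  by (rule set_integral_add(2)[OF i])
 finally show ?thesis by (simp add: convolution_def blinfun.bilinear_simps algebra_simps)
qed

lemma convolution_scale:
 assumes "s <= t"
 shows "convolution t s (\<lambda>r. c *\<^sub>R p r) = c *\<^sub>R convolution t s p"
proof -
 have "A (S (t - r) (c *\<^sub>R p t - c *\<^sub>R p r)) = c *\<^sub>R A (S (t - r) (p t - p r))" if "s <= r" "r <= t" for r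
 proof (cases "r = t")
  case False
  then show ?thesis using AS_simps(3)[of "t - r" c "p t - p r"] that by (simp add: scaleR_diff_right)
 qed (simp add: AS_zero A_0)
 then have "(LINT r:{s..t}|lborel. A (S (t - r) (c *\<^sub>R p t - c *\<^sub>R p r)))
   = (LINT r:{s..t}|lborel. c *\<^sub>R A (S (t - r) (p t - p r)))" by (intro set_lebesgue_integral_cong) auto
 then show ?thesis by (simp add: convolution_def blinfun.bilinear_simps scaleR_diff_right)
qed

text \<open>For increments of smoothness \<open>b\<close>, both \<open>S (t - s) - S 0\<close> and
  the integral gain the exponent \<open>b\<close>, so the convolution is the plain increment up to
  order \<open>a + b\<close>. In the second claim the delay \<open>\<rho>\<close> is at least the
  length of the interval, which lets \<open>(t - s) powr b / \<rho>\<close> be replaced by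
  \<open>\<rho> powr (b - 1)\<close>.\<close>

lemma convolution_smooth:
 assumes st: "s <= t" and a: "0 < a" and b: "0 < b" "b < 1" and N: "0 <= N" and p: "continuous_on {s..t} p"
  and sm: "\<And>r. s <= r ==> r <= t ==> smooth b (N * (t - r) powr a) (p t - p r)"
 shows "norm (convolution t s p - (p t - p s)) <= (1 / b + 1 / (a + b)) * N * (t - s) powr (a + b)"
  and "t - s <= \<rho> ==> 0 < \<rho> ==>
   norm (A (S \<rho> (convolution t s p))) <= M * (1 + 1 / (a + b)) * N * (t - s) powr a * \<rho> powr (b - 1)"
proof -
 have c: "continuous_on {s<..<t} (\<lambda>r. A (S (t - r) (p t - p r)))"
  by (intro continuous_AS_compose continuous_intros continuous_on_subset[OF p]) auto
 have bd: "norm (A (S (t - r) (p t - p r))) <= N * (t - r) powr (a + b - 1)" if r: "s < r" "r < t" for r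
 proof -
  have "norm (A (S (t - r) (p t - p r))) <= N * (t - r) powr a * (t - r) powr (b - 1)"
   using sm[of r] r by (simp add: smooth_def)
  then show ?thesis by (simp add: mult.assoc powr_add[symmetric] add_diff_eq)
 qed
 have ab: "0 < a + b" using a b by simp
 note i = set_integral_powr_right[OF st ab c bd]
 have "norm (S (t - s) (p t - p s) - (p t - p s)) <= N * (t - s) powr a / b * (t - s) powr b"
  using smooth_S_diff[OF sm[of s]] st b by simp
 then have "norm (S (t - s) (p t - p s) - (p t - p s)) <= N / b * (t - s) powr (a + b)" by (simp add: powr_add)
 then have "norm ((S (t - s) (p t - p s) - (p t - p s)) - (LINT r:{s..t}|lborel. A (S (t - r) (p t - p r))))
   <= N / b * (t - s) powr (a + b) + N * (t - s) powr (a + b) / (a + b)"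
  using i(2) by (meson add_mono norm_triangle_ineq4 order_trans)
 then show "norm (convolution t s p - (p t - p s)) <= (1 / b + 1 / (a + b)) * N * (t - s) powr (a + b)"
  by (simp add: convolution_def algebra_simps)
 assume \<rho>: "t - s <= \<rho>" "0 < \<rho>"
 note j = set_integral_bounded_linear[OF bounded_linear_AS[OF \<rho>(2)] i(1)]
 have "norm (A (S (\<rho> + (t - s)) (p t - p s))) <= N * (t - s) powr a * (\<rho> + (t - s)) powr (b - 1)"
  using sm[of s] st \<rho> by (simp add: smooth_def)
 also have "\<dots> <= N * (t - s) powr a * \<rho> powr (b - 1)" using st \<rho> b N by (intro mult_left_mono powr_mono2') auto
 finally have 1: "norm (A (S \<rho> (S (t - s) (p t - p s)))) <= N * (t - s) powr a * \<rho> powr (b - 1)"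
  using AS_swap[of \<rho> "t - s"] st \<rho> by simp
 have "norm (A (S \<rho> (LINT r:{s..t}|lborel. A (S (t - r) (p t - p r)))))
   <= M / \<rho> * norm (LINT r:{s..t}|lborel. A (S (t - r) (p t - p r)))" by (rule norm_AS[OF \<rho>(2)])
 also have "\<dots> <= M / \<rho> * (N * (t - s) powr (a + b) / (a + b))" using M_ge_1 \<rho> by (intro mult_left_mono i(2)) auto
 also have "\<dots> = M / (a + b) * N * (t - s) powr a * ((t - s) powr b / \<rho>)" by (simp add: powr_add mult_ac)
 also have "\<dots> <= M / (a + b) * N * (t - s) powr a * (\<rho> powr b / \<rho>)"
  using M_ge_1 ab N st \<rho> b by (intro mult_left_mono divide_right_mono powr_mono2) auto
 also have "\<rho> powr b / \<rho> = \<rho> powr (b - 1)" using \<rho> by (simp add: powr_diff)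
 finally have 2: "norm (A (S \<rho> (LINT r:{s..t}|lborel. A (S (t - r) (p t - p r)))))
   <= M / (a + b) * N * (t - s) powr a * \<rho> powr (b - 1)" .
 have "norm (A (S \<rho> (convolution t s p))) <= N * (t - s) powr a * \<rho> powr (b - 1)
   + M / (a + b) * N * (t - s) powr a * \<rho> powr (b - 1)"
  unfolding convolution_def AS_simps(2)[OF \<rho>(2)] using 1 2 by (meson add_mono norm_triangle_ineq4 order_trans)
 also have "\<dots> <= M * (N * (t - s) powr a * \<rho> powr (b - 1)) + M / (a + b) * N * (t - s) powr a * \<rho> powr (b - 1)"
  using mult_right_mono[OF M_ge_1, of "N * (t - s) powr a * \<rho> powr (b - 1)"] N by simp
 finally show "norm (A (S \<rho> (convolution t s p))) <= M * (1 + 1 / (a + b)) * N * (t - s) powr a * \<rho> powr (b - 1)"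
  by (simp add: algebra_simps)
qed

text \<open>Telescoping along the points \<open>t - (t - s) / 2\<^sup>n\<close>: the semigroup has time \<open>v - u\<close> to smooth
 the increment over \<open>[u, v]\<close>.\<close>

lemma smooth_path:
 assumes st: "s <= t" and a: "0 < a" and \<kappa>: "0 < \<kappa>" and N: "0 <= N" and I0: "I s = 0"
  and H: "\<And>u v. s <= u ==> u <= v ==> v <= t ==> norm (I v - S (v - u) (I u)) <= H * (v - u) powr a"
  and sm: "\<And>u v h. s <= u ==> u < v ==> v < t ==> t - v = v - u ==> 0 < h ==>
   norm (A (S (h + (v - u)) (I v - S (v - u) (I u)))) <= N * (v - u) powr \<kappa> * h powr (\<theta> - 1)"
 shows "smooth \<theta> (N / (2 powr \<kappa> - 1) * (t - s) powr \<kappa>) (I t)" unfolding smooth_def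
proof (intro allI impI)
 fix h :: real assume h: "0 < h"
 define \<sigma> where "\<sigma> n = t - (t - s) / 2 ^ n" for n :: nat
 define q where "q = (2::real) powr - \<kappa>"
 have q: "0 < q" "q < 1" using \<kappa> powr_less_mono[of "-\<kappa>" 0 2] by (auto simp: q_def)
 have qk: "1 / (2 powr \<kappa> - 1) = q / (1 - q)" using q by (simp add: q_def powr_minus field_simps)
 define N' where "N' = N * (t - s) powr \<kappa> * h powr (\<theta> - 1)"
 have \<sigma>: "s <= \<sigma> n" "\<sigma> n <= \<sigma> (Suc n)" "\<sigma> n <= t" "t - \<sigma> n = (t - s) / 2 ^ n"
  "t - \<sigma> (Suc n) = \<sigma> (Suc n) - \<sigma> n" for n
 proof -
  have "(t - s) / 2 ^ n <= (t - s) / 1" using st by (intro divide_left_mono) auto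
  then show "s <= \<sigma> n" by (simp add: \<sigma>_def)
  show "\<sigma> n <= \<sigma> (Suc n)" using st by (simp add: \<sigma>_def field_simps)
 qed (use st in \<open>auto simp: \<sigma>_def field_simps\<close>)
 \<comment> \<open>The interval from \<open>\<sigma> n\<close> to \<open>\<sigma> (Suc n)\<close> is
   as long as the remaining distance to \<open>t\<close>. It contributes
   \<open>N' * q ^ Suc n\<close>, and the claimed bound is the partial sum of this geometric series;
   its total is \<open>N' / (2 powr \<kappa> - 1)\<close>.\<close>
 have f: "norm (A (S h (S (t - \<sigma> n) (I (\<sigma> n))))) <= N' * (q * (1 - q ^ n) / (1 - q))" for n
 proof (induction n)
  case 0
  have "\<sigma> 0 = s" by (simp add: \<sigma>_def)
  then show ?case by (simp add: I0 blinfun.zero_right A_0)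
 next
  case (Suc n)
  let ?u = "\<sigma> n" and ?v = "\<sigma> (Suc n)"
  define X where "X = I ?v - S (?v - ?u) (I ?u)"
  have "S (t - ?v) (S (?v - ?u) (I ?u)) = S ((t - ?v) + (?v - ?u)) (I ?u)"
   using \<sigma>(2)[of n] \<sigma>(3)[of "Suc n"] by (intro S_add[symmetric]) auto
  also have "(t - ?v) + (?v - ?u) = t - ?u" by simp
  finally have eq: "S (t - ?v) (I ?v) = S (t - ?v) X + S (t - ?u) (I ?u)" by (simp add: X_def blinfun.diff_right)
  have "norm (A (S h (S (t - ?v) X))) <= N' * q ^ Suc n"
  proof (cases "s = t")
   case True
   then have "?v = s" "?u = s" by (auto simp: \<sigma>_def)
   then show ?thesis using I0 q True N by (simp add: X_def blinfun.zero_right A_0 N'_def)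
  next
   case False
   then have pos: "0 < (t - s) / 2 ^ Suc n" using st by simp
   have "norm (A (S (h + (?v - ?u)) X)) <= N * (?v - ?u) powr \<kappa> * h powr (\<theta> - 1)"
    unfolding X_def using \<sigma>[of n] \<sigma>[of "Suc n"] pos h by (intro sm) auto
   moreover have "(?v - ?u) powr \<kappa> = (t - s) powr \<kappa> * q ^ Suc n"
   proof -
    have d: "?v - ?u = (t - s) / 2 ^ Suc n" using \<sigma>(4,5) by metis
    have e: "(2 ^ Suc n :: real) powr \<kappa> = (2 powr \<kappa>) ^ Suc n"
     by (simp add: powr_powr powr_realpow[symmetric] mult.commute del: power_Suc)
    have "(?v - ?u) powr \<kappa> = (t - s) powr \<kappa> / (2 powr \<kappa>) ^ Suc n" unfolding d powr_divide e ..
    moreover have "q ^ Suc n = 1 / (2 powr \<kappa>) ^ Suc n"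
     by (simp add: q_def powr_minus_divide power_divide del: power_Suc)
    ultimately show ?thesis by simp
   qed
   moreover have "A (S h (S (t - ?v) X)) = A (S (h + (?v - ?u)) X)"
    unfolding \<sigma>(5)[of n] using AS_swap[of h "?v - ?u" X] h \<sigma>(2)[of n] by simp
   ultimately show ?thesis by (simp add: N'_def mult_ac)
  qed
  then have "norm (A (S h (S (t - ?v) (I ?v)))) <= N' * q ^ Suc n + N' * (q * (1 - q ^ n) / (1 - q))"
   unfolding eq AS_simps(1)[OF h] using Suc.IH by (intro norm_triangle_mono)
  also have "\<dots> = N' * (q ^ Suc n + q * (1 - q ^ n) / (1 - q))" by (simp only: distrib_left)
  also have "q ^ Suc n + q * (1 - q ^ n) / (1 - q) = q * (1 - q ^ Suc n) / (1 - q)"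
   using q by (simp add: field_simps)
  finally show ?case .
 qed
 have "0 <= N'" using N by (simp add: N'_def)
 then have fb: "norm (A (S h (S (t - \<sigma> n) (I (\<sigma> n))))) <= N' * (q / (1 - q))" for n
  using f[of n] q by (intro order_trans[OF f mult_left_mono]) (auto simp: field_simps)
 have "(\<lambda>n. S (t - \<sigma> n) (I (\<sigma> n))) \<longlonglongrightarrow> I t"
 proof (rule Lim_transform2[OF tendsto_const])
  show "(\<lambda>n. I t - S (t - \<sigma> n) (I (\<sigma> n))) \<longlonglongrightarrow> 0"
  proof (rule Lim_null_comparison)
   show "\<forall>\<^sub>F n in sequentially. norm (I t - S (t - \<sigma> n) (I (\<sigma> n))) <= H * ((t - s) / 2 ^ n) powr a"
    using H[OF \<sigma>(1) \<sigma>(3) order_refl] \<sigma>(4) by (intro always_eventually allI) metis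
   have "(\<lambda>n. (t - s) * (1 / 2) ^ n) \<longlonglongrightarrow> (t - s) * 0" by (intro tendsto_intros LIMSEQ_power_zero) simp
   then have "(\<lambda>n. (t - s) / 2 ^ n) \<longlonglongrightarrow> 0" by (simp add: power_divide)
   then have "(\<lambda>n. ((t - s) / 2 ^ n) powr a) \<longlonglongrightarrow> 0 powr a"
    using st a by (intro tendsto_powr') (auto intro!: tendsto_const)
   then show "(\<lambda>n. H * ((t - s) / 2 ^ n) powr a) \<longlonglongrightarrow> 0" using a by (intro tendsto_mult_right_zero) simp
  qed
 qed
 then have "(\<lambda>n. norm (A (S h (S (t - \<sigma> n) (I (\<sigma> n)))))) \<longlonglongrightarrow> norm (A (S h (I t)))"
  by (intro tendsto_norm bounded_linear.tendsto[OF bounded_linear_AS[OF h]])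
 then have "norm (A (S h (I t))) <= N' * (q / (1 - q))" by (rule LIMSEQ_le_const2) (use fb in blast)
 also have "\<dots> = N / (2 powr \<kappa> - 1) * (t - s) powr \<kappa> * h powr (\<theta> - 1)" unfolding qk[symmetric] N'_def by simp
 finally show "norm (A (S h (I t))) <= N / (2 powr \<kappa> - 1) * (t - s) powr \<kappa> * h powr (\<theta> - 1)" .
qed

text \<open>An increment over \<open>[u, v]\<close>, smoothed for a time \<open>v - u\<close>, has
  smoothness \<open>b\<close> with a constant of order \<open>(v - u) powr (a - b)\<close>; the
  telescoping sum converges because \<open>b < a\<close>.\<close>

lemma smooth_hoelder_path:
 assumes st: "s <= t" and b: "0 <= b" "b < a" "b <= 1" and H0: "0 <= H" and I0: "I s = 0"
  and H: "\<And>u v. s <= u ==> u <= v ==> v <= t ==> norm (I v - S (v - u) (I u)) <= H * (v - u) powr a"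
 shows "smooth b (M * H / (2 powr (a - b) - 1) * (t - s) powr (a - b)) (I t)"
proof (rule smooth_path[where I = I and H = H and a = a, OF st _ _ _ I0 H])
 fix u v h assume u: "s <= u" "u < v" "v < t" "0 < (h::real)"
 let ?X = "I v - S (v - u) (I u)"
 have "norm (A (S h (S (v - u) ?X))) <= M * norm ?X * (v - u) powr - b * h powr (b - 1)"
  using smooth_orbit[of "v - u" b ?X] u b by (simp add: smooth_def)
 also have "\<dots> <= M * (H * (v - u) powr a) * (v - u) powr - b * h powr (b - 1)"
  using u M_ge_1 by (intro mult_right_mono mult_left_mono H) auto
 also have "\<dots> = M * H * (v - u) powr (a - b) * h powr (b - 1)"
  using u by (simp add: powr_diff powr_minus divide_inverse)
 finally show "norm (A (S (h + (v - u)) ?X)) <= M * H * (v - u) powr (a - b) * h powr (b - 1)"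
  using AS_swap[of h "v - u" ?X] u by simp
qed (use b H0 M_ge_1 in auto)

end

section \<open>Convolution with the noise\<close>

lemma hoelder_continuous_on:
 fixes p :: "real => 'a::real_normed_vector"
 assumes "0 < a" and H: "\<And>r r'. s <= r ==> r <= r' ==> r' <= t ==> norm (p r' - p r) <= H * (r' - r) powr a"
 shows "continuous_on {s..t} p" unfolding continuous_on_def
proof
 fix x assume x: "x \<in> {s..t}"
 have b: "norm (p y - p x) <= \<bar>H\<bar> * \<bar>y - x\<bar> powr a" if "y \<in> {s..t}" for y
 proof -
  have "norm (p y - p x) <= H * \<bar>y - x\<bar> powr a"
   using H[of x y] H[of y x] x that by (cases "x <= y") (auto simp: norm_minus_commute)
  then show ?thesis using mult_right_mono[OF abs_ge_self[of H], of "\<bar>y - x\<bar> powr a"] by simp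
 qed
 show "(p \<longlongrightarrow> p x) (at x within {s..t})"
 proof (rule LIM_zero_cancel, rule Lim_null_comparison)
  show "\<forall>\<^sub>F y in at x within {s..t}. norm (p y - p x) <= \<bar>H\<bar> * \<bar>y - x\<bar> powr a"
   using b by (simp add: eventually_at_filter)
  have "((\<lambda>y. \<bar>H\<bar> * \<bar>y - x\<bar> powr a) \<longlongrightarrow> \<bar>H\<bar> * \<bar>x - x\<bar> powr a) (at x within {s..t})"
   using assms(1) by (intro tendsto_intros tendsto_powr') auto
  then show "((\<lambda>y. \<bar>H\<bar> * \<bar>y - x\<bar> powr a) \<longlongrightarrow> 0) (at x within {s..t})" by simp
 qed
qed

text \<open>\<open>H\<close> bounds both levels of the rough path. The horizon \<open>T0\<close> of
  this locale is at most 1, so that powers of interval lengths are ordered by their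
  exponents.\<close>

locale rough_noise = analytic_semigroup S A Ainv M \<delta>
 for S :: "real => 'w::{banach, second_countable_topology} \<Rightarrow>\<^sub>L 'w" and A Ainv M \<delta> +
 fixes \<omega> :: "real => 'v::real_normed_vector" and \<omega>2 :: "real => real => ('v, 'v) ptensor"
  and \<alpha> \<beta> T0 H :: real
 assumes \<beta>_pos: "0 < \<beta>" and \<beta>_less: "\<beta> < \<alpha>" and \<alpha>_le: "\<alpha> <= 1 / 2" and \<alpha>_2\<beta>: "1 < \<alpha> + 2 * \<beta>"
  and T0: "0 < T0" "T0 <= 1" and H_nonneg: "0 <= H"
  and hoelder: "0 <= s ==> s <= t ==> t <= T0 ==> norm (\<omega> t - \<omega> s) <= H * (t - s) powr \<alpha>"
  and hoelder2: "0 <= s ==> s <= t ==> t <= T0 ==> norm (\<omega>2 t s) <= H * (t - s) powr (2 * \<alpha>)"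
  and chen: "0 <= s ==> s <= u ==> u <= t ==> t <= T0 ==>
   \<omega>2 t s - \<omega>2 u s - \<omega>2 t u = tens (\<omega> u - \<omega> s) (\<omega> t - \<omega> u)"
begin

lemma \<alpha>_pos: "0 < \<alpha>" and \<beta>_less_1: "\<beta> < 1" "2 * \<beta> < 1" using \<beta>_pos \<beta>_less \<alpha>_le by auto

abbreviation W :: "real => real => ('v \<Rightarrow>\<^sub>L 'w) => 'w"
 where "W \<equiv> omega_S A S \<omega>"

lemma noise_path_hoelder:
 fixes K :: "'v \<Rightarrow>\<^sub>L 'w"
 assumes "0 <= r" "r <= r'" "r' <= T0"
 shows "norm (K (\<omega> r') - K (\<omega> r)) <= norm K * H * (r' - r) powr \<alpha>"
proof -
 have "norm (K (\<omega> r' - \<omega> r)) <= norm K * norm (\<omega> r' - \<omega> r)" by (rule norm_blinfun)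
 also have "\<dots> <= norm K * (H * (r' - r) powr \<alpha>)" using assms by (intro mult_left_mono hoelder) auto
 finally show ?thesis by (simp add: blinfun.diff_right mult.assoc)
qed

lemma noise_path_continuous:
 fixes K :: "'v \<Rightarrow>\<^sub>L 'w"
 assumes "0 <= s" "t <= T0"
 shows "continuous_on {s..t} (\<lambda>r. K (\<omega> r))"
 by (rule hoelder_continuous_on[OF \<alpha>_pos, of _ _ _ "norm K * H"]) (use assms in \<open>auto intro!: noise_path_hoelder\<close>)

text \<open>In \<open>omega_S\<close> the operator \<open>A\<close> stands before the integral.
  Since increments of the noise gain \<open>\<alpha>\<close>, the integral with \<open>A\<close>
  inside converges, and \<open>Ainv\<close> carries one form into the other.\<close>

lemma W_convolution:
 assumes "0 <= s" "s <= t" "t <= T0"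
 shows "W t s K = convolution t s (\<lambda>r. K (\<omega> r))"
proof -
 have i: "set_integrable lborel {s..t} (\<lambda>r. A (S (t - r) (K (\<omega> t) - K (\<omega> r))))"
  by (rule convolution_integrand(1)[OF assms(2) \<alpha>_pos noise_path_continuous[OF assms(1,3)], of K "norm K * H"])
   (use assms in \<open>auto intro!: noise_path_hoelder\<close>)
 have "(LINT r:{s..t}|lborel. S (t - r) (K (incr \<omega> t r)))
   = (LINT r:{s..t}|lborel. Ainv (A (S (t - r) (K (\<omega> t) - K (\<omega> r)))))"
 proof (rule set_lebesgue_integral_cong)
  show "\<forall>r. r \<in> {s..t} --> S (t - r) (K (incr \<omega> t r)) = Ainv (A (S (t - r) (K (\<omega> t) - K (\<omega> r))))"
  proof (intro allI impI)
   fix r assume r: "r \<in> {s..t}"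
   show "S (t - r) (K (incr \<omega> t r)) = Ainv (A (S (t - r) (K (\<omega> t) - K (\<omega> r))))"
   proof (cases "r = t")
    case True
    have "Ainv 0 = 0" using Ainv(1) by (simp add: linear_simps)
    then show ?thesis using True by (simp add: incr_def blinfun.zero_right A_0)
   next
    case False
    then show ?thesis using Ainv(3)[of "t - r" "K (\<omega> t) - K (\<omega> r)"] r by (simp add: incr_def blinfun.diff_right)
   qed
  qed
 qed simp
 also have "\<dots> = Ainv (LINT r:{s..t}|lborel. A (S (t - r) (K (\<omega> t) - K (\<omega> r))))"
  by (rule set_integral_bounded_linear(2)[OF Ainv(1) i])
 finally show ?thesis by (simp add: omega_S_def convolution_def Ainv(2)) (simp add: incr_def blinfun.diff_right)
qed

definition cW :: real where "cW = M * (1 + 1 / \<alpha>) * H"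

lemma cW_nonneg: "0 <= cW" using M_ge_1 H_nonneg \<alpha>_pos by (simp add: cW_def)

lemma norm_W:
 assumes "0 <= s" "s <= t" "t <= T0"
 shows "norm (W t s K) <= cW * norm K * (t - s) powr \<alpha>"
proof -
 have "norm (convolution t s (\<lambda>r. K (\<omega> r))) <= M * (1 + 1 / \<alpha>) * (norm K * H) * (t - s) powr \<alpha>"
  by (rule norm_convolution[OF assms(2) \<alpha>_pos noise_path_continuous[OF assms(1,3)]])
   (use assms in \<open>auto intro!: noise_path_hoelder\<close>)
 then show ?thesis by (simp add: W_convolution[OF assms] cW_def mult_ac)
qed

lemma norm_W_1:
 assumes "0 <= s" "s <= t" "t <= T0"
 shows "norm (W t s K) <= cW * norm K"
proof -
 have "(t - s) powr \<alpha> <= 1" using assms T0 \<alpha>_pos by (intro powr_le1) auto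
 then have "cW * norm K * (t - s) powr \<alpha> <= cW * norm K * 1" using cW_nonneg by (intro mult_left_mono) auto
 then show ?thesis using norm_W[OF assms, of K] by simp
qed

lemma W_refl [simp]: "0 <= t ==> t <= T0 ==> W t t K = 0" by (simp add: W_convolution)

lemma W_additive:
 assumes "0 <= s" "s <= m" "m <= t" "t <= T0"
 shows "W t s K = W t m K + S (t - m) (W m s K)"
proof -
 have "convolution t s (\<lambda>r. K (\<omega> r)) = convolution t m (\<lambda>r. K (\<omega> r)) + S (t - m) (convolution m s (\<lambda>r. K (\<omega> r)))"
  by (rule convolution_additive[OF assms(2,3) \<alpha>_pos noise_path_continuous, of _ "norm K * H"])
   (use assms in \<open>auto intro!: noise_path_hoelder\<close>)
 then show ?thesis using assms by (simp add: W_convolution)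
qed

lemma W_bounded_linear:
 assumes st: "0 <= s" "s <= t" "t <= T0"
 shows "bounded_linear (W t s)"
proof (rule bounded_linear_intro[where K = cW])
 fix K L :: "'v \<Rightarrow>\<^sub>L 'w" and c :: real
 have "convolution t s (\<lambda>r. K (\<omega> r) + L (\<omega> r)) = convolution t s (\<lambda>r. K (\<omega> r)) + convolution t s (\<lambda>r. L (\<omega> r))"
  by (rule convolution_add[OF st(2) \<alpha>_pos noise_path_continuous[OF st(1,3)] noise_path_continuous[OF st(1,3)],
     where H = "norm K * H" and H' = "norm L * H"])
   (use st in \<open>auto intro!: noise_path_hoelder\<close>)
 then show "W t s (K + L) = W t s K + W t s L" by (simp add: W_convolution[OF st] blinfun.add_left)
 show "W t s (c *\<^sub>R K) = c *\<^sub>R W t s K"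
  by (simp add: W_convolution[OF st] blinfun.scaleR_left convolution_scale[OF st(2)])
 show "norm (W t s K) <= norm K * cW" using norm_W_1[OF st, of K] by (simp add: mult.commute)
qed

lemma W_simps:
 assumes "0 <= s" "s <= t" "t <= T0"
 shows "W t s (K + L) = W t s K + W t s L" "W t s (K - L) = W t s K - W t s L"
  "W t s (c *\<^sub>R K) = c *\<^sub>R W t s K" "W t s 0 = 0" by (rule linear_simps[OF W_bounded_linear[OF assms]])+

lemma norm_W_apply:
 fixes E :: "'w \<Rightarrow>\<^sub>L 'v \<Rightarrow>\<^sub>L 'w"
 assumes "0 <= s" "s <= t" "t <= T0"
 shows "norm (W t s (E x)) <= cW * norm E * norm x * (t - s) powr \<alpha>"
proof -
 have "norm (W t s (E x)) <= cW * norm (E x) * (t - s) powr \<alpha>" by (rule norm_W[OF assms])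
 also have "\<dots> <= cW * (norm E * norm x) * (t - s) powr \<alpha>"
  using cW_nonneg by (intro mult_right_mono mult_left_mono norm_blinfun) auto
 finally show ?thesis by (simp add: mult_ac)
qed

lemma W_apply_bounded_linear:
 fixes E :: "'w \<Rightarrow>\<^sub>L 'v \<Rightarrow>\<^sub>L 'w"
 assumes "0 <= s" "s <= t" "t <= T0"
 shows "bounded_linear (\<lambda>x. W t s (E x))"
 by (rule bounded_linear_compose[OF W_bounded_linear[OF assms] blinfun.bounded_linear_right])

definition smooth_op :: "real => ('v \<Rightarrow>\<^sub>L 'w) => bool"
 where "smooth_op N K \<longleftrightarrow> (\<forall>v. smooth \<beta> (N * norm v) (K v))"

lemma smooth_opD: "smooth_op N K ==> smooth \<beta> (N * norm v) (K v)" by (simp add: smooth_op_def)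

lemma smooth_op_path:
 assumes "smooth_op N K" "0 <= N" "0 <= r" "r <= t" "t <= T0"
 shows "smooth \<beta> (N * H * (t - r) powr \<alpha>) (K (\<omega> t) - K (\<omega> r))"
proof (rule smooth_norm_le)
 show "smooth \<beta> (N * norm (\<omega> t - \<omega> r)) (K (\<omega> t) - K (\<omega> r))"
  using smooth_opD[OF assms(1), of "\<omega> t - \<omega> r"] by (simp add: blinfun.diff_right)
 show "N * norm (\<omega> t - \<omega> r) <= N * H * (t - r) powr \<alpha>"
  using mult_left_mono[OF hoelder[of r t] assms(2)] assms by (simp add: mult.assoc)
qed

lemma W_near:
 assumes K: "smooth_op N K" "0 <= N" and st: "0 <= s" "s <= t" "t <= T0"
 shows "norm (W t s K - K (\<omega> t - \<omega> s)) <= (1 / \<beta> + 1 / (\<alpha> + \<beta>)) * H * N * (t - s) powr (\<alpha> + \<beta>)"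
proof -
 have "norm (convolution t s (\<lambda>r. K (\<omega> r)) - (K (\<omega> t) - K (\<omega> s))) <= (1 / \<beta> + 1 / (\<alpha> + \<beta>)) * (N * H) * (t - s) powr (\<alpha> + \<beta>)"
  by (rule convolution_smooth(1)[OF st(2) \<alpha>_pos \<beta>_pos \<beta>_less_1(1) _ noise_path_continuous[OF st(1,3)]])
   (use K st H_nonneg in \<open>auto intro!: smooth_op_path\<close>)
 then show ?thesis by (simp add: W_convolution[OF st] blinfun.diff_right mult_ac)
qed

definition cW2 :: real where "cW2 = M * (1 + 1 / (\<alpha> + \<beta>)) * H / (2 powr (\<alpha> - \<beta>) - 1)"

lemma two_powr_gt_1: "0 < (x::real) ==> 1 < (2::real) powr x" using powr_less_mono[of 0 x 2] by simp

lemma cW2_nonneg: "0 <= cW2"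
proof -
 have "1 <= 2 powr (\<alpha> - \<beta>)" using two_powr_gt_1[of "\<alpha> - \<beta>"] \<beta>_less by linarith
 then show ?thesis unfolding cW2_def using M_ge_1 H_nonneg \<alpha>_pos \<beta>_pos
  by (intro divide_nonneg_nonneg mult_nonneg_nonneg add_nonneg_nonneg) auto
qed

text \<open>Smoothness \<open>\<beta>\<close> of the operator becomes \<open>2 * \<beta>\<close> for
  the convolution, at the price of \<open>\<beta>\<close> in the Hoelder exponent: in the
  telescoping of \<open>smooth_path\<close>, part of \<open>(h + (v - u)) powr (\<beta> - 1)\<close>
  is spent on \<open>(v - u) powr - \<beta>\<close>.\<close>

lemma W_smooth:
 assumes K: "smooth_op N K" "0 <= N" and st: "0 <= s" "s <= t" "t <= T0"
 shows "smooth (2 * \<beta>) (cW2 * N * (t - s) powr (\<alpha> - \<beta>)) (W t s K)"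
proof -
 let ?N = "M * (1 + 1 / (\<alpha> + \<beta>)) * (N * H)"
 have "smooth (2 * \<beta>) (?N / (2 powr (\<alpha> - \<beta>) - 1) * (t - s) powr (\<alpha> - \<beta>)) (W t s K)"
 proof (rule smooth_path[where I = "\<lambda>v. W v s K" and a = \<alpha> and H = "cW * norm K", OF st(2) \<alpha>_pos])
  show "0 < \<alpha> - \<beta>" using \<beta>_less by simp
  show "0 <= ?N" using M_ge_1 K H_nonneg \<alpha>_pos \<beta>_pos by simp
  show "W s s K = 0" using st by simp
  have inc: "W v s K - S (v - u) (W u s K) = W v u K" if "s <= u" "u <= v" "v <= t" for u v
   using W_additive[of s u v K] st that by simp
  show "norm (W v s K - S (v - u) (W u s K)) <= cW * norm K * (v - u) powr \<alpha>"
   if "s <= u" "u <= v" "v <= t" for u v unfolding inc[OF that] using that st by (intro norm_W) auto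
  show "norm (A (S (h + (v - u)) (W v s K - S (v - u) (W u s K)))) <= ?N * (v - u) powr (\<alpha> - \<beta>) * h powr (2 * \<beta> - 1)"
   if uv: "s <= u" "u < v" "v < t" and h: "0 < h" for u v h
  proof -
   have "norm (A (S (h + (v - u)) (convolution v u (\<lambda>r. K (\<omega> r)))))
     <= ?N * (v - u) powr \<alpha> * (h + (v - u)) powr (\<beta> - 1)"
    by (rule convolution_smooth(2)[OF _ \<alpha>_pos \<beta>_pos \<beta>_less_1(1) _ noise_path_continuous])
     (use K st uv h H_nonneg in \<open>auto intro!: smooth_op_path\<close>)
   also have "(h + (v - u)) powr (\<beta> - 1) <= (v - u) powr - \<beta> * h powr (2 * \<beta> - 1)"
   proof -
    have "(h + (v - u)) powr (\<beta> - 1) = (h + (v - u)) powr - \<beta> * (h + (v - u)) powr (2 * \<beta> - 1)"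
     unfolding powr_add[symmetric] by simp
    also have "\<dots> <= (v - u) powr - \<beta> * h powr (2 * \<beta> - 1)"
     using uv h \<beta>_pos \<beta>_less_1 by (intro mult_mono powr_mono2') auto
    finally show ?thesis .
   qed
   then have "?N * (v - u) powr \<alpha> * (h + (v - u)) powr (\<beta> - 1)
     <= ?N * (v - u) powr \<alpha> * ((v - u) powr - \<beta> * h powr (2 * \<beta> - 1))"
    using M_ge_1 K H_nonneg \<alpha>_pos \<beta>_pos by (intro mult_left_mono) auto
   also have "\<dots> = ?N * (v - u) powr (\<alpha> - \<beta>) * h powr (2 * \<beta> - 1)"
    using uv by (simp add: powr_diff powr_minus_divide)
   finally show ?thesis using inc[of u v] uv st by (simp add: W_convolution)
  qed
 qed
 then show ?thesis by (simp add: cW2_def mult_ac)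
qed

lemma W_continuous:
 fixes k :: "real => 'v \<Rightarrow>\<^sub>L 'w"
 assumes k: "continuous_on X k" and X: "X \<subseteq> {0..t}" and t: "t <= T0"
 shows "continuous_on X (\<lambda>r. W t r (k r))" unfolding continuous_on_def
proof
 fix a assume a: "a \<in> X"
 have dW: "norm (W t r K - W t a K) <= M * (cW * norm K * \<bar>r - a\<bar> powr \<alpha>)" if r: "r \<in> X" for r K
 proof -
  have *: "norm (W t p K - W t q K) <= M * (cW * norm K * (q - p) powr \<alpha>)" if "0 <= p" "p <= q" "q <= t" for p q
  proof -
   have "W t p K - W t q K = S (t - q) (W q p K)" using W_additive[of p q t K] that t by simp
   then have "norm (W t p K - W t q K) <= M * norm (W q p K)" using norm_S[of "t - q" "W q p K"] that by simp
   also have "\<dots> <= M * (cW * norm K * (q - p) powr \<alpha>)" using M_ge_1 that t by (intro mult_left_mono norm_W) auto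
   finally show ?thesis .
  qed
  have "r \<in> {0..t}" "a \<in> {0..t}" using r a X by blast+
  then show ?thesis using *[of r a] *[of a r] by (cases "r <= a") (auto simp: norm_minus_commute)
 qed
 have ka: "(k \<longlongrightarrow> k a) (at a within X)" using k a by (auto simp: continuous_on_def)
 show "((\<lambda>r. W t r (k r)) \<longlongrightarrow> W t a (k a)) (at a within X)"
 proof (rule LIM_zero_cancel, rule Lim_null_comparison)
  show "\<forall>\<^sub>F r in at a within X. norm (W t r (k r) - W t a (k a))
    <= cW * norm (k r - k a) + M * (cW * norm (k a) * \<bar>r - a\<bar> powr \<alpha>)" unfolding eventually_at_filter
  proof (intro always_eventually allI impI)
   fix r assume r: "r \<in> X"
   then have r': "0 <= r" "r <= t" using X by auto
   have "W t r (k r) - W t a (k a) = W t r (k r - k a) + (W t r (k a) - W t a (k a))"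
    using W_simps(2)[OF r' t] by simp
   then show "norm (W t r (k r) - W t a (k a)) <= cW * norm (k r - k a) + M * (cW * norm (k a) * \<bar>r - a\<bar> powr \<alpha>)"
    using norm_W_1[OF r' t, of "k r - k a"] dW[OF r, of "k a"] by (metis norm_triangle_mono)
  qed
  have "((\<lambda>r. cW * norm (k r - k a) + M * (cW * norm (k a) * \<bar>r - a\<bar> powr \<alpha>)) \<longlongrightarrow>
    cW * norm (k a - k a) + M * (cW * norm (k a) * \<bar>a - a\<bar> powr \<alpha>)) (at a within X)"
   using \<alpha>_pos by (intro tendsto_intros tendsto_powr' ka) auto
  then show "((\<lambda>r. cW * norm (k r - k a) + M * (cW * norm (k a) * \<bar>r - a\<bar> powr \<alpha>)) \<longlongrightarrow> 0) (at a within X)" by simp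
 qed
qed

section \<open>The process a\<close>

text \<open>By additivity of \<open>W\<close>, the integrand \<open>W t r\<close> of
  \<open>proc_a\<close> is \<open>W t s\<close> minus this one. The former integrates in closed form
  along the orbit; the latter is of order \<open>(r - s) powr (\<alpha> - 1)\<close> for any
  \<open>x\<close>, hence integrable at \<open>r = s\<close>.\<close>

abbreviation a_integrand :: "real => real => ('w \<Rightarrow>\<^sub>L 'v \<Rightarrow>\<^sub>L 'w) => 'w => real => 'w"
 where "a_integrand t s E x r \<equiv> S (t - r) (W r s (E (A (S (r - s) x))))"

lemma a_integrand_eq:
 fixes E :: "'w \<Rightarrow>\<^sub>L 'v \<Rightarrow>\<^sub>L 'w"
 assumes "0 <= s" "s <= r" "r <= t" "t <= T0"
 shows "a_integrand t s E x r = W t s (E (A (S (r - s) x))) - W t r (E (A (S (r - s) x)))"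
 using W_additive[OF assms, of "E (A (S (r - s) x))"] by simp

lemma orbit_continuous: "continuous_on {s<..t} (\<lambda>r. A (S (r - s) x))"
 by (intro continuous_on_compose2[OF continuous_AS] continuous_intros) auto

lemma a_integrand_continuous:
 fixes E :: "'w \<Rightarrow>\<^sub>L 'v \<Rightarrow>\<^sub>L 'w"
 assumes "0 <= s" "s <= t" "t <= T0"
 shows "continuous_on {s<..<t} (a_integrand t s E x)"
proof -
 have k: "continuous_on {s<..<t} (\<lambda>r. E (A (S (r - s) x)))"
  by (intro continuous_intros continuous_on_subset[OF orbit_continuous[of s t]]) auto
 have "continuous_on {s<..<t} (\<lambda>r. W t s (E (A (S (r - s) x))) - W t r (E (A (S (r - s) x))))" using assms
  by (intro continuous_on_diff W_continuous k bounded_linear.continuous_on[OF W_bounded_linear]) auto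
 then show ?thesis by (rule continuous_on_eq) (use assms in \<open>auto intro: a_integrand_eq[symmetric]\<close>)
qed

lemma a_integrand_bound:
 fixes E :: "'w \<Rightarrow>\<^sub>L 'v \<Rightarrow>\<^sub>L 'w"
 assumes x: "smooth \<theta> N x" and st: "0 <= s" "s < r" "r <= t" "t <= T0"
 shows "norm (a_integrand t s E x r) <= M * cW * norm E * N * (r - s) powr (\<alpha> + \<theta> - 1)"
proof -
 have "norm (a_integrand t s E x r) <= M * norm (W r s (E (A (S (r - s) x))))" using st by (intro norm_S) auto
 also have "\<dots> <= M * (cW * norm E * norm (A (S (r - s) x)) * (r - s) powr \<alpha>)"
  using M_ge_1 st by (intro mult_left_mono norm_W_apply) auto
 also have "\<dots> <= M * (cW * norm E * (N * (r - s) powr (\<theta> - 1)) * (r - s) powr \<alpha>)"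
  using M_ge_1 cW_nonneg x st by (intro mult_left_mono mult_right_mono) (auto simp: smooth_def)
 also have "\<dots> = M * cW * norm E * N * ((r - s) powr \<alpha> * (r - s) powr (\<theta> - 1))" by simp
 also have "(r - s) powr \<alpha> * (r - s) powr (\<theta> - 1) = (r - s) powr (\<alpha> + \<theta> - 1)"
  by (simp add: powr_add[symmetric] add_diff_eq)
 finally show ?thesis .
qed

text \<open>Lets the bounds for smooth \<open>x\<close> contain, at order 0, those for general
  \<open>x\<close>.\<close>

lemma smooth_0: "smooth 0 (M * norm x) x" unfolding smooth_def using norm_AS by (auto simp: powr_minus_divide)

lemma a_integral:
 fixes E :: "'w \<Rightarrow>\<^sub>L 'v \<Rightarrow>\<^sub>L 'w"
 assumes st: "0 <= s" "s <= t" "t <= T0" and t': "s <= t'" "t' <= t"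
 shows "set_integrable lborel {s..t} (a_integrand t s E x)"
  and "smooth \<theta> N x ==> 0 <= \<theta> ==>
   norm (LINT r:{s..t'}|lborel. a_integrand t s E x r) <= M * cW * norm E * N / (\<alpha> + \<theta>) * (t' - s) powr (\<alpha> + \<theta>)"
proof -
 show i: "set_integrable lborel {s..t} (a_integrand t s E x)"
  by (rule set_integral_powr_left(1)[OF st(2) \<alpha>_pos a_integrand_continuous[OF st],
     where K = "M * cW * norm E * (M * norm x)"])
   (use a_integrand_bound[OF smooth_0 st(1), of _ t E x] st in auto)
 assume x: "smooth \<theta> N x" and \<theta>: "0 <= \<theta>"
 have "norm (LINT r:{s..t'}|lborel. a_integrand t s E x r)
   <= M * cW * norm E * N * (t' - s) powr (\<alpha> + \<theta>) / (\<alpha> + \<theta>)"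
  by (rule set_integral_powr_left(2)[OF t'(1) _ continuous_on_subset[OF a_integrand_continuous[OF st]]])
   (use a_integrand_bound[OF x st(1), of _ t E] st t' \<alpha>_pos \<theta> in auto)
 then show "norm (LINT r:{s..t'}|lborel. a_integrand t s E x r) <= M * cW * norm E * N / (\<alpha> + \<theta>) * (t' - s) powr (\<alpha> + \<theta>)"
  by simp
qed

lemma orbit_integral:
 assumes "s < u" "u <= t"
 shows "(LINT r:{u..t}|lborel. A (S (r - s) x)) = S (t - s) x - S (u - s) x"
  and "set_integrable lborel {u..t} (\<lambda>r. A (S (r - s) x))"
proof -
 have c: "continuous_on {u..t} (\<lambda>r. A (S (r - s) x))"
  using assms by (intro continuous_on_subset[OF orbit_continuous[of s t]]) auto
 then show "set_integrable lborel {u..t} (\<lambda>r. A (S (r - s) x))" by (rule borel_integrable_atLeastAtMost')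
 show "(LINT r:{u..t}|lborel. A (S (r - s) x)) = S (t - s) x - S (u - s) x"
 proof (rule set_integral_FTC[OF assms(2) _ c])
  show "((\<lambda>r. S (r - s) x) has_vector_derivative A (S (r - s) x)) (at r within {u..t})"
   if "u <= r" "r <= t" for r
  proof -
   have "((\<lambda>r. r - s) has_vector_derivative 1) (at r)"
    by (auto intro!: derivative_eq_intros simp: has_real_derivative_iff_has_vector_derivative[symmetric])
   from vector_diff_chain_at[OF this S_derivative[of "r - s" x]] that assms
   show ?thesis by (auto simp: o_def intro: has_vector_derivative_at_within)
  qed
 qed
qed

text \<open>Removes the improper limit. In \<open>W t s\<close>, the orbit contributes
  \<open>S (t - s) x - S \<epsilon> x\<close>; as \<open>\<epsilon>\<close> tends to 0, the second
  term cancels the leading \<open>W t s (E x)\<close> of \<open>proc_a\<close>.\<close>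

lemma proc_a_eq:
 fixes E :: "'w \<Rightarrow>\<^sub>L 'v \<Rightarrow>\<^sub>L 'w"
 assumes st: "0 <= s" "s <= t" "t <= T0"
 shows "proc_a A S \<omega> t s E x = W t s (E (S (t - s) x)) - (LINT r:{s..t}|lborel. a_integrand t s E x r)"
proof -
 let ?I = "LINT r:{s..t}|lborel. a_integrand t s E x r"
 let ?f = "\<lambda>\<epsilon>. LINT r:{s + \<epsilon>..t}|lborel. W t r (E (A (S (r - s) x)))"
 have "(?f \<longlongrightarrow> W t s (E (S (t - s) x)) - W t s (E x) - ?I) (at_right 0)"
 proof (cases "s = t")
  case True
  have "?f \<epsilon> = 0" if "\<epsilon> > 0" for \<epsilon> using that True by (simp add: set_lebesgue_integral_def)
  then have "\<forall>\<^sub>F \<epsilon> in at_right 0. 0 = ?f \<epsilon>" using eventually_at_right_less[of 0] by (auto elim: eventually_mono)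
  moreover have "?I = 0" unfolding True by (rule set_integral_singleton)
  ultimately show ?thesis using True st by (auto simp: S_0 intro: Lim_transform_eventually[OF tendsto_const])
 next
  case False
  then have lt: "s < t" using st by simp
  note i = a_integral(1)[OF st order_refl st(2), of E x]
  note bl = W_apply_bounded_linear[OF st, of E]
  have eq: "?f \<epsilon> = W t s (E (S (t - s) x)) - W t s (E (S \<epsilon> x)) - (?I - (LINT r:{s..s + \<epsilon>}|lborel. a_integrand t s E x r))"
   if \<epsilon>: "0 < \<epsilon>" "\<epsilon> < t - s" for \<epsilon>
  proof -
   note o = orbit_integral[of s "s + \<epsilon>" t x]
   have o2: "set_integrable lborel {s + \<epsilon>..t} (\<lambda>r. A (S (r - s) x))" using o(2) \<epsilon> by simp
   note h = set_integral_bounded_linear[OF bl o2]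
   have i': "set_integrable lborel {s + \<epsilon>..t} (a_integrand t s E x)"
    using \<epsilon> by (intro set_integrable_subset[OF i]) auto
   have "?f \<epsilon> = (LINT r:{s + \<epsilon>..t}|lborel. W t s (E (A (S (r - s) x))) - a_integrand t s E x r)"
    using st \<epsilon> by (intro set_lebesgue_integral_cong) (auto simp: a_integrand_eq)
   also have "\<dots> = (LINT r:{s + \<epsilon>..t}|lborel. W t s (E (A (S (r - s) x))))
     - (LINT r:{s + \<epsilon>..t}|lborel. a_integrand t s E x r)" by (rule set_integral_diff(2)[OF h(1) i'])
   also have "(LINT r:{s + \<epsilon>..t}|lborel. W t s (E (A (S (r - s) x)))) = W t s (E (S (t - s) x - S \<epsilon> x))"
    using h(2) o(1) \<epsilon> by simp
   also have "\<dots> = W t s (E (S (t - s) x)) - W t s (E (S \<epsilon> x))"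
    using W_simps(2)[OF st] by (simp add: blinfun.diff_right)
   also have "(LINT r:{s + \<epsilon>..t}|lborel. a_integrand t s E x r) = ?I - (LINT r:{s..s + \<epsilon>}|lborel. a_integrand t s E x r)"
    using set_integral_split[OF i, of "s + \<epsilon>"] \<epsilon> by simp
   finally show ?thesis .
  qed
  have ev: "\<forall>\<^sub>F \<epsilon> in at_right 0. 0 < \<epsilon> \<and> \<epsilon> < t - s"
   unfolding eventually_at_right_field using lt by (intro exI[of _ "t - s"]) auto
  have 1: "((\<lambda>\<epsilon>. W t s (E (S \<epsilon> x))) \<longlongrightarrow> W t s (E x)) (at_right 0)" by (intro bounded_linear.tendsto[OF bl] S_at_0)
  have 2: "((\<lambda>\<epsilon>. LINT r:{s..s + \<epsilon>}|lborel. a_integrand t s E x r) \<longlongrightarrow> 0) (at_right 0)"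
  proof (rule Lim_null_comparison)
   let ?C = "M * cW * norm E * (M * norm x) / (\<alpha> + 0)"
   show "\<forall>\<^sub>F \<epsilon> in at_right 0. norm (LINT r:{s..s + \<epsilon>}|lborel. a_integrand t s E x r) <= ?C * \<epsilon> powr \<alpha>" using ev
   proof eventually_elim
    case (elim \<epsilon>)
    then show ?case using a_integral(2)[OF st _ _ smooth_0 order_refl, of "s + \<epsilon>" E x] by simp
   qed
   have "((\<lambda>\<epsilon>. ?C * \<epsilon> powr \<alpha>) \<longlongrightarrow> ?C * 0 powr \<alpha>) (at_right 0)" using \<alpha>_pos eventually_at_right_less[of 0]
    by (intro tendsto_intros tendsto_powr') (auto elim: eventually_mono)
   then show "((\<lambda>\<epsilon>. ?C * \<epsilon> powr \<alpha>) \<longlongrightarrow> 0) (at_right 0)" using \<alpha>_pos by simp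
  qed
  have "((\<lambda>\<epsilon>. W t s (E (S (t - s) x)) - W t s (E (S \<epsilon> x)) - (?I - (LINT r:{s..s + \<epsilon>}|lborel. a_integrand t s E x r)))
    \<longlongrightarrow> W t s (E (S (t - s) x)) - W t s (E x) - (?I - 0)) (at_right 0)" by (intro tendsto_intros 1 2)
  then have "(?f \<longlongrightarrow> W t s (E (S (t - s) x)) - W t s (E x) - (?I - 0)) (at_right 0)"
   by (rule Lim_transform_eventually) (use ev eq in \<open>auto elim!: eventually_mono\<close>)
  then show ?thesis by simp
 qed
 then have "Lim (at_right 0) ?f = W t s (E (S (t - s) x)) - W t s (E x) - ?I" by (intro tendsto_Lim) auto
 then show ?thesis by (simp add: proc_a_def)
qed

abbreviation a :: "real => real => ('w \<Rightarrow>\<^sub>L 'v \<Rightarrow>\<^sub>L 'w) => 'w => 'w"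
 where "a \<equiv> proc_a A S \<omega>"

text \<open>The smoothness \<open>\<theta>\<close> of \<open>x\<close> is gained in both terms, by
  \<open>S (t - s) x - x\<close> and by the integrand.\<close>

lemma a_near:
 fixes E :: "'w \<Rightarrow>\<^sub>L 'v \<Rightarrow>\<^sub>L 'w"
 assumes x: "smooth \<theta> N x" and \<theta>: "0 < \<theta>" and st: "0 <= s" "s <= t" "t <= T0"
 shows "norm (a t s E x - W t s (E x)) <= M * cW * (1 / \<theta> + 1 / (\<alpha> + \<theta>)) * norm E * N * (t - s) powr (\<alpha> + \<theta>)"
proof -
 have "norm (W t s (E (S (t - s) x - x))) <= cW * norm E * norm (S (t - s) x - x) * (t - s) powr \<alpha>"
  by (rule norm_W_apply[OF st])
 also have "\<dots> <= cW * norm E * (N / \<theta> * (t - s) powr \<theta>) * (t - s) powr \<alpha>"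
  using cW_nonneg st by (intro mult_right_mono mult_left_mono smooth_S_diff[OF x _ \<theta>]) auto
 also have "\<dots> = 1 * (cW * norm E * (N / \<theta>) * (t - s) powr (\<alpha> + \<theta>))" by (simp add: powr_add)
 also have "\<dots> <= M * (cW * norm E * (N / \<theta>) * (t - s) powr (\<alpha> + \<theta>))"
 proof (rule mult_right_mono[OF M_ge_1])
  have "0 <= norm (A (S 1 x))" by simp
  also have "\<dots> <= N * 1 powr (\<theta> - 1)" using x unfolding smooth_def by (metis zero_less_one)
  finally show "0 <= cW * norm E * (N / \<theta>) * (t - s) powr (\<alpha> + \<theta>)" using cW_nonneg \<theta> by simp
 qed
 finally have 1: "norm (W t s (E (S (t - s) x - x))) <= M * (cW * norm E * (N / \<theta>) * (t - s) powr (\<alpha> + \<theta>))" .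
 note 2 = a_integral(2)[OF st st(2) order_refl x less_imp_le[OF \<theta>], of E]
 have eq: "a t s E x - W t s (E x) = W t s (E (S (t - s) x - x)) - (LINT r:{s..t}|lborel. a_integrand t s E x r)"
  unfolding proc_a_eq[OF st] using W_simps(2)[OF st] by (simp add: blinfun.diff_right)
 have "norm (a t s E x - W t s (E x)) <= M * (cW * norm E * (N / \<theta>) * (t - s) powr (\<alpha> + \<theta>))
   + M * cW * norm E * N / (\<alpha> + \<theta>) * (t - s) powr (\<alpha> + \<theta>)"
  unfolding eq by (rule order_trans[OF norm_triangle_ineq4 add_mono[OF 1 2]])
 then show ?thesis by (simp add: algebra_simps)
qed

definition ca :: real where "ca = M * cW * (1 + M / \<alpha>)"

lemma ca_nonneg: "0 <= ca" using M_ge_1 cW_nonneg \<alpha>_pos by (simp add: ca_def)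

lemma norm_a:
 fixes E :: "'w \<Rightarrow>\<^sub>L 'v \<Rightarrow>\<^sub>L 'w"
 assumes st: "0 <= s" "s <= t" "t <= T0"
 shows "norm (a t s E x) <= ca * norm E * norm x * (t - s) powr \<alpha>"
proof -
 have "norm (W t s (E (S (t - s) x))) <= cW * norm E * norm (S (t - s) x) * (t - s) powr \<alpha>"
  by (rule norm_W_apply[OF st])
 also have "\<dots> <= cW * norm E * (M * norm x) * (t - s) powr \<alpha>"
  using cW_nonneg st by (intro mult_right_mono mult_left_mono norm_S) auto
 finally have 1: "norm (W t s (E (S (t - s) x))) <= cW * norm E * (M * norm x) * (t - s) powr \<alpha>" .
 have 2: "norm (LINT r:{s..t}|lborel. a_integrand t s E x r) <= M * cW * norm E * (M * norm x) / (\<alpha> + 0) * (t - s) powr (\<alpha> + 0)"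
  by (rule a_integral(2)[OF st st(2) order_refl smooth_0]) simp
 have "norm (a t s E x) <= cW * norm E * (M * norm x) * (t - s) powr \<alpha>
   + M * cW * norm E * (M * norm x) / (\<alpha> + 0) * (t - s) powr (\<alpha> + 0)"
  unfolding proc_a_eq[OF st] by (rule order_trans[OF norm_triangle_ineq4 add_mono[OF 1 2]])
 then show ?thesis by (simp add: ca_def algebra_simps)
qed

lemma a_linear:
 fixes E E' :: "'w \<Rightarrow>\<^sub>L 'v \<Rightarrow>\<^sub>L 'w"
 assumes st: "0 <= s" "s <= t" "t <= T0"
 shows "a t s E (x + y) = a t s E x + a t s E y" "a t s E (x - y) = a t s E x - a t s E y"
  "a t s (E + E') x = a t s E x + a t s E' x" "a t s (c *\<^sub>R E) x = c *\<^sub>R a t s E x"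
proof -
 note i = a_integral(1)[OF st order_refl st(2)]
 have cong: "(LINT r:{s..t}|lborel. f r) = (LINT r:{s..t}|lborel. g r)"
  if "set_integrable lborel {s..t} f" "set_integrable lborel {s..t} g" "\<And>r. s < r ==> r < t ==> f r = g r" for f g :: "real => 'w"
  by (rule set_integral_cong_Ioo[OF that])
 have Wr: "W r s (K + L) = W r s K + W r s L" "W r s (K - L) = W r s K - W r s L" "W r s (c *\<^sub>R K) = c *\<^sub>R W r s K"
  if "s < r" "r < t" for r K L using W_simps[of s r] st that by auto
 have "(LINT r:{s..t}|lborel. a_integrand t s E (x + y) r) = (LINT r:{s..t}|lborel. a_integrand t s E x r + a_integrand t s E y r)"
  by (rule cong[OF i set_integral_add(1)[OF i i]]) (subst AS_simps(1), simp_all add: Wr blinfun.bilinear_simps)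
 then show "a t s E (x + y) = a t s E x + a t s E y"
  unfolding proc_a_eq[OF st] using set_integral_add(2)[OF i i] W_simps[OF st] by (simp add: blinfun.bilinear_simps)
 have "(LINT r:{s..t}|lborel. a_integrand t s E (x - y) r) = (LINT r:{s..t}|lborel. a_integrand t s E x r - a_integrand t s E y r)"
  by (rule cong[OF i set_integral_diff(1)[OF i i]]) (subst AS_simps(2), simp_all add: Wr blinfun.bilinear_simps)
 then show "a t s E (x - y) = a t s E x - a t s E y"
  unfolding proc_a_eq[OF st] using set_integral_diff(2)[OF i i] W_simps[OF st] by (simp add: blinfun.bilinear_simps)
 have "(LINT r:{s..t}|lborel. a_integrand t s (E + E') x r) = (LINT r:{s..t}|lborel. a_integrand t s E x r + a_integrand t s E' x r)"
  by (rule cong[OF i set_integral_add(1)[OF i i]]) (simp add: Wr blinfun.bilinear_simps)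
 then show "a t s (E + E') x = a t s E x + a t s E' x"
  unfolding proc_a_eq[OF st] using set_integral_add(2)[OF i i] W_simps[OF st] by (simp add: blinfun.bilinear_simps)
 have "(LINT r:{s..t}|lborel. a_integrand t s (c *\<^sub>R E) x r) = (LINT r:{s..t}|lborel. c *\<^sub>R a_integrand t s E x r)"
  by (rule cong[OF i set_integrable_scaleR_right[OF i]]) (simp add: Wr blinfun.bilinear_simps)
 then show "a t s (c *\<^sub>R E) x = c *\<^sub>R a t s E x"
  unfolding proc_a_eq[OF st] using W_simps[OF st] by (simp add: blinfun.bilinear_simps scaleR_diff_right)
qed

text \<open>On \<open>[m, t]\<close>, \<open>W r s\<close> splits at \<open>m\<close>: one part is
  the integrand started at \<open>m\<close> from \<open>S (m - s) x\<close>, the other contains the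
  fixed \<open>W m s\<close> and integrates in closed form along the orbit.\<close>

lemma a_additive:
 fixes E :: "'w \<Rightarrow>\<^sub>L 'v \<Rightarrow>\<^sub>L 'w"
 assumes st: "0 <= s" "s <= m" "m <= t" "t <= T0"
 shows "a t s E x = a t m E (S (m - s) x) + S (t - m) (a m s E x)"
proof (cases "s = m")
 case True
 have "a m m E x = 0" using norm_a[of m m E x] st True by simp
 then show ?thesis using True by (simp add: S_0 blinfun.zero_right)
next
 case False
 then have sm: "s < m" using st by simp
 have ts: "0 <= s" "s <= t" "t <= T0" and tm: "0 <= m" "m <= t" "t <= T0" and ms: "0 <= s" "s <= m" "m <= T0" using st by auto
 note i = a_integral(1)[OF ts order_refl ts(2), of E x]
 note im = a_integral(1)[OF tm order_refl tm(2), of E "S (m - s) x"]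
 note is' = a_integral(1)[OF ms order_refl ms(2), of E x]
 have "(LINT r:{s..m}|lborel. a_integrand t s E x r) = (LINT r:{s..m}|lborel. S (t - m) (a_integrand m s E x r))"
 proof (rule set_lebesgue_integral_cong)
  show "\<forall>r. r \<in> {s..m} --> a_integrand t s E x r = S (t - m) (a_integrand m s E x r)"
  proof (intro allI impI)
   fix r assume "r \<in> {s..m}"
   then show "a_integrand t s E x r = S (t - m) (a_integrand m s E x r)" using S_add[of "t - m" "m - r"] tm by simp
  qed
 qed simp
 also have "\<dots> = S (t - m) (LINT r:{s..m}|lborel. a_integrand m s E x r)"
  by (rule set_integral_bounded_linear(2)[OF blinfun.bounded_linear_right is'])
 finally have 1: "(LINT r:{s..m}|lborel. a_integrand t s E x r) = S (t - m) (LINT r:{s..m}|lborel. a_integrand m s E x r)" .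
 note o = orbit_integral[OF sm tm(2), of x]
 have bl: "bounded_linear (\<lambda>y. S (t - m) (W m s (E y)))"
  by (rule bounded_linear_compose[OF blinfun.bounded_linear_right W_apply_bounded_linear[OF ms]])
 note h = set_integral_bounded_linear[OF bl o(2)]
 have "(LINT r:{m..t}|lborel. a_integrand t s E x r)
   = (LINT r:{m..t}|lborel. a_integrand t m E (S (m - s) x) r + S (t - m) (W m s (E (A (S (r - s) x)))))"
 proof (rule set_integral_cong_Ioo)
  show "set_integrable lborel {m..t} (a_integrand t s E x)" using st by (intro set_integrable_subset[OF i]) auto
  show "set_integrable lborel {m..t} (\<lambda>r. a_integrand t m E (S (m - s) x) r + S (t - m) (W m s (E (A (S (r - s) x)))))"
   by (rule set_integral_add(1)[OF im h(1)])
  fix r assume r: "m < r" "r < t"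
  let ?K = "E (A (S (r - s) x))"
  have "W r s ?K = W r m ?K + S (r - m) (W m s ?K)" using W_additive[of s m r ?K] st r by simp
  moreover have "S (t - r) (S (r - m) (W m s ?K)) = S (t - m) (W m s ?K)"
   using S_add[of "t - r" "r - m" "W m s ?K"] r by simp
  moreover have "A (S (r - s) x) = A (S (r - m) (S (m - s) x))" using AS_swap[of "r - m" "m - s" x] r st by simp
  ultimately show "a_integrand t s E x r = a_integrand t m E (S (m - s) x) r + S (t - m) (W m s ?K)"
   by (simp add: blinfun.add_right)
 qed
 also have "\<dots> = (LINT r:{m..t}|lborel. a_integrand t m E (S (m - s) x) r)
   + S (t - m) (W m s (E (S (t - s) x - S (m - s) x)))" unfolding set_integral_add(2)[OF im h(1)] h(2) o(1) ..
 finally have 2: "(LINT r:{m..t}|lborel. a_integrand t s E x r) = (LINT r:{m..t}|lborel. a_integrand t m E (S (m - s) x) r)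
   + S (t - m) (W m s (E (S (t - s) x - S (m - s) x)))" .
 have Sx: "S (t - m) (S (m - s) x) = S (t - s) x" using S_add[of "t - m" "m - s" x] st by simp
 have 3: "W t s (E (S (t - s) x)) = W t m (E (S (t - s) x)) + S (t - m) (W m s (E (S (t - s) x)))"
  by (rule W_additive[OF st])
 show ?thesis unfolding proc_a_eq[OF ts] proc_a_eq[OF tm] proc_a_eq[OF ms] set_integral_split[OF i st(2,3)] 1 2 3 Sx
  using W_simps(2)[OF ms] by (simp add: blinfun.bilinear_simps)
qed

end

section \<open>The processes c and b\<close>

context rough_noise
begin

sublocale action: semigroup_action "\<lambda>t. blinfun_apply (S t)" M
 by (intro semigroup_action.intro) (auto simp: S_0 S_add norm_S blinfun.bounded_linear_right)

lemma \<omega>2_refl: "0 <= t ==> t <= T0 ==> \<omega>2 t t = 0" using chen[of t t t] by simp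

lemma area_split:
 assumes "0 <= s" "s <= r" "r <= r'" "r' <= T0"
 shows "\<omega>2 r' s - \<omega>2 r s = \<omega>2 r' r + tens (\<omega> r - \<omega> s) (\<omega> r' - \<omega> r)"
 using chen[OF assms] by (metis add.commute diff_eq_eq)

text \<open>By Chen's relation the increment of \<open>r \<mapsto> \<omega>2 r s\<close> is an area
  over \<open>[r, r']\<close> plus a tensor product. The latter is only
  \<open>\<alpha>\<close>-Hoelder in \<open>r' - r\<close>, but its other factor is of order
  \<open>(r' - s) powr \<alpha>\<close>, so the full rate \<open>2 * \<alpha>\<close> is
  kept.\<close>

lemma area_hoelder:
 assumes "0 <= s" "s <= r" "r <= r'" "r' <= T0"
 shows "norm (\<omega>2 r' s - \<omega>2 r s) <= (H + H\<^sup>2) * (r' - s) powr \<alpha> * (r' - r) powr \<alpha>"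
proof -
 note area_split[OF assms]
 moreover have "norm (\<omega>2 r' r) <= H * ((r' - s) powr \<alpha> * (r' - r) powr \<alpha>)"
 proof -
  have "norm (\<omega>2 r' r) <= H * (r' - r) powr (\<alpha> + \<alpha>)" using hoelder2[of r r', unfolded mult_2] assms by simp
  also have "\<dots> <= H * ((r' - s) powr \<alpha> * (r' - r) powr \<alpha>)"
   unfolding powr_add using assms \<alpha>_pos H_nonneg by (intro mult_left_mono mult_right_mono powr_mono2) auto
  finally show ?thesis .
 qed
 moreover have "norm (tens (\<omega> r - \<omega> s) (\<omega> r' - \<omega> r)) <= H\<^sup>2 * ((r' - s) powr \<alpha> * (r' - r) powr \<alpha>)"
 proof -
  have "norm (tens (\<omega> r - \<omega> s) (\<omega> r' - \<omega> r)) <= norm (\<omega> r - \<omega> s) * norm (\<omega> r' - \<omega> r)" by (rule norm_tens_le)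
  also have "\<dots> <= (H * (r - s) powr \<alpha>) * (H * (r' - r) powr \<alpha>)"
   using assms H_nonneg by (intro mult_mono hoelder) auto
  also have "\<dots> <= (H * (r' - s) powr \<alpha>) * (H * (r' - r) powr \<alpha>)"
   using assms H_nonneg \<alpha>_pos by (intro mult_right_mono mult_left_mono powr_mono2) auto
  finally show ?thesis by (simp add: power2_eq_square mult_ac)
 qed
 ultimately have "norm (\<omega>2 r' s - \<omega>2 r s) <= H * ((r' - s) powr \<alpha> * (r' - r) powr \<alpha>) + H\<^sup>2 * ((r' - s) powr \<alpha> * (r' - r) powr \<alpha>)"
  by (simp only:) (rule norm_triangle_mono)
 then show ?thesis by (simp add: algebra_simps)
qed

lemma area_path_hoelder:
 fixes L :: "('v, 'v) ptensor \<Rightarrow>\<^sub>L 'w"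
 assumes "0 <= s" "s <= r" "r <= r'" "r' <= t" "t <= T0"
 shows "norm (L (\<omega>2 r' s) - L (\<omega>2 r s)) <= norm L * (H + H\<^sup>2) * (t - s) powr \<alpha> * (r' - r) powr \<alpha>"
proof -
 have "norm (L (\<omega>2 r' s - \<omega>2 r s)) <= norm L * norm (\<omega>2 r' s - \<omega>2 r s)" by (rule norm_blinfun)
 also have "\<dots> <= norm L * ((H + H\<^sup>2) * (r' - s) powr \<alpha> * (r' - r) powr \<alpha>)"
  using assms by (intro mult_left_mono area_hoelder) auto
 also have "\<dots> <= norm L * ((H + H\<^sup>2) * (t - s) powr \<alpha> * (r' - r) powr \<alpha>)"
  using assms H_nonneg \<alpha>_pos by (intro mult_right_mono mult_left_mono powr_mono2) auto
 finally show ?thesis by (simp add: blinfun.diff_right mult_ac)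
qed

lemma area_path_continuous:
 fixes L :: "('v, 'v) ptensor \<Rightarrow>\<^sub>L 'w"
 assumes "0 <= s" "t <= T0"
 shows "continuous_on {s..t} (\<lambda>r. L (\<omega>2 r s))"
 by (rule hoelder_continuous_on[OF \<alpha>_pos, where H = "norm L * (H + H\<^sup>2) * (t - s) powr \<alpha>"])
  (use assms in \<open>auto intro!: area_path_hoelder\<close>)

definition area_convolution :: "real => real => (('v, 'v) ptensor \<Rightarrow>\<^sub>L 'w) => 'w"
 where "area_convolution t s L = convolution t s (\<lambda>r. L (\<omega>2 r s))"

abbreviation c :: "real => real => ('w \<Rightarrow>\<^sub>L 'v \<Rightarrow>\<^sub>L 'w) => ('v \<Rightarrow>\<^sub>L 'w) => 'w"
 where "c \<equiv> proc_c A S \<omega> \<omega>2"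

text \<open>Chen's relation identifies the bracket in \<open>proc_c\<close> with
  \<open>\<omega>2 t s - \<omega>2 r s\<close>. So \<open>c\<close> is the convolution with the path
  \<open>r \<mapsto> \<omega>2 r s\<close> and inherits its estimates.\<close>

lemma c_eq:
 assumes st: "0 <= s" "s <= t" "t <= T0"
 shows "c t s E K = area_convolution t s (tensor_lift (E o\<^sub>L K))"
proof -
 let ?L = "tensor_lift (E o\<^sub>L K)"
 have "(LINT r:{s..t}|lborel. A (S (t - r) (?L (\<omega>2 t r + tens (incr \<omega> r s) (incr \<omega> t r)))))
   = (LINT r:{s..t}|lborel. A (S (t - r) (?L (\<omega>2 t s) - ?L (\<omega>2 r s))))"
 proof (rule set_lebesgue_integral_cong)
  show "\<forall>r. r \<in> {s..t} --> A (S (t - r) (?L (\<omega>2 t r + tens (incr \<omega> r s) (incr \<omega> t r))))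
    = A (S (t - r) (?L (\<omega>2 t s) - ?L (\<omega>2 r s)))"
  proof (intro allI impI)
   fix r assume "r \<in> {s..t}"
   then have "\<omega>2 t r + tens (incr \<omega> r s) (incr \<omega> t r) = \<omega>2 t s - \<omega>2 r s"
    using area_split[of s r t] st by (simp add: incr_def)
   then show "A (S (t - r) (?L (\<omega>2 t r + tens (incr \<omega> r s) (incr \<omega> t r))))
    = A (S (t - r) (?L (\<omega>2 t s) - ?L (\<omega>2 r s)))" by (simp add: blinfun.diff_right)
  qed
 qed simp
 moreover have "\<omega>2 s s = 0" using \<omega>2_refl st by simp
 ultimately show ?thesis by (simp add: proc_c_def area_convolution_def convolution_def blinfun.zero_right)
qed

definition cc :: real where "cc = M * (1 + 1 / \<alpha>) * (H + H\<^sup>2)"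

lemma cc_nonneg: "0 <= cc" using M_ge_1 H_nonneg \<alpha>_pos by (simp add: cc_def)

lemma norm_area_convolution:
 assumes st: "0 <= s" "s <= t" "t <= T0"
 shows "norm (area_convolution t s L) <= cc * norm L * (t - s) powr (2 * \<alpha>)"
proof -
 have "norm (area_convolution t s L) <= M * (1 + 1 / \<alpha>) * (norm L * (H + H\<^sup>2) * (t - s) powr \<alpha>) * (t - s) powr \<alpha>"
  unfolding area_convolution_def by (rule norm_convolution[OF st(2) \<alpha>_pos area_path_continuous[OF st(1,3)]])
   (use st in \<open>auto intro!: area_path_hoelder\<close>)
 also have "\<dots> = cc * norm L * (t - s) powr (\<alpha> + \<alpha>)" unfolding powr_add cc_def by simp
 finally show ?thesis by (simp only: mult_2)
qed

lemma area_convolution_bounded_linear: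
 assumes st: "0 <= s" "s <= t" "t <= T0"
 shows "bounded_linear (area_convolution t s)"
proof (rule bounded_linear_intro[where K = "cc * (t - s) powr (2 * \<alpha>)"])
 fix L L' :: "('v, 'v) ptensor \<Rightarrow>\<^sub>L 'w" and k :: real
 have "convolution t s (\<lambda>r. L (\<omega>2 r s) + L' (\<omega>2 r s)) = convolution t s (\<lambda>r. L (\<omega>2 r s)) + convolution t s (\<lambda>r. L' (\<omega>2 r s))"
  by (rule convolution_add[OF st(2) \<alpha>_pos area_path_continuous[OF st(1,3)] area_path_continuous[OF st(1,3)],
     where H = "norm L * (H + H\<^sup>2) * (t - s) powr \<alpha>" and H' = "norm L' * (H + H\<^sup>2) * (t - s) powr \<alpha>"])
   (use st in \<open>auto intro!: area_path_hoelder\<close>)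
 then show "area_convolution t s (L + L') = area_convolution t s L + area_convolution t s L'"
  by (simp add: area_convolution_def blinfun.add_left)
 show "area_convolution t s (k *\<^sub>R L) = k *\<^sub>R area_convolution t s L"
  by (simp add: area_convolution_def blinfun.scaleR_left convolution_scale[OF st(2)])
 show "norm (area_convolution t s L) <= norm L * (cc * (t - s) powr (2 * \<alpha>))"
  using norm_area_convolution[OF st, of L] by (simp add: mult_ac)
qed

lemma norm_tensor_lift_compose:
 fixes E :: "'w \<Rightarrow>\<^sub>L 'v \<Rightarrow>\<^sub>L 'w" and K :: "'v \<Rightarrow>\<^sub>L 'w"
 shows "norm (tensor_lift (E o\<^sub>L K)) <= norm E * norm K"
 by (rule order_trans[OF norm_tensor_lift norm_blinfun_compose])

lemma norm_c:
 assumes st: "0 <= s" "s <= t" "t <= T0"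
 shows "norm (c t s E K) <= cc * norm E * norm K * (t - s) powr (2 * \<alpha>)"
proof -
 have "norm (c t s E K) <= cc * norm (tensor_lift (E o\<^sub>L K)) * (t - s) powr (2 * \<alpha>)"
  unfolding c_eq[OF st] by (rule norm_area_convolution[OF st])
 also have "\<dots> <= cc * (norm E * norm K) * (t - s) powr (2 * \<alpha>)"
  using cc_nonneg by (intro mult_right_mono mult_left_mono norm_tensor_lift_compose) auto
 finally show ?thesis by (simp add: mult_ac)
qed

lemma c_linear:
 fixes E E' :: "'w \<Rightarrow>\<^sub>L 'v \<Rightarrow>\<^sub>L 'w" and K K' :: "'v \<Rightarrow>\<^sub>L 'w"
 assumes st: "0 <= s" "s <= t" "t <= T0"
 shows "c t s (E + E') K = c t s E K + c t s E' K" "c t s (k *\<^sub>R E) K = k *\<^sub>R c t s E K"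
  "c t s E (K - K') = c t s E K - c t s E K'"
proof -
 interpret bounded_linear "area_convolution t s" by (rule area_convolution_bounded_linear[OF st])
 have "(E + E') o\<^sub>L K = (E o\<^sub>L K) + (E' o\<^sub>L K)" "(k *\<^sub>R E) o\<^sub>L K = k *\<^sub>R (E o\<^sub>L K)"
  "E o\<^sub>L (K - K') = (E o\<^sub>L K) - (E o\<^sub>L K')" by (auto intro!: blinfun_eqI simp: blinfun.bilinear_simps)
 then show "c t s (E + E') K = c t s E K + c t s E' K" "c t s (k *\<^sub>R E) K = k *\<^sub>R c t s E K"
  "c t s E (K - K') = c t s E K - c t s E K'"
  by (simp_all add: c_eq[OF st] tensor_lift_add tensor_lift_diff tensor_lift_scaleR add diff scaleR)
qed

text \<open>On \<open>[m, v]\<close> the paths \<open>r \<mapsto> \<omega>2 r u\<close> and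
  \<open>r \<mapsto> \<omega>2 r m\<close> differ, up to a constant, by the tensor product of
  \<open>\<omega> m - \<omega> u\<close> with the noise path; its convolution is the extra
  \<open>W\<close> term.\<close>

lemma c_delta2:
 fixes E :: "'w \<Rightarrow>\<^sub>L 'v \<Rightarrow>\<^sub>L 'w" and K :: "'v \<Rightarrow>\<^sub>L 'w"
 assumes um: "0 <= u" "u <= m" "m <= v" "v <= T0"
 shows "c v u E K = c v m E K + W v m (E (K (\<omega> m - \<omega> u))) + S (v - m) (c m u E K)"
proof -
 let ?L = "tensor_lift (E o\<^sub>L K)" and ?K = "E (K (\<omega> m - \<omega> u))"
 have uv: "0 <= u" "u <= v" "v <= T0" and mv: "0 <= m" "m <= v" "v <= T0" and mu: "0 <= u" "u <= m" "m <= T0" using um by auto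
 have "convolution v u (\<lambda>r. ?L (\<omega>2 r u))
   = convolution v m (\<lambda>r. ?L (\<omega>2 r u)) + S (v - m) (convolution m u (\<lambda>r. ?L (\<omega>2 r u)))"
  by (rule convolution_additive[OF um(2,3) \<alpha>_pos area_path_continuous[OF uv(1,3)],
     where H = "norm ?L * (H + H\<^sup>2) * (v - u) powr \<alpha>"])
   (use um in \<open>auto intro!: area_path_hoelder\<close>)
 also have "convolution v m (\<lambda>r. ?L (\<omega>2 r u)) = convolution v m (\<lambda>r. ?L (\<omega>2 r m) + ?K (\<omega> r))"
 proof (rule convolution_cong[OF _ um(3)])
  have *: "?L (\<omega>2 r u) = ?L (\<omega>2 r m) + ?L (\<omega>2 m u) + (?K (\<omega> r) - ?K (\<omega> m))" if "m <= r" "r <= v" for r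
  proof -
   have "\<omega>2 r u - \<omega>2 m u = \<omega>2 r m + tens (\<omega> m - \<omega> u) (\<omega> r - \<omega> m)" using um that by (intro area_split) auto
   from arg_cong[OF this, of ?L] show ?thesis
    by (simp add: blinfun.add_right tensor_lift_tens blinfun.diff_right diff_eq_eq)
  qed
  show "?L (\<omega>2 v u) - ?L (\<omega>2 r u) = ?L (\<omega>2 v m) + ?K (\<omega> v) - (?L (\<omega>2 r m) + ?K (\<omega> r))"
   if "m <= r" "r <= v" for r using *[OF that] *[of v] um by simp
 qed
 also have "\<dots> = convolution v m (\<lambda>r. ?L (\<omega>2 r m)) + convolution v m (\<lambda>r. ?K (\<omega> r))"
  by (rule convolution_add[OF um(3) \<alpha>_pos area_path_continuous[OF mv(1,3)] noise_path_continuous[OF mv(1,3)],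
     where H = "norm ?L * (H + H\<^sup>2) * (v - m) powr \<alpha>" and H' = "norm ?K * H"])
   (use um in \<open>auto intro!: area_path_hoelder noise_path_hoelder\<close>)
 finally show ?thesis unfolding c_eq[OF uv] c_eq[OF mv] c_eq[OF mu] W_convolution[OF mv] area_convolution_def .
qed

lemma smooth_op_add: "smooth_op N K ==> smooth_op N' K' ==> smooth_op (N + N') (K + K')"
 unfolding smooth_op_def by (auto simp: blinfun.add_left distrib_right intro: smooth_add)

lemma smooth_op_uminus: "smooth_op N K ==> smooth_op N (- K)"
proof -
 assume K: "smooth_op N K"
 have "(- K) v = K (- v)" for v by (simp add: blinfun.minus_left blinfun.minus_right)
 then show ?thesis using K by (auto simp: smooth_op_def dest: spec[of _ "- _"])
qed

lemma smooth_op_diff: "smooth_op N K ==> smooth_op N' K' ==> smooth_op (N + N') (K - K')"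
 using smooth_op_add[OF _ smooth_op_uminus, of N K N' K'] by simp

lemma smooth_op_norm_le: "smooth_op N K ==> N <= N' ==> smooth_op N' K"
 unfolding smooth_op_def using smooth_norm_le mult_right_mono norm_ge_zero by blast

definition b_germ :: "real => ('w \<Rightarrow>\<^sub>L 'v \<Rightarrow>\<^sub>L 'w) => ('v \<Rightarrow>\<^sub>L 'w) => real => real => 'w"
 where "b_germ s E K v u = W v u (E (W u s K)) + c v u E K"

abbreviation b :: "real => real => ('w \<Rightarrow>\<^sub>L 'v \<Rightarrow>\<^sub>L 'w) => ('v \<Rightarrow>\<^sub>L 'w) => 'w"
 where "b \<equiv> proc_b A S \<omega> \<omega>2"

lemma b_germ_refl: "0 <= u ==> u <= T0 ==> b_germ s E K u u = 0" using norm_c[of u u E K] by (simp add: b_germ_def)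

definition cX :: real where "cX = (1 / \<beta> + 1 / (\<alpha> + \<beta>)) * H + cW2 / (2 * \<beta>)"

lemma cX_nonneg: "0 <= cX" using H_nonneg cW2_nonneg \<beta>_pos \<alpha>_pos by (simp add: cX_def)

text \<open>The increment is \<open>W m u K\<close>, close to
  \<open>K (\<omega> m - \<omega> u)\<close> by \<open>W_near\<close>, plus
  \<open>S (m - u) - S 0\<close> applied to \<open>W u s K\<close>, which gains
  \<open>2 * \<beta>\<close> by \<open>W_smooth\<close>. The surplus
  \<open>\<alpha> - \<beta>\<close> of the first error over \<open>2 * \<beta>\<close> is spent on
  \<open>t - s\<close>.\<close>

lemma W_increment:
 assumes K: "smooth_op N K" "0 <= N" and st: "0 <= s" "s <= u" "u <= m" "m <= t" "t <= T0"
 shows "norm (W m s K - W u s K - K (\<omega> m - \<omega> u)) <= cX * N * (t - s) powr (\<alpha> - \<beta>) * (m - u) powr (2 * \<beta>)"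
proof -
 let ?p = "(t - s) powr (\<alpha> - \<beta>) * (m - u) powr (2 * \<beta>)"
 have "norm (W m u K - K (\<omega> m - \<omega> u)) <= (1 / \<beta> + 1 / (\<alpha> + \<beta>)) * H * N * (m - u) powr (\<alpha> + \<beta>)"
  using st by (intro W_near K) auto
 also have "(m - u) powr (\<alpha> + \<beta>) = (m - u) powr ((\<alpha> - \<beta>) + 2 * \<beta>)" by (simp add: add.commute)
 also have "(1 / \<beta> + 1 / (\<alpha> + \<beta>)) * H * N * (m - u) powr ((\<alpha> - \<beta>) + 2 * \<beta>) <= (1 / \<beta> + 1 / (\<alpha> + \<beta>)) * H * N * ?p"
  unfolding powr_add using st \<beta>_less K(2) H_nonneg \<beta>_pos by (intro mult_left_mono mult_right_mono powr_mono2) auto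
 finally have 1: "norm (W m u K - K (\<omega> m - \<omega> u)) <= (1 / \<beta> + 1 / (\<alpha> + \<beta>)) * H * N * ?p" by simp
 have "norm (S (m - u) (W u s K) - W u s K) <= cW2 * N * (u - s) powr (\<alpha> - \<beta>) / (2 * \<beta>) * (m - u) powr (2 * \<beta>)"
  using st \<beta>_pos by (intro smooth_S_diff W_smooth K) auto
 also have "\<dots> <= cW2 * N * (t - s) powr (\<alpha> - \<beta>) / (2 * \<beta>) * (m - u) powr (2 * \<beta>)"
  using st \<beta>_less K(2) cW2_nonneg \<beta>_pos by (intro divide_right_mono mult_left_mono mult_right_mono powr_mono2) auto
 finally have 2: "norm (S (m - u) (W u s K) - W u s K) <= cW2 * N * (t - s) powr (\<alpha> - \<beta>) / (2 * \<beta>) * (m - u) powr (2 * \<beta>)" .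
 have "W m s K - W u s K - K (\<omega> m - \<omega> u) = (W m u K - K (\<omega> m - \<omega> u)) + (S (m - u) (W u s K) - W u s K)"
  using W_additive[of s u m K] st by simp
 then have "norm (W m s K - W u s K - K (\<omega> m - \<omega> u)) <= (1 / \<beta> + 1 / (\<alpha> + \<beta>)) * H * N * ?p
   + cW2 * N * (t - s) powr (\<alpha> - \<beta>) / (2 * \<beta>) * (m - u) powr (2 * \<beta>)"
  using norm_triangle_mono[OF 1 2] by (simp only:)
 then show ?thesis by (simp add: cX_def algebra_simps)
qed

abbreviation \<epsilon>b :: real where "\<epsilon>b \<equiv> \<alpha> + 2 * \<beta> - 1"

definition cb :: real where "cb = 2 * (M * cW * cX) / (1 - 2 powr - \<epsilon>b)"

lemma \<epsilon>b_pos: "0 < \<epsilon>b" and one_minus_powr_pos: "0 < x ==> 0 < 1 - 2 powr - (x::real)"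
 using \<alpha>_2\<beta> by (simp_all add: powr_minus two_powr_gt_1 inverse_less_1_iff)

lemma cb_nonneg: "0 <= cb" unfolding cb_def using M_ge_1 cW_nonneg cX_nonneg one_minus_powr_pos[OF \<epsilon>b_pos]
 by (intro divide_nonneg_pos) auto

text \<open>The \<open>W\<close> term of \<open>c_delta2\<close> cancels the leading part of the
  increment of \<open>W\<close>. What remains is \<open>W v m\<close> of the remainder in
  \<open>W_increment\<close>, of order \<open>\<alpha> + 2 * \<beta>\<close>, which exceeds
  1.\<close>

lemma b_germ_delta2:
 fixes E :: "'w \<Rightarrow>\<^sub>L 'v \<Rightarrow>\<^sub>L 'w"
 assumes K: "smooth_op N K" "0 <= N" and st: "0 <= s" "s <= u" "u <= m" "m <= v" "v <= t" "t <= T0" and r: "0 <= r"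
 shows "norm (S r (action.delta2 (b_germ s E K) v m u))
  <= M * cW * cX * norm E * N * (t - s) powr (\<alpha> - \<beta>) * (v - u) powr \<epsilon>b * (v - u)"
proof -
 let ?X = "W m s K - W u s K - K (\<omega> m - \<omega> u)"
 have mv: "0 <= m" "m <= v" "v <= T0" using st by auto
 have "W v u (E (W u s K)) = W v m (E (W u s K)) + S (v - m) (W m u (E (W u s K)))"
  using st by (intro W_additive) auto
 moreover have "c v u E K = c v m E K + W v m (E (K (\<omega> m - \<omega> u))) + S (v - m) (c m u E K)"
  using st by (intro c_delta2) auto
 moreover have "W v m (E ?X) = W v m (E (W m s K)) - W v m (E (W u s K)) - W v m (E (K (\<omega> m - \<omega> u)))"
  by (simp add: blinfun.diff_right W_simps(2)[OF mv])
 ultimately have eq: "action.delta2 (b_germ s E K) v m u = - W v m (E ?X)"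
  by (simp add: action.delta2_def b_germ_def blinfun.add_right)
 have "norm (S r (action.delta2 (b_germ s E K) v m u)) <= M * norm (W v m (E ?X))"
  using norm_S[OF r, of "- W v m (E ?X)"] unfolding eq by simp
 also have "\<dots> <= M * (cW * norm E * norm ?X * (v - m) powr \<alpha>)"
  using M_ge_1 mv by (intro mult_left_mono norm_W_apply) auto
 also have "\<dots> <= M * (cW * norm E * (cX * N * (t - s) powr (\<alpha> - \<beta>) * (m - u) powr (2 * \<beta>)) * (v - m) powr \<alpha>)"
  using M_ge_1 cW_nonneg st by (intro mult_left_mono mult_right_mono W_increment K) auto
 also have "\<dots> <= M * (cW * norm E * (cX * N * (t - s) powr (\<alpha> - \<beta>) * (v - u) powr (2 * \<beta>)) * (v - u) powr \<alpha>)"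
  using M_ge_1 cW_nonneg cX_nonneg st \<alpha>_pos \<beta>_pos K(2)
  by (intro mult_left_mono mult_mono powr_mono2 mult_nonneg_nonneg) auto
 also have "\<dots> = M * cW * cX * norm E * N * (t - s) powr (\<alpha> - \<beta>) * ((v - u) powr (2 * \<beta>) * (v - u) powr \<alpha>)" by simp
 also have "(v - u) powr (2 * \<beta>) * (v - u) powr \<alpha> = (v - u) powr \<epsilon>b * (v - u) powr 1"
  unfolding powr_add[symmetric] by (simp add: add.commute)
 also have "(v - u) powr 1 = v - u" using st by simp
 finally show ?thesis by (simp add: mult_ac)
qed

lemma b_limit:
 fixes E :: "'w \<Rightarrow>\<^sub>L 'v \<Rightarrow>\<^sub>L 'w"
 assumes K: "smooth_op N K" "0 <= N" and st: "0 <= s" "s <= t" "t <= T0"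
 shows "partition_limit s t (action.shifted (b_germ s E K) t) (b t s E K)"
  and "norm (b t s E K - c t s E K) <= cb * norm E * N * (t - s) powr (2 * \<alpha> + \<beta>)"
proof -
 let ?N = "M * cW * cX * norm E * N * (t - s) powr (\<alpha> - \<beta>)"
 have 0: "0 <= ?N" using M_ge_1 cW_nonneg cX_nonneg K(2) by simp
 obtain l where l: "partition_limit s t (action.shifted (b_germ s E K) t) l"
  "\<And>r. 0 <= r ==> norm (S r (l - b_germ s E K t s)) <= 2 * ?N / (1 - 2 powr - \<epsilon>b) * (t - s) powr \<epsilon>b * (t - s)"
 proof (rule action.partition_limit_exists[OF \<epsilon>b_pos 0, of s t "\<lambda>v. v" "b_germ s E K" _ s t])
  show "norm (S r (action.delta2 (b_germ s E K) v m u)) <= ?N * (v - u) powr \<epsilon>b * (v - u)"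
   if "0 <= r" "s <= u" "u <= m" "m <= v" "v <= t" for r u m v using b_germ_delta2[OF K st(1) that(2-5) st(3) that(1)] .
 qed (use st in \<open>auto intro: b_germ_refl\<close>)
 have bl: "b t s E K = l" unfolding proc_b_def by (rule the_equality, use l(1) in \<open>simp add: b_germ_def\<close>)
   (rule partition_limit_unique[OF _ l(1) st(2)], simp add: b_germ_def)
 show "partition_limit s t (action.shifted (b_germ s E K) t) (b t s E K)" using l(1) bl by simp
 \<comment> \<open>\<open>W s s K\<close> is 0, so on the whole interval the germ is
   \<open>c\<close> and the sewing error is \<open>b - c\<close>; the exponents add up,
   \<open>(\<alpha> - \<beta>) + \<epsilon>b + 1 = 2 * \<alpha> + \<beta>\<close>.\<close>
 have "b_germ s E K t s = c t s E K" using st by (simp add: b_germ_def blinfun.zero_right W_simps(4))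
 then have "norm (b t s E K - c t s E K) <= 2 * ?N / (1 - 2 powr - \<epsilon>b) * (t - s) powr \<epsilon>b * (t - s) powr 1"
  using l(2)[of 0] bl st by (simp add: S_0)
 also have "\<dots> = cb * norm E * N * ((t - s) powr (\<alpha> - \<beta>) * ((t - s) powr \<epsilon>b * (t - s) powr 1))" by (simp add: cb_def)
 also have "\<dots> = cb * norm E * N * (t - s) powr (2 * \<alpha> + \<beta>)"
  unfolding powr_add[symmetric] by (simp add: algebra_simps)
 finally show "norm (b t s E K - c t s E K) <= cb * norm E * N * (t - s) powr (2 * \<alpha> + \<beta>)" .
qed

lemma norm_b:
 fixes E :: "'w \<Rightarrow>\<^sub>L 'v \<Rightarrow>\<^sub>L 'w"
 assumes K: "smooth_op N K" "0 <= N" and st: "0 <= s" "s <= t" "t <= T0"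
 shows "norm (b t s E K) <= (cc + cb) * norm E * (norm K * (t - s) powr (2 * \<alpha>) + N * (t - s) powr (2 * \<alpha> + \<beta>))"
proof -
 have "norm (b t s E K) <= cc * norm E * norm K * (t - s) powr (2 * \<alpha>) + cb * norm E * N * (t - s) powr (2 * \<alpha> + \<beta>)"
  using norm_triangle_mono[OF norm_c[OF st, of E K] b_limit(2)[OF K st, of E]] by simp
 moreover have "0 <= cb * norm E * (norm K * (t - s) powr (2 * \<alpha>))" "0 <= cc * norm E * (N * (t - s) powr (2 * \<alpha> + \<beta>))"
  using cb_nonneg cc_nonneg K(2) by simp_all
 ultimately show ?thesis by (simp add: algebra_simps)
qed

lemma b_germ_linear:
 fixes E E' :: "'w \<Rightarrow>\<^sub>L 'v \<Rightarrow>\<^sub>L 'w"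
 assumes "0 <= s" "s <= u" "u <= v" "v <= T0"
 shows "b_germ s (E + E') K v u = b_germ s E K v u + b_germ s E' K v u"
  "b_germ s (k *\<^sub>R E) K v u = k *\<^sub>R b_germ s E K v u"
  "b_germ s E (K - K') v u = b_germ s E K v u - b_germ s E K' v u"
proof -
 have su: "0 <= s" "s <= u" "u <= T0" and uv: "0 <= u" "u <= v" "v <= T0" using assms by auto
 show "b_germ s (E + E') K v u = b_germ s E K v u + b_germ s E' K v u"
  "b_germ s (k *\<^sub>R E) K v u = k *\<^sub>R b_germ s E K v u"
  "b_germ s E (K - K') v u = b_germ s E K v u - b_germ s E K' v u"
  by (simp_all add: b_germ_def W_simps[OF su] W_simps[OF uv] c_linear[OF uv] blinfun.bilinear_simps scaleR_add_right)
qed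

lemma b_linear:
 fixes E E' :: "'w \<Rightarrow>\<^sub>L 'v \<Rightarrow>\<^sub>L 'w"
 assumes K: "smooth_op N K" "0 <= N" and st: "0 <= s" "s <= t" "t <= T0"
 shows "b t s (E + E') K = b t s E K + b t s E' K" "b t s (k *\<^sub>R E) K = k *\<^sub>R b t s E K"
  "smooth_op N' K' ==> 0 <= N' ==> b t s E (K - K') = b t s E K - b t s E K'"
proof -
 have v: "v <= T0" if "v <= t" for v using that st by simp
 note L = b_limit(1)[OF _ _ st]
 note simps = b_germ_linear[OF st(1)] blinfun.add_right blinfun.diff_right blinfun.scaleR_right
 have "partition_limit s t (action.shifted (b_germ s (E + E') K) t) (b t s E K + b t s E' K)"
  by (rule partition_limit_cong[OF partition_limit_add[OF L[OF K] L[OF K]]]) (simp add: simps v)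
 then show "b t s (E + E') K = b t s E K + b t s E' K" by (rule partition_limit_unique[OF L[OF K] _ st(2)])
 have "partition_limit s t (action.shifted (b_germ s (k *\<^sub>R E) K) t) (k *\<^sub>R b t s E K)"
  by (rule partition_limit_cong[OF partition_limit_linear[OF L[OF K] bounded_linear_scaleR_right]])
   (simp add: simps v)
 then show "b t s (k *\<^sub>R E) K = k *\<^sub>R b t s E K" by (rule partition_limit_unique[OF L[OF K] _ st(2)])
 assume K': "smooth_op N' K'" "0 <= N'"
 have d: "smooth_op (N + N') (K - K')" "0 <= N + N'" using smooth_op_diff[OF K(1) K'(1)] K K' by auto
 have "partition_limit s t (action.shifted (b_germ s E (K - K')) t) (b t s E K - b t s E K')"
  by (rule partition_limit_cong[OF partition_limit_diff[OF L[OF K] L[OF K']]]) (simp add: simps v)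
 then show "b t s E (K - K') = b t s E K - b t s E K'" by (rule partition_limit_unique[OF L[OF d] _ st(2)])
qed

text \<open>\<open>a v u E (S (u - \<tau>) x)\<close> is additive and close to the germ by
  \<open>a_near\<close>: the orbit has smoothness \<open>2 * \<beta>\<close> with a constant of
  order \<open>(u - \<tau>) powr - (2 * \<beta>)\<close>. This singular weight is moved to
  \<open>v\<close> and dominated by the control \<open>(v - \<tau>) powr (1 - 2 * \<beta>)\<close>.
  Such germs arise when the base point of \<open>b_germ\<close> is changed.\<close>

lemma a_limit:
 fixes E :: "'w \<Rightarrow>\<^sub>L 'v \<Rightarrow>\<^sub>L 'w"
 assumes st: "0 <= \<tau>" "\<tau> <= t" "t <= T0"
 shows "partition_limit \<tau> t (\<lambda>v u. S (t - v) (W v u (E (S (u - \<tau>) x)))) (a t \<tau> E x)"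
proof -
 define J where "J v u = a v u E (S (u - \<tau>) x)" for v u
 define C where "C = M * cW * (1 / (2 * \<beta>) + 1 / (\<alpha> + 2 * \<beta>)) * norm E * (M * norm x)
  + (ca + cW) * norm E * (M * norm x)"
 have C0: "0 <= C" unfolding C_def using M_ge_1 cW_nonneg ca_nonneg \<beta>_pos \<alpha>_pos by simp
 have near: "norm (J v u - W v u (E (S (u - \<tau>) x)))
   <= 2 * C / (1 - 2 * \<beta>) * (v - u) powr \<epsilon>b * ((v - \<tau>) powr (1 - 2 * \<beta>) - (u - \<tau>) powr (1 - 2 * \<beta>))"
  if uv: "\<tau> <= u" "u <= v" "v <= t" for u v
 proof (cases "u = v")
  case True
  have "norm (J v v) <= 0" using norm_a[of v v E] uv st by (simp add: J_def)
  then show ?thesis using True uv st by simp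
 next
  case False
  then have lt: "u < v" using uv by simp
  have uv': "0 <= u" "u <= v" "v <= T0" using uv st by auto
  let ?X = "norm (J v u - W v u (E (S (u - \<tau>) x)))"
  have Sx: "norm (S (u - \<tau>) x) <= M * norm x" using uv by (intro norm_S) auto
  have "?X <= ca * norm E * norm (S (u - \<tau>) x) * (v - u) powr \<alpha> + cW * norm E * norm (S (u - \<tau>) x) * (v - u) powr \<alpha>"
   unfolding J_def by (rule order_trans[OF norm_triangle_ineq4 add_mono[OF norm_a[OF uv'] norm_W_apply[OF uv']]])
  also have "\<dots> = (ca + cW) * norm E * norm (S (u - \<tau>) x) * (v - u) powr \<alpha>" by (simp add: algebra_simps)
  also have "\<dots> <= C * (v - u) powr \<alpha>"
  proof (rule mult_right_mono)
   have "(ca + cW) * norm E * norm (S (u - \<tau>) x) <= (ca + cW) * norm E * (M * norm x)"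
    using Sx ca_nonneg cW_nonneg by (intro mult_left_mono) auto
   also have "\<dots> <= C" unfolding C_def using M_ge_1 cW_nonneg \<beta>_pos \<alpha>_pos by simp
   finally show "(ca + cW) * norm E * norm (S (u - \<tau>) x) <= C" .
  qed simp
  finally have X1: "?X <= C * (v - u) powr \<alpha>" .
  have X2: "?X <= C * (u - \<tau>) powr - (2 * \<beta>) * (v - u) powr (\<alpha> + 2 * \<beta>)" if pos: "0 < u - \<tau>"
  proof -
   have "?X <= M * cW * (1 / (2 * \<beta>) + 1 / (\<alpha> + 2 * \<beta>)) * norm E * (M * norm x * (u - \<tau>) powr - (2 * \<beta>)) * (v - u) powr (\<alpha> + 2 * \<beta>)"
    unfolding J_def using pos \<beta>_pos \<beta>_less_1 by (intro a_near[OF smooth_orbit _ uv']) auto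
   also have "\<dots> = (M * cW * (1 / (2 * \<beta>) + 1 / (\<alpha> + 2 * \<beta>)) * norm E * (M * norm x)) * ((u - \<tau>) powr - (2 * \<beta>) * (v - u) powr (\<alpha> + 2 * \<beta>))"
    by simp
   also have "\<dots> <= C * ((u - \<tau>) powr - (2 * \<beta>) * (v - u) powr (\<alpha> + 2 * \<beta>))"
    unfolding C_def using M_ge_1 cW_nonneg ca_nonneg by (intro mult_right_mono) auto
   finally show ?thesis by (simp add: mult.assoc)
  qed
  have "?X <= 2 * C * (v - \<tau>) powr - (2 * \<beta>) * ((v - \<tau>) - (u - \<tau>)) powr (\<alpha> + 2 * \<beta>)"
   by (rule powr_left_to_right_weight[OF _ _ _ _ C0]) (use uv lt \<beta>_pos \<beta>_less_1 X1 X2 in auto)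
  also have "\<dots> = 2 * C * (v - u) powr \<epsilon>b * ((v - \<tau>) powr - (2 * \<beta>) * (v - u) powr 1)"
  proof -
   have "(v - u) powr (\<alpha> + 2 * \<beta>) = (v - u) powr \<epsilon>b * (v - u) powr 1" unfolding powr_add[symmetric] by simp
   then show ?thesis by simp
  qed
  also have "\<dots> <= 2 * C * (v - u) powr \<epsilon>b * (((v - \<tau>) powr (1 - 2 * \<beta>) - (u - \<tau>) powr (1 - 2 * \<beta>)) / (1 - 2 * \<beta>))"
  proof (rule mult_left_mono)
   have "(1 - 2 * \<beta>) * (v - \<tau>) powr - (2 * \<beta>) * ((v - \<tau>) - (u - \<tau>)) <= (v - \<tau>) powr (1 - 2 * \<beta>) - (u - \<tau>) powr (1 - 2 * \<beta>)"
    by (rule powr_increment_bounds(1)) (use uv lt \<beta>_pos \<beta>_less_1 in auto)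
   then show "(v - \<tau>) powr - (2 * \<beta>) * (v - u) powr 1 <= ((v - \<tau>) powr (1 - 2 * \<beta>) - (u - \<tau>) powr (1 - 2 * \<beta>)) / (1 - 2 * \<beta>)"
    using lt \<beta>_less_1 by (simp add: field_simps)
  qed (use C0 in simp)
  finally show ?thesis by simp
 qed
 have "partition_limit \<tau> t (action.shifted (\<lambda>v u. W v u (E (S (u - \<tau>) x))) t) (J t \<tau>)"
 proof (rule action.partition_limit_of_additive[OF _ \<epsilon>b_pos _ st(2) _ near])
  show "action.delta2 J v m u = 0" if "\<tau> <= u" "u <= m" "m <= v" "v <= t" for u m v
   using a_additive[of u m v E "S (u - \<tau>) x"] S_add[of "m - u" "u - \<tau>" x] that st
   by (simp add: action.delta2_def J_def)
  show "0 <= 2 * C / (1 - 2 * \<beta>)" using C0 \<beta>_less_1 by simp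
  show "(u - \<tau>) powr (1 - 2 * \<beta>) <= (v - \<tau>) powr (1 - 2 * \<beta>)" if "\<tau> <= u" "u <= v" "v <= t" for u v
   using that \<beta>_less_1 by (intro powr_mono2) auto
 qed
 then show ?thesis by (simp add: J_def S_0)
qed

text \<open>On \<open>[\<tau>, t]\<close> the germs based at \<open>s\<close> and at
  \<open>\<tau>\<close> differ by \<open>W v u (E (S (u - \<tau>) (W \<tau> s K)))\<close>, whose
  limit is given by \<open>a_limit\<close>.\<close>

lemma b_additive:
 fixes E :: "'w \<Rightarrow>\<^sub>L 'v \<Rightarrow>\<^sub>L 'w"
 assumes K: "smooth_op N K" "0 <= N" and st: "0 <= s" "s <= \<tau>" "\<tau> <= t" "t <= T0"
 shows "b t s E K = b t \<tau> E K + S (t - \<tau>) (b \<tau> s E K) + a t \<tau> E (W \<tau> s K)"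
proof -
 have ts: "0 <= s" "s <= t" "t <= T0" and t\<tau>: "0 <= \<tau>" "\<tau> <= t" "t <= T0" and \<tau>s: "0 <= s" "s <= \<tau>" "\<tau> <= T0" using st by auto
 have "partition_limit \<tau> t (action.shifted (b_germ s E K) t) (b t \<tau> E K + a t \<tau> E (W \<tau> s K))"
 proof (rule partition_limit_cong[OF partition_limit_add[OF b_limit(1)[OF K t\<tau>] a_limit[OF t\<tau>]]])
  fix u v assume uv: "\<tau> <= u" "u < v" "v <= t"
  have "W u s K = W u \<tau> K + S (u - \<tau>) (W \<tau> s K)" using uv st by (intro W_additive) auto
  moreover have "0 <= u" "u <= v" "v <= T0" using uv st by auto
  ultimately show "S (t - v) (b_germ \<tau> E K v u) + S (t - v) (W v u (E (S (u - \<tau>) (W \<tau> s K)))) = S (t - v) (b_germ s E K v u)"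
   by (simp add: b_germ_def W_simps blinfun.add_right)
 qed
 from action.partition_limit_additive[OF b_limit(1)[OF K \<tau>s] this b_limit(1)[OF K ts] st(2,3)]
 show ?thesis by (simp add: algebra_simps)
qed

end

section \<open>The nonlinearity\<close>

lemma has_derivative_fderiv:
 assumes "f differentiable (at x)"
 shows "(f has_derivative blinfun_apply (fderiv f x)) (at x)"
proof -
 have "(f has_derivative frechet_derivative f (at x)) (at x)" using assms by (simp add: frechet_derivative_works)
 then show ?thesis unfolding fderiv_def by (simp add: bounded_linear_Blinfun_apply has_derivative_bounded_linear)
qed

lemma increment_bound:
 fixes f :: "'a::real_normed_vector => 'b::real_normed_vector"
 assumes "\<And>x. (f has_derivative blinfun_apply (D x)) (at x)" "convex X" "\<And>x. x \<in> X ==> norm (D x) <= B" "x \<in> X" "y \<in> X"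
 shows "norm (f x - f y) <= B * norm (x - y)"
 by (rule differentiable_bound[OF assms(2) _ _ assms(4,5), of f "\<lambda>x. blinfun_apply (D x)"])
  (use assms(1,3) in \<open>auto simp: norm_blinfun.rep_eq[symmetric] intro: has_derivative_at_withinI\<close>)

text \<open>First the base point is moved with the same \<open>h\<close>, by the mean value
  inequality for \<open>f (a + h) - f a\<close> as a function of \<open>a\<close>; then
  \<open>h\<close> is changed to \<open>h'\<close> at \<open>a'\<close>.\<close>

lemma double_increment_bound:
 fixes f :: "'a::real_normed_vector => 'b::real_normed_vector"
 assumes D: "\<And>x. (f has_derivative blinfun_apply (D x)) (at x)"
  and bound: "\<And>x. norm (D x) <= B" and lip: "\<And>x y. norm (D x - D y) <= B * norm (x - y)"
 shows "norm (f (a + h) - f a - (f (a' + h') - f a')) <= B * (norm (a - a') * norm h + norm (h - h'))"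
proof -
 have "norm ((f (a + h) - f a) - (f (a' + h) - f a')) <= (B * norm h) * norm (a - a')"
 proof (rule increment_bound[where f = "\<lambda>a. f (a + h) - f a" and D = "\<lambda>a. D (a + h) - D a" and X = UNIV])
  fix x
  have "((\<lambda>a. f (a + h)) has_derivative (\<lambda>y. D (x + h) y)) (at x)"
   by (rule has_derivative_compose[OF _ D, of "\<lambda>a. a + h" "\<lambda>y. y"]) (auto intro!: derivative_eq_intros)
  from has_derivative_diff[OF this D[of x]]
  show "((\<lambda>a. f (a + h) - f a) has_derivative blinfun_apply (D (x + h) - D x)) (at x)"
   by (simp add: blinfun.diff_left[abs_def])
  show "norm (D (x + h) - D x) <= B * norm h" using lip[of "x + h" x] by simp
 qed auto
 moreover have "norm (f (a' + h) - f (a' + h')) <= B * norm (h - h')"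
  using increment_bound[OF D convex_UNIV bound, of "a' + h" "a' + h'"] by simp
 moreover have "f (a + h) - f a - (f (a' + h') - f a') = (f (a + h) - f a - (f (a' + h) - f a')) + (f (a' + h) - f (a' + h'))"
  by simp
 ultimately have "norm (f (a + h) - f a - (f (a' + h') - f a')) <= (B * norm h) * norm (a - a') + B * norm (h - h')"
  by (metis norm_triangle_mono)
 then show ?thesis by (simp add: algebra_simps)
qed

text \<open>Again base point first, then \<open>h\<close>. The mean value inequality is applied on
  balls, where the derivative of the Taylor remainder is small; for the base point this derivative
  is a double increment of \<open>D\<close>, bounded by \<open>dbl\<close>, and there the third
  derivative enters.\<close>

lemma taylor_increment_bound:
 fixes f :: "'a::real_normed_vector => 'b::real_normed_vector"
 assumes D: "\<And>x. (f has_derivative blinfun_apply (D x)) (at x)"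
  and lip: "\<And>x y. norm (D x - D y) <= B * norm (x - y)"
  and dbl: "\<And>a h a'. norm (D (a + h) - D a - (D (a' + h) - D a')) <= B * (norm (a - a') * norm h)"
  and B: "0 <= B"
 shows "norm (f (a + h) - f a - D a h - (f (a' + h') - f a' - D a' h'))
  <= B * (norm (a - a') * (norm h)\<^sup>2 + norm (h - h') * (norm h + norm h'))"
proof -
 have shift: "((\<lambda>y. f (a + y)) has_derivative (\<lambda>z. D (a + x) z)) (at x)" for a x
  by (rule has_derivative_compose[OF _ D, of "\<lambda>y. a + y" "\<lambda>y. y"]) (auto intro!: derivative_eq_intros)
 have lin: "((\<lambda>y. T y) has_derivative (\<lambda>z. T z)) (at x)" for T :: "'a \<Rightarrow>\<^sub>L 'b" and x
  by (rule bounded_linear_imp_has_derivative) (rule blinfun.bounded_linear_right)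
 let ?g = "\<lambda>y. f (a + y) - f (a' + y) - (D a - D a') y"
 have 1: "norm (?g h - ?g 0) <= (B * (norm (a - a') * norm h)) * norm (h - 0)"
 proof (rule increment_bound[where D = "\<lambda>y. D (a + y) - D (a' + y) - (D a - D a')" and X = "cball 0 (norm h)"])
  show "(?g has_derivative blinfun_apply (D (a + x) - D (a' + x) - (D a - D a'))) (at x)" for x
   using has_derivative_diff[OF has_derivative_diff[OF shift[of a x] shift[of a' x]] lin[of "D a - D a'" x]]
   by (simp add: blinfun.diff_left[abs_def])
  show "norm (D (a + x) - D (a' + x) - (D a - D a')) <= B * (norm (a - a') * norm h)"
   if "x \<in> cball 0 (norm h)" for x
  proof -
   have "D (a + x) - D (a' + x) - (D a - D a') = D (a + x) - D a - (D (a' + x) - D a')" by simp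
   also have "norm \<dots> <= B * (norm (a - a') * norm x)" by (rule dbl)
   also have "\<dots> <= B * (norm (a - a') * norm h)" using that B by (intro mult_left_mono) auto
   finally show ?thesis .
  qed
 qed auto
 let ?k = "\<lambda>y. f (a' + y) - D a' y"
 have 2: "norm (?k h - ?k h') <= (B * (norm h + norm h')) * norm (h - h')"
 proof (rule increment_bound[where D = "\<lambda>y. D (a' + y) - D a'" and X = "cball 0 (norm h + norm h')"])
  show "(?k has_derivative blinfun_apply (D (a' + x) - D a')) (at x)" for x
   using has_derivative_diff[OF shift[of a' x] lin[of "D a'" x]] by (simp add: blinfun.diff_left[abs_def])
  show "norm (D (a' + x) - D a') <= B * (norm h + norm h')" if "x \<in> cball 0 (norm h + norm h')" for x
  proof -
   have "norm (D (a' + x) - D a') <= B * norm x" using lip[of "a' + x" a'] by simp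
   also have "\<dots> <= B * (norm h + norm h')" using that B by (intro mult_left_mono) auto
   finally show ?thesis .
  qed
 qed auto
 have "f (a + h) - f a - D a h - (f (a' + h') - f a' - D a' h') = (?g h - ?g 0) + (?k h - ?k h')"
  by (simp add: blinfun.bilinear_simps)
 then have "norm (f (a + h) - f a - D a h - (f (a' + h') - f a' - D a' h'))
   <= (B * (norm (a - a') * norm h)) * norm (h - 0) + (B * (norm h + norm h')) * norm (h - h')"
  using norm_triangle_mono[OF 1 2] by (simp only:)
 then show ?thesis by (simp add: algebra_simps power2_eq_square)
qed

lemma C3_bounds:
 assumes "C3_bounded_derivs G"
 obtains L where "0 <= L" "\<And>x. norm (fderiv G x) <= L" "\<And>x y. norm (G x - G y) <= L * norm (x - y)"
  "\<And>x y. norm (fderiv G x - fderiv G y) <= L * norm (x - y)"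
  "\<And>a h a' h'. norm (G (a + h) - G a - (G (a' + h') - G a')) <= L * (norm (a - a') * norm h + norm (h - h'))"
  "\<And>a h a' h'. norm (fderiv G (a + h) - fderiv G a - (fderiv G (a' + h') - fderiv G a'))
   <= L * (norm (a - a') * norm h + norm (h - h'))"
  "\<And>a h a' h'. norm (G (a + h) - G a - fderiv G a h - (G (a' + h') - G a' - fderiv G a' h'))
   <= L * (norm (a - a') * (norm h)\<^sup>2 + norm (h - h') * (norm h + norm h'))"
proof -
 let ?D = "fderiv G" let ?D2 = "fderiv ?D" let ?D3 = "fderiv ?D2"
 obtain L1 L2 L3 where L: "\<And>x. norm (?D x) <= L1" "\<And>x. norm (?D2 x) <= L2" "\<And>x. norm (?D3 x) <= L3"
  using assms unfolding C3_bounded_derivs_def bounded_iff by (auto simp: image_iff)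
 define L where "L = L1 + L2 + L3"
 have "0 <= L1" "0 <= L2" "0 <= L3" using L order_trans[OF norm_ge_zero] by blast+
 then have L0: "0 <= L" "L1 <= L" "L2 <= L" "L3 <= L" by (auto simp: L_def)
 have B: "norm (?D x) <= L" "norm (?D2 x) <= L" "norm (?D3 x) <= L" for x using L[of x] L0 by linarith+
 have d: "(G has_derivative blinfun_apply (?D x)) (at x)" "(?D has_derivative blinfun_apply (?D2 x)) (at x)"
  "(?D2 has_derivative blinfun_apply (?D3 x)) (at x)" for x
  using assms unfolding C3_bounded_derivs_def by (auto intro: has_derivative_fderiv)
 have lip: "norm (G x - G y) <= L * norm (x - y)" "norm (?D x - ?D y) <= L * norm (x - y)"
  "norm (?D2 x - ?D2 y) <= L * norm (x - y)" for x y
  by (rule increment_bound[OF d(1) convex_UNIV B(1)] increment_bound[OF d(2) convex_UNIV B(2)]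
   increment_bound[OF d(3) convex_UNIV B(3)]; simp)+
 have dbl: "norm (?D (a + h) - ?D a - (?D (a' + h) - ?D a')) <= L * (norm (a - a') * norm h)" for a h a'
  using double_increment_bound[OF d(2) B(2) lip(3), of a h a' h] by simp
 show ?thesis by (rule that[OF L0(1) B(1) lip(1,2) double_increment_bound[OF d(1) B(1) lip(2)]
   double_increment_bound[OF d(2) B(2) lip(3)] taylor_increment_bound[OF d(1) lip(2) dbl L0(1)]])
qed

context rough_noise
begin

lemma neg_frac_pow_inj: "inj (neg_frac_pow S \<beta>)"
proof (rule injI)
 fix x y assume "neg_frac_pow S \<beta> x = neg_frac_pow S \<beta> y"
 then have "neg_frac_pow S \<beta> (x - y) = 0" using neg_frac_pow_linear(2)[OF \<beta>_pos \<beta>_less_1(1), of x y] by simp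
 then show "x = y" using neg_frac_pow_injective[OF \<beta>_pos \<beta>_less_1(1), of "x - y"] by simp
qed

lemma neg_frac_pow_frac_pow: "x \<in> dom_frac_pow S \<beta> ==> neg_frac_pow S \<beta> (frac_pow S \<beta> x) = x"
 by (simp add: frac_pow_def dom_frac_pow_def f_inv_into_f)

lemma smooth_op_frac_pow:
 assumes range: "range (blinfun_apply K) \<subseteq> dom_frac_pow S \<beta>"
  and bl: "bounded_linear (\<lambda>v. frac_pow S \<beta> (K v))" and le: "onorm (\<lambda>v. frac_pow S \<beta> (K v)) <= N"
 shows "smooth_op (1 / Gamma \<beta> * M * (1 / \<beta> + 1 / (1 - \<beta>)) * N) K" unfolding smooth_op_def
proof
 fix v
 let ?C = "1 / Gamma \<beta> * M * (1 / \<beta> + 1 / (1 - \<beta>))"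
 let ?x = "frac_pow S \<beta> (K v)"
 have "neg_frac_pow S \<beta> ?x = K v" using range by (intro neg_frac_pow_frac_pow) blast
 then have "smooth \<beta> (?C * norm ?x) (K v)" (is ?s) using smooth_neg_frac_pow[OF \<beta>_pos \<beta>_less_1(1), of ?x] by simp
 have "norm ?x <= N * norm v" using onorm[OF bl, of v] mult_right_mono[OF le, of "norm v"] by simp
 have "0 <= ?C" using Gamma_real_pos[OF \<beta>_pos] M_ge_1 \<beta>_pos \<beta>_less_1 by simp
 then have "?C * norm ?x <= ?C * (N * norm v)" by (rule mult_left_mono[OF \<open>norm ?x <= N * norm v\<close>])
 then have "?C * norm ?x <= ?C * N * norm v" by (simp only: mult.assoc)
 with \<open>?s\<close> show "smooth \<beta> (?C * N * norm v) (K v)" by (rule smooth_norm_le)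
qed

text \<open>\<open>frac_pow\<close> is a choice inverse. Injectivity of \<open>neg_frac_pow\<close>
  makes it additive on the differences \<open>G x v - G x' v\<close>; this gives the bounded
  linearity through which the operator norm in the Lipschitz bound controls single vectors.\<close>

lemma Lipschitz_smooth_op:
 assumes G: "Lipschitz_into_dom S \<beta> G"
 obtains L N where "0 <= L" "0 <= N" "\<And>x x'. smooth_op (L * norm (x - x')) (G x - G x')" "smooth_op N (G 0)"
proof -
 let ?C = "1 / Gamma \<beta> * M * (1 / \<beta> + 1 / (1 - \<beta>))"
 let ?f = "frac_pow S \<beta>" and ?P = "neg_frac_pow S \<beta>"
 have C: "0 <= ?C" using Gamma_real_pos[OF \<beta>_pos] M_ge_1 \<beta>_pos \<beta>_less_1 by simp
 have r: "range (blinfun_apply (G x)) \<subseteq> dom_frac_pow S \<beta>" and bl: "bounded_linear (\<lambda>v. ?f (G x v))" for x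
  using G by (auto simp: Lipschitz_into_dom_def)
 obtain L where L: "onorm (\<lambda>v. ?f ((G x - G x') v)) <= L * norm (x - x')" for x x'
  using G by (auto simp: Lipschitz_into_dom_def)
 have P: "?P (?f (G x v)) = G x v" for x v using r[of x] by (intro neg_frac_pow_frac_pow) blast
 have eq: "(G x - G x') v = ?P (?f (G x v) - ?f (G x' v))" for x x' v
  by (simp add: neg_frac_pow_linear(2)[OF \<beta>_pos \<beta>_less_1(1)] P blinfun.diff_left)
 have f: "?f ((G x - G x') v) = ?f (G x v) - ?f (G x' v)" for x x' v
  unfolding eq by (simp add: frac_pow_def inv_f_f[OF neg_frac_pow_inj])
 have 1: "smooth_op (?C * \<bar>L\<bar> * norm (x - x')) (G x - G x')" for x x' unfolding mult.assoc[of ?C]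
 proof (rule smooth_op_frac_pow)
  show "range (blinfun_apply (G x - G x')) \<subseteq> dom_frac_pow S \<beta>" by (auto simp: dom_frac_pow_def eq)
  show "bounded_linear (\<lambda>v. ?f ((G x - G x') v))" unfolding f by (rule bounded_linear_sub[OF bl bl])
  show "onorm (\<lambda>v. ?f ((G x - G x') v)) <= \<bar>L\<bar> * norm (x - x')"
   using L[of x x'] mult_right_mono[OF abs_ge_self[of L], of "norm (x - x')"] by simp
 qed
 have 2: "smooth_op (?C * onorm (\<lambda>v. ?f (G 0 v))) (G 0)" by (rule smooth_op_frac_pow[OF r bl order_refl])
 show thesis by (rule that[OF mult_nonneg_nonneg[OF C abs_ge_zero] mult_nonneg_nonneg[OF C onorm_pos_le[OF bl]] 1 2])
qed

end

section \<open>Sewing estimates\<close>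

lemma powr_prod_le:
 fixes x y w a b :: real
 assumes "0 <= x" "x <= w" "0 <= y" "y <= w" "0 <= a" "0 <= b"
 shows "x powr a * y powr b <= w powr (a + b)" unfolding powr_add using assms by (intro mult_mono powr_mono2) auto

lemma powr_le_1_antimono: "0 <= x ==> x <= 1 ==> 0 < a ==> a <= b ==> x powr b <= x powr (a :: real)"
 by (cases "x = 0") (auto intro: powr_mono')

context rough_noise
begin

lemma weight_ge_1: "0 < s ==> s <= 1 ==> 1 <= s powr - \<beta>" using powr_mono2'[of "- \<beta>" s 1] \<beta>_pos by simp

lemma weight_mono: "0 < s ==> s <= t ==> t powr - \<beta> <= s powr - \<beta>" using powr_mono2'[of "- \<beta>" s t] \<beta>_pos by simp

text \<open>Trades the missing exponent \<open>\<beta>\<close> for the weight at \<open>s\<close>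
  and leaves the full \<open>T powr \<alpha>\<close>, the factor that small \<open>T\<close> makes
  contractive.\<close>

lemma weight_gain:
 assumes "0 < s" "0 <= x" "x <= T" "s <= T"
 shows "x powr (\<alpha> - \<beta>) <= T powr \<alpha> * s powr - \<beta>"
proof -
 have "x powr (\<alpha> - \<beta>) <= T powr (\<alpha> - \<beta>)" using assms \<beta>_less by (intro powr_mono2) auto
 also have "\<dots> = T powr \<alpha> * T powr - \<beta>" unfolding powr_add[symmetric] by simp
 also have "\<dots> <= T powr \<alpha> * s powr - \<beta>" using assms by (intro mult_left_mono weight_mono) auto
 finally show ?thesis .
qed

definition cS :: real where "cS = M / (2 powr (\<alpha> - \<beta>) - 1)"

lemma cS_nonneg: "0 <= cS"
proof -
 have "1 <= 2 powr (\<alpha> - \<beta>)" using two_powr_gt_1[of "\<alpha> - \<beta>"] \<beta>_less by linarith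
 then show ?thesis unfolding cS_def using M_ge_1 by (intro divide_nonneg_nonneg) auto
qed

text \<open>The mild increments of \<open>I\<close> are \<open>\<alpha>\<close>-Hoelder. The plain
  ones contain \<open>S (t - s) - S 0\<close> applied to \<open>I s\<close>, which is smooth of
  order \<open>\<beta>\<close> with a constant of order \<open>s powr (\<alpha> - \<beta>)\<close>
  by \<open>smooth_hoelder_path\<close>; \<open>weight_gain\<close> converts the surplus into
  \<open>T powr \<alpha>\<close>.\<close>

lemma path_bounds:
 assumes T: "0 < T" "T <= 1" and C: "0 <= C" and I0: "I 0 = 0"
  and "\<forall>s t. 0 <= s --> s <= t --> t <= T --> norm (I t - S (t - s) (I s)) <= C * (t - s) powr \<alpha>"
 shows "0 <= t ==> t <= T ==> norm (I t) <= C * T powr \<alpha>"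
  and "0 < s ==> s <= T ==> smooth \<beta> (cS * C * T powr \<alpha> * s powr - \<beta>) (I s)"
  and "0 < s ==> s <= t ==> t <= T ==>
   norm (I t - I s) <= (1 + cS / \<beta>) * C * T powr \<alpha> * s powr - \<beta> * (t - s) powr \<beta>"
  and "continuous_on {0..T} I"
proof -
 note H = assms(5)[rule_format]
 show "norm (I t) <= C * T powr \<alpha>" if t: "0 <= t" "t <= T" for t
 proof -
  have "norm (I t) <= C * t powr \<alpha>" using H[of 0 t] t I0 by (simp add: blinfun.zero_right)
  also have "\<dots> <= C * T powr \<alpha>" using t C \<alpha>_pos by (intro mult_left_mono powr_mono2) auto
  finally show ?thesis .
 qed
 have sm: "smooth \<beta> (cS * C * s powr (\<alpha> - \<beta>)) (I s)" if s: "0 <= s" "s <= T" for s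
 proof -
  have "smooth \<beta> (M * C / (2 powr (\<alpha> - \<beta>) - 1) * (s - 0) powr (\<alpha> - \<beta>)) (I s)"
   by (rule smooth_hoelder_path[where s = 0 and I = I and a = \<alpha> and H = C]) (use C I0 \<beta>_less \<beta>_pos \<beta>_less_1 H s in auto)
  then show ?thesis by (simp add: cS_def)
 qed
 show "smooth \<beta> (cS * C * T powr \<alpha> * s powr - \<beta>) (I s)" if s: "0 < s" "s <= T" for s
 proof (rule smooth_norm_le[OF sm])
  have "cS * C * s powr (\<alpha> - \<beta>) <= cS * C * (T powr \<alpha> * s powr - \<beta>)"
   using s C cS_nonneg by (intro mult_left_mono weight_gain) auto
  then show "cS * C * s powr (\<alpha> - \<beta>) <= cS * C * T powr \<alpha> * s powr - \<beta>" by (simp add: mult.assoc)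
 qed (use s in auto)
 have inc: "norm (I t - I s) <= C * (t - s) powr \<alpha> + cS * C * s powr (\<alpha> - \<beta>) / \<beta> * (t - s) powr \<beta>"
  if st: "0 <= s" "s <= t" "t <= T" for s t
 proof -
  have 1: "norm (S (t - s) (I s) - I s) <= cS * C * s powr (\<alpha> - \<beta>) / \<beta> * (t - s) powr \<beta>"
   using st \<beta>_pos by (intro smooth_S_diff sm) auto
  have "I t - I s = (I t - S (t - s) (I s)) + (S (t - s) (I s) - I s)" by simp
  then show ?thesis using norm_triangle_mono[OF H[OF st] 1] by (simp only:)
 qed
 have a: "(t - s) powr \<alpha> = (t - s) powr (\<alpha> - \<beta>) * (t - s) powr \<beta>" for s t unfolding powr_add[symmetric] by simp
 show "norm (I t - I s) <= (1 + cS / \<beta>) * C * T powr \<alpha> * s powr - \<beta> * (t - s) powr \<beta>"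
  if st: "0 < s" "s <= t" "t <= T" for s t
 proof -
  let ?g = "T powr \<alpha> * s powr - \<beta>"
  have "C * (t - s) powr \<alpha> <= C * (?g * (t - s) powr \<beta>)"
   unfolding a using st C by (intro mult_left_mono mult_right_mono weight_gain) auto
  moreover have "cS * C * s powr (\<alpha> - \<beta>) / \<beta> * (t - s) powr \<beta> <= cS * C * ?g / \<beta> * (t - s) powr \<beta>"
   using st C cS_nonneg \<beta>_pos by (intro mult_right_mono divide_right_mono mult_left_mono weight_gain) auto
  ultimately have "norm (I t - I s) <= C * (?g * (t - s) powr \<beta>) + cS * C * ?g / \<beta> * (t - s) powr \<beta>"
   using inc[of s t] st by linarith
  then show ?thesis by (simp add: algebra_simps)
 qed
 show "continuous_on {0..T} I"
 proof (rule hoelder_continuous_on[OF \<beta>_pos])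
  fix s t assume st: "0 <= s" "s <= t" "t <= T"
  have "C * (t - s) powr \<alpha> <= C * (1 * (t - s) powr \<beta>)"
   unfolding a using st T C \<beta>_less by (intro mult_left_mono mult_right_mono powr_le1) auto
  moreover have "cS * C * s powr (\<alpha> - \<beta>) / \<beta> * (t - s) powr \<beta> <= cS * C * 1 / \<beta> * (t - s) powr \<beta>"
   using st T C cS_nonneg \<beta>_pos \<beta>_less by (intro mult_right_mono divide_right_mono mult_left_mono powr_le1) auto
  ultimately have "norm (I t - I s) <= C * (1 * (t - s) powr \<beta>) + cS * C * 1 / \<beta> * (t - s) powr \<beta>"
   using inc[OF st] by linarith
  then show "norm (I t - I s) <= (C + cS * C / \<beta>) * (t - s) powr \<beta>" by (simp add: algebra_simps)
 qed
qed

sublocale operator_action: semigroup_action "\<lambda>t \<zeta>. S t o\<^sub>L (\<zeta> :: ('v, 'w) Z)" M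
proof (intro semigroup_action.intro)
 show "norm (S t o\<^sub>L \<zeta>) <= M * norm \<zeta>" if "0 <= t" for t and \<zeta> :: "('v, 'w) Z"
 proof (rule norm_blinfun_bound)
  show "norm ((S t o\<^sub>L \<zeta>) E) <= M * norm \<zeta> * norm E" for E
   using order_trans[OF norm_S[OF that, of "\<zeta> E"] mult_left_mono[OF norm_blinfun[of \<zeta> E], of M]] M_ge_1
   by (simp add: mult.assoc)
 qed (use M_ge_1 in simp)
qed (auto intro!: blinfun_eqI simp: S_0 S_add bounded_bilinear.bounded_linear_right[OF bounded_bilinear_blinfun_compose])

text \<open>The germs of which \<open>\<Xi>\<^sup>(\<^sup>z\<^sup>)\<close> and its differences are instances.\<close>

definition germ_z :: "(real => 'v \<Rightarrow>\<^sub>L 'w) => (real => 'w) => real => real => ('v, 'w) Z"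
 where "germ_z K x v u = Blinfun (\<lambda>E. b v u E (K u) + a v u E (x u))"

lemma germ_z_apply:
 assumes K: "smooth_op N (K u)" "0 <= N" and uv: "0 <= u" "u <= v" "v <= T0"
 shows "germ_z K x v u E = b v u E (K u) + a v u E (x u)"
proof -
 have "bounded_linear (\<lambda>E. b v u E (K u) + a v u E (x u))"
 proof (rule bounded_linear_add; rule bounded_linear_intro)
  show "norm (b v u E (K u)) <= norm E * ((cc + cb) * (norm (K u) * (v - u) powr (2 * \<alpha>) + N * (v - u) powr (2 * \<alpha> + \<beta>)))" for E
   using norm_b[OF K uv, of E] by (simp add: mult_ac)
  show "norm (a v u E (x u)) <= norm E * (ca * norm (x u) * (v - u) powr \<alpha>)" for E
   using norm_a[OF uv, of E "x u"] by (simp add: mult_ac)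
 qed (simp_all add: b_linear(1,2)[OF K uv] a_linear(3,4)[OF uv])
 then show ?thesis by (simp add: germ_z_def bounded_linear_Blinfun_apply)
qed

text \<open>\<open>b_additive\<close> leaves \<open>a\<close> of \<open>W m u (K u)\<close>, and
  \<open>a_additive\<close> leaves \<open>a\<close> of the mild increment of \<open>x\<close>. They
  nearly cancel when \<open>x\<close> is driven by \<open>K\<close>, which is what
  \<open>tracks\<close> measures.\<close>

lemma germ_z_delta2:
 assumes K: "\<And>u. 0 <= u ==> u <= T0 ==> smooth_op N (K u)" "0 <= N" and um: "0 <= u" "u <= m" "m <= v" "v <= T0"
 shows "operator_action.delta2 (germ_z K x) v m u E
  = b v m E (K u - K m) + a v m E (W m u (K u) - (x m - S (m - u) (x u)))"
proof -
 have uv: "0 <= u" "u <= v" "v <= T0" and mv: "0 <= m" "m <= v" "v <= T0" and mu: "0 <= u" "u <= m" "m <= T0" using um by auto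
 note Ku = K(1)[OF mu(1)] and Km = K(1)[OF mv(1)]
 have "operator_action.delta2 (germ_z K x) v m u E
   = b v u E (K u) + a v u E (x u) - (b v m E (K m) + a v m E (x m)) - S (v - m) (b m u E (K u) + a m u E (x u))"
  using germ_z_apply[of N K u v x E] germ_z_apply[of N K m v x E] germ_z_apply[of N K u m x E] uv mv mu Ku Km K(2)
  by (simp add: operator_action.delta2_def blinfun.diff_left)
 moreover have "b v u E (K u) = b v m E (K u) + S (v - m) (b m u E (K u)) + a v m E (W m u (K u))"
  using b_additive[OF _ K(2) um] Ku uv by simp
 moreover have "a v u E (x u) = a v m E (S (m - u) (x u)) + S (v - m) (a m u E (x u))" by (rule a_additive[OF um])
 moreover have "b v m E (K u - K m) = b v m E (K u) - b v m E (K m)"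
  using b_linear(3)[OF _ K(2) mv _ K(2), of "K u" "K m" E] Ku Km uv mv by simp
 moreover have "a v m E (W m u (K u) - (x m - S (m - u) (x u)))
   = a v m E (W m u (K u)) - (a v m E (x m) - a v m E (S (m - u) (x u)))" by (simp add: a_linear(2)[OF mv])
 ultimately show ?thesis by (simp add: blinfun.add_right)
qed

text \<open>\<open>x\<close> is controlled by the noise with derivative \<open>K\<close>; the better rate is singular at \<open>s = 0\<close>.\<close>

definition tracks :: "real => real => (real => 'v \<Rightarrow>\<^sub>L 'w) => (real => 'w) => bool"
 where "tracks T C K x \<longleftrightarrow>
  (\<forall>s t. 0 <= s --> s <= t --> t <= T --> norm (W t s (K s) - (x t - S (t - s) (x s))) <= C * (t - s) powr \<alpha>) \<and>
  (\<forall>s t. 0 < s --> s <= t --> t <= T -->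
   norm (W t s (K s) - (x t - S (t - s) (x s))) <= C * (s powr - \<beta> * (t - s) powr (\<alpha> + \<beta>)))"

lemma tracks_mono:
 assumes x: "tracks T C K x" and C: "C <= C'"
 shows "tracks T C' K x" unfolding tracks_def
 using x[unfolded tracks_def] by (auto intro!: order_trans[OF _ mult_right_mono[OF C]])

text \<open>The 3 counts one \<open>C\<close> for \<open>norm (K u - K m)\<close> and two for the
  smoothness of \<open>K u - K m\<close>, taken as a sum.\<close>

definition cZ :: real
 where "cZ = operator_action.sewing_const \<beta> (2 * \<alpha> + \<beta> - 1) * (3 * (cc + cb) + ca)"

lemma sewing_const_nonneg:
 assumes "0 < e" "\<theta> < 1"
 shows "0 <= action.sewing_const \<theta> e" "0 <= operator_action.sewing_const \<theta> e"
 unfolding action.sewing_const_def operator_action.sewing_const_def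
 using assms one_minus_powr_pos[OF assms(1)] by (intro divide_nonneg_nonneg mult_nonneg_nonneg; simp)+

lemma \<epsilon>z_pos: "0 < 2 * \<alpha> + \<beta> - 1" using \<alpha>_2\<beta> \<beta>_less by simp

lemma cZ_nonneg: "0 <= cZ"
 unfolding cZ_def using sewing_const_nonneg(2)[OF \<epsilon>z_pos \<beta>_less_1(1)] cc_nonneg cb_nonneg ca_nonneg by simp

definition sews_z :: "real => real => (real => real => ('v, 'w) Z) => (real => ('v, 'w) Z) => bool"
 where "sews_z T C \<Xi> I \<longleftrightarrow> operator_action.sewn T \<Xi> I \<and> (\<forall>s t. 0 <= s --> s <= t --> t <= T -->
  norm (hat_incr (\<lambda>t \<zeta>. S t o\<^sub>L \<zeta>) I t s - \<Xi> t s) <= cZ * C * t powr - \<beta> * (t - s) powr (2 * \<alpha> + \<beta>))"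

text \<open>Three sources give the same order \<open>2 * \<alpha> + \<beta>\<close>: the increment
  of \<open>K\<close> in norm, \<open>\<beta>\<close> at the rate \<open>2 * \<alpha>\<close>; its
  smoothness, without decay, at the rate \<open>2 * \<alpha> + \<beta>\<close>; and the tracking
  error, \<open>\<alpha> + \<beta>\<close> at the rate \<open>\<alpha>\<close>.\<close>

lemma germ_z_sewing:
 assumes T: "0 < T" "T <= T0" and C: "0 <= C"
  and K: "\<And>u. 0 <= u ==> u <= T0 ==> smooth_op C (K u)"
  and K1: "\<And>u m. 0 <= u ==> u <= m ==> m <= T ==> norm (K u - K m) <= C"
  and K2: "\<And>u m. 0 < u ==> u <= m ==> m <= T ==> norm (K u - K m) <= C * (u powr - \<beta> * (m - u) powr \<beta>)"
  and x: "tracks T C K x"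
 shows "\<exists>I. sews_z T C (germ_z K x) I" unfolding sews_z_def
proof -
 let ?c = "3 * (cc + cb) + ca"
 \<comment> \<open>Used twice, unweighted and weighted: \<open>p\<close> and \<open>q\<close> stand
   for the rates of \<open>K\<close> and of the tracking error, \<open>B\<close> for the resulting
   bound of the defect.\<close>
 have core: "norm (operator_action.delta2 (germ_z K x) v m u) <= ?c * C * B"
  if um: "0 <= u" "u <= m" "m <= v" "v <= T" and p: "norm (K u - K m) <= C * p"
   and q: "norm (W m u (K u) - (x m - S (m - u) (x u))) <= C * q"
   and B: "p * (v - m) powr (2 * \<alpha>) <= B" "(v - m) powr (2 * \<alpha> + \<beta>) <= B" "q * (v - m) powr \<alpha> <= B"
  for u m v p q B
 proof (rule norm_blinfun_bound)
  have B0: "0 <= B" using B(2) by (meson order_trans powr_ge_zero)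
  show "0 <= ?c * C * B" using B0 C cc_nonneg cb_nonneg ca_nonneg by simp
  fix E
  let ?y = "W m u (K u) - (x m - S (m - u) (x u))"
  have mv: "0 <= m" "m <= v" "v <= T0" using um T by auto
  have "smooth_op (C + C) (K u - K m)" using um T by (intro smooth_op_diff K) auto
  then have "norm (b v m E (K u - K m))
    <= (cc + cb) * norm E * (norm (K u - K m) * (v - m) powr (2 * \<alpha>) + (C + C) * (v - m) powr (2 * \<alpha> + \<beta>))"
   using C by (intro norm_b mv) auto
  also have "\<dots> <= (cc + cb) * norm E * (C * B + (C + C) * B)"
  proof (intro mult_left_mono add_mono)
   have "norm (K u - K m) * (v - m) powr (2 * \<alpha>) <= C * p * (v - m) powr (2 * \<alpha>)"
    by (rule mult_right_mono[OF p]) simp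
   also have "\<dots> = C * (p * (v - m) powr (2 * \<alpha>))" by (rule mult.assoc)
   also have "\<dots> <= C * B" by (rule mult_left_mono[OF B(1) C])
   finally show "norm (K u - K m) * (v - m) powr (2 * \<alpha>) <= C * B" .
  qed (use C B cc_nonneg cb_nonneg in auto)
  finally have 1: "norm (b v m E (K u - K m)) <= (cc + cb) * norm E * (C * B + (C + C) * B)" .
  have "norm (a v m E ?y) <= ca * norm E * norm ?y * (v - m) powr \<alpha>" by (rule norm_a[OF mv])
  also have "\<dots> <= ca * norm E * (C * q) * (v - m) powr \<alpha>"
   using ca_nonneg by (intro mult_right_mono mult_left_mono q) auto
  also have "\<dots> = ca * norm E * (C * (q * (v - m) powr \<alpha>))" by simp
  also have "\<dots> <= ca * norm E * (C * B)" using ca_nonneg C by (intro mult_left_mono B) auto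
  finally have 2: "norm (a v m E ?y) <= ca * norm E * (C * B)" .
  have "operator_action.delta2 (germ_z K x) v m u E = b v m E (K u - K m) + a v m E ?y"
   by (rule germ_z_delta2[OF K C]) (use um T in auto)
  then have "norm (operator_action.delta2 (germ_z K x) v m u E)
    <= (cc + cb) * norm E * (C * B + (C + C) * B) + ca * norm E * (C * B)"
   using norm_triangle_mono[OF 1 2] by (simp only:)
  then show "norm (operator_action.delta2 (germ_z K x) v m u E) <= ?c * C * B * norm E" by (simp add: algebra_simps)
 qed
 have e: "2 * \<alpha> + \<beta> - \<beta> = 2 * \<alpha>" "1 + (2 * \<alpha> + \<beta> - 1) = 2 * \<alpha> + \<beta>" by auto
 have c0: "0 <= ?c * C" using C cc_nonneg cb_nonneg ca_nonneg by simp
 show "\<exists>I. operator_action.sewn T (germ_z K x) I \<and> (\<forall>s t. 0 <= s --> s <= t --> t <= T -->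
   norm (hat_incr (\<lambda>t \<zeta>. S t o\<^sub>L \<zeta>) I t s - germ_z K x t s) <= cZ * C * t powr - \<beta> * (t - s) powr (2 * \<alpha> + \<beta>))"
 proof (rule operator_action.sewing_weighted[OF \<epsilon>z_pos _ \<beta>_less_1(1) c0 T(1), of "germ_z K x", unfolded e])
  show "0 <= \<beta>" using \<beta>_pos by simp
  fix u assume u: "0 <= u" "u <= T"
  have "germ_z K x u u E = 0" for E
   using germ_z_apply[of C K u u x E] K[of u] C u T norm_a[of u u E "x u"] norm_b[of C "K u" u u E] by simp
  then show "germ_z K x u u = 0" by (intro blinfun_eqI) simp
 next
  fix u m v assume um: "0 <= u" "u <= m" "m <= v" "v <= T"
  show "norm (operator_action.delta2 (germ_z K x) v m u) <= ?c * C * (v - u) powr (2 * \<alpha>)"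
  proof (rule core[OF um])
   show "norm (K u - K m) <= C * 1" using K1 um by simp
   show "norm (W m u (K u) - (x m - S (m - u) (x u))) <= C * (m - u) powr \<alpha>" using x um by (simp add: tracks_def)
   have "(v - m) powr (2 * \<alpha>) <= (v - u) powr (2 * \<alpha>)" using um \<alpha>_pos by (intro powr_mono2) auto
   then show "1 * (v - m) powr (2 * \<alpha>) <= (v - u) powr (2 * \<alpha>)" by simp
   moreover have "(v - m) powr (2 * \<alpha> + \<beta>) <= (v - m) powr (2 * \<alpha>)"
    using um T T0 \<alpha>_pos \<beta>_pos by (intro powr_le_1_antimono) auto
   ultimately show "(v - m) powr (2 * \<alpha> + \<beta>) <= (v - u) powr (2 * \<alpha>)" by simp
   show "(m - u) powr \<alpha> * (v - m) powr \<alpha> <= (v - u) powr (2 * \<alpha>)"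
    unfolding mult_2 using um \<alpha>_pos by (intro powr_prod_le) auto
  qed
 next
  fix u m v assume um: "0 < u" "u <= m" "m <= v" "v <= T"
  have u1: "1 <= u powr - \<beta>" using um T T0 by (intro weight_ge_1) auto
  have x2: "norm (W m u (K u) - (x m - S (m - u) (x u))) <= C * (u powr - \<beta> * (m - u) powr (\<alpha> + \<beta>))"
   using x um by (simp add: tracks_def)
  show "norm (operator_action.delta2 (germ_z K x) v m u) <= ?c * C * u powr - \<beta> * (v - u) powr (2 * \<alpha> + \<beta>)"
   unfolding mult.assoc[of "?c * C"]
  proof (rule core[OF less_imp_le[OF um(1)] um(2-4) K2[OF um(1,2)] x2])
   have "(m - u) powr \<beta> * (v - m) powr (2 * \<alpha>) <= (v - u) powr (\<beta> + 2 * \<alpha>)"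
    using um \<alpha>_pos \<beta>_pos by (intro powr_prod_le) auto
   then show "u powr - \<beta> * (m - u) powr \<beta> * (v - m) powr (2 * \<alpha>) <= u powr - \<beta> * (v - u) powr (2 * \<alpha> + \<beta>)"
    by (simp add: mult.assoc mult_left_mono add.commute)
   have "(m - u) powr (\<alpha> + \<beta>) * (v - m) powr \<alpha> <= (v - u) powr (\<alpha> + \<beta> + \<alpha>)"
    using um \<alpha>_pos \<beta>_pos by (intro powr_prod_le) auto
   moreover have "\<alpha> + \<beta> + \<alpha> = 2 * \<alpha> + \<beta>" by simp
   ultimately show "u powr - \<beta> * (m - u) powr (\<alpha> + \<beta>) * (v - m) powr \<alpha> <= u powr - \<beta> * (v - u) powr (2 * \<alpha> + \<beta>)"
    by (simp only: mult.assoc) (simp add: mult_left_mono)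
   have "1 * (v - m) powr (2 * \<alpha> + \<beta>) <= u powr - \<beta> * (v - u) powr (2 * \<alpha> + \<beta>)"
    using um u1 \<alpha>_pos \<beta>_pos by (intro mult_mono powr_mono2) auto
   then show "(v - m) powr (2 * \<alpha> + \<beta>) <= u powr - \<beta> * (v - u) powr (2 * \<alpha> + \<beta>)" by simp
  qed (use um in auto)
 qed (auto simp: cZ_def mult.assoc)
qed

definition cR :: real
 where "cR = 2 * (cc + cb) + (ca + cW) + M * cW * (1 / \<beta> + 1 / (\<alpha> + \<beta>))"

lemma cR_nonneg: "0 <= cR" unfolding cR_def using cc_nonneg cb_nonneg ca_nonneg cW_nonneg M_ge_1 \<beta>_pos \<alpha>_pos by simp

text \<open>The expression is the second component of the image up to the sewing error.
  \<open>b\<close> is of order \<open>2 * \<alpha>\<close> and yields a factor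
  \<open>T powr \<alpha>\<close>; \<open>a - W\<close> is only as small as \<open>x\<close>, so
  \<open>X\<close> enters without a power of \<open>T\<close>.\<close>

lemma germ_z_remainder:
 fixes E :: "'w \<Rightarrow>\<^sub>L 'v \<Rightarrow>\<^sub>L 'w"
 assumes st: "0 <= s" "s <= t" "t <= T" and T: "T <= T0" and K: "smooth_op N K" "0 <= N" "norm K <= N"
  and x: "norm x <= X"
 shows "norm (b t s E K + a t s E x - W t s (E x)) <= cR * (N * T powr \<alpha> + X) * (t - s) powr \<alpha> * norm E"
  and "0 < s ==> smooth \<beta> (X * s powr - \<beta>) x ==>
   norm (b t s E K + a t s E x - W t s (E x))
    <= cR * (N * T powr \<alpha> + X) * (s powr - \<beta> * (t - s) powr (\<alpha> + \<beta>)) * norm E"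
proof -
 have X: "0 <= X" using x by (meson norm_ge_zero order_trans)
 have st': "0 <= s" "s <= t" "t <= T0" using st T by auto
 have "norm (b t s E K) <= (cc + cb) * norm E * (norm K * (t - s) powr (2 * \<alpha>) + N * (t - s) powr (2 * \<alpha> + \<beta>))"
  by (rule norm_b[OF K(1,2) st'])
 also have "\<dots> <= (cc + cb) * norm E * (N * (t - s) powr (2 * \<alpha>) + N * (t - s) powr (2 * \<alpha>))"
  using K(2,3) st' T0 cc_nonneg cb_nonneg \<alpha>_pos \<beta>_pos
  by (intro mult_left_mono add_mono mult_right_mono powr_le_1_antimono) auto
 finally have b: "norm (b t s E K) <= 2 * (cc + cb) * norm E * N * (t - s) powr (2 * \<alpha>)" by (simp add: algebra_simps)
 have split: "b t s E K + a t s E x - W t s (E x) = b t s E K + (a t s E x - W t s (E x))" by simp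
 have comb: "norm (b t s E K + a t s E x - W t s (E x)) <= cR * (N * T powr \<alpha> + X) * w * norm E"
  if p: "(t - s) powr (2 * \<alpha>) <= T powr \<alpha> * w" and w: "0 <= w"
   and r: "norm (a t s E x - W t s (E x)) <= k * norm E * X * w" "k <= cR - 2 * (cc + cb)" "0 <= k" for w k
 proof -
  have "norm (b t s E K) <= 2 * (cc + cb) * norm E * N * (T powr \<alpha> * w)"
   using b mult_left_mono[OF p, of "2 * (cc + cb) * norm E * N"] cc_nonneg cb_nonneg K(2) by simp
  from norm_triangle_mono[OF this r(1)]
  have "norm (b t s E K + a t s E x - W t s (E x)) <= 2 * (cc + cb) * (norm E * (N * (T powr \<alpha> * w))) + k * (norm E * (X * w))"
   unfolding split by (simp add: mult.assoc)
  also have "\<dots> <= cR * (norm E * (N * (T powr \<alpha> * w))) + cR * (norm E * (X * w))"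
   using r(2,3) cc_nonneg cb_nonneg K(2) X w by (intro add_mono mult_right_mono) auto
  finally show ?thesis by (simp add: algebra_simps)
 qed
 show "norm (b t s E K + a t s E x - W t s (E x)) <= cR * (N * T powr \<alpha> + X) * (t - s) powr \<alpha> * norm E"
 proof (rule comb)
  have "(t - s) powr (2 * \<alpha>) = (t - s) powr \<alpha> * (t - s) powr \<alpha>" unfolding powr_add[symmetric] by simp
  also have "\<dots> <= T powr \<alpha> * (t - s) powr \<alpha>" using st \<alpha>_pos by (intro mult_right_mono powr_mono2) auto
  finally show "(t - s) powr (2 * \<alpha>) <= T powr \<alpha> * (t - s) powr \<alpha>" .
  have "norm (a t s E x - W t s (E x)) <= ca * norm E * norm x * (t - s) powr \<alpha> + cW * norm E * norm x * (t - s) powr \<alpha>"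
   by (rule order_trans[OF norm_triangle_ineq4 add_mono[OF norm_a[OF st'] norm_W_apply[OF st']]])
  also have "\<dots> = (ca + cW) * norm E * norm x * (t - s) powr \<alpha>" by (simp add: algebra_simps)
  also have "\<dots> <= (ca + cW) * norm E * X * (t - s) powr \<alpha>"
   using x ca_nonneg cW_nonneg by (intro mult_right_mono mult_left_mono) auto
  finally show "norm (a t s E x - W t s (E x)) <= (ca + cW) * norm E * X * (t - s) powr \<alpha>" .
  show "ca + cW <= cR - 2 * (cc + cb)" unfolding cR_def using M_ge_1 cW_nonneg \<beta>_pos \<alpha>_pos by simp
 qed (use ca_nonneg cW_nonneg in auto)
 assume s: "0 < s" and sm: "smooth \<beta> (X * s powr - \<beta>) x"
 show "norm (b t s E K + a t s E x - W t s (E x))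
    <= cR * (N * T powr \<alpha> + X) * (s powr - \<beta> * (t - s) powr (\<alpha> + \<beta>)) * norm E"
 proof (rule comb)
  have "(t - s) powr (2 * \<alpha>) = (t - s) powr (\<alpha> - \<beta>) * (t - s) powr (\<alpha> + \<beta>)" unfolding powr_add[symmetric] by simp
  also have "\<dots> <= T powr \<alpha> * s powr - \<beta> * (t - s) powr (\<alpha> + \<beta>)"
   using s st by (intro mult_right_mono weight_gain) auto
  finally show "(t - s) powr (2 * \<alpha>) <= T powr \<alpha> * (s powr - \<beta> * (t - s) powr (\<alpha> + \<beta>))" by (simp add: mult.assoc)
  show "norm (a t s E x - W t s (E x)) <= M * cW * (1 / \<beta> + 1 / (\<alpha> + \<beta>)) * norm E * X * (s powr - \<beta> * (t - s) powr (\<alpha> + \<beta>))"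
   using a_near[OF sm \<beta>_pos st', of E] by (simp add: mult.assoc)
  show "M * cW * (1 / \<beta> + 1 / (\<alpha> + \<beta>)) <= cR - 2 * (cc + cb)" unfolding cR_def using ca_nonneg cW_nonneg by simp
 qed (use M_ge_1 cW_nonneg \<beta>_pos \<alpha>_pos in auto)
qed

end

section \<open>The solution map\<close>

context semigroup_action
begin

lemma sewn_cong:
 assumes "sewn T \<Xi> I" "\<And>u v. 0 <= u ==> u < v ==> v <= T ==> \<Xi> v u = \<Xi>' v u"
 shows "sewn T \<Xi>' I" unfolding sewn_def
proof (intro conjI ballI, goal_cases)
 case (3 p)
 obtain t s where p: "p = (t, s)" by (cases p)
 then have ts: "0 <= s" "t <= T" using 3 by (auto simp: Delta_def)
 have "partition_limit s t (shifted \<Xi> t) (hat_incr act I t s)" using assms(1) 3 p by (auto simp: sewn_def)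
 then have "partition_limit s t (shifted \<Xi>' t) (hat_incr act I t s)"
  by (rule partition_limit_cong) (use assms(2) ts in auto)
 then show ?case by (simp add: p)
qed (use assms(1) in \<open>auto simp: sewn_def\<close>)

lemma delta2_diff:
 "m <= v ==> delta2 (\<lambda>v u. \<Xi> v u - \<Xi>' v u) v m u = delta2 \<Xi> v m u - delta2 \<Xi>' v m u" by (simp add: delta2_def act_simps)

lemma hat_incr_additive:
 assumes "s <= \<tau>" "\<tau> <= t"
 shows "hat_incr act I t s = hat_incr act I t \<tau> + act (t - \<tau>) (hat_incr act I \<tau> s)"
 using assms act_add[of "t - \<tau>" "\<tau> - s" "I s"] by (simp add: hat_incr_def act_simps)

end

text \<open>Second differences and Taylor remainders are stated for two pairs of arguments, because
  the solution map is estimated through differences. A single \<open>L\<close> serves all of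
  them.\<close>

locale rough_equation = rough_noise S A Ainv M \<delta> \<omega> \<omega>2 \<alpha> \<beta> T0 H
 for S :: "real => 'w::{banach, second_countable_topology} \<Rightarrow>\<^sub>L 'w" and A Ainv M \<delta>
  and \<omega> :: "real => 'v::real_normed_vector" and \<omega>2 \<alpha> \<beta> T0 H +
 fixes G :: "'w => 'v \<Rightarrow>\<^sub>L 'w" and L N0 :: real
 assumes L_nonneg: "0 <= L" and N0_nonneg: "0 <= N0"
  and DG_bound: "norm (fderiv G x) <= L" and G_lip: "norm (G x - G x') <= L * norm (x - x')"
  and DG_lip: "norm (fderiv G x - fderiv G x') <= L * norm (x - x')"
  and G_double: "norm (G (x + h) - G x - (G (x' + h') - G x')) <= L * (norm (x - x') * norm h + norm (h - h'))"
  and DG_double: "norm (fderiv G (x + h) - fderiv G x - (fderiv G (x' + h') - fderiv G x'))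
   <= L * (norm (x - x') * norm h + norm (h - h'))"
  and G_taylor: "norm (G (x + h) - G x - fderiv G x h - (G (x' + h') - G x' - fderiv G x' h'))
   <= L * (norm (x - x') * (norm h)\<^sup>2 + norm (h - h') * (norm h + norm h'))"
  and G_smooth: "smooth_op (L * norm (x - x')) (G x - G x')" and G0_smooth: "smooth_op N0 (G 0)"
begin

abbreviation \<Xi>y :: "(real => 'w) \<times> (real => real => ('v, 'w) Z) => real => real => 'w"
 where "\<Xi>y \<equiv> Xi_y A S \<omega> G"

text \<open>One radius for the four suprema, as real inequalities that include \<open>s = t\<close>.
  Up to the factor 6 this is a bound on \<open>X_norm\<close>.\<close>

definition X_bound :: "real => real => (real => 'w) => (real => real => ('v, 'w) Z) => bool"
 where "X_bound T \<rho> y z \<longleftrightarrow>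
  (\<forall>t. 0 <= t --> t <= T --> norm (y t) <= \<rho>) \<and>
  (\<forall>s t. 0 < s --> s <= t --> t <= T --> norm (y t - y s) <= \<rho> * (s powr - \<beta> * (t - s) powr \<beta>)) \<and>
  (\<forall>s t. 0 <= s --> s <= t --> t <= T --> norm (z t s) <= \<rho> * (t - s) powr \<alpha>) \<and>
  (\<forall>s t. 0 < s --> s <= t --> t <= T --> norm (z t s) <= \<rho> * (s powr - \<beta> * (t - s) powr (\<alpha> + \<beta>)))"

lemma X_boundD:
 assumes "X_bound T \<rho> y z"
 shows "0 <= t ==> t <= T ==> norm (y t) <= \<rho>"
  "0 < s ==> s <= t ==> t <= T ==> norm (y t - y s) <= \<rho> * (s powr - \<beta> * (t - s) powr \<beta>)"
  "0 <= s ==> s <= t ==> t <= T ==> norm (z t s) <= \<rho> * (t - s) powr \<alpha>"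
  "0 < s ==> s <= t ==> t <= T ==> norm (z t s) <= \<rho> * (s powr - \<beta> * (t - s) powr (\<alpha> + \<beta>))"
 using assms by (auto simp: X_bound_def)

lemma X_bound_incr:
 assumes "X_bound T \<rho> y z" "0 <= s" "s <= t" "t <= T"
 shows "norm (y t - y s) <= 2 * \<rho>"
 using norm_triangle_ineq4[of "y t" "y s"] X_boundD(1)[OF assms(1), of t] X_boundD(1)[OF assms(1), of s] assms by simp

definition X_algebra :: "real => (real => 'w) => (real => real => ('v, 'w) Z) => bool"
 where "X_algebra T y z \<longleftrightarrow> (\<forall>s \<tau> t E. 0 <= s --> s <= \<tau> --> \<tau> <= t --> t <= T -->
  z t s E - z t \<tau> E - S (t - \<tau>) (z \<tau> s E) = W t \<tau> (E (y \<tau> - y s)))"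

text \<open>The relation defining the space contributes
  \<open>W v m (fderiv G (y u) (y m - y u))\<close>, which completes the increment of
  \<open>G\<close> along \<open>y\<close> to a Taylor remainder. Without \<open>z\<close> the defect
  would only be of order \<open>\<alpha> + \<beta>\<close>, below 1.\<close>

lemma Xi_y_delta2:
 assumes alg: "X_algebra T y z" and um: "0 <= u" "u <= m" "m <= v" "v <= T" and T: "T <= T0"
 shows "action.delta2 (\<Xi>y (y, z)) v m u
  = - (W v m (G (y m) - G (y u) - fderiv G (y u) (y m - y u)) + z v m (fderiv G (y m) - fderiv G (y u)))"
proof -
 have mv: "0 <= m" "m <= v" "v <= T0" using um T by auto
 have *: "x - x' - h = h' ==> x = x' + h + h'" for x x' h h' :: 'w by (simp add: algebra_simps)
 have 1: "z v u E = z v m E + S (v - m) (z m u E) + W v m (E (y m - y u))" for E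
  by (rule *) (use alg um in \<open>simp add: X_algebra_def\<close>)
 have 2: "W v u (G (y u)) = W v m (G (y u)) + S (v - m) (W m u (G (y u)))" using um T by (intro W_additive) auto
 show ?thesis unfolding action.delta2_def Xi_y_def prod.case 1[of "fderiv G (y u)"] 2 W_simps(2)[OF mv]
  by (simp add: blinfun.add_right blinfun.diff_right)
qed

text \<open>\<open>4 * \<rho>\<^sup>2 + 8 * \<rho>\<close> comes from the Taylor remainder with
  increments of size \<open>2 * \<rho> * p\<close>; it also dominates the
  \<open>4 * \<rho> + 2 * \<rho>\<^sup>2\<close> of the terms with \<open>z\<close>.\<close>

definition C1 :: "real => real" where "C1 \<rho> = (cW + 1) * L * (4 * \<rho>\<^sup>2 + 8 * \<rho>)"

text \<open>Serves both bounds required by \<open>sewing_weighted\<close>: \<open>p\<close> is the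
  size of increments of \<open>y\<close>, \<open>q\<close> that of \<open>z\<close>. With
  \<open>p = 1\<close> the factor 2 is the trivial bound of an increment by two values.\<close>

lemma Xi_y_delta2_bound:
 assumes y: "X_algebra T y z" "X_algebra T y' z'" and T: "T <= T0" and \<rho>: "0 <= \<rho>" and D: "0 <= D"
  and um: "0 <= u" "u <= m" "m <= v" "v <= T" and p: "0 <= p" and yy: "norm (y u - y' u) <= D"
  and h: "norm (y m - y u) <= 2 * \<rho> * p" "norm (y' m - y' u) <= 2 * \<rho> * p"
   "norm (y m - y u - (y' m - y' u)) <= 2 * D * p"
  and z: "norm (z' v m) <= \<rho> * q" "norm (z v m - z' v m) <= D * q"
  and B: "p\<^sup>2 * (v - m) powr \<alpha> <= B" "p * q <= B" and q: "0 <= q"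
 shows "norm (action.delta2 (\<lambda>v u. \<Xi>y (y, z) v u - \<Xi>y (y', z') v u) v m u) <= C1 \<rho> * D * B"
proof -
 have mv: "0 <= m" "m <= v" "v <= T0" using um T by auto
 let ?h = "y m - y u" and ?h' = "y' m - y' u"
 let ?Q = "G (y m) - G (y u) - fderiv G (y u) ?h" and ?Q' = "G (y' m) - G (y' u) - fderiv G (y' u) ?h'"
 let ?d = "fderiv G (y m) - fderiv G (y u)" and ?d' = "fderiv G (y' m) - fderiv G (y' u)"
 have pq: "0 <= p * q" using p q by simp
 then have B0: "0 <= B" using B(2) by linarith
 have "norm (?Q - ?Q') <= L * (norm (y u - y' u) * (norm ?h)\<^sup>2 + norm (?h - ?h') * (norm ?h + norm ?h'))"
  using G_taylor[of "y u" ?h "y' u" ?h'] by simp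
 also have "\<dots> <= L * (D * (2 * \<rho> * p)\<^sup>2 + 2 * D * p * (2 * \<rho> * p + 2 * \<rho> * p))"
  using L_nonneg yy h D \<rho> p by (intro mult_left_mono add_mono mult_mono power_mono) auto
 also have "\<dots> = L * (4 * \<rho>\<^sup>2 + 8 * \<rho>) * D * p\<^sup>2" by (simp add: power2_eq_square algebra_simps)
 finally have "norm (W v m (?Q - ?Q')) <= cW * (L * (4 * \<rho>\<^sup>2 + 8 * \<rho>) * D * p\<^sup>2) * (v - m) powr \<alpha>"
  using cW_nonneg by (intro order_trans[OF norm_W[OF mv]] mult_right_mono mult_left_mono) auto
 also have "\<dots> = cW * L * (4 * \<rho>\<^sup>2 + 8 * \<rho>) * D * (p\<^sup>2 * (v - m) powr \<alpha>)" by simp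
 also have "\<dots> <= cW * L * (4 * \<rho>\<^sup>2 + 8 * \<rho>) * D * B" using cW_nonneg L_nonneg \<rho> D by (intro mult_left_mono B) auto
 finally have 1: "norm (W v m (?Q - ?Q')) <= cW * L * (4 * \<rho>\<^sup>2 + 8 * \<rho>) * D * B" .
 have "norm ((z v m - z' v m) ?d) <= norm (z v m - z' v m) * norm ?d" by (rule norm_blinfun)
 also have "\<dots> <= (D * q) * (L * (2 * \<rho> * p))"
 proof (intro mult_mono z)
  have "norm ?d <= L * norm ?h" by (rule DG_lip)
  also have "\<dots> <= L * (2 * \<rho> * p)" using L_nonneg h by (intro mult_left_mono) auto
  finally show "norm ?d <= L * (2 * \<rho> * p)" .
 qed (use D q in auto)
 finally have 2: "norm ((z v m - z' v m) ?d) <= (D * q) * (L * (2 * \<rho> * p))" .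
 have "norm (z' v m (?d - ?d')) <= norm (z' v m) * norm (?d - ?d')" by (rule norm_blinfun)
 also have "\<dots> <= (\<rho> * q) * (L * (D * (2 * \<rho> * p) + 2 * D * p))"
 proof (intro mult_mono z)
  have "norm (?d - ?d') <= L * (norm (y u - y' u) * norm ?h + norm (?h - ?h'))"
   using DG_double[of "y u" ?h "y' u" ?h'] by simp
  also have "\<dots> <= L * (D * (2 * \<rho> * p) + 2 * D * p)"
   using L_nonneg yy h D by (intro mult_left_mono add_mono mult_mono) auto
  finally show "norm (?d - ?d') <= L * (D * (2 * \<rho> * p) + 2 * D * p)" .
 qed (use \<rho> q in auto)
 finally have "norm (z' v m (?d - ?d')) <= (\<rho> * q) * (L * (D * (2 * \<rho> * p) + 2 * D * p))" .
 from norm_triangle_mono[OF 2 this]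
 have "norm ((z v m - z' v m) ?d + z' v m (?d - ?d')) <= L * (4 * \<rho> + 2 * \<rho>\<^sup>2) * D * (p * q)"
  by (simp add: power2_eq_square algebra_simps)
 also have "\<dots> <= L * (4 * \<rho>\<^sup>2 + 8 * \<rho>) * D * B" using L_nonneg \<rho> D B(2) pq by (intro mult_mono) auto
 finally have 3: "norm ((z v m - z' v m) ?d + z' v m (?d - ?d')) <= L * (4 * \<rho>\<^sup>2 + 8 * \<rho>) * D * B" .
 have "action.delta2 (\<lambda>v u. \<Xi>y (y, z) v u - \<Xi>y (y', z') v u) v m u
   = - (W v m (?Q - ?Q') + ((z v m - z' v m) ?d + z' v m (?d - ?d')))"
  unfolding action.delta2_diff[OF um(3)] Xi_y_delta2[OF y(1) um T] Xi_y_delta2[OF y(2) um T] W_simps(2)[OF mv, of ?Q]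
  by (simp add: blinfun.bilinear_simps)
 then have "norm (action.delta2 (\<lambda>v u. \<Xi>y (y, z) v u - \<Xi>y (y', z') v u) v m u)
   <= cW * L * (4 * \<rho>\<^sup>2 + 8 * \<rho>) * D * B + L * (4 * \<rho>\<^sup>2 + 8 * \<rho>) * D * B"
  using norm_triangle_mono[OF 1 3] by (simp only: norm_minus_cancel)
 then show ?thesis by (simp add: C1_def algebra_simps)
qed

definition C2 :: "real => real" where "C2 \<rho> = L * (1 + \<rho>) + action.sewing_const (2 * \<beta>) \<epsilon>b * C1 \<rho>"

lemma C1_nonneg: "0 <= \<rho> ==> 0 <= C1 \<rho>" using cW_nonneg L_nonneg by (simp add: C1_def)

lemma C2_nonneg: "0 <= \<rho> ==> 0 <= C2 \<rho>"
 using sewing_const_nonneg(1)[OF \<epsilon>b_pos \<beta>_less_1(2)] C1_nonneg L_nonneg by (simp add: C2_def)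

text \<open>The weight is \<open>u powr - (2 * \<beta>)\<close>, since the defect is quadratic in
  weighted quantities. The sewn difference follows \<open>W\<close> of the difference of
  \<open>G\<close> up to the \<open>z\<close> term and the sewing error; this is the tracking needed
  to sew the second component.\<close>

lemma y_difference:
 assumes T: "0 < T" "T <= T0" and \<rho>: "0 <= \<rho>" and D: "0 <= D"
  and y: "X_bound T \<rho> y z" "X_bound T \<rho> y' z'" "X_bound T D (\<lambda>t. y t - y' t) (\<lambda>t s. z t s - z' t s)"
  and alg: "X_algebra T y z" "X_algebra T y' z'"
 obtains J where "action.sewn T (\<lambda>v u. \<Xi>y (y, z) v u - \<Xi>y (y', z') v u) J"
  and "tracks T (C2 \<rho> * D) (\<lambda>s. G (y s) - G (y' s)) J"
proof -
 let ?\<Xi> = "\<lambda>v u. \<Xi>y (y, z) v u - \<Xi>y (y', z') v u"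
 let ?sc = "action.sewing_const (2 * \<beta>) \<epsilon>b"
 have e: "\<alpha> + 2 * \<beta> - 2 * \<beta> = \<alpha>" "1 + \<epsilon>b = \<alpha> + 2 * \<beta>" by auto
 have c0: "0 <= C1 \<rho> * D" using C1_nonneg \<rho> D by simp
 have "\<exists>J. action.sewn T ?\<Xi> J \<and> (\<forall>s t. 0 <= s --> s <= t --> t <= T -->
   norm (hat_incr (\<lambda>t. blinfun_apply (S t)) J t s - ?\<Xi> t s) <= ?sc * (C1 \<rho> * D) * t powr - (2 * \<beta>) * (t - s) powr (1 + \<epsilon>b))"
 proof (rule action.sewing_weighted[OF \<epsilon>b_pos _ \<beta>_less_1(2) c0 T(1), of ?\<Xi>])
  show "0 <= 2 * \<beta>" using \<beta>_pos by simp
 next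
  show "?\<Xi> u u = 0" if "0 <= u" "u <= T" for u
   using that T X_boundD(3)[OF y(1), of u u] X_boundD(3)[OF y(2), of u u] by (simp add: Xi_y_def)
 next
  fix u m v assume um: "0 <= u" "u <= m" "m <= v" "v <= T"
  show "norm (action.delta2 ?\<Xi> v m u) <= C1 \<rho> * D * (v - u) powr (1 + \<epsilon>b - 2 * \<beta>)" unfolding e
  proof (rule Xi_y_delta2_bound[OF alg T(2) \<rho> D um, where p = 1 and q = "(v - m) powr \<alpha>"])
   show "norm (y u - y' u) <= D" using X_boundD(1)[OF y(3)] um by simp
   show "norm (y m - y u) <= 2 * \<rho> * 1" "norm (y' m - y' u) <= 2 * \<rho> * 1"
    using X_bound_incr[OF y(1), of u m] X_bound_incr[OF y(2), of u m] um by auto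
   show "norm (y m - y u - (y' m - y' u)) <= 2 * D * 1"
    using X_bound_incr[OF y(3), of u m] um by (simp add: algebra_simps)
   show "norm (z' v m) <= \<rho> * (v - m) powr \<alpha>" "norm (z v m - z' v m) <= D * (v - m) powr \<alpha>"
    using X_boundD(3)[OF y(2), of m v] X_boundD(3)[OF y(3), of m v] um by auto
   show "1\<^sup>2 * (v - m) powr \<alpha> <= (v - u) powr \<alpha>" "1 * (v - m) powr \<alpha> <= (v - u) powr \<alpha>"
    using um \<alpha>_pos by (auto intro!: powr_mono2)
  qed auto
 next
  fix u m v assume um: "0 < u" "u <= m" "m <= v" "v <= T"
  let ?p = "u powr - \<beta> * (m - u) powr \<beta>" and ?q = "u powr - \<beta> * (v - m) powr (\<alpha> + \<beta>)"
  have p: "0 <= \<rho> * ?p" "0 <= D * ?p" using \<rho> D by simp_all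
  have u2: "u powr - (2 * \<beta>) = u powr - \<beta> * u powr - \<beta>"
   and m2: "(m - u) powr (2 * \<beta>) = (m - u) powr \<beta> * (m - u) powr \<beta>" unfolding powr_add[symmetric] by simp_all
  show "norm (action.delta2 ?\<Xi> v m u) <= C1 \<rho> * D * u powr - (2 * \<beta>) * (v - u) powr (1 + \<epsilon>b)"
   unfolding e mult.assoc[of "C1 \<rho> * D"]
  proof (rule Xi_y_delta2_bound[OF alg T(2) \<rho> D less_imp_le[OF um(1)] um(2-4), where p = ?p and q = ?q])
   show "norm (y u - y' u) <= D" using X_boundD(1)[OF y(3)] um by simp
   show "norm (y m - y u) <= 2 * \<rho> * ?p" "norm (y' m - y' u) <= 2 * \<rho> * ?p"
    using X_boundD(2)[OF y(1), of u m] X_boundD(2)[OF y(2), of u m] um p by linarith+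
   have eq: "y m - y u - (y' m - y' u) = y m - y' m - (y u - y' u)" by simp
   show "norm (y m - y u - (y' m - y' u)) <= 2 * D * ?p"
    unfolding eq using X_boundD(2)[OF y(3), of u m] um p by linarith
   have w: "m powr - \<beta> * (v - m) powr (\<alpha> + \<beta>) <= ?q" using um by (intro mult_right_mono weight_mono) auto
   show "norm (z' v m) <= \<rho> * ?q" using X_boundD(4)[OF y(2), of m v] mult_left_mono[OF w \<rho>] um by simp
   show "norm (z v m - z' v m) <= D * ?q" using X_boundD(4)[OF y(3), of m v] mult_left_mono[OF w D] um by simp
   have "?p\<^sup>2 * (v - m) powr \<alpha> = u powr - (2 * \<beta>) * ((m - u) powr (2 * \<beta>) * (v - m) powr \<alpha>)"
    unfolding u2 m2 by (simp add: power2_eq_square)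
   also have "\<dots> <= u powr - (2 * \<beta>) * (v - u) powr (2 * \<beta> + \<alpha>)"
    using um \<alpha>_pos \<beta>_pos by (intro mult_left_mono powr_prod_le) auto
   finally show "?p\<^sup>2 * (v - m) powr \<alpha> <= u powr - (2 * \<beta>) * (v - u) powr (\<alpha> + 2 * \<beta>)" by (simp only: add.commute)
   have "?p * ?q = u powr - (2 * \<beta>) * ((m - u) powr \<beta> * (v - m) powr (\<alpha> + \<beta>))" unfolding u2 by simp
   also have "\<dots> <= u powr - (2 * \<beta>) * (v - u) powr (\<beta> + (\<alpha> + \<beta>))"
    using um \<alpha>_pos \<beta>_pos by (intro mult_left_mono powr_prod_le) auto
   also have "\<beta> + (\<alpha> + \<beta>) = \<alpha> + 2 * \<beta>" by simp
   finally show "?p * ?q <= u powr - (2 * \<beta>) * (v - u) powr (\<alpha> + 2 * \<beta>)" .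
  qed auto
 qed auto
 then obtain J where J: "action.sewn T ?\<Xi> J" and est: "0 <= s ==> s <= t ==> t <= T ==>
   norm (hat_incr (\<lambda>t. blinfun_apply (S t)) J t s - ?\<Xi> t s) <= ?sc * (C1 \<rho> * D) * t powr - (2 * \<beta>) * (t - s) powr (\<alpha> + 2 * \<beta>)" for s t
  unfolding e by blast
 have sc: "0 <= ?sc * (C1 \<rho> * D)" using sewing_const_nonneg(1)[OF \<epsilon>b_pos \<beta>_less_1(2)] c0 by simp
 \<comment> \<open>\<open>q\<close> is the rate, unweighted or weighted.\<close>
 have core: "norm (W t s (G (y s) - G (y' s)) - (J t - S (t - s) (J s))) <= C2 \<rho> * D * q"
  if st: "0 <= s" "s <= t" "t <= T" and q: "norm (z' t s) <= \<rho> * q" "norm (z t s - z' t s) <= D * q" "0 <= q"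
   "t powr - (2 * \<beta>) * (t - s) powr (\<alpha> + 2 * \<beta>) <= q" for s t q
 proof -
  let ?R = "z t s (fderiv G (y s)) - z' t s (fderiv G (y' s))"
  have st': "0 <= s" "s <= t" "t <= T0" using st T by auto
  have "norm ((z t s - z' t s) (fderiv G (y s))) <= (D * q) * L"
   using q D DG_bound[of "y s"] by (intro order_trans[OF norm_blinfun] mult_mono) auto
  moreover have "norm (z' t s (fderiv G (y s) - fderiv G (y' s))) <= (\<rho> * q) * (L * D)"
  proof (intro order_trans[OF norm_blinfun] mult_mono q)
   have "norm (fderiv G (y s) - fderiv G (y' s)) <= L * norm (y s - y' s)" by (rule DG_lip)
   also have "\<dots> <= L * D" using X_boundD(1)[OF y(3), of s] st L_nonneg by (intro mult_left_mono) auto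
   finally show "norm (fderiv G (y s) - fderiv G (y' s)) <= L * D" .
  qed (use \<rho> q in auto)
  ultimately have "norm ((z t s - z' t s) (fderiv G (y s)) + z' t s (fderiv G (y s) - fderiv G (y' s))) <= (D * q) * L + (\<rho> * q) * (L * D)"
   by (rule norm_triangle_mono)
  then have R: "norm ?R <= (D * q) * L + (\<rho> * q) * (L * D)" by (simp add: blinfun.bilinear_simps)
  have "norm (hat_incr (\<lambda>t. blinfun_apply (S t)) J t s - ?\<Xi> t s) <= ?sc * (C1 \<rho> * D) * q"
   using est[OF st] mult_left_mono[OF q(4) sc] by (simp add: mult.assoc)
  from norm_triangle_mono[OF R this]
  have "norm (?R + (hat_incr (\<lambda>t. blinfun_apply (S t)) J t s - ?\<Xi> t s)) <= C2 \<rho> * D * q"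
   by (simp add: C2_def algebra_simps)
  moreover have "W t s (G (y s) - G (y' s)) - (J t - S (t - s) (J s)) = - (?R + (hat_incr (\<lambda>t. blinfun_apply (S t)) J t s - ?\<Xi> t s))"
   by (simp add: Xi_y_def hat_incr_def W_simps(2)[OF st'])
  ultimately show ?thesis by (simp only: norm_minus_cancel)
 qed
 show thesis
 proof (rule that[OF J], unfold tracks_def, intro conjI allI impI)
  fix s t assume st: "0 <= s" "s <= t" "t <= T"
  show "norm (W t s (G (y s) - G (y' s)) - (J t - S (t - s) (J s))) <= C2 \<rho> * D * (t - s) powr \<alpha>"
  proof (rule core[OF st X_boundD(3)[OF y(2) st] X_boundD(3)[OF y(3) st]])
   \<comment> \<open>The surplus exponent \<open>2 * \<beta>\<close> pays for the whole weight at
     \<open>t\<close>, as \<open>t - s \<le> t\<close>; in the weighted case below only half of the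
     weight is paid.\<close>
   have "t powr - (2 * \<beta>) * (t - s) powr (2 * \<beta>) <= 1"
   proof (cases "t = 0")
    case False
    then have "(t - s) powr (2 * \<beta>) <= t powr (2 * \<beta>)" using st \<beta>_pos by (intro powr_mono2) auto
    then show ?thesis using False st by (simp add: powr_minus field_simps)
   qed simp
   from mult_right_mono[OF this, of "(t - s) powr \<alpha>"]
   show "t powr - (2 * \<beta>) * (t - s) powr (\<alpha> + 2 * \<beta>) <= (t - s) powr \<alpha>" by (simp add: powr_add mult_ac)
  qed auto
 next
  fix s t assume s: "0 < s" and st: "s <= t" "t <= T"
  show "norm (W t s (G (y s) - G (y' s)) - (J t - S (t - s) (J s))) <= C2 \<rho> * D * (s powr - \<beta> * (t - s) powr (\<alpha> + \<beta>))"
  proof (rule core[OF less_imp_le[OF s] st X_boundD(4)[OF y(2) s st] X_boundD(4)[OF y(3) s st]])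
   have "t powr - \<beta> * (t - s) powr \<beta> <= 1"
    using powr_mono2[of \<beta> "t - s" t] s st \<beta>_pos by (simp add: powr_minus field_simps)
   then have "t powr - \<beta> * (t - s) powr \<beta> * (t powr - \<beta> * (t - s) powr (\<alpha> + \<beta>)) <= 1 * (s powr - \<beta> * (t - s) powr (\<alpha> + \<beta>))"
    using s st by (intro mult_mono weight_mono) auto
   moreover have "t powr - (2 * \<beta>) * (t - s) powr (\<alpha> + 2 * \<beta>)
     = t powr - \<beta> * (t - s) powr \<beta> * (t powr - \<beta> * (t - s) powr (\<alpha> + \<beta>))"
   proof -
    have "t powr - (2 * \<beta>) = t powr - \<beta> * t powr - \<beta>" unfolding powr_add[symmetric] by simp
    moreover have "(t - s) powr (\<alpha> + 2 * \<beta>) = (t - s) powr \<beta> * (t - s) powr (\<alpha> + \<beta>)"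
     unfolding powr_add[symmetric] by (simp add: algebra_simps)
    ultimately show ?thesis by simp
   qed
   ultimately show "t powr - (2 * \<beta>) * (t - s) powr (\<alpha> + 2 * \<beta>) <= s powr - \<beta> * (t - s) powr (\<alpha> + \<beta>)" by simp
  qed auto
 qed
qed

end

context rough_equation
begin

text \<open>The Hoelder constant of the mild increments of a difference: the tracking error plus
  \<open>W\<close> of an operator of norm at most \<open>L * D\<close>.\<close>

definition C3 :: "real => real" where "C3 \<rho> = C2 \<rho> + cW * L"

text \<open>\<open>L * (2 * \<rho> + 2)\<close> bounds the double increments of \<open>G\<close>
  along two paths, \<open>C2 \<rho>\<close> the tracking error.\<close>

definition C4 :: "real => real" where "C4 \<rho> = L * (2 * \<rho> + 2) + C2 \<rho>"

text \<open>The Lipschitz constant of the solution map apart from \<open>T powr \<alpha>\<close>: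
  sewing error and germ of the second component, then the increments of the first.\<close>

definition \<kappa> :: "real => real"
 where "\<kappa> \<rho> = cZ * C4 \<rho> + cR * (L + (1 + cS) * C3 \<rho>) + (1 + cS / \<beta>) * C3 \<rho>"

text \<open>Bounds the image of the zero pair. Powers of \<open>T\<close> are estimated by 1, so
  that \<open>C0 r\<close>, and with it the radius, does not depend on \<open>T\<close>.\<close>

definition C0 :: "real => real"
 where "C0 r = (1 + 1 / \<beta>) * M * r + (1 + cS / \<beta>) * (cW * norm (G 0))
  + cR * (N0 + norm (G 0) + (M * r + (1 + cS) * (cW * norm (G 0))))"

lemma C3_nonneg: "0 <= \<rho> ==> 0 <= C3 \<rho>" and C4_nonneg: "0 <= \<rho> ==> 0 <= C4 \<rho>"
 using C2_nonneg[of \<rho>] cW_nonneg L_nonneg by (auto simp: C3_def C4_def)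

lemma \<kappa>_bounds:
 assumes "0 <= \<rho>"
 shows "C3 \<rho> <= \<kappa> \<rho>" "(1 + cS / \<beta>) * C3 \<rho> <= \<kappa> \<rho>" "cZ * C4 \<rho> + cR * (L + (1 + cS) * C3 \<rho>) <= \<kappa> \<rho>" "0 <= \<kappa> \<rho>"
proof -
 have n: "0 <= cZ * C4 \<rho>" "0 <= cR * (L + (1 + cS) * C3 \<rho>)" "0 <= C3 \<rho>" "0 <= cS / \<beta> * C3 \<rho>"
  using cZ_nonneg C4_nonneg[OF assms] cR_nonneg C3_nonneg[OF assms] L_nonneg cS_nonneg \<beta>_pos by simp_all
 show "C3 \<rho> <= \<kappa> \<rho>" "(1 + cS / \<beta>) * C3 \<rho> <= \<kappa> \<rho>" "cZ * C4 \<rho> + cR * (L + (1 + cS) * C3 \<rho>) <= \<kappa> \<rho>" "0 <= \<kappa> \<rho>"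
  using n unfolding \<kappa>_def distrib_right[of 1 "cS / \<beta>"] by linarith+
qed

lemma C0_bounds:
 assumes "0 <= r"
 shows "M * r + cW * norm (G 0) <= C0 r" "M * r / \<beta> + (1 + cS / \<beta>) * (cW * norm (G 0)) <= C0 r"
  "cR * (N0 + norm (G 0) + (M * r + (1 + cS) * (cW * norm (G 0)))) <= C0 r" "0 <= C0 r"
proof -
 have n: "0 <= M * r" "0 <= M * r / \<beta>" "0 <= cW * norm (G 0)" "0 <= cS / \<beta> * (cW * norm (G 0))"
   "0 <= cR * (N0 + norm (G 0) + (M * r + (1 + cS) * (cW * norm (G 0))))"
  using cR_nonneg N0_nonneg cS_nonneg \<beta>_pos cW_nonneg M_ge_1 assms by simp_all
 have eq: "C0 r = M * r + M * r / \<beta> + (cW * norm (G 0) + cS / \<beta> * (cW * norm (G 0)))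
  + cR * (N0 + norm (G 0) + (M * r + (1 + cS) * (cW * norm (G 0))))" by (simp add: C0_def distrib_right)
 show "M * r + cW * norm (G 0) <= C0 r" "M * r / \<beta> + (1 + cS / \<beta>) * (cW * norm (G 0)) <= C0 r"
  "cR * (N0 + norm (G 0) + (M * r + (1 + cS) * (cW * norm (G 0)))) <= C0 r" "0 <= C0 r"
  using n unfolding eq distrib_right[of 1 "cS / \<beta>"] by linarith+
qed

lemma G_path_smooth:
 assumes "norm x <= \<rho>"
 shows "smooth_op (L * \<rho> + N0) (G x)"
proof (rule smooth_op_norm_le)
 show "smooth_op (L * norm (x - 0) + N0) (G x)" using smooth_op_add[OF G_smooth[of x 0] G0_smooth] by simp
 show "L * norm (x - 0) + N0 <= L * \<rho> + N0" using assms L_nonneg by (simp add: mult_left_mono)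
qed

end

locale rough_equation_on = rough_equation S A Ainv M \<delta> \<omega> \<omega>2 \<alpha> \<beta> T0 H G L N0
 for S :: "real => 'w::{banach, second_countable_topology} \<Rightarrow>\<^sub>L 'w" and A Ainv M \<delta>
  and \<omega> :: "real => 'v::real_normed_vector" and \<omega>2 \<alpha> \<beta> T0 H G L N0 +
 fixes T r :: real and \<xi> :: 'w
 assumes T: "0 < T" "T <= T0" and \<xi>: "norm \<xi> <= r"
begin

lemma T_le_1: "T <= 1" and T_powr: "0 <= T powr \<alpha>" "T powr \<alpha> <= 1" using T T0 \<alpha>_pos by (auto intro: powr_le1)

lemma r_nonneg: "0 <= r" by (rule order_trans[OF norm_ge_zero \<xi>])

definition X_struct :: "(real => 'w) => (real => real => ('v, 'w) Z) => bool"
 where "X_struct y z \<longleftrightarrow> (\<forall>t. t \<notin> {0..T} --> y t = 0) \<and> continuous_on {0..T} y \<and>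
  (\<forall>t s. (t, s) \<notin> Delta T --> z t s = 0) \<and> X_algebra T y z"

abbreviation "act \<equiv> \<lambda>t (\<zeta> :: ('v, 'w) Z). S t o\<^sub>L \<zeta>"

definition Iy :: "(real => 'w) => (real => real => ('v, 'w) Z) => real => 'w"
 where "Iy y z = sew (\<lambda>t. blinfun_apply (S t)) T (\<Xi>y (y, z))"

definition ysol :: "(real => 'w) => (real => real => ('v, 'w) Z) => real => 'w"
 where "ysol y z t = (if t \<in> {0..T} then S t \<xi> + Iy y z t else 0)"

definition gz :: "(real => 'w) => (real => real => ('v, 'w) Z) => real => real => ('v, 'w) Z"
 where "gz y z = germ_z (\<lambda>u. G (y u)) (ysol y z)"

definition Iz :: "(real => 'w) => (real => real => ('v, 'w) Z) => real => ('v, 'w) Z"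
 where "Iz y z = sew act T (gz y z)"

definition zsol :: "(real => 'w) => (real => real => ('v, 'w) Z) => real => real => ('v, 'w) Z"
 where "zsol y z t s = (if (t, s) \<in> Delta T
  then Blinfun (\<lambda>E. hat_incr act (Iz y z) t s E - W t s (E (ysol y z s))) else 0)"

lemma solution_map_eq: "solution_map A S \<omega> \<omega>2 G \<xi> T (y, z) = (ysol y z, zsol y z)"
proof -
 have y: "(\<lambda>t. if t \<in> {0..T} then S t \<xi> + sew (\<lambda>t. blinfun_apply (S t)) T (\<Xi>y (y, z)) t else 0) = ysol y z"
  by (auto simp: ysol_def Iy_def)
 have z: "Xi_z A S \<omega> \<omega>2 G y (ysol y z) = gz y z" by (intro ext) (simp add: Xi_z_def gz_def germ_z_def)
 show ?thesis unfolding solution_map_def Let_def fst_conv y z Iz_def[symmetric] by (auto simp: zsol_def intro!: ext)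
qed

lemma zsol_apply:
 assumes "0 <= s" "s <= t" "t <= T"
 shows "zsol y z t s E = hat_incr act (Iz y z) t s E - W t s (E (ysol y z s))"
proof (cases "s = t")
 case True
 then show ?thesis using assms T by (simp add: zsol_def Delta_def hat_incr_def operator_action.act_0)
next
 case False
 have st: "0 <= s" "s <= t" "t <= T0" using assms T by auto
 have "bounded_linear (\<lambda>E. hat_incr act (Iz y z) t s E - W t s (E (ysol y z s)))"
  by (intro bounded_linear_sub blinfun.bounded_linear_right
    bounded_linear_compose[OF W_bounded_linear[OF st] blinfun.bounded_linear_left])
 then show ?thesis using False assms by (simp add: zsol_def Delta_def bounded_linear_Blinfun_apply)
qed

lemma X_bound_zero: "0 <= \<rho> ==> X_bound T \<rho> (\<lambda>_. 0) (\<lambda>_ _. 0)" by (simp add: X_bound_def)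

lemma X_struct_zero: "X_struct (\<lambda>_. 0) (\<lambda>_ _. 0)"
proof -
 have "W t \<tau> 0 = 0" if "0 <= \<tau>" "\<tau> <= t" "t <= T" for \<tau> t using W_simps(4)[of \<tau> t] that T by simp
 then show ?thesis by (auto simp: X_struct_def X_algebra_def blinfun.zero_right)
qed

text \<open>For the zero pair the germ reduces to \<open>W t s (G 0)\<close>, which is
  additive.\<close>

lemma Iy_zero_sewn:
 "action.sewn T (\<Xi>y (\<lambda>_. 0, \<lambda>_ _. 0)) (\<lambda>t. if t \<in> {0..T} then W t 0 (G 0) else 0)"
proof -
 have "action.sewn T (\<lambda>t s. W t s (G 0)) (\<lambda>t. if t \<in> {0..T} then W t 0 (G 0) else 0)"
 proof (rule action.sewn_additive(1)[OF _ T(1)])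
  show "action.delta2 (\<lambda>t s. W t s (G 0)) v m u = 0" if "0 <= u" "u <= m" "m <= v" "v <= T" for u m v
   using W_additive[of u m v "G 0"] that T by (simp add: action.delta2_def)
 qed
 then show ?thesis by (simp add: Xi_y_def)
qed

lemma Iy_zero: "Iy (\<lambda>_. 0) (\<lambda>_ _. 0) = (\<lambda>t. if t \<in> {0..T} then W t 0 (G 0) else 0)"
 unfolding Iy_def by (rule action.sew_eqI[OF Iy_zero_sewn])

text \<open>A single germ is the additive one of the zero pair minus a difference that
  \<open>y_difference\<close> sews.\<close>

lemma Iy_sewn:
 assumes y: "X_struct y z" "X_bound T \<rho> y z" "0 <= \<rho>"
 shows "action.sewn T (\<Xi>y (y, z)) (Iy y z)"
proof -
 have d: "X_bound T \<rho> (\<lambda>t. 0 - y t) (\<lambda>t s. 0 - z t s)" using y(2) by (simp add: X_bound_def norm_minus_commute)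
 obtain J where "action.sewn T (\<lambda>v u. \<Xi>y (\<lambda>_. 0, \<lambda>_ _. 0) v u - \<Xi>y (y, z) v u) J"
  by (rule y_difference[OF T y(3) y(3) X_bound_zero[OF y(3)] y(2) d]) (use y(1) X_struct_zero in \<open>auto simp: X_struct_def\<close>)
 from action.sewn_diff[OF Iy_zero_sewn this]
 have s: "action.sewn T (\<Xi>y (y, z)) (\<lambda>t. (if t \<in> {0..T} then W t 0 (G 0) else 0) - J t)" by simp
 then show ?thesis unfolding Iy_def action.sew_eqI[OF s] .
qed

lemma sewn_zero: "action.sewn T \<Xi> I ==> I 0 = 0" "action.sewn T \<Xi> I ==> t \<notin> {0..T} ==> I t = 0"
 by (auto simp: action.sewn_def)

lemma ysol_diff:
 assumes "X_struct y z" "X_bound T \<rho> y z" "X_struct y' z'" "X_bound T \<rho> y' z'" "0 <= \<rho>"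
 shows "ysol y z t - ysol y' z' t = Iy y z t - Iy y' z' t"
 using sewn_zero(2)[OF Iy_sewn[OF assms(1,2,5)], of t] sewn_zero(2)[OF Iy_sewn[OF assms(3,4,5)], of t]
 by (auto simp: ysol_def)

context
 fixes y y' z z' and \<rho> D :: real
 assumes p: "X_struct y z" "X_bound T \<rho> y z" and q: "X_struct y' z'" "X_bound T \<rho> y' z'"
  and pq: "X_bound T D (\<lambda>t. y t - y' t) (\<lambda>t s. z t s - z' t s)" and \<rho>: "0 <= \<rho>" and D: "0 <= D"
begin

abbreviation (input) "J \<equiv> \<lambda>t. Iy y z t - Iy y' z' t"
abbreviation (input) "K \<equiv> \<lambda>u. G (y u) - G (y' u)"

lemma J_near: "tracks T (C2 \<rho> * D) K J" "J 0 = 0"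
proof -
 obtain J' where J': "action.sewn T (\<lambda>v u. \<Xi>y (y, z) v u - \<Xi>y (y', z') v u) J'" "tracks T (C2 \<rho> * D) K J'"
  by (rule y_difference[OF T \<rho> D p(2) q(2) pq]) (use p(1) q(1) in \<open>auto simp: X_struct_def\<close>)
 have "J' = J" by (rule action.sewn_unique[OF J'(1) action.sewn_diff[OF Iy_sewn[OF p \<rho>] Iy_sewn[OF q \<rho>]]])
 then show "tracks T (C2 \<rho> * D) K J" using J'(2) by simp
 show "J 0 = 0" using sewn_zero(1)[OF Iy_sewn[OF p \<rho>]] sewn_zero(1)[OF Iy_sewn[OF q \<rho>]] by simp
qed

lemma norm_K: "0 <= s ==> s <= T ==> norm (K s) <= L * D"
 using order_trans[OF G_lip mult_left_mono[OF X_boundD(1)[OF pq] L_nonneg]] by simp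

lemma J_hoelder: "\<forall>s t. 0 <= s --> s <= t --> t <= T --> norm (J t - S (t - s) (J s)) <= C3 \<rho> * D * (t - s) powr \<alpha>"
proof (intro allI impI)
 fix s t assume st: "0 <= s" "s <= t" "t <= T"
 have "norm (W t s (K s)) <= cW * (L * D) * (t - s) powr \<alpha>"
  using st T cW_nonneg by (intro order_trans[OF norm_W] mult_right_mono mult_left_mono norm_K) auto
 from order_trans[OF norm_triangle_ineq4 add_mono[OF this J_near(1)[unfolded tracks_def, THEN conjunct1, rule_format, OF st]]]
 show "norm (J t - S (t - s) (J s)) <= C3 \<rho> * D * (t - s) powr \<alpha>" by (simp add: C3_def algebra_simps)
qed

lemma C3_D_nonneg: "0 <= C3 \<rho> * D" using C3_nonneg[OF \<rho>] D by simp

lemmas J_bounds = path_bounds[of T "C3 \<rho> * D" J, OF T(1) T_le_1 C3_D_nonneg J_near(2) J_hoelder]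

text \<open>Stated for all times, which is possible as the paths vanish off \<open>[0, T]\<close>:
  \<open>germ_z_sewing\<close> asks for smoothness of \<open>K\<close> up to
  \<open>T0\<close>.\<close>

lemma y_le: "norm (y u) <= \<rho>" "norm (y' u) <= \<rho>" "norm (y u - y' u) <= D"
proof -
 have "y u = 0" "y' u = 0" if "u \<notin> {0..T}" using p(1) q(1) that by (auto simp: X_struct_def)
 then show "norm (y u) <= \<rho>" "norm (y' u) <= \<rho>" "norm (y u - y' u) <= D"
  using X_boundD(1)[OF p(2), of u] X_boundD(1)[OF q(2), of u] X_boundD(1)[OF pq, of u] \<rho> D
  by (cases "u \<in> {0..T}"; force)+
qed

lemma K_smooth: "smooth_op (L * D) (K u)" by (rule smooth_op_norm_le[OF G_smooth mult_left_mono[OF y_le(3) L_nonneg]])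

lemma gz_diff:
 assumes uv: "0 <= u" "u <= v" "v <= T"
 shows "germ_z K J v u = gz y z v u - gz y' z' v u"
  and "(gz y z v u - gz y' z' v u) E = b v u E (K u) + a v u E (J u)"
proof -
 have uv': "0 <= u" "u <= v" "v <= T0" using uv T by auto
 have n: "0 <= L * \<rho> + N0" using L_nonneg \<rho> N0_nonneg by simp
 have n': "0 <= L * D" using L_nonneg D by simp
 note G = G_path_smooth[OF y_le(1)[of u]] G_path_smooth[OF y_le(2)[of u]]
 have 1: "germ_z K J v u E = b v u E (K u) + a v u E (J u)" for E
  by (rule germ_z_apply[where K = K, OF K_smooth n' uv'])
 moreover have "gz y z v u E = b v u E (G (y u)) + a v u E (ysol y z u)"
   "gz y' z' v u E = b v u E (G (y' u)) + a v u E (ysol y' z' u)" for E unfolding gz_def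
  by (rule germ_z_apply[where K = "\<lambda>u. G (y u)", OF G(1) n uv'] germ_z_apply[where K = "\<lambda>u. G (y' u)", OF G(2) n uv'])+
 moreover have "b v u E (K u) = b v u E (G (y u)) - b v u E (G (y' u))" for E
  by (rule b_linear(3)[OF G(1) n uv' G(2) n])
 moreover have "a v u E (J u) = a v u E (ysol y z u) - a v u E (ysol y' z' u)" for E
  unfolding ysol_diff[OF p q \<rho>, symmetric] by (rule a_linear(2)[OF uv'])
 ultimately show eq: "germ_z K J v u = gz y z v u - gz y' z' v u"
  by (intro blinfun_eqI) (simp add: blinfun.diff_left)
 show "(gz y z v u - gz y' z' v u) E = b v u E (K u) + a v u E (J u)" using 1 unfolding eq .
qed

lemma gz_difference:
 shows "\<exists>I. sews_z T (C4 \<rho> * D) (\<lambda>v u. gz y z v u - gz y' z' v u) I"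
proof -
 have c: "0 <= C4 \<rho> * D" using C4_nonneg[OF \<rho>] D by simp
 have c2: "L * (2 * \<rho> + 2) * D <= C4 \<rho> * D" "C2 \<rho> * D <= C4 \<rho> * D"
  using C2_nonneg[OF \<rho>] D L_nonneg \<rho> by (auto intro!: mult_right_mono simp: C4_def)
 \<comment> \<open>The increment of \<open>K\<close> is a double increment of \<open>G\<close>, with
   base points \<open>y u\<close>, \<open>y' u\<close> and steps \<open>y m - y u\<close>,
   \<open>y' m - y' u\<close>.\<close>
 have Kd: "norm (K u - K m) <= L * (D * norm (y m - y u) + norm (y m - y u - (y' m - y' u)))" for u m
 proof -
  have "norm (K u - K m) = norm (G (y m) - G (y u) - (G (y' m) - G (y' u)))"
   by (simp add: norm_minus_commute algebra_simps)
  also have "\<dots> <= L * (norm (y u - y' u) * norm (y m - y u) + norm (y m - y u - (y' m - y' u)))"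
   using G_double[of "y u" "y m - y u" "y' u" "y' m - y' u"] by simp
  also have "\<dots> <= L * (D * norm (y m - y u) + norm (y m - y u - (y' m - y' u)))"
   using L_nonneg y_le(3) by (intro mult_left_mono add_right_mono mult_right_mono) auto
  finally show ?thesis .
 qed
 have sw: "y m - y u - (y' m - y' u) = y m - y' m - (y u - y' u)" for u m by simp
 have "\<exists>I. sews_z T (C4 \<rho> * D) (germ_z K J) I"
 proof (rule germ_z_sewing[of T "C4 \<rho> * D" K J, OF T c])
  have "L * 1 * D <= L * (2 * \<rho> + 2) * D" using L_nonneg D \<rho> by (intro mult_right_mono mult_left_mono) auto
  then show "smooth_op (C4 \<rho> * D) (K u)" for u using smooth_op_norm_le[OF K_smooth] c2 by simp
 next
  fix u m assume um: "0 <= u" "u <= m" "m <= T"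
  have "L * (D * norm (y m - y u) + norm (y m - y u - (y' m - y' u))) <= L * (D * (2 * \<rho>) + 2 * D)"
   using X_bound_incr[OF p(2) um] X_bound_incr[OF pq um] unfolding sw
   by (intro mult_left_mono[OF _ L_nonneg] add_mono mult_left_mono[OF _ D]) auto
  then have "norm (K u - K m) <= L * (D * (2 * \<rho>) + 2 * D)" by (rule order_trans[OF Kd])
  then show "norm (K u - K m) <= C4 \<rho> * D" using c2 by (simp add: algebra_simps)
 next
  fix u m assume um: "0 < u" "u <= m" "m <= T"
  let ?p = "u powr - \<beta> * (m - u) powr \<beta>"
  have "L * (D * norm (y m - y u) + norm (y m - y u - (y' m - y' u))) <= L * (D * (\<rho> * ?p) + D * ?p)"
   using X_boundD(2)[OF p(2) um] X_boundD(2)[OF pq um] unfolding sw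
   by (intro mult_left_mono[OF _ L_nonneg] add_mono mult_left_mono[OF _ D]) auto
  then have "norm (K u - K m) <= L * (D * (\<rho> * ?p) + D * ?p)" by (rule order_trans[OF Kd])
  also have "\<dots> = L * (\<rho> + 1) * D * ?p" by (simp add: algebra_simps)
  also have "\<dots> <= C4 \<rho> * D * ?p"
  proof (rule mult_right_mono)
   have "L * (\<rho> + 1) * D <= L * (2 * \<rho> + 2) * D" using L_nonneg D \<rho> by (intro mult_right_mono mult_left_mono) auto
   then show "L * (\<rho> + 1) * D <= C4 \<rho> * D" using c2 by simp
  qed simp
  finally show "norm (K u - K m) <= C4 \<rho> * D * ?p" .
 qed (rule tracks_mono[OF J_near(1) c2(2)])
 then obtain I where I: "sews_z T (C4 \<rho> * D) (germ_z K J) I" ..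
 have "operator_action.sewn T (\<lambda>v u. gz y z v u - gz y' z' v u) I"
  by (rule operator_action.sewn_cong[of T "germ_z K J"]) (use I in \<open>auto simp: sews_z_def gz_diff(1)\<close>)
 moreover have "norm (hat_incr act I t s - (gz y z t s - gz y' z' t s)) <= cZ * (C4 \<rho> * D) * t powr - \<beta> * (t - s) powr (2 * \<alpha> + \<beta>)"
  if "0 <= s" "s <= t" "t <= T" for s t using I that unfolding sews_z_def gz_diff(1)[OF that, symmetric] by blast
 ultimately show ?thesis unfolding sews_z_def by blast
qed

end

end

context rough_equation_on
begin

text \<open>The operator \<open>G 0\<close> is constant in time, and the mild increments of the path
  are exactly \<open>W m u (G 0)\<close>, so both terms of \<open>germ_z_delta2\<close>
  vanish.\<close>

lemma gz_zero_sewn: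
 shows "operator_action.sewn T (gz (\<lambda>_. 0) (\<lambda>_ _. 0)) (Iz (\<lambda>_. 0) (\<lambda>_ _. 0))"
  and "0 <= s ==> s <= t ==> t <= T ==>
   hat_incr act (Iz (\<lambda>_. 0) (\<lambda>_ _. 0)) t s = gz (\<lambda>_. 0) (\<lambda>_ _. 0) t s"
proof -
 let ?x = "ysol (\<lambda>_. 0) (\<lambda>_ _. 0)" and ?g = "gz (\<lambda>_. 0) (\<lambda>_ _. 0)"
 have d: "operator_action.delta2 ?g v m u = 0" if um: "0 <= u" "u <= m" "m <= v" "v <= T" for u m v
 proof (rule blinfun_eqI)
  fix E
  have mv: "0 <= m" "m <= v" "v <= T0" and um': "0 <= u" "u <= m" "m <= v" "v <= T0" using um T by auto
  have "?x m - S (m - u) (?x u) = W m u (G 0)" using um T S_add[of "m - u" u \<xi>] W_additive[of 0 u m "G 0"]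
   by (simp add: ysol_def Iy_zero blinfun.add_right)
  moreover have "b v m E (G 0 - G 0) = 0"
   using b_linear(3)[OF G0_smooth N0_nonneg mv G0_smooth N0_nonneg, of E] by simp
  moreover have "a v m E (W m u (G 0) - W m u (G 0)) = 0" using a_linear(2)[OF mv, of E "W m u (G 0)" "W m u (G 0)"] by simp
  ultimately show "operator_action.delta2 ?g v m u E = blinfun_apply 0 E"
   unfolding gz_def using germ_z_delta2[OF G0_smooth N0_nonneg um', of ?x E] by simp
 qed
 note s = operator_action.sewn_additive[OF d T(1)]
 have I: "Iz (\<lambda>_. 0) (\<lambda>_ _. 0) = (\<lambda>t. if t \<in> {0..T} then ?g t 0 else 0)"
  unfolding Iz_def by (rule operator_action.sew_eqI[OF s(1)])
 show "operator_action.sewn T ?g (Iz (\<lambda>_. 0) (\<lambda>_ _. 0))" unfolding I by (rule s(1))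
 show "0 <= s ==> s <= t ==> t <= T ==> hat_incr act (Iz (\<lambda>_. 0) (\<lambda>_ _. 0)) t s = ?g t s" unfolding I by (rule s(2))
qed

lemma Iz_sewn:
 assumes y: "X_struct y z" "X_bound T \<rho> y z" "0 <= \<rho>"
 shows "operator_action.sewn T (gz y z) (Iz y z)"
proof -
 have d: "X_bound T \<rho> (\<lambda>t. 0 - y t) (\<lambda>t s. 0 - z t s)" using y(2) by (simp add: X_bound_def norm_minus_commute)
 obtain I where "operator_action.sewn T (\<lambda>v u. gz (\<lambda>_. 0) (\<lambda>_ _. 0) v u - gz y z v u) I"
  using gz_difference[OF X_struct_zero X_bound_zero[OF y(3)] y(1,2) d y(3,3)] unfolding sews_z_def by blast
 from operator_action.sewn_diff[OF gz_zero_sewn(1) this]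
 have s: "operator_action.sewn T (gz y z) (\<lambda>t. Iz (\<lambda>_. 0) (\<lambda>_ _. 0) t - I t)" by simp
 then show ?thesis unfolding Iz_def[of y] operator_action.sew_eqI[OF s] .
qed

text \<open>The difference of the second components is the sewing error plus the germ with
  \<open>W\<close> subtracted. \<open>w\<close> is the rate, to be chosen for each of the two
  seminorms of \<open>z\<close>.\<close>

lemma zsol_difference:
 assumes p: "X_struct y z" "X_bound T \<rho> y z" and q: "X_struct y' z'" "X_bound T \<rho> y' z'"
  and pq: "X_bound T D (\<lambda>t. y t - y' t) (\<lambda>t s. z t s - z' t s)" and \<rho>: "0 <= \<rho>" and D: "0 <= D"
  and st: "0 <= s" "s <= t" "t <= T" and w: "0 <= w" "t powr - \<beta> * (t - s) powr (2 * \<alpha> + \<beta>) <= T powr \<alpha> * w"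
  and r: "\<And>E. norm (b t s E (G (y s) - G (y' s)) + a t s E (Iy y z s - Iy y' z' s) - W t s (E (Iy y z s - Iy y' z' s)))
   <= cR * (L * D * T powr \<alpha> + (1 + cS) * (C3 \<rho> * D * T powr \<alpha>)) * w * norm E"
 shows "norm (zsol y z t s - zsol y' z' t s) <= \<kappa> \<rho> * T powr \<alpha> * D * w"
proof -
 let ?g = "gz y z t s - gz y' z' t s" and ?J = "Iy y z s - Iy y' z' s"
 have st': "0 <= s" "s <= t" "t <= T0" using st T by auto
 obtain I where I: "operator_action.sewn T (\<lambda>v u. gz y z v u - gz y' z' v u) I"
  and est: "norm (hat_incr act I t s - ?g) <= cZ * (C4 \<rho> * D) * t powr - \<beta> * (t - s) powr (2 * \<alpha> + \<beta>)"
  using gz_difference[OF p q pq \<rho> D] st unfolding sews_z_def by blast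
 have "I = (\<lambda>t. Iz y z t - Iz y' z' t)"
  by (rule operator_action.sewn_unique[OF I operator_action.sewn_diff[OF Iz_sewn[OF p \<rho>] Iz_sewn[OF q \<rho>]]])
 then have h: "hat_incr act I t s = hat_incr act (Iz y z) t s - hat_incr act (Iz y' z') t s"
  using operator_action.hat_incr_diff[OF st(2)] by simp
 have c: "0 <= cZ * (C4 \<rho> * D)" using cZ_nonneg C4_nonneg[OF \<rho>] D by simp
 have 1: "norm (hat_incr act I t s - ?g) <= cZ * (C4 \<rho> * D) * (T powr \<alpha> * w)"
  using est mult_left_mono[OF w(2) c] by (simp add: mult.assoc)
 have "norm (zsol y z t s - zsol y' z' t s)
  <= cZ * (C4 \<rho> * D) * (T powr \<alpha> * w) + cR * (L * D * T powr \<alpha> + (1 + cS) * (C3 \<rho> * D * T powr \<alpha>)) * w"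
 proof (rule norm_blinfun_bound)
  show "0 <= cZ * (C4 \<rho> * D) * (T powr \<alpha> * w) + cR * (L * D * T powr \<alpha> + (1 + cS) * (C3 \<rho> * D * T powr \<alpha>)) * w"
   using c w cR_nonneg L_nonneg D cS_nonneg C3_nonneg[OF \<rho>] by simp
  fix E
  have 2: "norm ((hat_incr act I t s - ?g) E) <= cZ * (C4 \<rho> * D) * (T powr \<alpha> * w) * norm E"
   by (rule order_trans[OF norm_blinfun mult_right_mono[OF 1]]) simp
  have "W t s (E ?J) = W t s (E (ysol y z s)) - W t s (E (ysol y' z' s))"
   unfolding ysol_diff[OF p q \<rho>, symmetric] by (simp add: blinfun.diff_right W_simps(2)[OF st'])
  then have eq: "(zsol y z t s - zsol y' z' t s) E = (hat_incr act I t s - ?g) E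
    + (b t s E (G (y s) - G (y' s)) + a t s E ?J - W t s (E ?J))"
   unfolding gz_diff(2)[OF p q pq \<rho> D st, symmetric] h by (simp add: blinfun.diff_left zsol_apply[OF st])
  show "norm ((zsol y z t s - zsol y' z' t s) E)
   <= (cZ * (C4 \<rho> * D) * (T powr \<alpha> * w) + cR * (L * D * T powr \<alpha> + (1 + cS) * (C3 \<rho> * D * T powr \<alpha>)) * w) * norm E"
   unfolding eq distrib_right[of _ _ "norm E"] by (rule norm_triangle_mono[OF 2 r])
 qed
 also have "\<dots> = (cZ * C4 \<rho> + cR * (L + (1 + cS) * C3 \<rho>)) * (T powr \<alpha> * D * w)" by (simp add: algebra_simps)
 also have "\<dots> <= \<kappa> \<rho> * (T powr \<alpha> * D * w)" using \<kappa>_bounds(3)[OF \<rho>] D w by (intro mult_right_mono) auto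
 finally show ?thesis by (simp add: mult.assoc)
qed

text \<open>All four bounds come with \<open>T powr \<alpha>\<close>. For \<open>y\<close>, the mild
  increments are \<open>\<alpha>\<close>-Hoelder while only \<open>\<beta>\<close> and a weight are
  measured. For \<open>z\<close>, the sewing error and \<open>b\<close> have exponents to spare, and
  the remaining part contains the difference of the updated first components, which is already
  small.\<close>

lemma solution_difference:
 assumes p: "X_struct y z" "X_bound T \<rho> y z" and q: "X_struct y' z'" "X_bound T \<rho> y' z'"
  and pq: "X_bound T D (\<lambda>t. y t - y' t) (\<lambda>t s. z t s - z' t s)" and \<rho>: "0 <= \<rho>" and D: "0 <= D"
 shows "X_bound T (\<kappa> \<rho> * T powr \<alpha> * D) (\<lambda>t. ysol y z t - ysol y' z' t) (\<lambda>t s. zsol y z t s - zsol y' z' t s)"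
proof -
 note J = J_bounds[OF p q pq \<rho> D]
 let ?J = "\<lambda>t. Iy y z t - Iy y' z' t" and ?K = "\<lambda>s. G (y s) - G (y' s)" and ?X = "(1 + cS) * (C3 \<rho> * D * T powr \<alpha>)"
 have c: "0 <= T powr \<alpha> * D" using D by simp
 have C: "0 <= C3 \<rho> * D * T powr \<alpha>" using C3_nonneg[OF \<rho>] D by simp
 then have X: "C3 \<rho> * D * T powr \<alpha> <= ?X" "cS * (C3 \<rho> * D) * T powr \<alpha> <= ?X" "0 <= ?X"
  using cS_nonneg mult_right_mono[of 1 "1 + cS" "C3 \<rho> * D * T powr \<alpha>"] mult_right_mono[of cS "1 + cS" "C3 \<rho> * D * T powr \<alpha>"]
  by (auto simp: mult.assoc)
 have LD: "0 <= L * D" using L_nonneg D by simp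
 show ?thesis unfolding X_bound_def ysol_diff[OF p q \<rho>]
 proof (intro conjI allI impI)
  fix t assume t: "0 <= t" "t <= T"
  have "norm (?J t) <= C3 \<rho> * (T powr \<alpha> * D)" using J(1)[OF t] by (simp add: mult_ac)
  also have "\<dots> <= \<kappa> \<rho> * (T powr \<alpha> * D)" using \<kappa>_bounds(1)[OF \<rho>] c by (intro mult_right_mono)
  finally show "norm (?J t) <= \<kappa> \<rho> * T powr \<alpha> * D" by (simp add: mult.assoc)
 next
  fix s t assume st: "0 < s" "s <= t" "t <= T"
  have "norm (?J t - ?J s) <= ((1 + cS / \<beta>) * C3 \<rho>) * (T powr \<alpha> * D * (s powr - \<beta> * (t - s) powr \<beta>))"
   using J(3)[OF st] by (simp add: mult_ac)
  also have "\<dots> <= \<kappa> \<rho> * (T powr \<alpha> * D * (s powr - \<beta> * (t - s) powr \<beta>))"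
   using \<kappa>_bounds(2)[OF \<rho>] c by (intro mult_right_mono) auto
  finally show "norm (?J t - ?J s) <= \<kappa> \<rho> * T powr \<alpha> * D * (s powr - \<beta> * (t - s) powr \<beta>)" by (simp add: mult.assoc)
 next
  fix s t assume st: "0 <= s" "s <= t" "t <= T"
  have s: "0 <= s" "s <= T" using st by auto
  show "norm (zsol y z t s - zsol y' z' t s) <= \<kappa> \<rho> * T powr \<alpha> * D * (t - s) powr \<alpha>"
  proof (rule zsol_difference[OF p q pq \<rho> D st])
   show "t powr - \<beta> * (t - s) powr (2 * \<alpha> + \<beta>) <= T powr \<alpha> * (t - s) powr \<alpha>"
   proof (cases "t = 0")
    case False
    have "(t - s) powr (2 * \<alpha> + \<beta>) = (t - s) powr \<beta> * ((t - s) powr \<alpha> * (t - s) powr \<alpha>)"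
     unfolding powr_add[symmetric] by (simp add: algebra_simps)
    also have "\<dots> <= t powr \<beta> * (T powr \<alpha> * (t - s) powr \<alpha>)"
     using st \<alpha>_pos \<beta>_pos by (intro mult_mono powr_mono2) auto
    finally show ?thesis using False st by (simp add: powr_minus field_simps)
   qed simp
   show "norm (b t s E (?K s) + a t s E (?J s) - W t s (E (?J s))) <= cR * (L * D * T powr \<alpha> + ?X) * (t - s) powr \<alpha> * norm E" for E
    by (rule germ_z_remainder(1)[OF st T(2) K_smooth[OF p q pq \<rho> D] LD norm_K[OF p q pq \<rho> D s] order_trans[OF J(1)[OF s] X(1)]])
  qed simp
 next
  fix s t assume s: "0 < s" and st: "s <= t" "t <= T"
  have s': "0 <= s" "s <= T" using s st by auto
  show "norm (zsol y z t s - zsol y' z' t s) <= \<kappa> \<rho> * T powr \<alpha> * D * (s powr - \<beta> * (t - s) powr (\<alpha> + \<beta>))"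
  proof (rule zsol_difference[OF p q pq \<rho> D s'(1) st])
   have "(t - s) powr (2 * \<alpha> + \<beta>) = (t - s) powr \<alpha> * (t - s) powr (\<alpha> + \<beta>)"
    unfolding powr_add[symmetric] by (simp add: algebra_simps)
   also have "\<dots> <= T powr \<alpha> * (t - s) powr (\<alpha> + \<beta>)" using s st \<alpha>_pos by (intro mult_right_mono powr_mono2) auto
   finally have "t powr - \<beta> * (t - s) powr (2 * \<alpha> + \<beta>) <= s powr - \<beta> * (T powr \<alpha> * (t - s) powr (\<alpha> + \<beta>))"
    using s st by (intro mult_mono weight_mono) auto
   then show "t powr - \<beta> * (t - s) powr (2 * \<alpha> + \<beta>) <= T powr \<alpha> * (s powr - \<beta> * (t - s) powr (\<alpha> + \<beta>))" by (simp add: mult_ac)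
   have "smooth \<beta> (?X * s powr - \<beta>) (?J s)"
    by (rule smooth_norm_le[OF J(2)[OF s s'(2)] mult_right_mono[OF X(2)]]) simp
   then show "norm (b t s E (?K s) + a t s E (?J s) - W t s (E (?J s)))
    <= cR * (L * D * T powr \<alpha> + ?X) * (s powr - \<beta> * (t - s) powr (\<alpha> + \<beta>)) * norm E" for E
    by (rule germ_z_remainder(2)[OF s'(1) st T(2) K_smooth[OF p q pq \<rho> D] LD norm_K[OF p q pq \<rho> D s'] order_trans[OF J(1)[OF s'] X(1)] s])
  qed simp
 qed
qed

lemma W_path:
 shows "0 <= cW * norm (G 0)" "W 0 0 (G 0) = 0"
  and "\<forall>s t. 0 <= s --> s <= t --> t <= T -->
   norm (W t 0 (G 0) - S (t - s) (W s 0 (G 0))) <= cW * norm (G 0) * (t - s) powr \<alpha>"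
proof -
 show "0 <= cW * norm (G 0)" using cW_nonneg by simp
 show "W 0 0 (G 0) = 0" using norm_W[of 0 0 "G 0"] T by simp
 show "\<forall>s t. 0 <= s --> s <= t --> t <= T -->
   norm (W t 0 (G 0) - S (t - s) (W s 0 (G 0))) <= cW * norm (G 0) * (t - s) powr \<alpha>"
 proof (intro allI impI)
  fix s t assume st: "0 <= s" "s <= t" "t <= T"
  then show "norm (W t 0 (G 0) - S (t - s) (W s 0 (G 0))) <= cW * norm (G 0) * (t - s) powr \<alpha>"
   using T by (subst W_additive[of 0 s]) (auto intro: norm_W)
 qed
qed

lemmas W_path_bounds =
 path_bounds[of T "cW * norm (G 0)" "\<lambda>t. W t 0 (G 0)", OF T(1) T_le_1 W_path]

text \<open>The first component is explicit: the orbit of \<open>\<xi>\<close> plus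
  \<open>W t 0 (G 0)\<close>. The orbit is what forces the weight \<open>s powr - \<beta>\<close>,
  and it carries no power of \<open>T\<close>.\<close>

lemma solution_zero: "X_bound T (C0 r) (ysol (\<lambda>_. 0) (\<lambda>_ _. 0)) (zsol (\<lambda>_. 0) (\<lambda>_ _. 0))"
proof -
 let ?y = "ysol (\<lambda>_. 0) (\<lambda>_ _. 0)" and ?z = "zsol (\<lambda>_. 0) (\<lambda>_ _. 0)"
 let ?g = "cW * norm (G 0)" let ?X = "M * r + (1 + cS) * ?g" and ?N = "N0 + norm (G 0)"
 note C0 = C0_bounds[OF r_nonneg]
 have y: "?y t = S t \<xi> + W t 0 (G 0)" if "0 <= t" "t <= T" for t using that by (simp add: ysol_def Iy_zero)
 have g: "0 <= ?g" "?g * T powr \<alpha> <= ?g" "cS * ?g * T powr \<alpha> <= cS * ?g"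
  using cW_nonneg cS_nonneg T_powr by (auto intro!: mult_left_le)
 have X: "0 <= ?X" "M * r + ?g <= ?X" using g M_ge_1 r_nonneg cS_nonneg by (auto simp: distrib_right)
 have norm_y: "norm (?y t) <= M * r + ?g" if t: "0 <= t" "t <= T" for t
 proof -
  have "norm (S t \<xi>) <= M * r" using M_ge_1 by (intro order_trans[OF norm_S[OF t(1)] mult_left_mono[OF \<xi>]]) auto
  moreover have "norm (W t 0 (G 0)) <= ?g" using W_path_bounds(1)[OF t] g by simp
  ultimately show ?thesis unfolding y[OF t] by (rule norm_triangle_mono)
 qed
 have orbit: "smooth \<beta> (M * r * s powr - \<beta>) (S s \<xi>)" if "0 < s" for s
 proof (rule smooth_norm_le[OF smooth_orbit[OF that]])
  show "M * norm \<xi> * s powr - \<beta> <= M * r * s powr - \<beta>" using \<xi> M_ge_1 by (intro mult_right_mono mult_left_mono) auto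
 qed (use \<beta>_pos \<beta>_less_1 in auto)
 have N: "smooth_op ?N (G 0)" "0 <= ?N" "norm (G 0) <= ?N" using smooth_op_norm_le[OF G0_smooth, of ?N] N0_nonneg by auto
 have z: "norm (?z t s) <= C0 r * w" if st: "0 <= s" "s <= t" "t <= T" and w: "0 <= w"
   and r: "\<And>E. norm (b t s E (G 0) + a t s E (?y s) - W t s (E (?y s))) <= cR * (?N * T powr \<alpha> + ?X) * w * norm E" for s t w
 proof -
  have "norm (?z t s) <= cR * (?N * T powr \<alpha> + ?X) * w"
  proof (rule norm_blinfun_bound)
   show "0 <= cR * (?N * T powr \<alpha> + ?X) * w" using cR_nonneg N(2) X w by simp
   have st': "0 <= s" "s <= t" "t <= T0" using st T by auto
   have "?z t s E = b t s E (G 0) + a t s E (?y s) - W t s (E (?y s))" for E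
    unfolding zsol_apply[OF st] gz_zero_sewn(2)[OF st] gz_def
    using germ_z_apply[where K = "\<lambda>_. G 0", OF G0_smooth N0_nonneg st'] by simp
   then show "norm (?z t s E) <= cR * (?N * T powr \<alpha> + ?X) * w * norm E" for E using r by simp
  qed
  also have "\<dots> <= cR * (?N + ?X) * w"
   using cR_nonneg w mult_left_mono[OF T_powr(2) N(2)] by (intro mult_right_mono mult_left_mono) auto
  also have "\<dots> <= C0 r * w" using C0(3) w by (intro mult_right_mono) auto
  finally show ?thesis .
 qed
 show ?thesis unfolding X_bound_def
 proof (intro conjI allI impI)
  show "norm (?y t) <= C0 r" if "0 <= t" "t <= T" for t using norm_y[OF that] C0(1) by simp
 next
  fix s t assume st: "0 < s" "s <= t" "t <= T"
  let ?w = "s powr - \<beta> * (t - s) powr \<beta>"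
  have "norm (S (t - s) (S s \<xi>) - S s \<xi>) <= M * r * s powr - \<beta> / \<beta> * (t - s) powr \<beta>"
   using st \<beta>_pos by (intro smooth_S_diff orbit) auto
  then have 1: "norm (S t \<xi> - S s \<xi>) <= M * r / \<beta> * ?w" using S_add[of "t - s" s \<xi>] st by simp
  have "(1 + cS / \<beta>) * ?g * T powr \<alpha> <= (1 + cS / \<beta>) * ?g * 1"
   using g cS_nonneg \<beta>_pos T_powr by (intro mult_left_mono) auto
  from mult_right_mono[OF this, of ?w]
  have 2: "norm (W t 0 (G 0) - W s 0 (G 0)) <= (1 + cS / \<beta>) * ?g * ?w"
   using W_path_bounds(3)[OF st] by (simp add: mult.assoc)
  have "?y t - ?y s = (S t \<xi> - S s \<xi>) + (W t 0 (G 0) - W s 0 (G 0))" using st y[of t] y[of s] by simp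
  then have "norm (?y t - ?y s) <= M * r / \<beta> * ?w + (1 + cS / \<beta>) * ?g * ?w"
   using norm_triangle_mono[OF 1 2] by (simp only:)
  also have "\<dots> = (M * r / \<beta> + (1 + cS / \<beta>) * ?g) * ?w" by (rule distrib_right[symmetric])
  also have "\<dots> <= C0 r * ?w" using C0(2) by (intro mult_right_mono) auto
  finally show "norm (?y t - ?y s) <= C0 r * ?w" .
 next
  fix s t assume st: "0 <= s" "s <= t" "t <= T"
  have "norm (?y s) <= ?X" using norm_y[of s] X st by simp
  then show "norm (?z t s) <= C0 r * (t - s) powr \<alpha>" by (intro z[OF st] germ_z_remainder(1)[OF st T(2) N]) auto
 next
  fix s t assume s: "0 < s" and st: "s <= t" "t <= T"
  have s': "0 <= s" "s <= T" using s st by auto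
  have n: "norm (?y s) <= ?X" using norm_y[OF s'] X by simp
  have "smooth \<beta> (M * r * s powr - \<beta> + cS * ?g * T powr \<alpha> * s powr - \<beta>) (?y s)"
   unfolding y[OF s'] by (rule smooth_add[OF orbit[OF s] W_path_bounds(2)[OF s s'(2)]])
  moreover have "M * r * s powr - \<beta> + cS * ?g * T powr \<alpha> * s powr - \<beta> <= ?X * s powr - \<beta>"
   unfolding distrib_right[symmetric] using g by (intro mult_right_mono) (auto simp: distrib_right)
  ultimately have sm: "smooth \<beta> (?X * s powr - \<beta>) (?y s)" by (rule smooth_norm_le)
  show "norm (?z t s) <= C0 r * (s powr - \<beta> * (t - s) powr (\<alpha> + \<beta>))"
   by (intro z[OF s'(1) st] germ_z_remainder(2)[OF s'(1) st T(2) N n s sm]) auto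
 qed
qed

text \<open>In the algebraic relation the mild increments of \<open>Iz\<close> cancel by additivity,
  and additivity of \<open>W\<close> leaves \<open>W t \<tau>\<close> of the increment of
  \<open>ysol\<close>.\<close>

lemma solution_struct:
 assumes y: "X_struct y z" "X_bound T \<rho> y z" "0 <= \<rho>"
 shows "X_struct (ysol y z) (zsol y z)" unfolding X_struct_def
proof (intro conjI allI impI)
 show "ysol y z t = 0" if "t \<notin> {0..T}" for t using that by (auto simp: ysol_def)
 show "zsol y z t s = 0" if "(t, s) \<notin> Delta T" for t s using that by (simp add: zsol_def)
 have d: "X_bound T \<rho> (\<lambda>t. y t - 0) (\<lambda>t s. z t s - 0)" using y(2) by simp
 have "continuous_on {0..T} (\<lambda>t. Iy y z t - Iy (\<lambda>_. 0) (\<lambda>_ _. 0) t)"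
  by (rule J_bounds(4)[OF y(1,2) X_struct_zero X_bound_zero[OF y(3)] d y(3,3)])
 then have c: "continuous_on {0..T} (\<lambda>t. S t \<xi> + ((Iy y z t - Iy (\<lambda>_. 0) (\<lambda>_ _. 0) t) + W t 0 (G 0)))"
  by (intro continuous_on_add continuous_on_subset[OF continuous_S] W_path_bounds(4)) auto
 show "continuous_on {0..T} (ysol y z)" by (rule continuous_on_eq[OF c]) (simp add: ysol_def Iy_zero)
 show "X_algebra T (ysol y z) (zsol y z)" unfolding X_algebra_def
 proof (intro allI impI)
  fix s \<tau> t E assume st: "0 <= s" "s <= \<tau>" "\<tau> <= t" "t <= T"
  have st': "0 <= s" "s <= \<tau>" "\<tau> <= t" "t <= T0" and t: "0 <= \<tau>" "\<tau> <= t" "t <= T0" using st T by auto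
  have a: "zsol y z t s E = hat_incr act (Iz y z) t s E - W t s (E (ysol y z s))"
   "zsol y z t \<tau> E = hat_incr act (Iz y z) t \<tau> E - W t \<tau> (E (ysol y z \<tau>))"
   "zsol y z \<tau> s E = hat_incr act (Iz y z) \<tau> s E - W \<tau> s (E (ysol y z s))" using st by (auto intro!: zsol_apply)
  show "zsol y z t s E - zsol y z t \<tau> E - S (t - \<tau>) (zsol y z \<tau> s E) = W t \<tau> (E (ysol y z \<tau> - ysol y z s))"
   unfolding a operator_action.hat_incr_additive[OF st(2,3)] W_additive[OF st', of "E (ysol y z s)"]
   by (simp add: blinfun.bilinear_simps W_simps(2)[OF t])
 qed
qed

end

section \<open>The fixed point\<close>

lemma seminorm_le_iff:
 assumes "0 <= \<rho>"
 shows "sup_norm T y <= ennreal \<rho> \<longleftrightarrow> (\<forall>t. 0 <= t --> t <= T --> norm (y t) <= \<rho>)"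
  and "holder_seminorm \<gamma> T f <= ennreal \<rho> \<longleftrightarrow>
   (\<forall>s t. 0 <= s --> s < t --> t <= T --> norm (f t s) <= \<rho> * (t - s) powr \<gamma>)"
  and "weighted_seminorm \<gamma> \<theta> T f <= ennreal \<rho> \<longleftrightarrow>
   (\<forall>s t. 0 < s --> s < t --> t <= T --> norm (f t s) <= \<rho> * (s powr - \<theta> * (t - s) powr \<gamma>))"
proof -
 have q: "s powr \<theta> * (x / (t - s) powr \<gamma>) <= \<rho> \<longleftrightarrow> x <= \<rho> * (s powr - \<theta> * (t - s) powr \<gamma>)"
  if "0 < s" "s < t" for s t x using that by (simp add: powr_minus field_simps)
 show "weighted_seminorm \<gamma> \<theta> T f <= ennreal \<rho> \<longleftrightarrow>
   (\<forall>s t. 0 < s --> s < t --> t <= T --> norm (f t s) <= \<rho> * (s powr - \<theta> * (t - s) powr \<gamma>))"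
  using assms by (auto simp: weighted_seminorm_def SUP_le_iff q simp del: times_divide_eq_right)
qed (use assms in \<open>auto simp: sup_norm_def holder_seminorm_def Delta_def SUP_le_iff pos_divide_le_eq\<close>)

context rough_equation_on
begin

text \<open>\<^const>\<open>X_norm\<close> adds six suprema, as \<open>z t 0\<close> occurs twice.\<close>

lemma X_norm_le:
 assumes y: "X_bound T \<rho> y z" and \<rho>: "0 <= \<rho>"
 shows "y_norm \<beta> T y <= ennreal (2 * \<rho>)" "z_norm \<alpha> T z <= ennreal (2 * \<rho>)"
  "z_weighted_norm (\<alpha> + \<beta>) \<beta> T z <= ennreal (2 * \<rho>)" "X_norm \<alpha> \<beta> T (y, z) <= ennreal (6 * \<rho>)"
proof -
 have two: "ennreal (2 * \<rho>) = ennreal \<rho> + ennreal \<rho>" using \<rho> by (simp flip: ennreal_plus)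
 note iff = seminorm_le_iff[OF \<rho>] and D = X_boundD[OF y]
 have "norm (z t 0) <= \<rho>" if t: "0 <= t" "t <= T" for t
 proof -
  have "norm (z t 0) <= \<rho> * t powr \<alpha>" using D(3)[of 0 t] t by simp
  also have "\<dots> <= \<rho>" using t T_le_1 \<alpha>_pos \<rho> by (intro mult_left_le powr_le1) auto
  finally show ?thesis .
 qed
 then have "sup_norm T y <= ennreal \<rho>" "weighted_seminorm \<beta> \<beta> T (incr y) <= ennreal \<rho>"
  "sup_norm T (\<lambda>t. z t 0) <= ennreal \<rho>" "holder_seminorm \<alpha> T z <= ennreal \<rho>"
  "weighted_seminorm (\<alpha> + \<beta>) \<beta> T z <= ennreal \<rho>" using D unfolding iff incr_def by auto
 note le = this
 show a: "y_norm \<beta> T y <= ennreal (2 * \<rho>)" "z_norm \<alpha> T z <= ennreal (2 * \<rho>)"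
  "z_weighted_norm (\<alpha> + \<beta>) \<beta> T z <= ennreal (2 * \<rho>)"
  unfolding y_norm_def z_norm_def z_weighted_norm_def two by (intro add_mono le)+
 have "ennreal (6 * \<rho>) = ennreal (2 * \<rho>) + ennreal (2 * \<rho>) + ennreal (2 * \<rho>)" using \<rho> by (simp flip: ennreal_plus)
 then show "X_norm \<alpha> \<beta> T (y, z) <= ennreal (6 * \<rho>)" unfolding X_norm_def using a by (auto intro!: add_mono)
qed

lemma X_bound_of_norm:
 assumes n: "X_norm \<alpha> \<beta> T (y, z) <= ennreal \<rho>" and \<rho>: "0 <= \<rho>" and z: "\<And>t. z t t = 0"
 shows "X_bound T \<rho> y z"
proof -
 have n': "sup_norm T y + weighted_seminorm \<beta> \<beta> T (incr y) + (sup_norm T (\<lambda>t. z t 0) + holder_seminorm \<alpha> T z)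
   + (sup_norm T (\<lambda>t. z t 0) + weighted_seminorm (\<alpha> + \<beta>) \<beta> T z) <= ennreal \<rho>"
  using n by (simp add: X_norm_def y_norm_def z_norm_def z_weighted_norm_def)
 have le: "sup_norm T y <= ennreal \<rho>" "weighted_seminorm \<beta> \<beta> T (incr y) <= ennreal \<rho>"
  "holder_seminorm \<alpha> T z <= ennreal \<rho>" "weighted_seminorm (\<alpha> + \<beta>) \<beta> T z <= ennreal \<rho>"
  by (rule order_trans[OF _ n'], simp add: add_increasing add_increasing2)+
 have *: "norm (y t - y s) <= \<rho> * (s powr - \<beta> * (t - s) powr \<beta>)" if "0 < s" "s <= t" "t <= T" for s t
  using le(2) that unfolding seminorm_le_iff[OF \<rho>] incr_def by (cases "s = t") auto
 have "norm (z t s) <= \<rho> * (t - s) powr \<alpha>" if "0 <= s" "s <= t" "t <= T" for s t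
  using le(3) that unfolding seminorm_le_iff[OF \<rho>] by (cases "s = t") (auto simp: z)
 moreover have "norm (z t s) <= \<rho> * (s powr - \<beta> * (t - s) powr (\<alpha> + \<beta>))" if "0 < s" "s <= t" "t <= T" for s t
  using le(4) that unfolding seminorm_le_iff[OF \<rho>] by (cases "s = t") (auto simp: z)
 ultimately show ?thesis using le(1) * unfolding X_bound_def seminorm_le_iff[OF \<rho>] by blast
qed

lemma X_struct_refl: "X_struct y z ==> z t t = 0" by (simp add: X_struct_def Delta_def)

lemma X_ballD:
 assumes "(y, z) \<in> X_ball A S \<alpha> \<beta> \<omega> T R" "0 <= R"
 shows "X_struct y z" "X_bound T R y z"
proof -
 show s: "X_struct y z" using assms by (auto simp: X_ball_def X_space_def X_struct_def X_algebra_def incr_def)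
 show "X_bound T R y z" using assms by (intro X_bound_of_norm X_struct_refl[OF s]) (auto simp: X_ball_def)
qed

lemma X_ballI:
 assumes s: "X_struct y z" and y: "X_bound T \<rho> y z" and \<rho>: "0 <= \<rho>" "6 * \<rho> <= R"
 shows "(y, z) \<in> X_ball A S \<alpha> \<beta> \<omega> T R"
proof -
 note n = X_norm_le[OF y \<rho>(1)]
 have "X_norm \<alpha> \<beta> T (y, z) <= ennreal R" using n(4) ennreal_leI[OF \<rho>(2)] by (rule order_trans)
 moreover have "y_norm \<beta> T y < \<infinity>" "z_norm \<alpha> T z < \<infinity>" "z_weighted_norm (\<alpha> + \<beta>) \<beta> T z < \<infinity>"
  using n(1-3) le_less_trans ennreal_less_top by (metis infinity_ennreal_def)+
 ultimately show ?thesis using s by (auto simp: X_ball_def X_space_def X_struct_def X_algebra_def incr_def)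
qed

section \<open>Bounds and structure under sums and limits\<close>

lemma X_bound_add:
 assumes "X_bound T \<rho> y z" "X_bound T \<sigma> y' z'"
 shows "X_bound T (\<rho> + \<sigma>) (\<lambda>t. y t + y' t) (\<lambda>t s. z t s + z' t s)"
proof -
 note b = X_boundD[OF assms(1)] X_boundD[OF assms(2)]
 have "norm (y t + y' t - (y s + y' s)) <= norm (y t - y s) + norm (y' t - y' s)" for s t
  by (metis add_diff_add norm_triangle_ineq)
 then show ?thesis unfolding X_bound_def distrib_right using b
  by (auto intro!: norm_triangle_mono) (meson add_mono order_trans)
qed

lemma X_bound_uminus: "X_bound T \<rho> y z ==> X_bound T \<rho> (\<lambda>t. - y t) (\<lambda>t s. - z t s)"
 by (simp add: X_bound_def norm_minus_commute)

lemma X_bound_minus: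
 assumes "X_bound T \<rho> y z" "X_bound T \<rho> y' z'"
 shows "X_bound T (2 * \<rho>) (\<lambda>t. y t - y' t) (\<lambda>t s. z t s - z' t s)"
 using X_bound_add[OF assms(1) X_bound_uminus[OF assms(2)]] by simp

lemma X_bound_mono:
 assumes "X_bound T \<rho> y z" "\<rho> <= \<sigma>"
 shows "X_bound T \<sigma> y z" using X_boundD[OF assms(1)] assms(2) unfolding X_bound_def
 by (auto intro: order_trans[OF _ assms(2)] order_trans[OF _ mult_right_mono[OF assms(2)]])

lemma X_bound_limit:
 assumes "\<And>n. X_bound T \<rho> (Y n) (Z n)" "\<And>t. (\<lambda>n. Y n t) \<longlonglongrightarrow> y t" "\<And>t s. (\<lambda>n. Z n t s) \<longlonglongrightarrow> z t s"
 shows "X_bound T \<rho> y z" unfolding X_bound_def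
proof (intro conjI allI impI)
 show "norm (y t) <= \<rho>" if "0 <= t" "t <= T" for t
  by (rule LIMSEQ_le_const2[OF tendsto_norm[OF assms(2)]]) (use X_boundD(1)[OF assms(1)] that in auto)
 show "norm (y t - y s) <= \<rho> * (s powr - \<beta> * (t - s) powr \<beta>)" if "0 < s" "s <= t" "t <= T" for s t
  by (rule LIMSEQ_le_const2[OF tendsto_norm[OF tendsto_diff[OF assms(2,2)]]]) (use X_boundD(2)[OF assms(1)] that in auto)
 show "norm (z t s) <= \<rho> * (t - s) powr \<alpha>" if "0 <= s" "s <= t" "t <= T" for s t
  by (rule LIMSEQ_le_const2[OF tendsto_norm[OF assms(3)]]) (use X_boundD(3)[OF assms(1)] that in auto)
 show "norm (z t s) <= \<rho> * (s powr - \<beta> * (t - s) powr (\<alpha> + \<beta>))" if "0 < s" "s <= t" "t <= T" for s t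
  by (rule LIMSEQ_le_const2[OF tendsto_norm[OF assms(3)]]) (use X_boundD(4)[OF assms(1)] that in auto)
qed

lemma X_struct_limit:
 assumes s: "\<And>n. X_struct (Y n) (Z n)" and y: "\<And>t. (\<lambda>n. Y n t) \<longlonglongrightarrow> y t" and z: "\<And>t s. (\<lambda>n. Z n t s) \<longlonglongrightarrow> z t s"
  and u: "\<And>n t. t \<in> {0..T} ==> norm (Y n t - y t) <= e n" and e: "e \<longlonglongrightarrow> 0"
 shows "X_struct y z" unfolding X_struct_def
proof (intro conjI allI impI)
 show "y t = 0" if "t \<notin> {0..T}" for t using s that by (intro LIMSEQ_unique[OF y]) (simp add: X_struct_def)
 show "z t s = 0" if "(t, s) \<notin> Delta T" for t s using s that by (intro LIMSEQ_unique[OF z]) (simp add: X_struct_def)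
 show "continuous_on {0..T} y"
 proof (rule uniform_limit_theorem)
  show "\<forall>\<^sub>F n in sequentially. continuous_on {0..T} (Y n)" using s by (simp add: X_struct_def)
  show "uniform_limit {0..T} Y y sequentially"
  proof (rule uniform_limitI)
   fix \<epsilon> :: real assume "0 < \<epsilon>"
   with e have "\<forall>\<^sub>F n in sequentially. e n < \<epsilon>" by (rule order_tendstoD)
   then show "\<forall>\<^sub>F n in sequentially. \<forall>t\<in>{0..T}. dist (Y n t) (y t) < \<epsilon>"
    by eventually_elim (auto simp: dist_norm intro: le_less_trans[OF u])
  qed
 qed simp
 show "X_algebra T y z" unfolding X_algebra_def
 proof (intro allI impI)
  fix s \<tau> t E assume st: "0 <= s" "s <= \<tau>" "\<tau> <= t" "t <= T"
  have zE: "(\<lambda>n. Z n t s E) \<longlonglongrightarrow> z t s E" for t s by (rule bounded_linear.tendsto[OF blinfun.bounded_linear_left z])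
  have "(\<lambda>n. Z n t s E - Z n t \<tau> E - S (t - \<tau>) (Z n \<tau> s E)) \<longlonglongrightarrow> z t s E - z t \<tau> E - S (t - \<tau>) (z \<tau> s E)"
   by (intro tendsto_diff zE bounded_linear.tendsto[OF blinfun.bounded_linear_right])
  moreover have "(\<lambda>n. W t \<tau> (E (Y n \<tau> - Y n s))) \<longlonglongrightarrow> W t \<tau> (E (y \<tau> - y s))"
   using st T by (intro bounded_linear.tendsto[OF W_apply_bounded_linear] tendsto_diff y) auto
  moreover have "Z n t s E - Z n t \<tau> E - S (t - \<tau>) (Z n \<tau> s E) = W t \<tau> (E (Y n \<tau> - Y n s))" for n
   using s[of n] st by (simp add: X_struct_def X_algebra_def)
  ultimately show "z t s E - z t \<tau> E - S (t - \<tau>) (z \<tau> s E) = W t \<tau> (E (y \<tau> - y s))" by (simp add: LIMSEQ_unique)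
 qed
qed

lemma X_bound_0_eq:
 assumes "X_struct y z" "X_struct y' z'" "\<And>n :: nat. X_bound T (e n) (\<lambda>t. y t - y' t) (\<lambda>t s. z t s - z' t s)" "e \<longlonglongrightarrow> 0"
 shows "y = y'" "z = z'"
proof -
 have *: "x = x'" if "\<And>n. norm (x - x') <= e n" for x x' :: "'a::real_normed_vector"
  using LIMSEQ_le_const[OF assms(4), of "norm (x - x')"] that by auto
 show "y = y'"
 proof
  fix t
  show "y t = y' t"
  proof (cases "t \<in> {0..T}")
   case True
   then show ?thesis using X_boundD(1)[OF assms(3)] by (intro *) auto
  qed (use assms(1,2) in \<open>auto simp: X_struct_def\<close>)
 qed
 show "z = z'"
 proof (intro ext)
  fix t s
  show "z t s = z' t s"
  proof (cases "(t, s) \<in> Delta T")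
   case True
   then have st: "0 <= s" "s <= t" "t <= T" by (auto simp: Delta_def)
   have "norm (z t s - z' t s) <= e n" for n
   proof -
    have "0 <= e n" using order_trans[OF norm_ge_zero X_boundD(1)[OF assms(3), of 0 n]] T by simp
    then have "e n * (t - s) powr \<alpha> <= e n" using st T_le_1 \<alpha>_pos by (intro mult_left_le powr_le1) auto
    then show ?thesis using X_boundD(3)[OF assms(3) st, of n] by simp
   qed
   then show ?thesis by (rule *)
  qed (use assms(1,2) in \<open>auto simp: X_struct_def\<close>)
 qed
qed

text \<open>Images of the ball satisfy \<open>X_bound\<close> with
  \<open>C0 r + \<kappa> R * T powr \<alpha> * R\<close>, at most \<open>C0 r + 1\<close>; the
  factor 6 returns to \<open>X_norm\<close>. The summand 12 in \<open>small\<close> gives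
  \<open>6 * k \<le> 1 / 2\<close>, the contraction constant in \<open>X_norm\<close>.\<close>

context
 fixes R :: real
 assumes R: "R = 6 * (C0 r + 1)" and small: "\<kappa> R * T powr \<alpha> * (R + 12) <= 1"
begin

abbreviation (input) "k \<equiv> \<kappa> R * T powr \<alpha>"

lemma R_pos: "0 < R" and k: "0 <= k" "k * R <= 1" "6 * k <= 1 / 2" "k < 1"
proof -
 show R': "0 < R" using C0_bounds(4)[OF r_nonneg] R by simp
 show k0: "0 <= k" using \<kappa>_bounds(4)[of R] R' by simp
 have "k * R + k * 12 <= 1" using small by (simp add: algebra_simps)
 moreover have "0 <= k * R" "0 <= k * 12" using k0 R' by simp_all
 ultimately show "k * R <= 1" "6 * k <= 1 / 2" "k < 1" by linarith+
qed

text \<open>Contains the norm ball of radius \<open>R\<close>. Images and Picard iterates have the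
  smaller radius \<open>C0 r + 1\<close>, which brings them back into the norm ball.\<close>

abbreviation (input) "in_ball y z \<equiv> X_struct y z \<and> X_bound T R y z"

lemma solution_in_ball:
 assumes "in_ball y z"
 shows "X_struct (ysol y z) (zsol y z)" "X_bound T (C0 r + 1) (ysol y z) (zsol y z)" "in_ball (ysol y z) (zsol y z)"
proof -
 show s: "X_struct (ysol y z) (zsol y z)" using assms solution_struct R_pos by auto
 have "X_bound T (k * R) (\<lambda>t. ysol y z t - ysol (\<lambda>_. 0) (\<lambda>_ _. 0) t) (\<lambda>t s. zsol y z t s - zsol (\<lambda>_. 0) (\<lambda>_ _. 0) t s)"
  using assms R_pos X_struct_zero X_bound_zero by (intro solution_difference) auto
 from X_bound_add[OF solution_zero this] have "X_bound T (C0 r + k * R) (ysol y z) (zsol y z)" by simp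
 then show b: "X_bound T (C0 r + 1) (ysol y z) (zsol y z)" by (rule X_bound_mono) (use k in simp)
 show "in_ball (ysol y z) (zsol y z)" using s X_bound_mono[OF b] R C0_bounds(4)[OF r_nonneg] by auto
qed

lemma contraction_in_ball:
 assumes "in_ball y z" "in_ball y' z'" "X_bound T D (\<lambda>t. y t - y' t) (\<lambda>t s. z t s - z' t s)" "0 <= D"
 shows "X_bound T (k * D) (\<lambda>t. ysol y z t - ysol y' z' t) (\<lambda>t s. zsol y z t s - zsol y' z' t s)"
 using assms R_pos by (intro solution_difference) auto

lemma powers_of_k: "(\<lambda>n. k ^ n * (2 * R)) \<longlonglongrightarrow> 0"
 using tendsto_mult_left_zero[OF LIMSEQ_power_zero, of k "2 * R"] k by simp

text \<open>A bound on the difference of two fixed points reproduces itself with the factor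
  \<open>k\<close>, hence \<open>k ^ n * (2 * R)\<close> is a bound for every
  \<open>n\<close>.\<close>

lemma fixed_point_unique:
 assumes "in_ball y z" "in_ball y' z'" "ysol y z = y" "zsol y z = z" "ysol y' z' = y'" "zsol y' z' = z'"
 shows "y = y'" "z = z'"
proof -
 have "X_bound T (k ^ n * (2 * R)) (\<lambda>t. y t - y' t) (\<lambda>t s. z t s - z' t s)" for n
 proof (induction n)
  case 0
  then show ?case using X_bound_minus assms by simp
 next
  case (Suc n)
  from contraction_in_ball[OF assms(1,2) Suc] show ?case using k R_pos assms(3-6) by (simp add: mult.assoc)
 qed
 then show "y = y'" "z = z'" using X_bound_0_eq[OF _ _ _ powers_of_k] assms by blast+
qed

text \<open>Iterates converge pointwise at a geometric rate; structure and bounds pass to the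
  pointwise limits, which takes the place of completeness of the solution space.\<close>

lemma fixed_point_exists:
 obtains y z where "X_struct y z" "X_bound T (C0 r + 1) y z" "ysol y z = y" "zsol y z = z"
proof -
 define f where "f p = (ysol (fst p) (snd p), zsol (fst p) (snd p))" for p
 \<comment> \<open>Starting from the image of the zero pair gives every iterate the radius
   \<open>C0 r + 1\<close>.\<close>
 define P where "P n = (f ^^ n) (f (\<lambda>_. 0, \<lambda>_ _. 0))" for n
 define Y where "Y n = fst (P n)" for n
 define Z where "Z n = snd (P n)" for n
 have step: "Y (Suc n) = ysol (Y n) (Z n)" "Z (Suc n) = zsol (Y n) (Z n)" for n
  by (simp_all add: Y_def Z_def P_def f_def)
 have zero: "in_ball (\<lambda>_. 0) (\<lambda>_ _. 0)" using X_struct_zero X_bound_zero R_pos by auto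
 have small: "X_struct (Y n) (Z n)" "X_bound T (C0 r + 1) (Y n) (Z n)" "in_ball (Y n) (Z n)" for n
 proof (induction n)
  case 0
  have "Y 0 = ysol (\<lambda>_. 0) (\<lambda>_ _. 0)" "Z 0 = zsol (\<lambda>_. 0) (\<lambda>_ _. 0)" by (simp_all add: Y_def Z_def P_def f_def)
  then show "X_struct (Y 0) (Z 0)" "X_bound T (C0 r + 1) (Y 0) (Z 0)" "in_ball (Y 0) (Z 0)"
   using solution_in_ball[OF zero] by auto
 next
  case (Suc n)
  show "X_struct (Y (Suc n)) (Z (Suc n))" "X_bound T (C0 r + 1) (Y (Suc n)) (Z (Suc n))" "in_ball (Y (Suc n)) (Z (Suc n))"
   unfolding step using solution_in_ball[OF Suc(3)] by auto
 qed
 have d: "X_bound T (k ^ n * (2 * R)) (\<lambda>t. Y (n + m) t - Y n t) (\<lambda>t s. Z (n + m) t s - Z n t s)" for n m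
 proof (induction n)
  case 0
  then show ?case using X_bound_minus small(3) by simp
 next
  case (Suc n)
  from contraction_in_ball[OF small(3) small(3) Suc] show ?case using k R_pos by (simp add: step mult.assoc)
 qed
 have e: "0 <= k ^ n * (2 * R)" for n using k R_pos by simp
 have Yd: "norm (Y (n + m) t - Y n t) <= k ^ n * (2 * R)" for n m t
 proof (cases "t \<in> {0..T}")
  case True
  then show ?thesis using X_boundD(1)[OF d[of n m], of t] by simp
 next
  case False
  then have "Y j t = 0" for j using small(1)[of j] by (simp add: X_struct_def)
  then show ?thesis using e by simp
 qed
 have Zd: "norm (Z (n + m) t s - Z n t s) <= k ^ n * (2 * R)" for n m t s
 proof (cases "(t, s) \<in> Delta T")
  case True
  then have st: "0 <= s" "s <= t" "t <= T" by (auto simp: Delta_def)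
  have "k ^ n * (2 * R) * (t - s) powr \<alpha> <= k ^ n * (2 * R)"
   using st T_le_1 \<alpha>_pos by (intro mult_left_le e powr_le1) auto
  then show ?thesis using X_boundD(3)[OF d[of n m] st] by linarith
 next
  case False
  then have "Z j t s = 0" for j using small(1)[of j] by (simp add: X_struct_def)
  then show ?thesis using e by simp
 qed
 define y where "y t = lim (\<lambda>n. Y n t)" for t
 define z where "z t s = lim (\<lambda>n. Z n t s)" for t s
 have y: "(\<lambda>n. Y n t) \<longlonglongrightarrow> y t" for t
  unfolding y_def by (rule convergent_LIMSEQ_iff[THEN iffD1, OF convergent_of_tail_bound[OF Yd powers_of_k]])
 have z: "(\<lambda>n. Z n t s) \<longlonglongrightarrow> z t s" for t s
  unfolding z_def by (rule convergent_LIMSEQ_iff[THEN iffD1, OF convergent_of_tail_bound[OF Zd powers_of_k]])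
 have shift: "(\<lambda>m. Y (n + m) t) \<longlonglongrightarrow> y t" "(\<lambda>m. Z (n + m) t s) \<longlonglongrightarrow> z t s" for n t s
  using LIMSEQ_ignore_initial_segment[OF y, of n t] LIMSEQ_ignore_initial_segment[OF z, of n t s] by (simp_all add: add.commute)
 have dn: "X_bound T (k ^ n * (2 * R)) (\<lambda>t. y t - Y n t) (\<lambda>t s. z t s - Z n t s)" for n
  by (rule X_bound_limit[where Y = "\<lambda>m t. Y (n + m) t - Y n t" and Z = "\<lambda>m t s. Z (n + m) t s - Z n t s"])
   (intro d tendsto_diff shift tendsto_const)+
 have s: "X_struct y z"
 proof (rule X_struct_limit[OF small(1) y z _ powers_of_k])
  show "norm (Y n t - y t) <= k ^ n * (2 * R)" if "t \<in> {0..T}" for n t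
   using X_boundD(1)[OF dn[of n], of t] that by (simp add: norm_minus_commute)
 qed
 have b: "X_bound T (C0 r + 1) y z" by (rule X_bound_limit[OF small(2) y z])
 have ball: "in_ball y z" using s X_bound_mono[OF b] R C0_bounds(4)[OF r_nonneg] by auto
 \<comment> \<open>The image of the limit is compared with the limit through the iterate of index
   \<open>Suc n\<close>.\<close>
 have near: "X_bound T (k ^ n * (2 * R) * 2) (\<lambda>t. ysol y z t - y t) (\<lambda>t s. zsol y z t s - z t s)" for n
 proof -
  have "X_bound T (k * (k ^ n * (2 * R))) (\<lambda>t. ysol y z t - Y (Suc n) t) (\<lambda>t s. zsol y z t s - Z (Suc n) t s)"
   unfolding step by (rule contraction_in_ball[OF ball small(3) dn e])
  from X_bound_add[OF this X_bound_uminus[OF dn[of "Suc n"]]]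
  have "X_bound T (k * (k ^ n * (2 * R)) + k ^ Suc n * (2 * R)) (\<lambda>t. ysol y z t - y t) (\<lambda>t s. zsol y z t s - z t s)"
   by simp
  moreover have "k * (k ^ n * (2 * R)) + k ^ Suc n * (2 * R) <= k ^ n * (2 * R) * 2"
   using mult_right_mono[OF less_imp_le[OF k(4)] e[of n]] by (simp add: mult_ac)
  ultimately show ?thesis by (rule X_bound_mono)
 qed
 have "(\<lambda>n. k ^ n * (2 * R) * 2) \<longlonglongrightarrow> 0" by (rule tendsto_mult_left_zero[OF powers_of_k])
 note eq = X_bound_0_eq[OF solution_struct[OF s b] s near this]
 show thesis by (rule that[OF s b]) (use eq C0_bounds(4)[OF r_nonneg] in auto)
qed

theorem solution_map_ball:
 "let M = solution_map A S \<omega> \<omega>2 G \<xi> T; B = X_ball A S \<alpha> \<beta> \<omega> T R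
  in (\<forall>p\<in>B. M p \<in> B) \<and>
   (\<exists>k. 0 <= k \<and> k < 1 \<and> (\<forall>p\<in>B. \<forall>q\<in>B. X_norm \<alpha> \<beta> T (M p - M q) <= ennreal k * X_norm \<alpha> \<beta> T (p - q))) \<and>
   (\<exists>!p. p \<in> B \<and> M p = p)"
proof -
 let ?M = "solution_map A S \<omega> \<omega>2 G \<xi> T" and ?B = "X_ball A S \<alpha> \<beta> \<omega> T R"
 note R0 = less_imp_le[OF R_pos]
 have c: "0 <= C0 r + 1" "6 * (C0 r + 1) <= R" using C0_bounds(4)[OF r_nonneg] R by auto
 have B: "in_ball y z" if "(y, z) \<in> ?B" for y z using X_ballD[OF that R0] by simp
 have "?M p \<in> ?B" if "p \<in> ?B" for p
 proof (cases p)
  case (Pair y z)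
  then have "(y, z) \<in> ?B" using that by simp
  from X_ballI[OF solution_in_ball(1,2)[OF B[OF this]] c] show ?thesis by (simp add: Pair solution_map_eq)
 qed
 moreover have "X_norm \<alpha> \<beta> T (?M p - ?M q) <= ennreal (1 / 2) * X_norm \<alpha> \<beta> T (p - q)" if pq: "p \<in> ?B" "q \<in> ?B" for p q
 proof (cases "X_norm \<alpha> \<beta> T (p - q)")
  case top
  then show ?thesis by (simp add: ennreal_mult_top)
 next
  case (real D)
  obtain y z y' z' where p: "p = (y, z)" and q: "q = (y', z')" by (cases p, cases q)
  have d: "p - q = (\<lambda>t. y t - y' t, \<lambda>t s. z t s - z' t s)" by (simp add: p q fun_diff_def)
  note b = B[OF pq(1)[unfolded p]] B[OF pq(2)[unfolded q]]
  have "X_bound T D (\<lambda>t. y t - y' t) (\<lambda>t s. z t s - z' t s)"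
   using real X_struct_refl[of y z] X_struct_refl[of y' z'] b unfolding d by (intro X_bound_of_norm) auto
  then have "X_bound T (k * D) (\<lambda>t. ysol y z t - ysol y' z' t) (\<lambda>t s. zsol y z t s - zsol y' z' t s)"
   by (rule contraction_in_ball[OF b]) (use real in simp)
  \<comment> \<open>Going to \<open>X_bound\<close> and back to \<open>X_norm\<close> costs the
    factor 6.\<close>
  from X_norm_le(4)[OF this] have "X_norm \<alpha> \<beta> T (?M p - ?M q) <= ennreal (6 * (k * D))"
   using real k by (simp add: p q solution_map_eq fun_diff_def)
  also have "\<dots> <= ennreal (1 / 2 * D)" using mult_right_mono[OF k(3), of D] real by (intro ennreal_leI) (simp add: mult.assoc)
  also have "\<dots> = ennreal (1 / 2) * X_norm \<alpha> \<beta> T (p - q)" using real by (simp only: ennreal_mult')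
  finally show ?thesis .
 qed
 moreover have "\<exists>!p. p \<in> ?B \<and> ?M p = p"
 proof -
  obtain y z where yz: "X_struct y z" "X_bound T (C0 r + 1) y z" "ysol y z = y" "zsol y z = z" by (rule fixed_point_exists)
  then have "(y, z) \<in> ?B" by (intro X_ballI[OF _ _ c])
  then show ?thesis
  proof (intro ex1I[of _ "(y, z)"] conjI)
   show "?M (y, z) = (y, z)" using yz by (simp add: solution_map_eq)
   fix p assume p: "p \<in> ?B \<and> ?M p = p"
   obtain y' z' where e: "p = (y', z')" by (cases p)
   have m: "(y', z') \<in> ?B" "ysol y' z' = y'" "zsol y' z' = z'" using p by (simp_all add: e solution_map_eq)
   note fixed_point_unique[OF B[OF m(1)] B[OF \<open>(y, z) \<in> ?B\<close>] m(2,3) yz(3,4)]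
   then show "p = (y, z)" using e by simp
  qed
 qed
 ultimately show ?thesis unfolding Let_def by (intro conjI exI[of _ "1 / 2"]) auto
qed

end

end

section \<open>From the hypotheses to the abstract setting\<close>

lemma hoelder_constant:
 assumes "holder_seminorm \<gamma> T f < \<infinity>"
 obtains H where "0 <= H" "\<And>s t. 0 <= s ==> s < t ==> t <= T ==> norm (f t s) <= H * (t - s) powr \<gamma>"
proof -
 obtain H where H: "0 <= H" "holder_seminorm \<gamma> T f = ennreal H" using assms by (cases "holder_seminorm \<gamma> T f") auto
 then show thesis using that seminorm_le_iff(2)[OF H(1), of \<gamma> T f] by auto
qed

lemma rough_path_rough_noise:
 assumes S: "analytic_semigroup S A Ainv M \<delta>" and \<beta>: "0 < \<beta>" "\<beta> < \<alpha>" "\<alpha> <= 1 / 2" "1 < \<alpha> + 2 * \<beta>"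
  and T: "0 < T" "T <= 1" "T <= T0" and \<omega>: "rough_path \<alpha> T0 \<omega> \<omega>2"
 obtains H where "rough_noise S A Ainv M \<delta> \<omega> \<omega>2 \<alpha> \<beta> T H"
proof -
 obtain H1 where H1: "0 <= H1" "\<And>s t. 0 <= s ==> s < t ==> t <= T0 ==> norm (incr \<omega> t s) <= H1 * (t - s) powr \<alpha>"
  using hoelder_constant[of \<alpha> T0 "incr \<omega>"] \<omega> unfolding rough_path_def by blast
 obtain H2 where H2: "0 <= H2" "\<And>s t. 0 <= s ==> s < t ==> t <= T0 ==> norm (\<omega>2 t s) <= H2 * (t - s) powr (2 * \<alpha>)"
  using hoelder_constant[of "2 * \<alpha>" T0 \<omega>2] \<omega> unfolding rough_path_def by blast
 have chen: "\<omega>2 t s - \<omega>2 u s - \<omega>2 t u = tens (\<omega> u - \<omega> s) (\<omega> t - \<omega> u)" if "0 <= s" "s <= u" "u <= t" "t <= T0" for s u t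
  using \<omega> that unfolding rough_path_def incr_def by blast
 have "rough_noise S A Ainv M \<delta> \<omega> \<omega>2 \<alpha> \<beta> T (H1 + H2)"
 proof (intro rough_noise.intro[OF S] rough_noise_axioms.intro \<beta> T(1,2))
  show "0 <= H1 + H2" using H1 H2 by simp
  fix s t :: real assume st: "0 <= s" "s <= t" "t <= T"
  show "norm (\<omega> t - \<omega> s) <= (H1 + H2) * (t - s) powr \<alpha>"
  proof (cases "s = t")
   case False
   then have "norm (\<omega> t - \<omega> s) <= H1 * (t - s) powr \<alpha>" using H1(2)[of s t] st T by (simp add: incr_def)
   also have "\<dots> <= (H1 + H2) * (t - s) powr \<alpha>" using H2 by (intro mult_right_mono) auto
   finally show ?thesis .
  qed simp
  show "norm (\<omega>2 t s) <= (H1 + H2) * (t - s) powr (2 * \<alpha>)"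
  proof (cases "s = t")
   \<comment> \<open>The seminorm is silent on the diagonal; Chen's relation at a single time forces
     \<open>\<omega>2 t t = 0\<close>.\<close>
   case True
   then show ?thesis using chen[of t t t] st T by simp
  next
   case False
   then have "norm (\<omega>2 t s) <= H2 * (t - s) powr (2 * \<alpha>)" using H2(2)[of s t] st T by simp
   also have "\<dots> <= (H1 + H2) * (t - s) powr (2 * \<alpha>)" using H1 by (intro mult_right_mono) auto
   finally show ?thesis .
  qed
 next
  fix s u t :: real assume "0 <= s" "s <= u" "u <= t" "t <= T"
  then show "\<omega>2 t s - \<omega>2 u s - \<omega>2 t u = tens (\<omega> u - \<omega> s) (\<omega> t - \<omega> u)" using T by (intro chen) auto
 qed
 then show thesis by (rule that)
qed

lemma rough_noise_rough_equation:
 assumes noise: "rough_noise S A Ainv M \<delta> \<omega> \<omega>2 \<alpha> \<beta> T0 H"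
  and G: "C3_bounded_derivs G" "Lipschitz_into_dom S \<beta> G"
 obtains L N where "rough_equation S A Ainv M \<delta> \<omega> \<omega>2 \<alpha> \<beta> T0 H G L N"
proof -
 interpret rough_noise S A Ainv M \<delta> \<omega> \<omega>2 \<alpha> \<beta> T0 H by (rule noise)
 obtain L1 where L1: "0 <= L1" "\<And>x. norm (fderiv G x) <= L1" "\<And>x y. norm (G x - G y) <= L1 * norm (x - y)"
  "\<And>x y. norm (fderiv G x - fderiv G y) <= L1 * norm (x - y)"
  "\<And>a h a' h'. norm (G (a + h) - G a - (G (a' + h') - G a')) <= L1 * (norm (a - a') * norm h + norm (h - h'))"
  "\<And>a h a' h'. norm (fderiv G (a + h) - fderiv G a - (fderiv G (a' + h') - fderiv G a'))
   <= L1 * (norm (a - a') * norm h + norm (h - h'))"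
  "\<And>a h a' h'. norm (G (a + h) - G a - fderiv G a h - (G (a' + h') - G a' - fderiv G a' h'))
   <= L1 * (norm (a - a') * (norm h)\<^sup>2 + norm (h - h') * (norm h + norm h'))"
  by (rule C3_bounds[OF G(1)]) (rule that)
 obtain L2 N where L2: "0 <= L2" "0 <= N" "\<And>x x'. smooth_op (L2 * norm (x - x')) (G x - G x')" "smooth_op N (G 0)"
  by (rule Lipschitz_smooth_op[OF G(2)]) (rule that)
 have le: "L1 * x <= (L1 + L2) * x" "L2 * x <= (L1 + L2) * x" if "0 <= x" for x
  using that L1 L2 by (auto intro: mult_right_mono)
 have "rough_equation S A Ainv M \<delta> \<omega> \<omega>2 \<alpha> \<beta> T0 H G (L1 + L2) N"
 proof (intro rough_equation.intro[OF noise] rough_equation_axioms.intro L2)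
  show "0 <= L1 + L2" using L1 L2 by simp
  show "norm (fderiv G x) <= L1 + L2" for x using L1(2)[of x] L2 by simp
  show "smooth_op ((L1 + L2) * norm (x - x')) (G x - G x')" for x x'
   by (rule smooth_op_norm_le[OF L2(3) le(2)]) simp
 qed (rule order_trans[OF _ le(1)], rule L1, simp)+
 then show thesis by (rule that)
qed

theorem theorem6p9:
  fixes S :: "real \<Rightarrow> 'w::{banach, second_countable_topology} \<Rightarrow>\<^sub>L 'w"
    and D :: "'w set" and A :: "'w \<Rightarrow> 'w"
    and G :: "'w \<Rightarrow> 'v::{real_inner, complete_space} \<Rightarrow>\<^sub>L 'w"
    and \<omega> :: "real \<Rightarrow> 'v" and \<omega>2 :: "real \<Rightarrow> real \<Rightarrow> ('v, 'v) ptensor"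
    and \<alpha> \<beta> T0 :: real
  assumes "sectorial D A" and "C0_semigroup S" and "generates D A S"
    and "1 / 3 < \<beta>" and "\<beta> < \<alpha>" and "\<alpha> \<le> 1 / 2" and "\<alpha> + 2 * \<beta> > 1"
    and "C3_bounded_derivs G" and "Lipschitz_into_dom S \<beta> G"
    and "0 < T0" and "rough_path \<alpha> T0 \<omega> \<omega>2" and "limit_of_piecewise_linear \<alpha> T0 \<omega> \<omega>2"
  shows "\<exists>(R :: real \<Rightarrow> real) (T :: real \<Rightarrow> real). \<forall>r>0.
    0 < R r \<and> 0 < T (R r) \<and> T (R r) \<le> T0 \<and>
    (\<forall>\<xi>. norm \<xi> \<le> r \<longrightarrow>
      (let M = solution_map A S \<omega> \<omega>2 G \<xi> (T (R r));
           B = X_ball A S \<alpha> \<beta> \<omega> (T (R r)) (R r)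
       in (\<forall>p\<in>B. M p \<in> B) \<and>
          (\<exists>k. 0 \<le> k \<and> k < 1 \<and> (\<forall>p\<in>B. \<forall>q\<in>B.
             X_norm \<alpha> \<beta> (T (R r)) (M p - M q) \<le> ennreal k * X_norm \<alpha> \<beta> (T (R r)) (p - q))) \<and>
          (\<exists>!p. p \<in> B \<and> M p = p)))"
proof -
 interpret sectorial_generator S D A
  using assms(1-3) by (intro sectorial_generator.intro c0_semigroup.intro sectorial_generator_axioms.intro)
 obtain M \<delta> where as: "analytic_semigroup S A Ainv M \<delta>" using analytic_semigroup by blast
 \<comment> \<open>Shortens the horizon to at most 1, as the estimates require.\<close>
 define T1 where "T1 = min T0 1"
 have T1: "0 < T1" "T1 <= 1" "T1 <= T0" using assms(10) by (auto simp: T1_def)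
 have \<beta>: "0 < \<beta>" using assms(4) by simp
 obtain H where "rough_noise S A Ainv M \<delta> \<omega> \<omega>2 \<alpha> \<beta> T1 H"
  by (rule rough_path_rough_noise[OF as \<beta> assms(5-7) T1 assms(11)])
 then obtain L N where eq: "rough_equation S A Ainv M \<delta> \<omega> \<omega>2 \<alpha> \<beta> T1 H G L N"
  by (rule rough_noise_rough_equation[OF _ assms(8,9)])
 interpret E: rough_equation S A Ainv M \<delta> \<omega> \<omega>2 \<alpha> \<beta> T1 H G L N by (rule eq)
 define R where "R r = 6 * (E.C0 r + 1)" for r
 \<comment> \<open>\<open>R\<close> is fixed by \<open>r\<close> before \<open>T\<close>, as
   \<open>\<kappa>\<close> depends on the radius. The power solves
   \<open>(\<kappa> \<rho> * (\<rho> + 12) + 1) * T powr \<alpha> = 1\<close>; adding 1 keeps the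
   denominator positive.\<close>
 define T where "T \<rho> = min T1 ((1 / (E.\<kappa> \<rho> * (\<rho> + 12) + 1)) powr (1 / \<alpha>))" for \<rho>
 have R: "0 < R r" if "0 < r" for r using E.C0_bounds(4)[of r] that by (simp add: R_def)
 have small: "0 < T \<rho> \<and> T \<rho> <= T1 \<and> E.\<kappa> \<rho> * T \<rho> powr \<alpha> * (\<rho> + 12) <= 1" if "0 < \<rho>" for \<rho>
 proof (intro conjI)
  let ?c = "E.\<kappa> \<rho> * (\<rho> + 12)"
  have c: "0 <= ?c" using E.\<kappa>_bounds(4)[of \<rho>] that by simp
  then show T: "0 < T \<rho>" "T \<rho> <= T1" using T1 by (auto simp: T_def)
  have "T \<rho> powr \<alpha> <= ((1 / (?c + 1)) powr (1 / \<alpha>)) powr \<alpha>" using T E.\<alpha>_pos by (intro powr_mono2) (auto simp: T_def)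
  also have "\<dots> = 1 / (?c + 1)" using c E.\<alpha>_pos by (simp add: powr_powr)
  finally have "?c * T \<rho> powr \<alpha> <= ?c * (1 / (?c + 1))" using c by (rule mult_left_mono)
  also have "\<dots> <= 1" using c by (simp add: field_simps)
  finally show "E.\<kappa> \<rho> * T \<rho> powr \<alpha> * (\<rho> + 12) <= 1" by (simp add: mult_ac)
 qed
 show ?thesis
 proof (rule exI[of _ R], rule exI[of _ T], intro allI impI conjI)
  fix r :: real assume r: "0 < r"
  note s = small[OF R[OF r]]
  show "0 < R r" "0 < T (R r)" "T (R r) <= T0" using R[OF r] s T1 by auto
  fix \<xi> :: 'w assume \<xi>: "norm \<xi> <= r"
  have "rough_equation_on S A Ainv M \<delta> \<omega> \<omega>2 \<alpha> \<beta> T1 H G L N (T (R r)) r \<xi>"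
   using s \<xi> by (intro rough_equation_on.intro[OF eq] rough_equation_on_axioms.intro) auto
  from rough_equation_on.solution_map_ball[OF this R_def] s
  show "let M = solution_map A S \<omega> \<omega>2 G \<xi> (T (R r)); B = X_ball A S \<alpha> \<beta> \<omega> (T (R r)) (R r)
    in (\<forall>p\<in>B. M p \<in> B) \<and>
     (\<exists>k. 0 <= k \<and> k < 1 \<and> (\<forall>p\<in>B. \<forall>q\<in>B.
       X_norm \<alpha> \<beta> (T (R r)) (M p - M q) <= ennreal k * X_norm \<alpha> \<beta> (T (R r)) (p - q))) \<and>
     (\<exists>!p. p \<in> B \<and> M p = p)" by simp
 qed
qed

end
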